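(* Assume that, for some $T<\infty$, the following hold. (1) $|q|_\infty<\infty$, and for all $0\le t\le T$, $g_t$ is positive and $|g_t|_\infty<\infty$. (2) $|\omega_t|_\infty<\infty$ for all $0\le t\le T$, and $|\vartheta_t|_\infty<\infty$, $|p_t|_\infty<\infty$ for all $1\le t\le T$. (3) For all $0\le t\le T-1$, $|\vartheta_{t|T}/\gamma_{t+1}|_\infty<\infty$ and $|r_{t|T}|_\infty<\infty$; for all $0\le t\le T$, $|\check\omega_{t|T}|_\infty<\infty$; and for all $1\le t\le T-1$, $|\tilde\vartheta_{t|T}\odot\gamma_{t+1}^{-1}|_\infty<\infty$, $|q\odot\gamma_{t+1}^{-1}|_\infty<\infty$, $|\tilde\omega_{t|T}|_\infty<\infty$ and $|\tilde r_{t|T}|_\infty<\infty$. Then, for all $1\le s\le T-1$ and all bounded measurable $h:\mathsf X\to\mathbb R$, as $N\to\infty$, $$\sqrt N\left(\sum_{i=1}^N\frac{\tilde\omega_{s|T}^{i,\mathrm f}}{\tilde\Omega_{s|T}^{\mathrm f}}h(\xi_s^i)-\phi_{\chi,s|T}[h]\right)\xrightarrow{\ \mathcal D\ }\mathcal N\left(0,\Delta^{\mathrm f}_{\chi,s|T}\big[h-\phi_{\chi,s|T}[h]\big]\right),$$ where $$\Delta^{\mathrm f}_{\chi,s|T}[h]=\frac{\tilde\Gamma_{s,s+1|T}[H_s^{\mathrm f}]}{\left\{\phi_{\chi,s}\otimes\psi_{\gamma,s+1|T}[q\odot\gamma_{s+1}^{-1}]\right\}^2},\qquad H_s^{\mathrm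 f}(x,x')=h(x)q(x,x')\gamma_{s+1}^{-1}(x').$$ Similarly, $$\sqrt N\left(\sum_{i=1}^N\frac{\tilde\omega_{s|T}^{i,\mathrm b}}{\tilde\Omega_{s|T}^{\mathrm b}}h(\check\xi_{s|T}^i)-\phi_{\chi,s|T}[h]\right)\xrightarrow{\ \mathcal D\ }\mathcal N\left(0,\Delta^{\mathrm b}_{\chi,s|T}\big[h-\phi_{\chi,s|T}[h]\big]\right),$$ where $$\Delta^{\mathrm b}_{\chi,s|T}[h]=\frac{\tilde\Gamma_{s-1,s|T}[H_s^{\mathrm b}]}{\left\{\phi_{\chi,s-1}\otimes\psi_{\gamma,s|T}[q\odot\gamma_s^{-1}]\right\}^2},\qquad H_s^{\mathrm b}(x,x')=q(x,x')\gamma_s^{-1}(x')h(x').$$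
   Context: **Model.** $(\mathsf X,\mathcal X)$ is a measurable space with countably generated $\sigma$-field, $\lambda$ a measure on it; $dx$ stands for $\lambda(dx)$. $Q$ is a Markov kernel on $\mathsf X$ with $Q(x,dx')=q(x,x')\,dx'$. $g_0,\dots,g_T$ are positive measurable functions on $\mathsf X$, $\chi$ a probability on $\mathsf X$. $|\cdot|_\infty$ is the supremum norm and $(f\odot g)(x,x')=f(x,x')g(x')$ for $f:\mathsf X^2\to\mathbb R$, $g:\mathsf X\to\mathbb R$. $\mu[h]$ denotes $\int h\,d\mu$ and $\mu^2[h]=(\mu[h])^2$. The smoothing and filtering distributions are, for $0\le s\le n\le T$, $$\phi_{\chi,s|n}[h]=\frac{\int\chi(dx_0)g_0(x_0)\prod_{u=1}^nQ(x_{u-1},dx_u)g_u(x_u)\,h(x_s)}{\int\chi(dx_0)g_0(x_0)\prod_{u=1}^nQ(x_{u-1},dx_u)g_u(x_u)},\qquad\phi_{\chi,s}=\phi_{\chi,s|s}.$$ $\gamma_0,\dots,\gamma_T$ are positive measurable functions with $\int\gamma_t(x_t)dx_t\left[\prod_{u=t+1}^Tg_{u-1}(x_{u-1})Q(x_{u-1},dx_u)\right]g_T(x_T)<\infty$ for all $0\le t\le T$, and the backward information filter is $$\psi_{\gamma,t|T}[h]=\frac{\int\gamma_t(x_t)dx_t\left[\prod_{u=t+1}^Tg_{u-1}(x_{u-1})Q(x_{u-1},dx_u)\right]g_T(x_T)h(x_t)}{\int\gamma_t(x_t)dx_t\left[\prod_{u=t+1}^Tg_{u-1}(x_{u-1})Q(x_{u-1},dx_u)\right]g_T(x_T)}.$$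 **Forward filter.** $\rho_0$ is a probability with $\chi\ll\rho_0$; for $1\le t\le T$, $\vartheta_t\ge0$ is a measurable function on $\mathsf X$ and $p_t(x,\cdot)$ a Markov transition density w.r.t. $\lambda$. Set $$\omega_0(x)=\frac{d\chi}{d\rho_0}(x)g_0(x),\qquad \omega_t(x,x')=\frac{q(x,x')g_t(x')}{\vartheta_t(x)p_t(x,x')}\ (t\ge1).$$ For each $N$: $\xi_0^1,\dots,\xi_0^N$ are i.i.d. from $\rho_0$, $\omega_0^\ell=\omega_0(\xi_0^\ell)$. For $s\ge1$, conditionally on the past, the pairs $(I_s^\ell,\xi_s^\ell)$, $1\le \ell\le N$, are i.i.d. on $\{1,\dots,N\}\times\mathsf X$ with density proportional to $(i,x)\mapsto\omega_{s-1}^i\vartheta_s(\xi_{s-1}^i)p_s(\xi_{s-1}^i,x)$, and $\omega_s^\ell=\omega_s(\xi_{s-1}^{I_s^\ell},\xi_s^\ell)$. **Backward filter.** $\check\rho_T$ is a probability density on $\mathsf X$; for $0\le t\le T-1$, $\vartheta_{t|T}\ge0$ is a measurable function on $\mathsf X$ and $r_{t|T}(x',\cdot)$ a Markov transition density. Set $$\check\omega_{T|T}(x)=\frac{g_T(x)\gamma_T(x)}{\check\rho_T(x)},\qquad\check\omega_{t|T}(x,x')=\frac{\gamma_t(x)g_t(x)q(x,x')}{\vartheta_{t|T}(x')r_{t|T}(x',x)}\ (t<T).$$ $\check\xi_{T|T}^1,\dots,\check\xi_{T|T}^N$ are i.i.d. from $\check\rho_T$, $\check\omega_{T|T}^i=\check\omega_{T|T}(\check\xi_{T|T}^i)$.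 For $t=T-1,\dots,0$, conditionally on the previously generated backward particles, the pairs $(\check I_t^i,\check\xi_{t|T}^i)$, $1\le i\le N$, are i.i.d. with density proportional to $(j,x)\mapsto\check\omega_{t+1|T}^j\,\vartheta_{t|T}(\check\xi_{t+1|T}^j)\,\gamma_{t+1}^{-1}(\check\xi_{t+1|T}^j)\,r_{t|T}(\check\xi_{t+1|T}^j,x)$, and $\check\omega_{t|T}^i=\check\omega_{t|T}(\check\xi_{t|T}^i,\check\xi_{t+1|T}^{\check I_t^i})$. The forward and backward particle systems are independent. **Two-filter algorithm of Briers, Doucet and Maskell.** For $1\le s\le T-1$, the forward particles $\xi_s^i$ and the backward particles $\check\xi_{s|T}^j$ are reweighted respectively by $$\tilde\omega_{s|T}^{i,\mathrm f}=\omega_s^i\sum_{j=1}^N\frac{\check\omega_{s+1|T}^j\,q(\xi_s^i,\check\xi_{s+1|T}^j)}{\gamma_{s+1}(\check\xi_{s+1|T}^j)},\qquad\tilde\omega_{s|T}^{j,\mathrm b}=\check\omega_{s|T}^j\sum_{i=1}^N\frac{\omega_{s-1}^i\,q(\xi_{s-1}^i,\check\xi_{s|T}^j)}{\gamma_s(\check\xi_{s|T}^j)},$$ with $\tilde\Omega^{\mathrm f}_{s|T}=\sum_i\tilde\omega_{s|T}^{i,\mathrm f}$ and $\tilde\Omega^{\mathrm b}_{s|T}=\sum_j\tilde\omega_{s|T}^{j,\mathrm b}$. **Asymptotic variances.** For functions $h$ on $\mathsf X$, $$\Gamma_{\chi,0}[h]=\frac{\int\rho_0(dx)\omega_0^2(x)h^2(x)}{\left(\int\rho_0(dx)\omega_0(x)\right)^2},$$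 and for $s\ge1$, $$\Gamma_{\chi,s}[h]=\frac{\Gamma_{\chi,s-1}\left[\int q(\cdot,x)g_s(x)h(x)dx\right]+\phi_{\chi,s-1}\left[\int\omega_s(\cdot,x)q(\cdot,x)g_s(x)h^2(x)dx\right]\phi_{\chi,s-1}[\vartheta_s]}{\phi_{\chi,s-1}^2\left[\int q(\cdot,x)g_s(x)dx\right]};$$ $$\check\Gamma_{\gamma,T|T}[h]=\frac{\int\check\rho_T(x)\check\omega_{T|T}^2(x)h^2(x)dx}{\left(\int\check\rho_T(x)\check\omega_{T|T}(x)dx\right)^2},$$ and for $t\le T-1$, with $K_t(x,x')=\gamma_t(x)g_t(x)q(x,x')\gamma_{t+1}^{-1}(x')$, $$\check\Gamma_{\gamma,t|T}[h]=\frac{\check\Gamma_{\gamma,t+1|T}\left[\int K_t(x,\cdot)h(x)dx\right]+\psi_{\gamma,t+1|T}\left[\int\check\omega_{t|T}(x,\cdot)K_t(x,\cdot)h^2(x)dx\right]\psi_{\gamma,t+1|T}\left[\vartheta_{t|T}\gamma_{t+1}^{-1}\right]}{\psi_{\gamma,t+1|T}^2\left[\int K_t(x,\cdot)dx\right]}.$$ For functions $H$ on $\mathsf X^2$ and $0\le s<t\le T$, $$\tilde\Gamma_{s,t|T}[H]=\Gamma_{\chi,s}\left[\int\psi_{\gamma,t|T}(dx_t)H(\cdot,x_t)\right]+\check\Gamma_{\gamma,t|T}\left[\int\phi_{\chi,s}(dx_s)H(x_s,\cdot)\right].$$ **Smoothing proposals (used only in the assumptions).** For $1\le t\le T-1$,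 $\tilde\vartheta_{t|T}\ge0$ is a measurable function on $\mathsf X^2$, $\tilde r_{t|T}(x,x';\cdot)$ is a probability density for each $(x,x')$, and $$\tilde\omega_{t|T}(x,x';x'')=\frac{q(x,x'')q(x'',x')g_t(x'')}{\tilde\vartheta_{t|T}(x,x')\tilde r_{t|T}(x,x';x'')}.$$ **Conventions.** In weight functions, $0/0=0$ and $c/0=\infty$ for $c>0$. All sums of weights and normalizing constants appearing in denominators are assumed almost surely positive, so that all estimators and sampling distributions are well defined. $\mathcal N(0,0)$ is the Dirac mass at $0$.
   Formalization: For s = 1 the backward limit theorem is stated under the additional assumption that q⊙γ_1^{-1} is bounded (the case t = 0 missing from the bound on q⊙γ_{t+1}^{-1} in (3)), since without it the claim can fail; the forward claim and the backward claim for s ≥ 2 are unchanged. *)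

theory Defs
  imports "HOL-Probability.Probability"
begin

definition countably_generated :: "'a measure \<Rightarrow> bool" where
  "countably_generated M \<longleftrightarrow>
     (\<exists>G. countable G \<and> G \<subseteq> Pow (space M) \<and> sets M = sigma_sets (space M) G)"

definition markov_density :: "'a measure \<Rightarrow> ('a \<Rightarrow> 'a \<Rightarrow> real) \<Rightarrow> bool" where
  "markov_density L k \<longleftrightarrow>
     (\<lambda>(x, x'). k x x') \<in> borel_measurable (L \<Otimes>\<^sub>M L) \<and>
     (\<forall>x\<in>space L. \<forall>x'\<in>space L. 0 \<le> k x x') \<and>
     (\<forall>x\<in>space L. (\<integral>\<^sup>+x'. ennreal (k x x') \<partial>L) = 1)"

definition odot :: "('a \<Rightarrow> 'a \<Rightarrow> real) \<Rightarrow> ('a \<Rightarrow> real) \<Rightarrow> 'a \<Rightarrow> 'a \<Rightarrow> real" (infixl "\<odot>" 70) where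
  "(f \<odot> u) x x' = f x x' * u x'"

definition gaussian :: "real \<Rightarrow> real measure" where
  "gaussian v = (if v = 0 then return borel 0 else density lborel (\<lambda>x. ennreal (normal_density 0 (sqrt v) x)))"

section \<open>Model data\<close>

text \<open>The first argument of time-indexed fields is the time. The field \<open>init_deriv\<close> is a version of
  the density of \<open>init_law\<close> with respect to \<open>init_prop\<close>; it is a parameter because the pointwise
  bound on the initial weight depends on the version.\<close>

record 'a model =
  base :: "'a measure"                                (* lambda *)
  trans_dens :: "'a \<Rightarrow> 'a \<Rightarrow> real"                    (* q *)
  pot :: "nat \<Rightarrow> 'a \<Rightarrow> real"                           (* g_t *)
  init_law :: "'a measure"                            (* chi *)
  init_prop :: "'a measure"                           (* rho_0 *)
  init_deriv :: "'a \<Rightarrow> ennreal"                       (* d chi / d rho_0 *)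
  fwd_adj :: "nat \<Rightarrow> 'a \<Rightarrow> real"                       (* vartheta_t *)
  fwd_prop :: "nat \<Rightarrow> 'a \<Rightarrow> 'a \<Rightarrow> real"               (* p_t *)
  gam :: "nat \<Rightarrow> 'a \<Rightarrow> real"                           (* gamma_t *)
  bwd_init_prop :: "'a \<Rightarrow> real"                       (* check rho_T *)
  bwd_adj :: "nat \<Rightarrow> 'a \<Rightarrow> real"                       (* vartheta_{t|T} *)
  bwd_prop :: "nat \<Rightarrow> 'a \<Rightarrow> 'a \<Rightarrow> real"               (* r_{t|T} *)
  smo_adj :: "nat \<Rightarrow> 'a \<Rightarrow> 'a \<Rightarrow> real"                (* tilde vartheta_{t|T} *)
  smo_prop :: "nat \<Rightarrow> 'a \<Rightarrow> 'a \<Rightarrow> 'a \<Rightarrow> real"        (* tilde r_{t|T} *)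

abbreviation inv_gam :: "'a model \<Rightarrow> nat \<Rightarrow> 'a \<Rightarrow> real" where
  "inv_gam S t \<equiv> (\<lambda>x. inverse (gam S t x))"

section \<open>Smoothing distributions and backward information filter\<close>

text \<open>\<open>path_int L k m u y F\<close> is the integral of
  \<open>k u (y u) (y (u+1)) * \<dots> * k (u+m-1) (y (u+m-1)) (y (u+m)) * F y\<close>
  over the coordinates \<open>u+1, \<dots>, u+m\<close> of the path \<open>y\<close>.\<close>

primrec path_int :: "'a measure \<Rightarrow> (nat \<Rightarrow> 'a \<Rightarrow> 'a \<Rightarrow> ennreal) \<Rightarrow> nat \<Rightarrow> nat \<Rightarrow> (nat \<Rightarrow> 'a) \<Rightarrow>
    ((nat \<Rightarrow> 'a) \<Rightarrow> ennreal) \<Rightarrow> ennreal" where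
  "path_int L k 0 u y F = F y"
| "path_int L k (Suc m) u y F =
     (\<integral>\<^sup>+x. k u (y u) x * path_int L k m (Suc u) (y(Suc u := x)) F \<partial>L)"

definition smoothing_int :: "'a model \<Rightarrow> nat \<Rightarrow> nat \<Rightarrow> ('a \<Rightarrow> ennreal) \<Rightarrow> ennreal" where
  "smoothing_int S s n h =
     (\<integral>\<^sup>+x. ennreal (pot S 0 x) *
        path_int (base S) (\<lambda>v x x'. ennreal (trans_dens S x x' * pot S (Suc v) x')) n 0 (\<lambda>_. x)
          (\<lambda>y. h (y s)) \<partial>init_law S)"

definition smoothing :: "'a model \<Rightarrow> nat \<Rightarrow> nat \<Rightarrow> 'a measure" where
  "smoothing S s n = measure_of (space (base S)) (sets (base S))
     (\<lambda>A. smoothing_int S s n (indicator A) / smoothing_int S s n (\<lambda>_. 1))"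

definition filtering :: "'a model \<Rightarrow> nat \<Rightarrow> 'a measure" where
  "filtering S s = smoothing S s s"

definition bwd_info_int :: "'a model \<Rightarrow> nat \<Rightarrow> nat \<Rightarrow> ('a \<Rightarrow> ennreal) \<Rightarrow> ennreal" where
  "bwd_info_int S T t h =
     (\<integral>\<^sup>+x. ennreal (gam S t x) *
        path_int (base S) (\<lambda>v x x'. ennreal (pot S v x * trans_dens S x x')) (T - t) t (\<lambda>_. x)
          (\<lambda>y. ennreal (pot S T (y T)) * h (y t)) \<partial>base S)"

definition bwd_info :: "'a model \<Rightarrow> nat \<Rightarrow> nat \<Rightarrow> 'a measure" where
  "bwd_info S T t = measure_of (space (base S)) (sets (base S))
     (\<lambda>A. bwd_info_int S T t (indicator A) / bwd_info_int S T t (\<lambda>_. 1))"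

section \<open>Weight functions\<close>

text \<open>Division in \<^typ>\<open>ennreal\<close> satisfies \<open>0/0 = 0\<close> and \<open>c/0 = \<infinity>\<close> for \<open>c > 0\<close>.\<close>

definition omega0 :: "'a model \<Rightarrow> 'a \<Rightarrow> ennreal" where
  "omega0 S x = init_deriv S x * ennreal (pot S 0 x)"

definition omega :: "'a model \<Rightarrow> nat \<Rightarrow> 'a \<Rightarrow> 'a \<Rightarrow> ennreal" where
  "omega S t x x' =
     ennreal (trans_dens S x x' * pot S t x') / ennreal (fwd_adj S t x * fwd_prop S t x x')"

definition bwd_omega_final :: "'a model \<Rightarrow> nat \<Rightarrow> 'a \<Rightarrow> ennreal" where
  "bwd_omega_final S T x = ennreal (pot S T x * gam S T x) / ennreal (bwd_init_prop S x)"

definition bwd_omega :: "'a model \<Rightarrow> nat \<Rightarrow> 'a \<Rightarrow> 'a \<Rightarrow> ennreal" where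
  "bwd_omega S t x x' =
     ennreal (gam S t x * pot S t x * trans_dens S x x') /
     ennreal (bwd_adj S t x' * bwd_prop S t x' x)"

definition smo_omega :: "'a model \<Rightarrow> nat \<Rightarrow> 'a \<Rightarrow> 'a \<Rightarrow> 'a \<Rightarrow> ennreal" where
  "smo_omega S t x x' x'' =
     ennreal (trans_dens S x x'' * trans_dens S x'' x' * pot S t x'') /
     ennreal (smo_adj S t x x' * smo_prop S t x x' x'')"

section \<open>Standing assumptions on the model\<close>

definition standing_assumptions :: "'a model \<Rightarrow> nat \<Rightarrow> bool" where
  "standing_assumptions S T \<longleftrightarrow>
     (let L = base S; X = space L in
       countably_generated L \<and>
       markov_density L (trans_dens S) \<and>
       (\<forall>t\<le>T. pot S t \<in> borel_measurable L \<and> (\<forall>x\<in>X. 0 < pot S t x)) \<and>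
       prob_space (init_law S) \<and> sets (init_law S) = sets L \<and>
       prob_space (init_prop S) \<and> sets (init_prop S) = sets L \<and>
       absolutely_continuous (init_prop S) (init_law S) \<and>
       init_deriv S \<in> borel_measurable L \<and> density (init_prop S) (init_deriv S) = init_law S \<and>
       (\<forall>t\<in>{1..T}. fwd_adj S t \<in> borel_measurable L \<and> (\<forall>x\<in>X. 0 \<le> fwd_adj S t x) \<and>
          markov_density L (fwd_prop S t)) \<and>
       (\<forall>t\<le>T. gam S t \<in> borel_measurable L \<and> (\<forall>x\<in>X. 0 < gam S t x) \<and>
          bwd_info_int S T t (\<lambda>_. 1) < \<infinity>) \<and>
       bwd_init_prop S \<in> borel_measurable L \<and> (\<forall>x\<in>X. 0 \<le> bwd_init_prop S x) \<and>
       (\<integral>\<^sup>+x. ennreal (bwd_init_prop S x) \<partial>L) = 1 \<and>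
       (\<forall>t<T. bwd_adj S t \<in> borel_measurable L \<and> (\<forall>x\<in>X. 0 \<le> bwd_adj S t x) \<and>
          markov_density L (bwd_prop S t)) \<and>
       (\<forall>t\<in>{1..<T}.
          (\<lambda>(x, x'). smo_adj S t x x') \<in> borel_measurable (L \<Otimes>\<^sub>M L) \<and>
          (\<forall>x\<in>X. \<forall>x'\<in>X. 0 \<le> smo_adj S t x x') \<and>
          (\<lambda>(x, x', x''). smo_prop S t x x' x'') \<in> borel_measurable (L \<Otimes>\<^sub>M L \<Otimes>\<^sub>M L) \<and>
          (\<forall>x\<in>X. \<forall>x'\<in>X. \<forall>x''\<in>X. 0 \<le> smo_prop S t x x' x'') \<and>
          (\<forall>x\<in>X. \<forall>x'\<in>X. (\<integral>\<^sup>+x''. ennreal (smo_prop S t x x' x'') \<partial>L) = 1)))"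

section \<open>Particle filters\<close>

text \<open>Random variables are families \<open>xi s l\<close> (positions) and \<open>I s l\<close> (ancestor indices) indexed by
  the time \<open>s\<close> and the particle label \<open>l \<in> {1..N}\<close>. \<open>particle_history P L N U V I xi\<close> is the
  sigma-field generated by the positions at the times in \<open>U\<close> and the indices at the times in \<open>V\<close>.\<close>

definition particle_history :: "'w measure \<Rightarrow> 'a measure \<Rightarrow> nat \<Rightarrow> nat set \<Rightarrow> nat set \<Rightarrow>
    (nat \<Rightarrow> nat \<Rightarrow> 'w \<Rightarrow> nat) \<Rightarrow> (nat \<Rightarrow> nat \<Rightarrow> 'w \<Rightarrow> 'a) \<Rightarrow> 'w measure" where
  "particle_history P L N U V I xi = sigma (space P)
     ({xi u l -` A \<inter> space P | u l A. u \<in> U \<and> l \<in> {1..N} \<and> A \<in> sets L} \<union>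
      {I u l -` J \<inter> space P | u l J. u \<in> V \<and> l \<in> {1..N} \<and> J \<subseteq> {1..N}})"

definition normalized_density :: "'b measure \<Rightarrow> ('b \<Rightarrow> ennreal) \<Rightarrow> 'b measure" where
  "normalized_density M f = density M (\<lambda>z. f z / (\<integral>\<^sup>+z. f z \<partial>M))"

text \<open>Given \<open>F\<close>, the variables \<open>Z 1, \<dots>, Z N\<close> are i.i.d. with (random) law \<open>K\<close>.\<close>

definition cond_iid :: "'w measure \<Rightarrow> 'w measure \<Rightarrow> nat \<Rightarrow> 'b measure \<Rightarrow> (nat \<Rightarrow> 'w \<Rightarrow> 'b) \<Rightarrow>
    ('w \<Rightarrow> 'b measure) \<Rightarrow> bool" where
  "cond_iid P F N M Z K \<longleftrightarrow>
     (\<forall>l\<in>{1..N}. Z l \<in> measurable P M) \<and>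
     (\<forall>B. (\<forall>l\<in>{1..N}. B l \<in> sets M) \<longrightarrow>
        (AE w in P. nn_cond_exp P F (\<lambda>w. \<Prod>l=1..N. indicator (B l) (Z l w)) w =
                    (\<Prod>l=1..N. emeasure (K w) (B l))))"

definition fwd_weight :: "'a model \<Rightarrow> (nat \<Rightarrow> nat \<Rightarrow> 'w \<Rightarrow> nat) \<Rightarrow> (nat \<Rightarrow> nat \<Rightarrow> 'w \<Rightarrow> 'a) \<Rightarrow>
    nat \<Rightarrow> nat \<Rightarrow> 'w \<Rightarrow> real" where
  "fwd_weight S I xi s l w =
     (if s = 0 then enn2real (omega0 S (xi 0 l w))
      else enn2real (omega S s (xi (s - 1) (I s l w) w) (xi s l w)))"

definition forward_filter :: "'a model \<Rightarrow> nat \<Rightarrow> 'w measure \<Rightarrow> nat \<Rightarrow> (nat \<Rightarrow> nat \<Rightarrow> 'w \<Rightarrow> nat) \<Rightarrow>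
    (nat \<Rightarrow> nat \<Rightarrow> 'w \<Rightarrow> 'a) \<Rightarrow> bool" where
  "forward_filter S T P N I xi \<longleftrightarrow>
     prob_space.indep_vars P (\<lambda>_. base S) (xi 0) {1..N} \<and>
     (\<forall>l\<in>{1..N}. distr P (base S) (xi 0 l) = init_prop S) \<and>
     (\<forall>s\<in>{1..T}.
        cond_iid P (particle_history P (base S) N {..<s} {1..<s} I xi) N
          (count_space {1..N} \<Otimes>\<^sub>M base S) (\<lambda>l w. (I s l w, xi s l w))
          (\<lambda>w. normalized_density (count_space {1..N} \<Otimes>\<^sub>M base S)
             (\<lambda>(i, x). ennreal (fwd_weight S I xi (s - 1) i w * fwd_adj S s (xi (s - 1) i w) *
                                fwd_prop S s (xi (s - 1) i w) x))))"

definition bwd_weight :: "'a model \<Rightarrow> nat \<Rightarrow> (nat \<Rightarrow> nat \<Rightarrow> 'w \<Rightarrow> nat) \<Rightarrow> (nat \<Rightarrow> nat \<Rightarrow> 'w \<Rightarrow> 'a) \<Rightarrow>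
    nat \<Rightarrow> nat \<Rightarrow> 'w \<Rightarrow> real" where
  "bwd_weight S T J zeta t l w =
     (if t = T then enn2real (bwd_omega_final S T (zeta T l w))
      else enn2real (bwd_omega S t (zeta t l w) (zeta (Suc t) (J t l w) w)))"

definition backward_filter :: "'a model \<Rightarrow> nat \<Rightarrow> 'w measure \<Rightarrow> nat \<Rightarrow> (nat \<Rightarrow> nat \<Rightarrow> 'w \<Rightarrow> nat) \<Rightarrow>
    (nat \<Rightarrow> nat \<Rightarrow> 'w \<Rightarrow> 'a) \<Rightarrow> bool" where
  "backward_filter S T P N J zeta \<longleftrightarrow>
     prob_space.indep_vars P (\<lambda>_. base S) (zeta T) {1..N} \<and>
     (\<forall>l\<in>{1..N}. distributed P (base S) (zeta T l) (\<lambda>x. ennreal (bwd_init_prop S x))) \<and>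
     (\<forall>t<T.
        cond_iid P (particle_history P (base S) N {Suc t..T} {Suc t..<T} J zeta) N
          (count_space {1..N} \<Otimes>\<^sub>M base S) (\<lambda>l w. (J t l w, zeta t l w))
          (\<lambda>w. normalized_density (count_space {1..N} \<Otimes>\<^sub>M base S)
             (\<lambda>(j, x). ennreal (bwd_weight S T J zeta (Suc t) j w * bwd_adj S t (zeta (Suc t) j w) *
                                inv_gam S (Suc t) (zeta (Suc t) j w) *
                                bwd_prop S t (zeta (Suc t) j w) x))))"

definition filters_independent :: "'a model \<Rightarrow> nat \<Rightarrow> 'w measure \<Rightarrow> nat \<Rightarrow>
    (nat \<Rightarrow> nat \<Rightarrow> 'w \<Rightarrow> nat) \<Rightarrow> (nat \<Rightarrow> nat \<Rightarrow> 'w \<Rightarrow> 'a) \<Rightarrow>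
    (nat \<Rightarrow> nat \<Rightarrow> 'w \<Rightarrow> nat) \<Rightarrow> (nat \<Rightarrow> nat \<Rightarrow> 'w \<Rightarrow> 'a) \<Rightarrow> bool" where
  "filters_independent S T P N I xi J zeta \<longleftrightarrow>
     prob_space.indep_set P
       (sets (particle_history P (base S) N {0..T} {1..T} I xi))
       (sets (particle_history P (base S) N {0..T} {0..<T} J zeta))"

section \<open>Two-filter reweighting\<close>

definition two_filter_fwd_weight :: "'a model \<Rightarrow> nat \<Rightarrow> nat \<Rightarrow>
    (nat \<Rightarrow> nat \<Rightarrow> 'w \<Rightarrow> nat) \<Rightarrow> (nat \<Rightarrow> nat \<Rightarrow> 'w \<Rightarrow> 'a) \<Rightarrow>
    (nat \<Rightarrow> nat \<Rightarrow> 'w \<Rightarrow> nat) \<Rightarrow> (nat \<Rightarrow> nat \<Rightarrow> 'w \<Rightarrow> 'a) \<Rightarrow> nat \<Rightarrow> nat \<Rightarrow> 'w \<Rightarrow> real" where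
  "two_filter_fwd_weight S T N I xi J zeta s i w =
     fwd_weight S I xi s i w *
     (\<Sum>j=1..N. bwd_weight S T J zeta (s + 1) j w * trans_dens S (xi s i w) (zeta (s + 1) j w) /
        gam S (s + 1) (zeta (s + 1) j w))"

definition two_filter_bwd_weight :: "'a model \<Rightarrow> nat \<Rightarrow> nat \<Rightarrow>
    (nat \<Rightarrow> nat \<Rightarrow> 'w \<Rightarrow> nat) \<Rightarrow> (nat \<Rightarrow> nat \<Rightarrow> 'w \<Rightarrow> 'a) \<Rightarrow>
    (nat \<Rightarrow> nat \<Rightarrow> 'w \<Rightarrow> nat) \<Rightarrow> (nat \<Rightarrow> nat \<Rightarrow> 'w \<Rightarrow> 'a) \<Rightarrow> nat \<Rightarrow> nat \<Rightarrow> 'w \<Rightarrow> real" where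
  "two_filter_bwd_weight S T N I xi J zeta s j w =
     bwd_weight S T J zeta s j w *
     (\<Sum>i=1..N. fwd_weight S I xi (s - 1) i w * trans_dens S (xi (s - 1) i w) (zeta s j w) /
        gam S s (zeta s j w))"

definition self_normalized :: "nat \<Rightarrow> (nat \<Rightarrow> 'w \<Rightarrow> real) \<Rightarrow> (nat \<Rightarrow> 'w \<Rightarrow> 'a) \<Rightarrow> ('a \<Rightarrow> real) \<Rightarrow> 'w \<Rightarrow> real" where
  "self_normalized N W x h w = (\<Sum>i=1..N. W i w / (\<Sum>l=1..N. W l w) * h (x i w))"

definition normalizers_positive :: "'a model \<Rightarrow> nat \<Rightarrow> 'w measure \<Rightarrow> nat \<Rightarrow>
    (nat \<Rightarrow> nat \<Rightarrow> 'w \<Rightarrow> nat) \<Rightarrow> (nat \<Rightarrow> nat \<Rightarrow> 'w \<Rightarrow> 'a) \<Rightarrow>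
    (nat \<Rightarrow> nat \<Rightarrow> 'w \<Rightarrow> nat) \<Rightarrow> (nat \<Rightarrow> nat \<Rightarrow> 'w \<Rightarrow> 'a) \<Rightarrow> bool" where
  "normalizers_positive S T P N I xi J zeta \<longleftrightarrow>
     (\<forall>s\<in>{1..T}. AE w in P. 0 < (\<Sum>i=1..N. fwd_weight S I xi (s - 1) i w * fwd_adj S s (xi (s - 1) i w))) \<and>
     (\<forall>t<T. AE w in P. 0 < (\<Sum>j=1..N. bwd_weight S T J zeta (Suc t) j w *
         bwd_adj S t (zeta (Suc t) j w) * inv_gam S (Suc t) (zeta (Suc t) j w))) \<and>
     (\<forall>s\<in>{1..<T}. AE w in P. 0 < (\<Sum>i=1..N. two_filter_fwd_weight S T N I xi J zeta s i w)) \<and>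
     (\<forall>s\<in>{1..<T}. AE w in P. 0 < (\<Sum>j=1..N. two_filter_bwd_weight S T N I xi J zeta s j w))"

section \<open>Asymptotic variances\<close>

primrec Gamma_fwd :: "'a model \<Rightarrow> nat \<Rightarrow> ('a \<Rightarrow> real) \<Rightarrow> real" where
  "Gamma_fwd S 0 h =
     (\<integral>x. (enn2real (omega0 S x))\<^sup>2 * (h x)\<^sup>2 \<partial>init_prop S) /
     (\<integral>x. enn2real (omega0 S x) \<partial>init_prop S)\<^sup>2"
| "Gamma_fwd S (Suc s) h =
     (Gamma_fwd S s (\<lambda>y. \<integral>x. trans_dens S y x * pot S (Suc s) x * h x \<partial>base S) +
      (\<integral>y. (\<integral>x. enn2real (omega S (Suc s) y x) * trans_dens S y x * pot S (Suc s) x * (h x)\<^sup>2 \<partial>base S)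
         \<partial>filtering S s) *
      (\<integral>y. fwd_adj S (Suc s) y \<partial>filtering S s)) /
     (\<integral>y. (\<integral>x. trans_dens S y x * pot S (Suc s) x \<partial>base S) \<partial>filtering S s)\<^sup>2"

definition bwd_kernel :: "'a model \<Rightarrow> nat \<Rightarrow> 'a \<Rightarrow> 'a \<Rightarrow> real" where
  "bwd_kernel S t x x' = gam S t x * pot S t x * trans_dens S x x' * inv_gam S (Suc t) x'"

text \<open>The recursion runs over the number \<open>m = T - t\<close> of steps back from the final time \<open>T\<close>.\<close>

primrec Gamma_bwd_steps :: "'a model \<Rightarrow> nat \<Rightarrow> nat \<Rightarrow> ('a \<Rightarrow> real) \<Rightarrow> real" where
  "Gamma_bwd_steps S T 0 h =
     (\<integral>x. bwd_init_prop S x * (enn2real (bwd_omega_final S T x))\<^sup>2 * (h x)\<^sup>2 \<partial>base S) /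
     (\<integral>x. bwd_init_prop S x * enn2real (bwd_omega_final S T x) \<partial>base S)\<^sup>2"
| "Gamma_bwd_steps S T (Suc m) h =
     (let t = T - Suc m in
       (Gamma_bwd_steps S T m (\<lambda>y. \<integral>x. bwd_kernel S t x y * h x \<partial>base S) +
        (\<integral>y. (\<integral>x. enn2real (bwd_omega S t x y) * bwd_kernel S t x y * (h x)\<^sup>2 \<partial>base S)
           \<partial>bwd_info S T (Suc t)) *
        (\<integral>y. bwd_adj S t y * inv_gam S (Suc t) y \<partial>bwd_info S T (Suc t))) /
       (\<integral>y. (\<integral>x. bwd_kernel S t x y \<partial>base S) \<partial>bwd_info S T (Suc t))\<^sup>2)"

definition Gamma_bwd :: "'a model \<Rightarrow> nat \<Rightarrow> nat \<Rightarrow> ('a \<Rightarrow> real) \<Rightarrow> real" where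
  "Gamma_bwd S T t h = Gamma_bwd_steps S T (T - t) h"

definition Gamma_tilde :: "'a model \<Rightarrow> nat \<Rightarrow> nat \<Rightarrow> nat \<Rightarrow> ('a \<Rightarrow> 'a \<Rightarrow> real) \<Rightarrow> real" where
  "Gamma_tilde S T s t H =
     Gamma_fwd S s (\<lambda>x. \<integral>x'. H x x' \<partial>bwd_info S T t) +
     Gamma_bwd S T t (\<lambda>x'. \<integral>x. H x x' \<partial>filtering S s)"

definition H_fwd :: "'a model \<Rightarrow> nat \<Rightarrow> ('a \<Rightarrow> real) \<Rightarrow> 'a \<Rightarrow> 'a \<Rightarrow> real" where
  "H_fwd S s h x x' = h x * trans_dens S x x' * inv_gam S (s + 1) x'"

definition H_bwd :: "'a model \<Rightarrow> nat \<Rightarrow> ('a \<Rightarrow> real) \<Rightarrow> 'a \<Rightarrow> 'a \<Rightarrow> real" where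
  "H_bwd S s h x x' = trans_dens S x x' * inv_gam S s x' * h x'"

definition Delta_fwd :: "'a model \<Rightarrow> nat \<Rightarrow> nat \<Rightarrow> ('a \<Rightarrow> real) \<Rightarrow> real" where
  "Delta_fwd S T s h =
     Gamma_tilde S T s (s + 1) (H_fwd S s h) /
     (\<integral>(x, x'). (trans_dens S \<odot> inv_gam S (s + 1)) x x' \<partial>(filtering S s \<Otimes>\<^sub>M bwd_info S T (s + 1)))\<^sup>2"

definition Delta_bwd :: "'a model \<Rightarrow> nat \<Rightarrow> nat \<Rightarrow> ('a \<Rightarrow> real) \<Rightarrow> real" where
  "Delta_bwd S T s h =
     Gamma_tilde S T (s - 1) s (H_bwd S s h) /
     (\<integral>(x, x'). (trans_dens S \<odot> inv_gam S s) x x' \<partial>(filtering S (s - 1) \<Otimes>\<^sub>M bwd_info S T s))\<^sup>2"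

end

theory Submission
  imports Defs
begin

text \<open>
  A weighted sample has a law of large numbers and a central limit theorem for all bounded test
  functions, where the test function may depend on \<open>N\<close> and on an independent random parameter
  whose own Gaussian fluctuation is added to the limiting variance. One step of a particle filter
  preserves both properties: given the past, the new particles are i.i.d., so the characteristic
  function of the centred sum is close to that of a Gaussian with the conditional variance, while the
  conditional mean is a ratio of weighted averages over the previous generation. This yields the
  recursion for \<open>\<Gamma>\<close>, and time reversal with \<open>g\<^sub>T \<gamma>\<^sub>T\<close> as initial potential turns the backward filter
  into an instance of the same chain.

  The two-filter estimator is a ratio of double sums over the two independent particle systems. With
  the backward system as the random parameter, \<open>x \<mapsto> \<Sum>\<^sub>j w\<^sub>j K(x, y\<^sub>j)\<close> is a random test function for the
  forward sample. Its integral under the filtering law is a backward average and contributes the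
  backward variance, and its limit contributes the forward variance. Slutsky's theorem treats the
  denominator.
\<close>

section \<open>Convergence to centred Gaussian laws\<close>

text \<open>Limits are handled through characteristic functions on a separate probability space for
  each \<open>N\<close>: there conditioning turns sums into products, and a further Gaussian source
  multiplies the limit. The obstacle is that no random denominator is bounded below. The normalising
  sums are positive, but may be arbitrarily small. Since importance weights are bounded, every
  numerator is dominated by a multiple of its denominator, and such ratios converge in L1 all the
  same. Random test functions converge only at each fixed \<open>x\<close>, in mean over the
  parameter. A law of large numbers for the other system delivers no more, but this mode of
  convergence passes through bounded kernels by dominated convergence, hence back through every time
  step. Weighted averages stay unnormalised: they converge to \<open>c\<close> times a filter
  integral, and the positive constant \<open>c\<close> changes from step to step and cancels in
  ratios. The functions \<open>\<gamma>\<close> are artificial: each backward kernel divides by the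
  one its predecessor introduced. Positivity and integrability of \<open>g T * \<gamma> T\<close>
  also yield sigma-finiteness of the base measure, which the model does not postulate.\<close>

lemma gaussian_eq_distr:
  assumes "0 < v"
  shows "gaussian v = distr std_normal_distribution borel (\<lambda>x. sqrt v * x)"
proof -
  interpret prob_space std_normal_distribution
    by (simp add: prob_space_normal_density)
  have "distributed std_normal_distribution lborel (\<lambda>x. x) std_normal_density"
    unfolding distributed_def
    by (auto simp: distr_id2 intro!: measure_eqI simp: emeasure_distr)
  from normal_density_affine[OF this, of "sqrt v" 0] assms
  have "distributed std_normal_distribution lborel (\<lambda>x. sqrt v * x) (normal_density 0 (sqrt v))"
    by simp
  then show ?thesis
    using assms by (simp add: distributed_def gaussian_def cong: distr_cong)
qed

lemma real_distribution_gaussian: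
  assumes "0 \<le> v"
  shows "real_distribution (gaussian v)"
proof (cases "v = 0")
  case True
  then show ?thesis
    by (auto simp: gaussian_def real_distribution_def real_distribution_axioms_def prob_space_return)
next
  case False
  with assms have v: "0 < v" by simp
  interpret real_distribution std_normal_distribution by (rule real_dist_normal_dist)
  show ?thesis
    unfolding gaussian_eq_distr[OF v] by (rule real_distribution_distr) simp
qed

lemma char_gaussian:
  assumes "0 \<le> v"
  shows "char (gaussian v) t = complex_of_real (exp (- (t\<^sup>2 * v / 2)))"
proof (cases "v = 0")
  case True
  then show ?thesis
    by (simp add: gaussian_def char_def integral_return)
next
  case False
  with assms have v: "0 < v" by simp
  have "char (gaussian v) t = char std_normal_distribution (t * sqrt v)"
    unfolding gaussian_eq_distr[OF v] char_def
    by (subst integral_distr) (simp_all add: mult_ac)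
  also have "\<dots> = complex_of_real (exp (- (t\<^sup>2 * v / 2)))"
    using v by (simp add: char_std_normal_distribution power_mult_distrib)
  finally show ?thesis .
qed

text \<open>Convergence in law to \<open>gaussian v\<close> in the form of Levy's criterion, with
  one probability space per \<open>N\<close>. An asymptotically independent Gaussian contribution
  multiplies the limit, so variances add. Neither measurability nor \<open>0 \<le> v\<close> is
  built in; the sign follows in \<open>cf_lim_nonneg\<close>.\<close>

definition cf_lim :: "(nat \<Rightarrow> 'w measure) \<Rightarrow> (nat \<Rightarrow> 'w \<Rightarrow> real) \<Rightarrow> real \<Rightarrow> bool" where
  "cf_lim M X v \<longleftrightarrow>
     (\<forall>t. (\<lambda>N. \<integral>w. iexp (t * X N w) \<partial>M N) \<longlonglongrightarrow> complex_of_real (exp (- (t\<^sup>2 * v / 2))))"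

text \<open>The Bochner integral of a non-integrable function is 0, so the bound survives without
  measurability.\<close>

lemma norm_integral_le_one:
  fixes f :: "'w \<Rightarrow> complex"
  assumes "prob_space M" "\<And>x. norm (f x) \<le> 1"
  shows "norm (\<integral>x. f x \<partial>M) \<le> 1"
proof -
  interpret prob_space M by fact
  show ?thesis
  proof (cases "integrable M f")
    case True
    have "norm (\<integral>x. f x \<partial>M) \<le> (\<integral>x. norm (f x) \<partial>M)" by simp
    also have "\<dots> \<le> (\<integral>x. 1 \<partial>M)"
      using assms(2) True by (intro integral_mono) auto
    finally show ?thesis by (simp add: prob_space)
  qed (simp add: not_integrable_integral_eq)
qed

text \<open>A characteristic function has modulus at most 1; at \<open>t = 1\<close> this forces
  \<open>exp (- v / 2) \<le> 1\<close>. The sign of the recursively defined asymptotic variances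
  thus comes from the limit itself.\<close>

lemma cf_lim_nonneg:
  assumes "cf_lim M X v" "\<And>N. prob_space (M N)"
  shows "0 \<le> v"
proof -
  have "(\<lambda>N. \<integral>w. iexp (1 * X N w) \<partial>M N) \<longlonglongrightarrow> complex_of_real (exp (- (1\<^sup>2 * v / 2)))"
    using assms(1) unfolding cf_lim_def by blast
  then have "(\<lambda>N. norm (\<integral>w. iexp (1 * X N w) \<partial>M N)) \<longlonglongrightarrow> norm (complex_of_real (exp (- (1\<^sup>2 * v / 2))))"
    by (rule tendsto_norm)
  then have "norm (complex_of_real (exp (- (1\<^sup>2 * v / 2)))) \<le> 1"
    by (rule LIMSEQ_le_const2) (intro exI[of _ 0] allI impI norm_integral_le_one assms, simp)
  then show ?thesis by simp
qed

lemma cf_lim_weak_conv: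
  assumes lim: "cf_lim M X v" and prob: "\<And>N. prob_space (M N)"
    and [measurable]: "\<And>N. X N \<in> borel_measurable (M N)"
  shows "weak_conv_m (\<lambda>N. distr (M N) borel (X N)) (gaussian v)"
proof (rule levy_continuity)
  have v: "0 \<le> v" by (rule cf_lim_nonneg[OF lim prob])
  show "real_distribution (distr (M N) borel (X N))" for N
    by (intro prob_space.real_distribution_distr prob) simp
  show "real_distribution (gaussian v)" by (rule real_distribution_gaussian[OF v])
  show "(\<lambda>N. char (distr (M N) borel (X N)) t) \<longlonglongrightarrow> char (gaussian v) t" for t
    using lim unfolding char_gaussian[OF v] by (simp add: char_def integral_distr cf_lim_def)
qed

lemma le_mult_min_one:
  fixes n a d :: real
  assumes "n \<le> a * d" "n \<le> 2" "0 \<le> a" "0 \<le> d"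
  shows "n \<le> (a + 2) * min 1 d"
proof (cases "1 \<le> d")
  case True
  then show ?thesis using assms by simp
next
  case False
  then show ?thesis using assms by (simp add: distrib_right)
qed

text \<open>The mean of \<open>min 1 \<bar>X - Y\<bar>\<close> metrises convergence in probability.
  The map \<open>iexp (t * x)\<close> is Lipschitz with constant \<open>\<bar>t\<bar>\<close> and
  oscillates by at most 2, hence it is controlled by
  \<open>(\<bar>t\<bar> + 2) * min 1 \<bar>x - y\<bar>\<close>.\<close>

lemma cf_lim_perturb:
  assumes lim: "cf_lim M X v" and prob: "\<And>N. prob_space (M N)"
    and [measurable]: "\<And>N. X N \<in> borel_measurable (M N)" "\<And>N. Y N \<in> borel_measurable (M N)"
    and small: "(\<lambda>N. \<integral>w. min 1 \<bar>X N w - Y N w\<bar> \<partial>M N) \<longlonglongrightarrow> 0"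
  shows "cf_lim M Y v"
  unfolding cf_lim_def
proof
  fix t :: real
  have bnd: "norm (iexp (t * X N w) - iexp (t * Y N w)) \<le> (\<bar>t\<bar> + 2) * min 1 \<bar>X N w - Y N w\<bar>" for N w
  proof -
    have "iexp (t * X N w) - iexp (t * Y N w) = iexp (t * Y N w) * (iexp (t * (X N w - Y N w)) - 1)"
      by (simp add: algebra_simps flip: exp_add)
    then have e: "norm (iexp (t * X N w) - iexp (t * Y N w)) = norm (iexp (t * (X N w - Y N w)) - 1)"
      by (simp add: norm_mult)
    show ?thesis
    proof (rule le_mult_min_one)
      show "norm (iexp (t * X N w) - iexp (t * Y N w)) \<le> \<bar>t\<bar> * \<bar>X N w - Y N w\<bar>"
        using iexp_approx1[of "t * (X N w - Y N w)" 0] unfolding e abs_mult[symmetric] by simp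
      show "norm (iexp (t * X N w) - iexp (t * Y N w)) \<le> 2"
        using norm_triangle_ineq4[of "iexp (t * (X N w - Y N w))" 1] unfolding e by simp
    qed auto
  qed
  have "norm ((\<integral>w. iexp (t * X N w) \<partial>M N) - (\<integral>w. iexp (t * Y N w) \<partial>M N))
      \<le> (\<bar>t\<bar> + 2) * (\<integral>w. min 1 \<bar>X N w - Y N w\<bar> \<partial>M N)" for N
  proof -
    interpret prob_space "M N" by (rule prob)
    have i1: "integrable (M N) (\<lambda>w. iexp (t * X N w))" by (intro integrable_iexp) auto
    have i2: "integrable (M N) (\<lambda>w. iexp (t * Y N w))" by (intro integrable_iexp) auto
    have i3: "integrable (M N) (\<lambda>w. min 1 \<bar>X N w - Y N w\<bar>)"
      by (rule integrable_const_bound[where B=1]) auto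
    have "(\<integral>w. iexp (t * X N w) \<partial>M N) - (\<integral>w. iexp (t * Y N w) \<partial>M N)
        = (\<integral>w. iexp (t * X N w) - iexp (t * Y N w) \<partial>M N)"
      using i1 i2 by simp
    also have "norm \<dots> \<le> (\<integral>w. norm (iexp (t * X N w) - iexp (t * Y N w)) \<partial>M N)"
      by simp
    also have "\<dots> \<le> (\<integral>w. (\<bar>t\<bar> + 2) * min 1 \<bar>X N w - Y N w\<bar> \<partial>M N)"
      using i1 i2 i3 bnd by (intro integral_mono) auto
    finally show ?thesis by simp
  qed
  then have "\<forall>\<^sub>F N in sequentially. norm ((\<integral>w. iexp (t * X N w) \<partial>M N) - (\<integral>w. iexp (t * Y N w) \<partial>M N))
      \<le> (\<bar>t\<bar> + 2) * (\<integral>w. min 1 \<bar>X N w - Y N w\<bar> \<partial>M N)"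
    by (intro always_eventually allI)
  then have "(\<lambda>N. (\<integral>w. iexp (t * X N w) \<partial>M N) - (\<integral>w. iexp (t * Y N w) \<partial>M N)) \<longlonglongrightarrow> 0"
    by (rule Lim_null_comparison) (rule tendsto_mult_right_zero[OF small])
  moreover have "(\<lambda>N. \<integral>w. iexp (t * X N w) \<partial>M N) \<longlonglongrightarrow> complex_of_real (exp (- (t\<^sup>2 * v / 2)))"
    using lim unfolding cf_lim_def by blast
  ultimately show "(\<lambda>N. \<integral>w. iexp (t * Y N w) \<partial>M N) \<longlonglongrightarrow> complex_of_real (exp (- (t\<^sup>2 * v / 2)))"
    by (rule Lim_transform2[rotated])
qed

text \<open>Truncation at level \<open>c\<close>: either \<open>a\<close> reaches \<open>c\<close>,
  which tightness makes rare, or \<open>a * b \<le> c * b\<close>.\<close>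

lemma min_one_mult_le:
  fixes a b c :: real
  assumes "0 \<le> a" "0 \<le> b" "0 < c"
  shows "min 1 (a * b) \<le> min 1 (a / c) + min 1 (c * b)"
proof (cases "a < c \<and> c * b < 1")
  case True
  then have "a * b \<le> c * b" "0 \<le> min 1 (a / c)" using assms by (auto intro: mult_right_mono)
  moreover have "min 1 (c * b) = c * b" using True by simp
  moreover have "min 1 (a * b) \<le> a * b" by simp
  ultimately show ?thesis by linarith
next
  case False
  then have "1 \<le> a / c \<or> 1 \<le> c * b" using assms by (auto simp: field_simps)
  moreover have "0 \<le> min 1 (a / c)" "0 \<le> min 1 (c * b)" using assms by auto
  moreover have "min 1 (a * b) \<le> 1" by simp
  moreover have "1 \<le> a / c \<Longrightarrow> min 1 (a / c) = 1" "1 \<le> c * b \<Longrightarrow> min 1 (c * b) = 1" by auto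
  ultimately show ?thesis by linarith
qed

text \<open>A sequence converging in law is tight: this is where the Levy continuity theorem enters.\<close>

lemma cf_lim_mult_small:
  assumes lim: "cf_lim M X v" and prob: "\<And>N. prob_space (M N)"
    and [measurable]: "\<And>N. X N \<in> borel_measurable (M N)" "\<And>N. Y N \<in> borel_measurable (M N)"
    and small: "(\<lambda>N. \<integral>w. min 1 \<bar>Y N w\<bar> \<partial>M N) \<longlonglongrightarrow> 0"
  shows "(\<lambda>N. \<integral>w. min 1 \<bar>X N w * Y N w\<bar> \<partial>M N) \<longlonglongrightarrow> 0"
proof (rule LIMSEQ_I)
  fix e :: real assume e: "0 < e"
  have v: "0 \<le> v" by (rule cf_lim_nonneg[OF lim prob])
  interpret G: real_distribution "gaussian v" by (rule real_distribution_gaussian[OF v])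
  \<comment> \<open>The truncation level is found under the Gaussian limit, where
    \<open>min 1 (\<bar>x\<bar> / c)\<close> has integral below \<open>e / 3\<close> once
    \<open>c\<close> is large. The integrand is bounded and continuous, so weak convergence
    transfers the bound to the laws of \<open>X N\<close>.\<close>
  have "(\<lambda>k. \<integral>x. min 1 (\<bar>x\<bar> / real (Suc k)) \<partial>gaussian v) \<longlonglongrightarrow> (\<integral>x. 0 \<partial>gaussian v)"
  proof (rule integral_dominated_convergence[where w="\<lambda>_. 1"])
    show "AE x in gaussian v. (\<lambda>k. min 1 (\<bar>x\<bar> / real (Suc k))) \<longlonglongrightarrow> 0"
    proof (rule AE_I2)
      fix x :: real
      have "(\<lambda>k. \<bar>x\<bar> / real (Suc k)) \<longlonglongrightarrow> 0"
        by (rule LIMSEQ_Suc[OF lim_const_over_n])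
      from tendsto_min[OF tendsto_const[of 1] this] show "(\<lambda>k. min 1 (\<bar>x\<bar> / real (Suc k))) \<longlonglongrightarrow> 0"
        by simp
    qed
  qed auto
  from LIMSEQ_D[OF this, of "e / 3"] e obtain k where
    k: "norm (\<integral>x. min 1 (\<bar>x\<bar> / real (Suc k)) \<partial>gaussian v) < e / 3"
    by auto
  define c where "c = real (Suc k)"
  have c: "0 < c" "1 \<le> c" by (auto simp: c_def)
  have "(\<lambda>N. \<integral>x. min 1 (\<bar>x\<bar> / c) \<partial>distr (M N) borel (X N)) \<longlonglongrightarrow> (\<integral>x. min 1 (\<bar>x\<bar> / c) \<partial>gaussian v)"
  proof (rule weak_conv_imp_integral_bdd_continuous_conv[where B=1])
    show "real_distribution (distr (M N) borel (X N))" for N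
      by (intro prob_space.real_distribution_distr prob) simp
    show "weak_conv_m (\<lambda>N. distr (M N) borel (X N)) (gaussian v)"
      by (rule cf_lim_weak_conv[OF lim prob]) simp
    show "isCont (\<lambda>x. min 1 (\<bar>x\<bar> / c)) x" for x
      using c by (intro continuous_intros) auto
  qed (use c G.real_distribution_axioms in \<open>auto simp: min_def\<close>)
  then have "(\<lambda>N. \<integral>w. min 1 (\<bar>X N w\<bar> / c) \<partial>M N) \<longlonglongrightarrow> (\<integral>x. min 1 (\<bar>x\<bar> / c) \<partial>gaussian v)"
    by (simp add: integral_distr)
  from LIMSEQ_D[OF this, of "e / 3"] e obtain N1 where
    N1: "\<And>N. N \<ge> N1 \<Longrightarrow> \<bar>(\<integral>w. min 1 (\<bar>X N w\<bar> / c) \<partial>M N) - (\<integral>x. min 1 (\<bar>x\<bar> / c) \<partial>gaussian v)\<bar> < e / 3"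
    by auto
  \<comment> \<open>Because \<open>1 \<le> c\<close>,
    \<open>min 1 (c * \<bar>y\<bar>) \<le> c * min 1 \<bar>y\<bar>\<close>; the factor
    \<open>c\<close> is paid for by this smaller threshold.\<close>
  from LIMSEQ_D[OF small, of "e / (3 * c)"] e c obtain N2 where
    N2: "\<And>N. N \<ge> N2 \<Longrightarrow> \<bar>\<integral>w. min 1 \<bar>Y N w\<bar> \<partial>M N\<bar> < e / (3 * c)"
    by auto
  show "\<exists>N0. \<forall>N\<ge>N0. norm ((\<integral>w. min 1 \<bar>X N w * Y N w\<bar> \<partial>M N) - 0) < e"
  proof (intro exI[of _ "max N1 N2"] allI impI)
    fix N assume N: "max N1 N2 \<le> N"
    interpret prob_space "M N" by (rule prob)
    have le: "min 1 \<bar>X N w * Y N w\<bar> \<le> min 1 (\<bar>X N w\<bar> / c) + c * min 1 \<bar>Y N w\<bar>" for w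
    proof -
      have "min 1 (c * \<bar>Y N w\<bar>) \<le> c * min 1 \<bar>Y N w\<bar>"
        using c by (cases "1 \<le> \<bar>Y N w\<bar>") simp_all
      with min_one_mult_le[of "\<bar>X N w\<bar>" "\<bar>Y N w\<bar>" c] c show ?thesis
        by (auto simp: abs_mult)
    qed
    have i1: "integrable (M N) (\<lambda>w. min 1 \<bar>X N w * Y N w\<bar>)"
      by (rule integrable_const_bound[where B=1]) auto
    have i2: "integrable (M N) (\<lambda>w. min 1 (\<bar>X N w\<bar> / c))"
      using c by (intro integrable_const_bound[where B=1]) (auto simp: min_def)
    have i3: "integrable (M N) (\<lambda>w. min 1 \<bar>Y N w\<bar>)"
      by (rule integrable_const_bound[where B=1]) auto
    have "(\<integral>w. min 1 \<bar>X N w * Y N w\<bar> \<partial>M N) \<le> (\<integral>w. min 1 (\<bar>X N w\<bar> / c) + c * min 1 \<bar>Y N w\<bar> \<partial>M N)"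
      using i1 i2 i3 le by (intro integral_mono) auto
    also have "\<dots> = (\<integral>w. min 1 (\<bar>X N w\<bar> / c) \<partial>M N) + c * (\<integral>w. min 1 \<bar>Y N w\<bar> \<partial>M N)"
      using i2 i3 by simp
    also have "\<dots> < e"
    proof -
      have "c * (\<integral>w. min 1 \<bar>Y N w\<bar> \<partial>M N) < e / 3"
        using N2[of N] N c by (simp add: field_simps abs_less_iff)
      moreover have "(\<integral>w. min 1 (\<bar>X N w\<bar> / c) \<partial>M N) < 2 * e / 3"
        using N1[of N] N k[folded c_def] unfolding real_norm_def by linarith
      ultimately show ?thesis by simp
    qed
    finally show "norm ((\<integral>w. min 1 \<bar>X N w * Y N w\<bar> \<partial>M N) - 0) < e"
      by (simp add: abs_of_nonneg integral_nonneg)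
  qed
qed

lemma cf_lim_scale:
  assumes "cf_lim M X v"
  shows "cf_lim M (\<lambda>N w. X N w * d) (d\<^sup>2 * v)"
  unfolding cf_lim_def
proof
  fix t :: real
  have "(\<lambda>N. \<integral>w. iexp ((t * d) * X N w) \<partial>M N) \<longlonglongrightarrow> complex_of_real (exp (- ((t * d)\<^sup>2 * v / 2)))"
    using assms unfolding cf_lim_def by blast
  then show "(\<lambda>N. \<integral>w. iexp (t * (X N w * d)) \<partial>M N) \<longlonglongrightarrow> complex_of_real (exp (- (t\<^sup>2 * (d\<^sup>2 * v) / 2)))"
    by (simp add: mult_ac power_mult_distrib)
qed

text \<open>\<open>X * d - X * D = X * (d - D)\<close> is a tight sequence times one that vanishes
  in probability.\<close>

lemma cf_lim_slutsky:
  assumes lim: "cf_lim M X v" and prob: "\<And>N. prob_space (M N)"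
    and [measurable]: "\<And>N. X N \<in> borel_measurable (M N)" "\<And>N. D N \<in> borel_measurable (M N)"
    and small: "(\<lambda>N. \<integral>w. min 1 \<bar>D N w - d\<bar> \<partial>M N) \<longlonglongrightarrow> 0"
  shows "cf_lim M (\<lambda>N w. X N w * D N w) (d\<^sup>2 * v)"
proof (rule cf_lim_perturb[OF cf_lim_scale[OF lim] prob])
  have "(\<lambda>N. \<integral>w. min 1 \<bar>X N w * (d - D N w)\<bar> \<partial>M N) \<longlonglongrightarrow> 0"
    using small by (intro cf_lim_mult_small[OF lim prob]) (auto simp: abs_minus_commute)
  then show "(\<lambda>N. \<integral>w. min 1 \<bar>X N w * d - X N w * D N w\<bar> \<partial>M N) \<longlonglongrightarrow> 0"
    by (simp add: algebra_simps)
qed auto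

lemma inverse_conv_in_prob:
  fixes D :: "nat \<Rightarrow> 'w \<Rightarrow> real"
  assumes prob: "\<And>N. prob_space (M N)"
    and [measurable]: "\<And>N. D N \<in> borel_measurable (M N)"
    and int: "\<And>N. integrable (M N) (D N)"
    and lim: "(\<lambda>N. \<integral>w. \<bar>D N w - d\<bar> \<partial>M N) \<longlonglongrightarrow> 0" and d: "d \<noteq> 0"
  shows "(\<lambda>N. \<integral>w. min 1 \<bar>c / D N w - c / d\<bar> \<partial>M N) \<longlonglongrightarrow> 0"
proof -
  \<comment> \<open>The first term is a Lipschitz constant at \<open>d\<close> for
    \<open>c / x\<close> on \<open>\<bar>x - d\<bar> \<le> \<bar>d\<bar> / 2\<close>. Farther away
    the truncation by 1 suffices, since
    \<open>1 \<le> 2 / \<bar>d\<bar> * \<bar>x - d\<bar>\<close>; this includes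
    \<open>x = 0\<close>, where the quotient is 0.\<close>
  define K where "K = 2 * \<bar>c\<bar> / d\<^sup>2 + 2 / \<bar>d\<bar>"
  have le: "min 1 \<bar>c / x - c / d\<bar> \<le> K * \<bar>x - d\<bar>" for x
  proof (cases "\<bar>x - d\<bar> \<le> \<bar>d\<bar> / 2")
    case True
    then have x: "\<bar>d\<bar> / 2 \<le> \<bar>x\<bar>" by linarith
    then have "x \<noteq> 0" using d by auto
    note x = x this
    have "c / x - c / d = c * (d - x) / (x * d)"
      using x d by (simp add: field_simps)
    then have "\<bar>c / x - c / d\<bar> = \<bar>c\<bar> * \<bar>x - d\<bar> / (\<bar>x\<bar> * \<bar>d\<bar>)"
      by (simp add: abs_mult abs_minus_commute)
    also have "\<dots> \<le> \<bar>c\<bar> * \<bar>x - d\<bar> / (\<bar>d\<bar> / 2 * \<bar>d\<bar>)"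
      using x d by (intro divide_left_mono mult_right_mono mult_nonneg_nonneg mult_pos_pos) auto
    also have "\<dots> = 2 * \<bar>c\<bar> / d\<^sup>2 * \<bar>x - d\<bar>"
      by (simp add: field_simps power2_eq_square)
    also have "\<dots> \<le> K * \<bar>x - d\<bar>"
      unfolding K_def by (intro mult_right_mono) auto
    finally show ?thesis by simp
  next
    case False
    then have "1 \<le> 2 / \<bar>d\<bar> * \<bar>x - d\<bar>" using d by (simp add: field_simps)
    also have "\<dots> \<le> K * \<bar>x - d\<bar>" unfolding K_def by (intro mult_right_mono) auto
    finally show ?thesis by simp
  qed
  have "\<forall>\<^sub>F N in sequentially. norm (\<integral>w. min 1 \<bar>c / D N w - c / d\<bar> \<partial>M N) \<le> K * (\<integral>w. \<bar>D N w - d\<bar> \<partial>M N)"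
  proof (intro always_eventually allI)
    fix N
    interpret prob_space "M N" by (rule prob)
    have "norm (\<integral>w. min 1 \<bar>c / D N w - c / d\<bar> \<partial>M N) = (\<integral>w. min 1 \<bar>c / D N w - c / d\<bar> \<partial>M N)"
      by (simp add: integral_nonneg)
    also have "\<dots> \<le> (\<integral>w. K * \<bar>D N w - d\<bar> \<partial>M N)"
    proof (rule integral_mono)
      show "integrable (M N) (\<lambda>w. min 1 \<bar>c / D N w - c / d\<bar>)"
        by (rule integrable_const_bound[where B=1]) auto
      show "integrable (M N) (\<lambda>w. K * \<bar>D N w - d\<bar>)"
        using int by simp
    qed (rule le)
    finally show "norm (\<integral>w. min 1 \<bar>c / D N w - c / d\<bar> \<partial>M N) \<le> K * (\<integral>w. \<bar>D N w - d\<bar> \<partial>M N)"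
      by simp
  qed
  then show ?thesis
    by (rule Lim_null_comparison) (rule tendsto_mult_right_zero[OF lim])
qed

text \<open>In \<open>x / s - x0 / s0 = (x / s * (s0 - s) + (x - x0)) / s0\<close> the variable
  denominator occurs only in \<open>x / s\<close>, which the domination
  \<open>\<bar>x\<bar> \<le> K * s\<close> keeps below \<open>K\<close>. So \<open>s\<close> may
  come arbitrarily close to 0; at \<open>s = 0\<close> also \<open>x = 0\<close>, and the quotient
  is 0.\<close>

lemma ratio_diff_le:
  fixes x s x0 s0 K :: real
  assumes "\<bar>x\<bar> \<le> K * s" "0 \<le> s" "0 < s0" "0 \<le> K"
  shows "\<bar>x / s - x0 / s0\<bar> \<le> (K * \<bar>s - s0\<bar> + \<bar>x - x0\<bar>) / s0"
proof (cases "s = 0")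
  case True
  then have "x = 0" using assms by simp
  then have "\<bar>x / s - x0 / s0\<bar> = \<bar>x0\<bar> / s0" using assms by (simp add: abs_divide)
  also have "\<dots> \<le> (K * \<bar>s - s0\<bar> + \<bar>x - x0\<bar>) / s0"
    using assms \<open>x = 0\<close> by (intro divide_right_mono) auto
  finally show ?thesis .
next
  case False
  with assms have s: "0 < s" by simp
  have "x / s - x0 / s0 = (x / s * (s0 - s) + (x - x0)) / s0"
    using s assms by (simp add: field_simps)
  also have "\<bar>\<dots>\<bar> = \<bar>x / s * (s0 - s) + (x - x0)\<bar> / s0"
    using assms by (simp only: abs_divide abs_of_pos)
  also have "\<dots> \<le> (\<bar>x / s * (s0 - s)\<bar> + \<bar>x - x0\<bar>) / s0"
    using assms by (intro divide_right_mono abs_triangle_ineq) auto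
  also have "\<dots> \<le> (K * \<bar>s - s0\<bar> + \<bar>x - x0\<bar>) / s0"
  proof -
    have "\<bar>x / s\<bar> \<le> K" using s assms by (simp add: abs_divide field_simps)
    then have "\<bar>x / s * (s0 - s)\<bar> \<le> K * \<bar>s - s0\<bar>"
      unfolding abs_mult abs_minus_commute[of s0 s] by (rule mult_right_mono) simp
    then show ?thesis using assms by (intro divide_right_mono) auto
  qed
  finally show ?thesis .
qed

section \<open>Conditionally independent samples\<close>

declare One_nat_def [simp del]

text \<open>\<open>F\<close> plays the role of the past; given it, \<open>Z 1, \<dots>, Z n\<close> are i.i.d. with density \<open>k w\<close>.\<close>

locale cond_sampling = prob_space P for P :: "'w measure" +
  fixes F :: "'w measure" and M :: "'z measure" and n :: nat
    and Z :: "nat \<Rightarrow> 'w \<Rightarrow> 'z" and k :: "'w \<Rightarrow> 'z \<Rightarrow> real"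
  assumes subalg: "subalgebra P F"
    and sf_M: "sigma_finite_measure M"
    and n_pos: "0 < n"
    and Z_meas: "\<And>l. l \<in> {1..n} \<Longrightarrow> Z l \<in> measurable P M"
    and k_meas: "(\<lambda>(w, z). k w z) \<in> borel_measurable (F \<Otimes>\<^sub>M M)"
    and k_nonneg: "\<And>w z. w \<in> space P \<Longrightarrow> z \<in> space M \<Longrightarrow> 0 \<le> k w z"
    and k_le: "\<And>w. w \<in> space P \<Longrightarrow> (\<integral>\<^sup>+z. ennreal (k w z) \<partial>M) \<le> 1"
    and k_eq: "AE w in P. (\<integral>\<^sup>+z. ennreal (k w z) \<partial>M) = 1"
    and law: "\<And>A B. A \<in> sets F \<Longrightarrow> (\<And>l. l \<in> {1..n} \<Longrightarrow> B l \<in> sets M) \<Longrightarrow>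
      (\<integral>\<^sup>+w. indicator A w * (\<Prod>l=1..n. indicator (B l) (Z l w)) \<partial>P) =
      (\<integral>\<^sup>+w. indicator A w * (\<Prod>l=1..n. \<integral>\<^sup>+z. ennreal (k w z) * indicator (B l) z \<partial>M) \<partial>P)"
begin

text \<open>The law of the past, as a measure on the sigma-field \<open>F\<close> itself: past and
  sample together then have a density on \<open>R \<Otimes>\<^sub>M ZM\<close>, and Fubini
  applies.\<close>

definition R where "R = restr_to_subalg P F"

sublocale M: sigma_finite_measure M by (rule sf_M)
sublocale R: prob_space R
  unfolding R_def by (rule prob_space_restr_to_subalg[OF subalg prob_space_axioms])
sublocale prd: product_sigma_finite "\<lambda>_::nat. M" ..

abbreviation "ZM \<equiv> Pi\<^sub>M {1..n} (\<lambda>_. M)"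

sublocale ZM: sigma_finite_measure ZM
  by (rule prd.sigma_finite) simp
sublocale RZ: pair_sigma_finite R ZM ..

lemma space_F: "space F = space P"
  using subalg by (simp add: subalgebra_def)

lemma sets_R[measurable_cong]: "sets R = sets F"
  unfolding R_def by (rule sets_restr_to_subalg[OF subalg])

lemma space_R: "space R = space P"
  using sets_eq_imp_space_eq[OF sets_R] space_F by simp

lemma from_F: "f \<in> measurable F N \<Longrightarrow> f \<in> measurable P N"
  by (rule measurable_from_subalg[OF subalg])

lemma id_meas[measurable]: "(\<lambda>w. w) \<in> measurable P R"
  by (rule from_F) (use measurable_ident_sets[OF sets_R[symmetric]] in simp)

lemma k_meas_R[measurable]: "(\<lambda>(w, z). k w z) \<in> borel_measurable (R \<Otimes>\<^sub>M M)"
  using k_meas by (simp cong: measurable_cong_sets)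

lemma Z_tuple[measurable]: "(\<lambda>w. \<lambda>l\<in>{1..n}. Z l w) \<in> measurable P ZM"
  by (intro measurable_restrict Z_meas)

lemma joint_meas[measurable]: "(\<lambda>w. (w, \<lambda>l\<in>{1..n}. Z l w)) \<in> measurable P (R \<Otimes>\<^sub>M ZM)"
  by measurable

lemma k_meas_w: "w \<in> space P \<Longrightarrow> k w \<in> borel_measurable M"
  using measurable_compose[OF measurable_Pair1' k_meas, of w] by (simp add: space_F)

lemma dens_meas: "(\<lambda>(w, z). \<Prod>l=1..n. ennreal (k w (z l))) \<in> borel_measurable (R \<Otimes>\<^sub>M ZM)"
proof -
  have "(\<lambda>x. ennreal (k (fst x) (snd x l))) \<in> borel_measurable (R \<Otimes>\<^sub>M ZM)" if "l \<in> {1..n}" for l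
    using measurable_compose[OF _ k_meas_R, of "\<lambda>x. (fst x, snd x l)" "R \<Otimes>\<^sub>M ZM"] that by simp
  then show ?thesis unfolding case_prod_beta by (rule borel_measurable_prod_ennreal)
qed

text \<open>The assumption \<open>law\<close> is this equality on rectangles. Rectangles with one
  side in \<open>F\<close> and the other in the product algebra are stable under intersection and
  generate the product sigma-field, so equality of the finite measures extends to all sets.\<close>

lemma joint_law:
  "distr P (R \<Otimes>\<^sub>M ZM) (\<lambda>w. (w, \<lambda>l\<in>{1..n}. Z l w)) =
   density (R \<Otimes>\<^sub>M ZM) (\<lambda>(w, z). \<Prod>l=1..n. ennreal (k w (z l)))"
    (is "?D = ?K")
proof (rule measure_eqI_generator_eq)
  let ?E = "{a \<times> b | a b. a \<in> sets F \<and> b \<in> prod_algebra {1..n} (\<lambda>_. M)}"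
  let ?\<Omega> = "space P \<times> (\<Pi>\<^sub>E i\<in>{1..n}. space M)"
  have \<Omega>2: "(\<Pi>\<^sub>E i\<in>{1..n}. space M) \<in> prod_algebra {1..n} (\<lambda>_. M)"
    by (rule prod_algebraI_finite) auto
  show "Int_stable ?E"
  proof (rule Int_stableI)
    fix x y assume "x \<in> ?E" "y \<in> ?E"
    then obtain a b c d where *: "x = a \<times> b" "y = c \<times> d" "a \<in> sets F" "c \<in> sets F"
      "b \<in> prod_algebra {1..n} (\<lambda>_. M)" "d \<in> prod_algebra {1..n} (\<lambda>_. M)" by blast
    then have "x \<inter> y = (a \<inter> c) \<times> (b \<inter> d)" by auto
    moreover have "b \<inter> d \<in> prod_algebra {1..n} (\<lambda>_. M)"
      using * Int_stable_prod_algebra by (blast dest: Int_stableD)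
    moreover have "a \<inter> c \<in> sets F" using * by auto
    ultimately show "x \<inter> y \<in> ?E" by blast
  qed
  show "?E \<subseteq> Pow ?\<Omega>"
  proof
    fix x assume "x \<in> ?E"
    then obtain a b where x: "x = a \<times> b" "a \<in> sets F" "b \<in> prod_algebra {1..n} (\<lambda>_. M)" by blast
    have "a \<subseteq> space P" using sets.sets_into_space[OF x(2)] by (simp add: space_F)
    moreover have "b \<subseteq> (\<Pi>\<^sub>E i\<in>{1..n}. space M)" using x(3) prod_algebra_sets_into_space by blast
    ultimately show "x \<in> Pow ?\<Omega>" unfolding x by (simp add: Sigma_mono)
  qed
  have "sets (R \<Otimes>\<^sub>M ZM) = sets (sigma (space P) (sets F) \<Otimes>\<^sub>M sigma (\<Pi>\<^sub>E i\<in>{1..n}. space M) (prod_algebra {1..n} (\<lambda>_. M)))"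
  proof (rule sets_pair_measure_cong)
    show "sets R = sets (sigma (space P) (sets F))"
      by (simp add: sets_R flip: space_F)
    show "sets ZM = sets (sigma (\<Pi>\<^sub>E i\<in>{1..n}. space M) (prod_algebra {1..n} (\<lambda>_. M)))"
      using prod_algebra_sets_into_space[of "{1..n}" "\<lambda>_. M"] by (simp add: sets_PiM)
  qed
  also have "\<dots> = sets (sigma ?\<Omega> ?E)"
  proof (rule arg_cong[where f=sets], rule sigma_prod)
    show "\<exists>E\<subseteq>sets F. countable E \<and> space P = \<Union> E"
      using sets.top[of F] by (intro exI[of _ "{space P}"]) (auto simp: space_F)
    show "\<exists>E\<subseteq>prod_algebra {1..n} (\<lambda>_. M). countable E \<and> (\<Pi>\<^sub>E i\<in>{1..n}. space M) = \<Union> E"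
      by (intro exI[of _ "{\<Pi>\<^sub>E i\<in>{1..n}. space M}"]) (use \<Omega>2 in auto)
    show "sets F \<subseteq> Pow (space P)" using sets.sets_into_space[of _ F] by (auto simp: space_F)
    show "prod_algebra {1..n} (\<lambda>_. M) \<subseteq> Pow (\<Pi>\<^sub>E i\<in>{1..n}. space M)"
      using prod_algebra_sets_into_space[of "{1..n}" "\<lambda>_. M"] by simp
  qed
  also have "\<dots> = sigma_sets ?\<Omega> ?E"
    using \<open>?E \<subseteq> Pow ?\<Omega>\<close> by simp
  finally have sets_eq: "sets (R \<Otimes>\<^sub>M ZM) = sigma_sets ?\<Omega> ?E" .
  then show "sets ?D = sigma_sets ?\<Omega> ?E" "sets ?K = sigma_sets ?\<Omega> ?E"
    by simp_all
  show "range (\<lambda>_::nat. ?\<Omega>) \<subseteq> ?E"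
    using \<Omega>2 sets.top[of F] by (auto simp: space_F)
  show "(\<Union>i::nat. ?\<Omega>) = ?\<Omega>" by simp
  interpret D: prob_space ?D by (rule prob_space_distr) (rule joint_meas)
  show "emeasure ?D ?\<Omega> \<noteq> \<infinity>" by (rule D.emeasure_finite[unfolded infinity_ennreal_def[symmetric]])
  fix X assume "X \<in> ?E"
  then obtain a b where a: "a \<in> sets F" and b: "b \<in> prod_algebra {1..n} (\<lambda>_. M)" and X': "X = a \<times> b"
    by blast
  from b obtain B where B': "b = (\<Pi>\<^sub>E i\<in>{1..n}. B i)" "B \<in> {1..n} \<rightarrow> sets M"
    unfolding prod_algebra_eq_finite[OF finite_atLeastAtMost] by blast
  have B: "B i \<in> sets M" if "i \<in> {1..n}" for i using B'(2) that by (rule Pi_mem)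
  have X: "X = a \<times> (\<Pi>\<^sub>E i\<in>{1..n}. B i)" unfolding X' B'(1) ..
  have [measurable]: "a \<in> sets R" "a \<in> sets P"
    using a subalg by (auto simp: sets_R subalgebra_def)
  have PB[measurable]: "(\<Pi>\<^sub>E i\<in>{1..n}. B i) \<in> sets ZM"
    using B by (intro sets_PiM_I_finite) auto
  have Xm[measurable]: "X \<in> sets (R \<Otimes>\<^sub>M ZM)" unfolding X by measurable
  have "emeasure ?D X = (\<integral>\<^sup>+w. indicator X (w, \<lambda>l\<in>{1..n}. Z l w) \<partial>P)"
    using nn_integral_distr[OF joint_meas, of "indicator X"] Xm by (simp del: nn_integral_indicator add: nn_integral_indicator[symmetric])
  also have "\<dots> = (\<integral>\<^sup>+w. indicator a w * (\<Prod>l=1..n. indicator (B l) (Z l w)) \<partial>P)"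
  proof (rule nn_integral_cong)
    fix w
    have "(\<Prod>l=1..n. indicator (B l) (Z l w) :: ennreal) = indicator (\<Pi>\<^sub>E i\<in>{1..n}. B i) (\<lambda>l\<in>{1..n}. Z l w)"
    proof (cases "\<forall>l\<in>{1..n}. Z l w \<in> B l")
      case True
      then have "(\<lambda>l\<in>{1..n}. Z l w) \<in> (\<Pi>\<^sub>E i\<in>{1..n}. B i)" by auto
      with True show ?thesis by simp
    next
      case False
      then have "(\<lambda>l\<in>{1..n}. Z l w) \<notin> (\<Pi>\<^sub>E i\<in>{1..n}. B i)" by (auto simp: PiE_iff)
      moreover have "(\<Prod>l=1..n. indicator (B l) (Z l w) :: ennreal) = 0"
        using False by (intro prod_zero) (auto simp: indicator_def)
      ultimately show ?thesis by simp
    qed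
    then show "indicator X (w, \<lambda>l\<in>{1..n}. Z l w) = indicator a w * (\<Prod>l=1..n. indicator (B l) (Z l w) :: ennreal)"
      unfolding X by (simp add: indicator_times)
  qed
  also have "\<dots> = (\<integral>\<^sup>+w. indicator a w * (\<Prod>l=1..n. \<integral>\<^sup>+z. ennreal (k w z) * indicator (B l) z \<partial>M) \<partial>P)"
    by (rule law[OF a B])
  also have "\<dots> = (\<integral>\<^sup>+w. indicator a w * (\<Prod>l=1..n. \<integral>\<^sup>+z. ennreal (k w z) * indicator (B l) z \<partial>M) \<partial>R)"
    unfolding R_def
  proof (rule nn_integral_subalgebra2[OF subalg, symmetric])
    have [measurable]: "a \<in> sets F" by (rule a)
    have "(\<lambda>w. \<integral>\<^sup>+z. ennreal (k w z) * indicator (B l) z \<partial>M) \<in> borel_measurable F" if "l \<in> {1..n}" for l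
    proof -
      note [measurable] = B[OF that] k_meas
      show ?thesis by measurable
    qed
    then have prod_meas: "(\<lambda>w. \<Prod>l=1..n. \<integral>\<^sup>+z. ennreal (k w z) * indicator (B l) z \<partial>M) \<in> borel_measurable F"
      by (rule borel_measurable_prod_ennreal)
    show "(\<lambda>w. indicator a w * (\<Prod>l=1..n. \<integral>\<^sup>+z. ennreal (k w z) * indicator (B l) z \<partial>M)) \<in> borel_measurable F"
      by (rule borel_measurable_times_ennreal[OF borel_measurable_indicator[OF a] prod_meas])
  qed
  also have "\<dots> = (\<integral>\<^sup>+w. \<integral>\<^sup>+z. (\<Prod>l=1..n. ennreal (k w (z l))) * indicator X (w, z) \<partial>ZM \<partial>R)"
  proof (rule nn_integral_cong)
    fix w assume w: "w \<in> space R"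
    have kw: "k w \<in> borel_measurable M" using w by (simp add: k_meas_w space_R)
    have "(\<integral>\<^sup>+z. (\<Prod>l=1..n. ennreal (k w (z l))) * indicator X (w, z) \<partial>ZM)
        = (\<integral>\<^sup>+z. indicator a w * (\<Prod>l=1..n. ennreal (k w (z l)) * indicator (B l) (z l)) \<partial>ZM)"
    proof (rule nn_integral_cong)
      fix z assume z: "z \<in> space ZM"
      have "(\<Prod>l=1..n. indicator (B l) (z l) :: ennreal) = indicator (\<Pi>\<^sub>E i\<in>{1..n}. B i) z"
      proof (cases "\<forall>l\<in>{1..n}. z l \<in> B l")
        case True
        then have "z \<in> (\<Pi>\<^sub>E i\<in>{1..n}. B i)" using z by (auto simp: space_PiM PiE_iff)
        with True show ?thesis by simp
      next
        case False
        then have "z \<notin> (\<Pi>\<^sub>E i\<in>{1..n}. B i)" by (auto simp: PiE_iff)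
        moreover have "(\<Prod>l=1..n. indicator (B l) (z l) :: ennreal) = 0"
          using False by (intro prod_zero) (auto simp: indicator_def)
        ultimately show ?thesis by simp
      qed
      then show "(\<Prod>l=1..n. ennreal (k w (z l))) * indicator X (w, z)
          = indicator a w * (\<Prod>l=1..n. ennreal (k w (z l)) * indicator (B l) (z l))"
        unfolding X by (simp add: indicator_times prod.distrib mult_ac)
    qed
    also have "\<dots> = indicator a w * (\<integral>\<^sup>+z. (\<Prod>l=1..n. ennreal (k w (z l)) * indicator (B l) (z l)) \<partial>ZM)"
    proof (rule nn_integral_cmult)
      have "(\<lambda>z. ennreal (k w (z l)) * indicator (B l) (z l)) \<in> borel_measurable ZM" if "l \<in> {1..n}" for l
        using B[OF that] kw that by measurable
      then show "(\<lambda>z. \<Prod>l=1..n. ennreal (k w (z l)) * indicator (B l) (z l)) \<in> borel_measurable ZM"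
        by (intro borel_measurable_prod_ennreal)
    qed
    also have "\<dots> = indicator a w * (\<Prod>l=1..n. \<integral>\<^sup>+z. ennreal (k w z) * indicator (B l) z \<partial>M)"
    proof -
      have "(\<lambda>z. ennreal (k w z) * indicator (B l) z) \<in> borel_measurable M" if "l \<in> {1..n}" for l
        using B[OF that] kw by measurable
      then show ?thesis
        by (intro arg_cong[where f="\<lambda>x. indicator a w * x"]
            prd.product_nn_integral_prod[of "{1..n}" "\<lambda>l z. ennreal (k w z) * indicator (B l) z", OF finite_atLeastAtMost])
    qed
    finally show "indicator a w * (\<Prod>l=1..n. \<integral>\<^sup>+z. ennreal (k w z) * indicator (B l) z \<partial>M)
        = (\<integral>\<^sup>+z. (\<Prod>l=1..n. ennreal (k w (z l))) * indicator X (w, z) \<partial>ZM)"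
      by (rule sym)
  qed
  also have "\<dots> = (\<integral>\<^sup>+x. (case x of (w, z) \<Rightarrow> \<Prod>l=1..n. ennreal (k w (z l))) * indicator X x \<partial>(R \<Otimes>\<^sub>M ZM))"
  proof (subst ZM.nn_integral_fst[symmetric])
    show "(\<lambda>x. (case x of (w, z) \<Rightarrow> \<Prod>l=1..n. ennreal (k w (z l))) * indicator X x) \<in> borel_measurable (R \<Otimes>\<^sub>M ZM)"
      by (rule borel_measurable_times_ennreal[OF dens_meas borel_measurable_indicator[OF Xm]])
  qed (simp only: prod.case)
  also have "\<dots> = emeasure ?K X"
    by (rule emeasure_density[symmetric, OF dens_meas Xm])
  finally show "emeasure ?D X = emeasure ?K X" .
qed

text \<open>Integrability is wanted at every \<open>w\<close>. Hence the total mass of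
  \<open>k w\<close> is assumed to be at most 1 everywhere, but equal to 1 only almost surely: a
  sampling density becomes the zero function where its normalising sum vanishes.\<close>

lemma integrable_k:
  assumes w: "w \<in> space P" and u: "u \<in> borel_measurable M" and bd: "\<And>z. z \<in> space M \<Longrightarrow> norm (u z) \<le> D"
  shows "integrable M (\<lambda>z. k w z *\<^sub>R (u z :: 'b::{banach, second_countable_topology}))"
proof (rule Bochner_Integration.integrable_bound)
  have "integrable M (k w)"
  proof (rule integrableI_nonneg)
    show "AE z in M. 0 \<le> k w z" using k_nonneg[OF w] by auto
    show "(\<integral>\<^sup>+z. ennreal (k w z) \<partial>M) < \<infinity>" using k_le[OF w] by (simp add: order_le_less_trans)
  qed (rule k_meas_w[OF w])
  then show "integrable M (\<lambda>z. D * k w z)" by simp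
  show "AE z in M. norm (k w z *\<^sub>R u z) \<le> norm (D * k w z)"
  proof (rule AE_I2)
    fix z assume z: "z \<in> space M"
    have "norm (u z) \<le> \<bar>D\<bar>" using bd[OF z] by linarith
    then have "k w z * norm (u z) \<le> k w z * \<bar>D\<bar>" using k_nonneg[OF w z] by (intro mult_left_mono) auto
    then show "norm (k w z *\<^sub>R u z) \<le> norm (D * k w z)"
      using k_nonneg[OF w z] by (simp add: abs_mult mult_ac)
  qed
qed (use u k_meas_w[OF w] in measurable)

text \<open>Given the past, the expectation of a product factors over the labels. The factors
  \<open>u l\<close> may differ from label to label, which serves covariances as well as
  characteristic functions, and \<open>b\<close> is any bounded function of the past.\<close>

lemma expectation_prod:
  fixes b :: "'w \<Rightarrow> 'b::{real_normed_field,banach,second_countable_topology}"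
    and u :: "nat \<Rightarrow> 'w \<Rightarrow> 'z \<Rightarrow> 'b"
  assumes b_meas: "b \<in> borel_measurable F" and b_bd: "\<And>w. w \<in> space P \<Longrightarrow> norm (b w) \<le> Cb"
    and u_meas: "\<And>l. l \<in> {1..n} \<Longrightarrow> (\<lambda>(w, z). u l w z) \<in> borel_measurable (F \<Otimes>\<^sub>M M)"
    and u_bd: "\<And>l w z. l \<in> {1..n} \<Longrightarrow> w \<in> space P \<Longrightarrow> z \<in> space M \<Longrightarrow> norm (u l w z) \<le> Cu"
  shows "(\<integral>w. b w * (\<Prod>l=1..n. u l w (Z l w)) \<partial>P) =
         (\<integral>w. b w * (\<Prod>l=1..n. \<integral>z. k w z *\<^sub>R u l w z \<partial>M) \<partial>P)"
proof -
  let ?\<Phi> = "\<lambda>(w, z). b w * (\<Prod>l=1..n. u l w (z l))"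
  let ?k = "\<lambda>(w, z). \<Prod>l=1..n. k w (z l)"
  have b_R[measurable]: "b \<in> borel_measurable R"
    using b_meas by (simp cong: measurable_cong_sets)
  have u_R: "(\<lambda>(w, z). u l w z) \<in> borel_measurable (R \<Otimes>\<^sub>M M)" if "l \<in> {1..n}" for l
    using u_meas[OF that] by (simp cong: measurable_cong_sets)
  have "(\<lambda>x. u l (fst x) (snd x l)) \<in> borel_measurable (R \<Otimes>\<^sub>M ZM)" if "l \<in> {1..n}" for l
    using measurable_compose[OF _ u_R[OF that], of "\<lambda>x. (fst x, snd x l)" "R \<Otimes>\<^sub>M ZM"] that by simp
  then have \<Phi>_meas[measurable]: "?\<Phi> \<in> borel_measurable (R \<Otimes>\<^sub>M ZM)"
    unfolding case_prod_beta by (intro borel_measurable_times borel_measurable_prod) auto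
  have k_prod_meas[measurable]: "?k \<in> borel_measurable (R \<Otimes>\<^sub>M ZM)"
  proof -
    have "(\<lambda>x. k (fst x) (snd x l)) \<in> borel_measurable (R \<Otimes>\<^sub>M ZM)" if "l \<in> {1..n}" for l
      using measurable_compose[OF _ k_meas_R, of "\<lambda>x. (fst x, snd x l)" "R \<Otimes>\<^sub>M ZM"] that by simp
    then show ?thesis unfolding case_prod_beta by (intro borel_measurable_prod) auto
  qed
  have comp: "w \<in> space P \<and> (\<forall>l\<in>{1..n}. z l \<in> space M)" if "(w, z) \<in> space (R \<Otimes>\<^sub>M ZM)" for w z
    using that by (auto simp: space_pair_measure space_PiM space_R PiE_iff)
  have dens: "density (R \<Otimes>\<^sub>M ZM) (\<lambda>(w, z). \<Prod>l=1..n. ennreal (k w (z l))) = density (R \<Otimes>\<^sub>M ZM) (\<lambda>x. ennreal (?k x))"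
  proof (rule density_cong)
    show "AE x in R \<Otimes>\<^sub>M ZM. (case x of (w, z) \<Rightarrow> \<Prod>l=1..n. ennreal (k w (z l))) = ennreal (?k x)"
    proof (rule AE_I2)
      fix x assume x: "x \<in> space (R \<Otimes>\<^sub>M ZM)"
      obtain w z where wz: "x = (w, z)" by (cases x)
      show "(case x of (w, z) \<Rightarrow> \<Prod>l=1..n. ennreal (k w (z l))) = ennreal (?k x)"
        unfolding wz prod.case using comp[of w z] x wz by (intro prod_ennreal) (auto intro: k_nonneg)
    qed
  qed auto
  have law_eq: "distr P (R \<Otimes>\<^sub>M ZM) (\<lambda>w. (w, \<lambda>l\<in>{1..n}. Z l w)) = density (R \<Otimes>\<^sub>M ZM) (\<lambda>x. ennreal (?k x))"
    using joint_law dens by (rule trans)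
  have k_nn: "AE x in R \<Otimes>\<^sub>M ZM. 0 \<le> ?k x"
  proof (rule AE_I2)
    fix x assume x: "x \<in> space (R \<Otimes>\<^sub>M ZM)"
    obtain w z where wz: "x = (w, z)" by (cases x)
    show "0 \<le> ?k x"
      unfolding wz prod.case using comp[of w z] x wz by (intro prod_nonneg) (auto intro: k_nonneg)
  qed
  interpret D: prob_space "distr P (R \<Otimes>\<^sub>M ZM) (\<lambda>w. (w, \<lambda>l\<in>{1..n}. Z l w))"
    by (rule prob_space_distr) (rule joint_meas)
  have "integrable (distr P (R \<Otimes>\<^sub>M ZM) (\<lambda>w. (w, \<lambda>l\<in>{1..n}. Z l w))) ?\<Phi>"
  proof (rule D.integrable_const_bound[where B="Cb * Cu ^ n"])
    show "AE x in distr P (R \<Otimes>\<^sub>M ZM) (\<lambda>w. (w, \<lambda>l\<in>{1..n}. Z l w)). norm (?\<Phi> x) \<le> Cb * Cu ^ n"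
    proof (rule AE_I2)
      fix x assume "x \<in> space (distr P (R \<Otimes>\<^sub>M ZM) (\<lambda>w. (w, \<lambda>l\<in>{1..n}. Z l w)))"
      then have x: "x \<in> space (R \<Otimes>\<^sub>M ZM)" by simp
      obtain w z where wz: "x = (w, z)" by (cases x)
      have "norm (?\<Phi> x) = norm (b w) * (\<Prod>l=1..n. norm (u l w (z l)))"
        by (simp add: wz norm_mult prod_norm)
      also have "\<dots> \<le> Cb * (\<Prod>l=1..n. Cu)"
      proof (intro mult_mono prod_mono conjI)
        show "norm (b w) \<le> Cb" using b_bd comp[of w z] x wz by auto
        then show "0 \<le> Cb" using norm_ge_zero[of "b w"] by linarith
      qed (use comp[of w z] x wz in \<open>auto intro: u_bd prod_nonneg\<close>)
      finally show "norm (?\<Phi> x) \<le> Cb * Cu ^ n" by simp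
    qed
  qed (simp only: measurable_distr_eq1, rule \<Phi>_meas)
  then have intD: "integrable (density (R \<Otimes>\<^sub>M ZM) (\<lambda>x. ennreal (?k x))) ?\<Phi>"
    by (simp only: law_eq)
  have int: "integrable (R \<Otimes>\<^sub>M ZM) (\<lambda>x. ?k x *\<^sub>R ?\<Phi> x)"
    using intD
    by (rule iffD1[OF integrable_density[OF \<Phi>_meas k_prod_meas k_nn]])
  have "(\<integral>w. b w * (\<Prod>l=1..n. u l w (Z l w)) \<partial>P)
      = (\<integral>x. ?\<Phi> x \<partial>distr P (R \<Otimes>\<^sub>M ZM) (\<lambda>w. (w, \<lambda>l\<in>{1..n}. Z l w)))"
    by (subst integral_distr[OF joint_meas \<Phi>_meas]) (auto intro!: Bochner_Integration.integral_cong prod.cong)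
  also have "\<dots> = (\<integral>x. ?k x *\<^sub>R ?\<Phi> x \<partial>(R \<Otimes>\<^sub>M ZM))"
    unfolding law_eq by (rule integral_density[OF \<Phi>_meas k_prod_meas k_nn])
  also have "\<dots> = (\<integral>w. \<integral>z. ?k (w, z) *\<^sub>R ?\<Phi> (w, z) \<partial>ZM \<partial>R)"
    by (rule RZ.integral_fst'[symmetric, OF int])
  also have "\<dots> = (\<integral>w. b w * (\<Prod>l=1..n. \<integral>z. k w z *\<^sub>R u l w z \<partial>M) \<partial>R)"
  proof (rule Bochner_Integration.integral_cong[OF refl])
    fix w assume "w \<in> space R"
    then have w: "w \<in> space P" by (simp add: space_R)
    have uw: "u l w \<in> borel_measurable M" if "l \<in> {1..n}" for l
      using measurable_compose[OF measurable_Pair1' u_meas[OF that], of w] w by (simp add: space_F)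
    have sw: "(\<Prod>l=1..n. k w (z l)) *\<^sub>R (b w * (\<Prod>l=1..n. u l w (z l)))
        = b w * (\<Prod>l=1..n. k w (z l) *\<^sub>R u l w (z l))" for z
      by (simp add: scaleR_conv_of_real prod.distrib mult_ac)
    have "(\<integral>z. ?k (w, z) *\<^sub>R ?\<Phi> (w, z) \<partial>ZM) = b w * (\<integral>z. (\<Prod>l=1..n. k w (z l) *\<^sub>R u l w (z l)) \<partial>ZM)"
      by (simp add: sw)
    also have "(\<integral>z. (\<Prod>l=1..n. k w (z l) *\<^sub>R u l w (z l)) \<partial>ZM) = (\<Prod>l=1..n. \<integral>z. k w z *\<^sub>R u l w z \<partial>M)"
      by (rule prd.product_integral_prod) (auto intro!: integrable_k[OF w uw] u_bd w)
    finally show "(\<integral>z. ?k (w, z) *\<^sub>R ?\<Phi> (w, z) \<partial>ZM) = b w * (\<Prod>l=1..n. \<integral>z. k w z *\<^sub>R u l w z \<partial>M)" .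
  qed
  also have "\<dots> = (\<integral>w. b w * (\<Prod>l=1..n. \<integral>z. k w z *\<^sub>R u l w z \<partial>M) \<partial>P)"
    unfolding R_def
  proof (rule integral_subalgebra2[OF subalg])
    have m: "(\<lambda>w. \<integral>z. k w z *\<^sub>R u l w z \<partial>M) \<in> borel_measurable F" if "l \<in> {1..n}" for l
    proof -
      note [measurable] = u_meas[OF that] k_meas
      show ?thesis by measurable
    qed
    show "(\<lambda>w. b w * (\<Prod>l=1..n. \<integral>z. k w z *\<^sub>R u l w z \<partial>M)) \<in> borel_measurable F"
      by (rule borel_measurable_times[OF b_meas borel_measurable_prod[OF m]])
  qed
  finally show ?thesis .
qed

end

text \<open>With \<open>s = t / sqrt n\<close> and deviations bounded by \<open>2 * D\<close>: the
  first summand is the third-order Taylor remainder for one deviation, the second the error of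
  replacing \<open>1 - x\<close> by \<open>exp (- x)\<close> at \<open>x = s\<^sup>2 * v / 2\<close>
  with variance \<open>v\<close> at most \<open>(2 * D)\<^sup>2\<close>. The factor \<open>n\<close>
  counts the factors of the product.\<close>

definition cf_err :: "real \<Rightarrow> real \<Rightarrow> nat \<Rightarrow> real" where
  "cf_err D t n = real n * (\<bar>t / sqrt n\<bar> ^ 3 * (2 * D) ^ 3 / 6 + ((t / sqrt n)\<^sup>2 * (2 * D)\<^sup>2 / 2)\<^sup>2)"

text \<open>The two summands are of order \<open>1 / sqrt n\<close> and
  \<open>1 / n\<close>.\<close>

lemma cf_err_tendsto: "(\<lambda>N. cf_err D t (Suc N)) \<longlonglongrightarrow> 0"
proof -
  have eq: "cf_err D t (Suc N) = (\<bar>t\<bar> ^ 3 * (2 * D) ^ 3 / 6) * inverse (sqrt (real (Suc N)))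
      + (t ^ 4 * (2 * D) ^ 4 / 4) * inverse (real (Suc N))" for N
  proof -
    define r where "r = sqrt (real (Suc N))"
    have r: "0 < r" "real (Suc N) = r * r" by (auto simp: r_def)
    show ?thesis
      unfolding cf_err_def r_def[symmetric] unfolding r(2) using r(1)
      by (simp add: abs_divide field_simps power2_eq_square power3_eq_cube power4_eq_xxxx)
  qed
  have "(\<lambda>N. inverse (sqrt (real (Suc N)))) \<longlonglongrightarrow> 0"
    using LIMSEQ_inverse_real_of_nat[THEN tendsto_real_sqrt] by (simp add: real_sqrt_inverse)
  then have "(\<lambda>N. (\<bar>t\<bar> ^ 3 * (2 * D) ^ 3 / 6) * inverse (sqrt (real (Suc N)))
      + (t ^ 4 * (2 * D) ^ 4 / 4) * inverse (real (Suc N))) \<longlonglongrightarrow> 0"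
    using LIMSEQ_inverse_real_of_nat by (intro tendsto_add_zero tendsto_mult_right_zero)
  then show ?thesis by (simp only: eq)
qed

text \<open>Sandwich: \<open>1 - x \<le> exp (- x) \<le> 1 / (1 + x)\<close>.\<close>

lemma exp_minus_approx:
  fixes x :: real
  assumes "0 \<le> x"
  shows "\<bar>exp (- x) - (1 - x)\<bar> \<le> x\<^sup>2"
proof -
  have "1 - x \<le> exp (- x)" using exp_ge_add_one_self[of "- x"] by simp
  moreover have "exp (- x) \<le> 1 / (1 + x)"
    using exp_ge_add_one_self[of x] assms by (simp add: exp_minus field_simps)
  moreover have "1 / (1 + x) - (1 - x) \<le> x\<^sup>2"
  proof -
    have "1 / (1 + x) - (1 - x) = x\<^sup>2 / (1 + x)" using assms by (simp add: field_simps power2_eq_square)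
    also have "\<dots> \<le> x\<^sup>2 / 1" using assms by (intro divide_left_mono) auto
    finally show ?thesis by simp
  qed
  ultimately show ?thesis by linarith
qed

lemma integral_double_sum:
  fixes f :: "'i \<Rightarrow> 'j \<Rightarrow> 'w \<Rightarrow> real"
  assumes "\<And>i j. i \<in> A \<Longrightarrow> j \<in> B \<Longrightarrow> integrable M (f i j)"
  shows "(\<integral>w. (\<Sum>i\<in>A. \<Sum>j\<in>B. f i j w) \<partial>M) = (\<Sum>i\<in>A. \<Sum>j\<in>B. \<integral>w. f i j w \<partial>M)"
  using assms by simp

lemma abs_le_imp_square_le: "\<bar>x\<bar> \<le> c \<Longrightarrow> x\<^sup>2 \<le> c\<^sup>2" for x c :: real
  using power_mono[of "\<bar>x\<bar>" c 2] by simp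

text \<open>Jensen's inequality, read off from the nonnegative variance of
  \<open>\<bar>X\<bar>\<close>.\<close>

lemma (in prob_space) expectation_abs_le_sqrt:
  fixes X :: "'a \<Rightarrow> real"
  assumes "integrable M X" "integrable M (\<lambda>x. (X x)\<^sup>2)" "expectation (\<lambda>x. (X x)\<^sup>2) \<le> c\<^sup>2" "0 \<le> c"
  shows "expectation (\<lambda>x. \<bar>X x\<bar>) \<le> c"
proof -
  have "variance (\<lambda>x. \<bar>X x\<bar>) = expectation (\<lambda>x. \<bar>X x\<bar>\<^sup>2) - (expectation (\<lambda>x. \<bar>X x\<bar>))\<^sup>2"
    using assms by (intro variance_eq[of "\<lambda>x. \<bar>X x\<bar>"]) auto
  then have "(expectation (\<lambda>x. \<bar>X x\<bar>))\<^sup>2 \<le> c\<^sup>2"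
    using variance_positive[of "\<lambda>x. \<bar>X x\<bar>"] assms(3) by (simp only: power2_abs)
  then show ?thesis using assms(4) by (rule power2_le_imp_le)
qed

section \<open>Conditional moments and the characteristic function of the sample mean\<close>

context cond_sampling
begin

text \<open>The conditional expectation of \<open>y w (Z l w)\<close> given the past, as an explicit
  function of \<open>w\<close> rather than an almost sure class.\<close>

definition cmean :: "('w \<Rightarrow> 'z \<Rightarrow> real) \<Rightarrow> 'w \<Rightarrow> real" where
  "cmean y w = (\<integral>z. k w z * y w z \<partial>M)"

definition cvar :: "('w \<Rightarrow> 'z \<Rightarrow> real) \<Rightarrow> 'w \<Rightarrow> real" where
  "cvar y w = cmean (\<lambda>w z. (y w z)\<^sup>2) w - (cmean y w)\<^sup>2"

definition smean :: "('w \<Rightarrow> 'z \<Rightarrow> real) \<Rightarrow> 'w \<Rightarrow> real" where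
  "smean y w = (\<Sum>l=1..n. y w (Z l w)) / real n"

lemma cmean_meas:
  assumes "(\<lambda>(w, z). y w z) \<in> borel_measurable (F \<Otimes>\<^sub>M M)"
  shows "cmean y \<in> borel_measurable F"
proof -
  note [measurable] = assms k_meas
  show ?thesis unfolding cmean_def by measurable
qed

lemma int_k_le: "w \<in> space P \<Longrightarrow> (\<integral>z. k w z \<partial>M) \<le> 1"
proof -
  assume w: "w \<in> space P"
  have "ennreal (\<integral>z. k w z \<partial>M) \<le> (\<integral>\<^sup>+z. ennreal (k w z) \<partial>M)"
    using integrable_k[OF w, of "\<lambda>_. 1 :: real" 1] k_nonneg[OF w]
    by (subst nn_integral_eq_integral) auto
  also have "\<dots> \<le> 1" by (rule k_le[OF w])
  finally show ?thesis by simp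
qed

lemma int_k_eq: "AE w in P. (\<integral>z. k w z \<partial>M) = 1"
  using k_eq AE_space
proof eventually_elim
  case (elim w)
  then have "ennreal (\<integral>z. k w z \<partial>M) = 1"
    using integrable_k[of w "\<lambda>_. 1 :: real" 1] k_nonneg[of w]
    by (subst nn_integral_eq_integral[symmetric]) auto
  then show ?case
    by (metis enn2real_ennreal ennreal_1 enn2real_1 k_nonneg elim(2) Bochner_Integration.integral_nonneg)
qed

lemma y_meas_w:
  assumes "(\<lambda>(w, z). y w z) \<in> borel_measurable (F \<Otimes>\<^sub>M M)" "w \<in> space P"
  shows "y w \<in> borel_measurable M"
  using measurable_compose[OF measurable_Pair1' assms(1), of w] assms(2) by (simp add: space_F)

lemma norm_cmean_le:
  fixes u :: "'z \<Rightarrow> 'b::{banach, second_countable_topology}"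
  assumes w: "w \<in> space P" and u: "u \<in> borel_measurable M" and bd: "\<And>z. z \<in> space M \<Longrightarrow> norm (u z) \<le> D"
    and D: "0 \<le> D"
  shows "norm (\<integral>z. k w z *\<^sub>R u z \<partial>M) \<le> D"
proof -
  have i: "integrable M (k w)"
    using integrable_k[OF w, of "\<lambda>_. 1 :: real" 1] by simp
  have "norm (\<integral>z. k w z *\<^sub>R u z \<partial>M) \<le> (\<integral>z. norm (k w z *\<^sub>R u z) \<partial>M)" by (rule integral_norm_bound)
  also have "\<dots> \<le> (\<integral>z. D * k w z \<partial>M)"
  proof (rule integral_mono)
    show "integrable M (\<lambda>z. norm (k w z *\<^sub>R u z))" using integrable_k[OF w u bd] by (rule integrable_norm)
    show "norm (k w z *\<^sub>R u z) \<le> D * k w z" if z: "z \<in> space M" for z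
      using mult_right_mono[OF bd[OF z] k_nonneg[OF w z]] k_nonneg[OF w z] by (simp add: mult_ac)
  qed (use i in simp)
  also have "\<dots> \<le> D" using mult_left_mono[OF int_k_le[OF w] D] by simp
  finally show ?thesis .
qed

context
  fixes y :: "'w \<Rightarrow> 'z \<Rightarrow> real" and D :: real
  assumes y_meas: "(\<lambda>(w, z). y w z) \<in> borel_measurable (F \<Otimes>\<^sub>M M)"
    and y_bd: "\<And>w z. w \<in> space P \<Longrightarrow> z \<in> space M \<Longrightarrow> \<bar>y w z\<bar> \<le> D"
    and D: "0 \<le> D"
begin

lemma abs_cmean_le: "w \<in> space P \<Longrightarrow> \<bar>cmean y w\<bar> \<le> D"
  using norm_cmean_le[OF _ y_meas_w[OF y_meas], of w w D] y_bd D by (simp add: cmean_def)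

definition dev :: "'w \<Rightarrow> 'z \<Rightarrow> real" where "dev w z = y w z - cmean y w"

lemma dev_meas: "(\<lambda>(w, z). dev w z) \<in> borel_measurable (F \<Otimes>\<^sub>M M)"
proof -
  note [measurable] = y_meas cmean_meas[OF y_meas]
  show ?thesis unfolding dev_def by measurable
qed

lemma dev_bd: "w \<in> space P \<Longrightarrow> z \<in> space M \<Longrightarrow> \<bar>dev w z\<bar> \<le> 2 * D"
  using abs_cmean_le[of w] y_bd[of w z] unfolding dev_def by linarith

lemma cmean_dev:
  assumes w: "w \<in> space P" "(\<integral>z. k w z \<partial>M) = 1"
  shows "(\<integral>z. k w z * dev w z \<partial>M) = 0" "(\<integral>z. k w z * (dev w z)\<^sup>2 \<partial>M) = cvar y w"
proof -
  have yw: "y w \<in> borel_measurable M" by (rule y_meas_w[OF y_meas w(1)])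
  have ik: "integrable M (k w)"
    using integrable_k[OF w(1), of "\<lambda>_. 1 :: real" 1] by simp
  have iy: "integrable M (\<lambda>z. k w z * y w z)"
    using integrable_k[OF w(1) yw, of D] y_bd[OF w(1)] by simp
  have iy2: "integrable M (\<lambda>z. k w z * (y w z)\<^sup>2)"
    using integrable_k[OF w(1), of "\<lambda>z. (y w z)\<^sup>2" "D\<^sup>2"] yw abs_le_imp_square_le[OF y_bd[OF w(1)]]
    by simp
  show "(\<integral>z. k w z * dev w z \<partial>M) = 0"
    using iy ik w(2) unfolding dev_def by (simp add: right_diff_distrib cmean_def)
  have "(\<lambda>z. k w z * (dev w z)\<^sup>2) = (\<lambda>z. k w z * (y w z)\<^sup>2 - 2 * cmean y w * (k w z * y w z) + (cmean y w)\<^sup>2 * k w z)"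
    unfolding dev_def by (auto simp: fun_eq_iff power2_eq_square algebra_simps)
  then have "(\<integral>z. k w z * (dev w z)\<^sup>2 \<partial>M) = cmean (\<lambda>w z. (y w z)\<^sup>2) w - 2 * cmean y w * cmean y w + (cmean y w)\<^sup>2 * 1"
    using iy ik iy2 w(2) by (simp add: cmean_def)
  then show "(\<integral>z. k w z * (dev w z)\<^sup>2 \<partial>M) = cvar y w"
    unfolding cvar_def by (simp add: power2_eq_square)
qed

lemma smean_minus_cmean: "smean y w - cmean y w = (\<Sum>l=1..n. dev w (Z l w)) / real n"
  using n_pos by (simp add: smean_def dev_def sum_subtractf field_simps)

lemma dev_Z_meas: "l \<in> {1..n} \<Longrightarrow> (\<lambda>w. dev w (Z l w)) \<in> borel_measurable P"
proof -
  assume l: "l \<in> {1..n}"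
  have "(\<lambda>w. (w, Z l w)) \<in> measurable P (F \<Otimes>\<^sub>M M)"
    using from_F[OF measurable_ident] Z_meas[OF l] by (intro measurable_Pair) (simp_all add: id_def)
  from measurable_compose[OF this dev_meas] show ?thesis by simp
qed

lemma smean_meas: "smean y \<in> borel_measurable P"
proof -
  have "smean y = (\<lambda>w. (\<Sum>l=1..n. dev w (Z l w)) / real n + cmean y w)"
    using smean_minus_cmean by (auto simp: fun_eq_iff algebra_simps)
  moreover have "(\<lambda>w. (\<Sum>l=1..n. dev w (Z l w)) / real n + cmean y w) \<in> borel_measurable P"
    by (rule borel_measurable_add[OF borel_measurable_divide[OF borel_measurable_sum[OF dev_Z_meas] borel_measurable_const] from_F[OF cmean_meas[OF y_meas]]])
  ultimately show ?thesis by simp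
qed

lemma dev_Z_bd: "w \<in> space P \<Longrightarrow> l \<in> {1..n} \<Longrightarrow> \<bar>dev w (Z l w)\<bar> \<le> 2 * D"
  using dev_bd measurable_space[OF Z_meas] by blast

text \<open>Off the diagonal the conditional expectation factors, and a factor is the mean of a
  centred variable; on the diagonal the bound \<open>2 * D\<close> is squared.\<close>

lemma expectation_dev_dev:
  assumes i: "i \<in> {1..n}" and j: "j \<in> {1..n}"
  shows "(\<integral>w. dev w (Z i w) * dev w (Z j w) \<partial>P) \<le> (if i = j then 4 * D\<^sup>2 else 0)"
proof (cases "i = j")
  case True
  have "(\<integral>w. dev w (Z i w) * dev w (Z i w) \<partial>P) \<le> (\<integral>w. 4 * D\<^sup>2 \<partial>P)"
  proof (rule integral_mono)
    show "integrable P (\<lambda>w. dev w (Z i w) * dev w (Z i w))"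
    proof (rule integrable_const_bound[where B="(2 * D)\<^sup>2"])
      show "AE w in P. norm (dev w (Z i w) * dev w (Z i w)) \<le> (2 * D)\<^sup>2"
        using abs_le_imp_square_le[OF dev_Z_bd[OF _ i]] by (intro AE_I2) (simp only: real_norm_def abs_mult_self_eq power2_eq_square[symmetric] abs_power2)
    qed (use dev_Z_meas[OF i] in measurable)
    show "dev w (Z i w) * dev w (Z i w) \<le> 4 * D\<^sup>2" if "w \<in> space P" for w
    proof -
      have "(dev w (Z i w))\<^sup>2 \<le> (2 * D)\<^sup>2"
        using dev_Z_bd[OF that i] by (rule abs_le_imp_square_le)
      then show ?thesis by (simp add: power2_eq_square)
    qed
  qed simp
  then show ?thesis using True by (simp add: prob_space)
next
  case False
  \<comment> \<open>Labels other than \<open>i\<close> and \<open>j\<close> get the constant 1: the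
    product over all labels reduces to the pair, while \<open>expectation_prod\<close> still
    applies.\<close>
  define u where "u l w z = (if l = i \<or> l = j then dev w z else 1)" for l w z
  have pick: "(\<Prod>l=1..n. if l = i \<or> l = j then f l else (1::real)) = f i * f j" for f
  proof -
    have "(\<Prod>l=1..n. if l = i \<or> l = j then f l else 1) = (\<Prod>l\<in>{i, j}. f l)"
      using i j by (intro prod.mono_neutral_cong_right) auto
    then show ?thesis using False by simp
  qed
  have "(\<integral>w. dev w (Z i w) * dev w (Z j w) \<partial>P) = (\<integral>w. 1 * (\<Prod>l=1..n. u l w (Z l w)) \<partial>P)"
    unfolding u_def pick by simp
  also have "\<dots> = (\<integral>w. 1 * (\<Prod>l=1..n. \<integral>z. k w z *\<^sub>R u l w z \<partial>M) \<partial>P)"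
  proof (rule expectation_prod[where Cb=1 and Cu="max 1 (2 * D)"])
    show "(\<lambda>(w, z). u l w z) \<in> borel_measurable (F \<Otimes>\<^sub>M M)" for l
      unfolding u_def using dev_meas by (cases "l = i \<or> l = j") auto
    show "norm (u l w z) \<le> max 1 (2 * D)" if "w \<in> space P" "z \<in> space M" for l w z
      using dev_bd[OF that] by (auto simp: u_def)
  qed auto
  also have "\<dots> = (\<integral>w. 0 \<partial>P)"
  proof (rule integral_cong_AE)
    have m: "(\<lambda>w. \<integral>z. k w z *\<^sub>R u l w z \<partial>M) \<in> borel_measurable P" for l
    proof (rule from_F)
      have [measurable]: "(\<lambda>(w, z). u l w z) \<in> borel_measurable (F \<Otimes>\<^sub>M M)"
        unfolding u_def using dev_meas by (cases "l = i \<or> l = j") auto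
      note [measurable] = k_meas
      show "(\<lambda>w. \<integral>z. k w z *\<^sub>R u l w z \<partial>M) \<in> borel_measurable F" by measurable
    qed
    show "(\<lambda>w. 1 * (\<Prod>l=1..n. \<integral>z. k w z *\<^sub>R u l w z \<partial>M)) \<in> borel_measurable P"
      unfolding mult_1_left by (rule borel_measurable_prod[OF m])
    show "AE w in P. 1 * (\<Prod>l=1..n. \<integral>z. k w z *\<^sub>R u l w z \<partial>M) = 0"
      using int_k_eq AE_space
    proof eventually_elim
      case (elim w)
      have "(\<integral>z. k w z *\<^sub>R u i w z \<partial>M) = 0"
        using cmean_dev(1)[OF elim(2,1)] by (simp add: u_def)
      then show ?case using i by (auto intro!: bexI[of _ i])
    qed
  qed simp
  finally show ?thesis using False by simp
qed

text \<open>Second moment method: of the \<open>n\<^sup>2\<close> products only the \<open>n\<close>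
  diagonal ones contribute, each at most \<open>4 * D\<^sup>2\<close>.\<close>

lemma smean_L1: "(\<integral>w. \<bar>smean y w - cmean y w\<bar> \<partial>P) \<le> 2 * D / sqrt n"
proof (rule expectation_abs_le_sqrt)
  have meas: "(\<lambda>w. smean y w - cmean y w) \<in> borel_measurable P"
    using smean_meas from_F[OF cmean_meas[OF y_meas]] by measurable
  have bd: "\<bar>smean y w - cmean y w\<bar> \<le> 2 * D" if w: "w \<in> space P" for w
  proof -
    have "\<bar>\<Sum>l=1..n. dev w (Z l w)\<bar> \<le> (\<Sum>l=1..n. 2 * D)"
      using dev_Z_bd[OF w] by (intro order_trans[OF sum_abs] sum_mono) auto
    then show ?thesis
      unfolding smean_minus_cmean using n_pos by (simp add: field_simps)
  qed
  show "integrable P (\<lambda>w. smean y w - cmean y w)"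
    using meas bd by (intro integrable_const_bound[where B="2 * D"]) auto
  show "integrable P (\<lambda>w. (smean y w - cmean y w)\<^sup>2)"
  proof (rule integrable_const_bound[where B="(2 * D)\<^sup>2"])
    show "AE w in P. norm ((smean y w - cmean y w)\<^sup>2) \<le> (2 * D)\<^sup>2"
      using abs_le_imp_square_le[OF bd] by (intro AE_I2) (simp del: power_mult_distrib)
  qed (use meas in measurable)
  have intd: "integrable P (\<lambda>w. dev w (Z i w) * dev w (Z j w))" if "i \<in> {1..n}" "j \<in> {1..n}" for i j
  proof (rule integrable_const_bound[where B="2 * D * (2 * D)"])
    show "AE w in P. norm (dev w (Z i w) * dev w (Z j w)) \<le> 2 * D * (2 * D)"
      using dev_Z_bd[OF _ that(1)] dev_Z_bd[OF _ that(2)] D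
      by (intro AE_I2) (simp only: real_norm_def abs_mult, intro mult_mono, auto)
  qed (use dev_Z_meas that in measurable)
  have "(\<integral>w. (smean y w - cmean y w)\<^sup>2 \<partial>P) = (\<integral>w. (\<Sum>i=1..n. \<Sum>j=1..n. dev w (Z i w) * dev w (Z j w)) / (real n)\<^sup>2 \<partial>P)"
    unfolding smean_minus_cmean by (simp add: power_divide power2_eq_square sum_product)
  also have "\<dots> = (\<Sum>i=1..n. \<Sum>j=1..n. \<integral>w. dev w (Z i w) * dev w (Z j w) \<partial>P) / (real n)\<^sup>2"
    unfolding integral_divide_zero by (subst integral_double_sum) (rule intd, auto)
  also have "\<dots> \<le> (\<Sum>i=1..n. \<Sum>j=1..n. if i = j then 4 * D\<^sup>2 else 0) / (real n)\<^sup>2"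
    using expectation_dev_dev by (intro divide_right_mono sum_mono) auto
  also have "\<dots> = (2 * D / sqrt n)\<^sup>2"
    using n_pos by (simp add: power_divide power_mult_distrib) (simp add: field_simps power2_eq_square)
  finally show "(\<integral>w. (smean y w - cmean y w)\<^sup>2 \<partial>P) \<le> (2 * D / sqrt n)\<^sup>2" .
qed (use D in simp)

lemma cvar_bounds:
  assumes w: "w \<in> space P" "(\<integral>z. k w z \<partial>M) = 1"
  shows "0 \<le> cvar y w" "cvar y w \<le> (2 * D)\<^sup>2"
proof -
  have dw: "dev w \<in> borel_measurable M" by (rule y_meas_w[OF dev_meas w(1)])
  show "0 \<le> cvar y w"
    unfolding cmean_dev(2)[OF w, symmetric] using k_nonneg[OF w(1)] by (intro Bochner_Integration.integral_nonneg) auto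
  have "norm (\<integral>z. k w z *\<^sub>R (dev w z)\<^sup>2 \<partial>M) \<le> (2 * D)\<^sup>2"
    using dw abs_le_imp_square_le[OF dev_bd[OF w(1)]] by (intro norm_cmean_le[OF w(1)]) (auto simp del: power_mult_distrib)
  then show "cvar y w \<le> (2 * D)\<^sup>2"
    unfolding cmean_dev(2)[OF w, symmetric] by simp
qed

text \<open>Second-order Taylor expansion: the linear term drops out by centring and the quadratic
  one leaves \<open>1 - s\<^sup>2 * cvar y w / 2\<close>, which is then compared with the
  exponential.\<close>

lemma cf_factor:
  fixes s :: real
  assumes w: "w \<in> space P" "(\<integral>z. k w z \<partial>M) = 1"
  shows "norm ((\<integral>z. k w z *\<^sub>R iexp (s * dev w z) \<partial>M) - complex_of_real (exp (- (s\<^sup>2 * cvar y w / 2))))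
    \<le> \<bar>s\<bar> ^ 3 * (2 * D) ^ 3 / 6 + (s\<^sup>2 * (2 * D)\<^sup>2 / 2)\<^sup>2"
proof -
  have dw[measurable]: "dev w \<in> borel_measurable M" by (rule y_meas_w[OF dev_meas w(1)])
  let ?T = "\<lambda>x::real. 1 + \<i> * x - complex_of_real (x\<^sup>2) / 2"
  have ik: "integrable M (k w)"
    using integrable_k[OF w(1), of "\<lambda>_. 1 :: real" 1] by simp
  have i1: "integrable M (\<lambda>z. k w z *\<^sub>R iexp (s * dev w z))"
    by (rule integrable_k[OF w(1), where D=1]) auto
  have id: "integrable M (\<lambda>z. k w z * dev w z)"
    using integrable_k[OF w(1) dw, of "2 * D"] dev_bd[OF w(1)] by simp
  have id2: "integrable M (\<lambda>z. k w z * (dev w z)\<^sup>2)"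
    using integrable_k[OF w(1), of "\<lambda>z. (dev w z)\<^sup>2" "(2 * D)\<^sup>2"] abs_le_imp_square_le[OF dev_bd[OF w(1)]]
    by (simp del: power_mult_distrib)
  have Teq: "k w z *\<^sub>R ?T (s * dev w z) = complex_of_real (k w z) + \<i> * s * complex_of_real (k w z * dev w z)
      - complex_of_real (s\<^sup>2 / 2) * complex_of_real (k w z * (dev w z)\<^sup>2)" for z
    by (simp add: scaleR_conv_of_real algebra_simps power2_eq_square)
  have i2: "integrable M (\<lambda>z. k w z *\<^sub>R ?T (s * dev w z))"
    unfolding Teq using ik id id2 by (intro Bochner_Integration.integrable_diff Bochner_Integration.integrable_add integrable_mult_right integrable_of_real)
  have T: "(\<integral>z. k w z *\<^sub>R ?T (s * dev w z) \<partial>M) = complex_of_real (1 - s\<^sup>2 * cvar y w / 2)"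
  proof -
    have "(\<integral>z. k w z *\<^sub>R ?T (s * dev w z) \<partial>M) = complex_of_real (\<integral>z. k w z \<partial>M)
        + \<i> * s * complex_of_real (\<integral>z. k w z * dev w z \<partial>M)
        - complex_of_real (s\<^sup>2 / 2) * complex_of_real (\<integral>z. k w z * (dev w z)\<^sup>2 \<partial>M)"
      unfolding Teq using ik id id2
      by (simp only: Bochner_Integration.integral_diff Bochner_Integration.integral_add Bochner_Integration.integrable_add integrable_mult_right integrable_of_real integral_mult_right_zero integral_complex_of_real)
    then show ?thesis unfolding cmean_dev[OF w] w(2) by simp
  qed
  have "norm ((\<integral>z. k w z *\<^sub>R iexp (s * dev w z) \<partial>M) - complex_of_real (1 - s\<^sup>2 * cvar y w / 2))
      = norm (\<integral>z. k w z *\<^sub>R (iexp (s * dev w z) - ?T (s * dev w z)) \<partial>M)"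
    unfolding T[symmetric] Bochner_Integration.integral_diff[OF i1 i2, symmetric] by (simp only: scaleR_diff_right)
  also have "\<dots> \<le> \<bar>s\<bar> ^ 3 * (2 * D) ^ 3 / 6"
  proof (rule norm_cmean_le[OF w(1)])
    show "norm (iexp (s * dev w z) - ?T (s * dev w z)) \<le> \<bar>s\<bar> ^ 3 * (2 * D) ^ 3 / 6" if z: "z \<in> space M" for z
    proof -
      have taylor: "(\<Sum>k\<le>2. (\<i> * complex_of_real x) ^ k / fact k) = ?T x" for x
        by (simp add: numeral_2_eq_2 power2_eq_square complex_eq_iff)
      have "norm (iexp (s * dev w z) - ?T (s * dev w z)) \<le> \<bar>s * dev w z\<bar> ^ Suc 2 / fact (Suc 2)"
        using iexp_approx1[of "s * dev w z" 2] unfolding taylor .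
      also have "\<dots> = \<bar>s * dev w z\<bar> ^ 3 / 6"
        by (simp add: fact_numeral)
      also have "\<dots> = \<bar>s\<bar> ^ 3 * \<bar>dev w z\<bar> ^ 3 / 6" by (simp only: abs_mult power_mult_distrib)
      also have "\<dots> \<le> \<bar>s\<bar> ^ 3 * (2 * D) ^ 3 / 6"
        using dev_bd[OF w(1) z] by (intro divide_right_mono mult_left_mono power_mono) auto
      finally show ?thesis .
    qed
    show "(\<lambda>z. iexp (s * dev w z) - ?T (s * dev w z)) \<in> borel_measurable M" by measurable
    show "0 \<le> \<bar>s\<bar> ^ 3 * (2 * D) ^ 3 / 6" using D by simp
  qed
  finally have 1: "norm ((\<integral>z. k w z *\<^sub>R iexp (s * dev w z) \<partial>M) - complex_of_real (1 - s\<^sup>2 * cvar y w / 2))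
      \<le> \<bar>s\<bar> ^ 3 * (2 * D) ^ 3 / 6" .
  have "norm (complex_of_real (1 - s\<^sup>2 * cvar y w / 2) - complex_of_real (exp (- (s\<^sup>2 * cvar y w / 2))))
      = \<bar>exp (- (s\<^sup>2 * cvar y w / 2)) - (1 - s\<^sup>2 * cvar y w / 2)\<bar>"
    by (simp only: of_real_diff[symmetric] norm_of_real abs_minus_commute)
  also have "\<dots> \<le> (s\<^sup>2 * cvar y w / 2)\<^sup>2"
    using cvar_bounds[OF w] by (intro exp_minus_approx) auto
  also have "\<dots> \<le> (s\<^sup>2 * (2 * D)\<^sup>2 / 2)\<^sup>2"
    using cvar_bounds[OF w] by (intro power_mono divide_right_mono mult_left_mono) auto
  finally have 2: "norm (complex_of_real (1 - s\<^sup>2 * cvar y w / 2) - complex_of_real (exp (- (s\<^sup>2 * cvar y w / 2))))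
      \<le> (s\<^sup>2 * (2 * D)\<^sup>2 / 2)\<^sup>2" .
  show ?thesis
    by (rule norm_diff_triangle_le[OF 1 2])
qed

text \<open>Given the past, the characteristic function of the centred sum is a power
  \<open>\<zeta> w ^ n\<close>, and numbers of modulus at most 1 satisfy
  \<open>norm (a ^ n - b ^ n) \<le> n * norm (a - b)\<close>. The multiplier \<open>b\<close> makes
  room for the phase of the conditional mean, which is a function of the past.\<close>

lemma smean_cf:
  assumes b_meas: "b \<in> borel_measurable F" and b_bd: "\<And>w. w \<in> space P \<Longrightarrow> norm (b w) \<le> 1"
  shows "norm ((\<integral>w. b w * iexp (t * sqrt n * (smean y w - cmean y w)) \<partial>P)
       - (\<integral>w. b w * complex_of_real (exp (- (t\<^sup>2 * cvar y w / 2))) \<partial>P)) \<le> cf_err D t n"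
proof -
  define s where "s = t / sqrt n"
  have sn: "real n * s\<^sup>2 = t\<^sup>2" using n_pos by (simp add: s_def power_divide)
  define \<zeta> where "\<zeta> w = (\<integral>z. k w z *\<^sub>R iexp (s * dev w z) \<partial>M)" for w
  have ie_meas: "(\<lambda>(w, z). iexp (s * dev w z)) \<in> borel_measurable (F \<Otimes>\<^sub>M M)"
  proof -
    note [measurable] = dev_meas
    show ?thesis by measurable
  qed
  have \<zeta>_meas: "\<zeta> \<in> borel_measurable F"
  proof -
    note [measurable] = ie_meas k_meas
    show ?thesis unfolding \<zeta>_def by measurable
  qed
  have eq: "iexp (t * sqrt n * (smean y w - cmean y w)) = (\<Prod>l=1..n. iexp (s * dev w (Z l w)))" for w
  proof -
    have "t * sqrt n * (smean y w - cmean y w) = (\<Sum>l=1..n. s * dev w (Z l w))"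
    proof -
      have "t * sqrt n / real n = s"
        using n_pos by (simp add: s_def field_simps)
      then show ?thesis
        unfolding smean_minus_cmean sum_distrib_left[symmetric] by (metis times_divide_eq_left times_divide_eq_right)
    qed
    then show ?thesis by (simp add: exp_sum sum_distrib_left)
  qed
  have "(\<integral>w. b w * iexp (t * sqrt n * (smean y w - cmean y w)) \<partial>P) = (\<integral>w. b w * (\<zeta> w) ^ n \<partial>P)"
    unfolding eq \<zeta>_def using expectation_prod[OF b_meas b_bd, of "\<lambda>_ w z. iexp (s * dev w z)" 1] ie_meas by simp
  moreover have "norm ((\<integral>w. b w * (\<zeta> w) ^ n \<partial>P) - (\<integral>w. b w * complex_of_real (exp (- (t\<^sup>2 * cvar y w / 2))) \<partial>P))
      \<le> cf_err D t n"
  proof -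
    have \<zeta>_bd: "norm (\<zeta> w) \<le> 1" if "w \<in> space P" for w
      unfolding \<zeta>_def using y_meas_w[OF ie_meas that] by (intro norm_cmean_le[OF that]) auto
    have cvar_meas: "cvar y \<in> borel_measurable F"
    proof -
      have "(\<lambda>(w, z). (y w z)\<^sup>2) \<in> borel_measurable (F \<Otimes>\<^sub>M M)"
        using y_meas unfolding case_prod_beta by measurable
      note [measurable] = cmean_meas[OF this] cmean_meas[OF y_meas]
      show ?thesis unfolding cvar_def by measurable
    qed
    have i1: "integrable P (\<lambda>w. b w * (\<zeta> w) ^ n)"
    proof (rule integrable_const_bound[where B=1])
      show "AE w in P. norm (b w * (\<zeta> w) ^ n) \<le> 1"
        using b_bd \<zeta>_bd by (auto intro!: AE_I2 mult_le_one power_le_one simp: norm_mult norm_power)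
    qed (use from_F[OF b_meas] from_F[OF \<zeta>_meas] in measurable)
    have i2: "integrable P (\<lambda>w. b w * complex_of_real (exp (- (t\<^sup>2 * cvar y w / 2))))"
    proof (rule integrable_const_bound[where B=1])
      show "AE w in P. norm (b w * complex_of_real (exp (- (t\<^sup>2 * cvar y w / 2)))) \<le> 1"
        using int_k_eq AE_space
      proof eventually_elim
        case (elim w)
        then show ?case using b_bd[of w] cvar_bounds(1)[of w]
          by (auto intro!: mult_le_one simp: norm_mult)
      qed
    qed (use from_F[OF b_meas] from_F[OF cvar_meas] in measurable)
    have "norm ((\<integral>w. b w * (\<zeta> w) ^ n \<partial>P) - (\<integral>w. b w * complex_of_real (exp (- (t\<^sup>2 * cvar y w / 2))) \<partial>P))
        \<le> (\<integral>w. norm (b w * (\<zeta> w) ^ n - b w * complex_of_real (exp (- (t\<^sup>2 * cvar y w / 2)))) \<partial>P)"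
      unfolding Bochner_Integration.integral_diff[OF i1 i2, symmetric] by (rule integral_norm_bound)
    also have "\<dots> \<le> (\<integral>w. cf_err D t n \<partial>P)"
    proof (rule integral_mono_AE)
      show "AE w in P. norm (b w * (\<zeta> w) ^ n - b w * complex_of_real (exp (- (t\<^sup>2 * cvar y w / 2)))) \<le> cf_err D t n"
        using int_k_eq AE_space
      proof eventually_elim
        case (elim w)
        let ?e = "complex_of_real (exp (- (s\<^sup>2 * cvar y w / 2)))"
        \<comment> \<open>As \<open>n * s\<^sup>2 = t\<^sup>2\<close>, the Gaussian factor of the
          sum is the \<open>n\<close>-th power of the one for a single deviation.\<close>
        have en: "complex_of_real (exp (- (t\<^sup>2 * cvar y w / 2))) = ?e ^ n"
          unfolding sn[symmetric] of_real_power[symmetric] exp_of_nat_mult[symmetric] by (simp add: mult_ac)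
        have "norm (b w * (\<zeta> w) ^ n - b w * ?e ^ n) = norm (b w) * norm ((\<zeta> w) ^ n - ?e ^ n)"
          by (simp add: norm_mult flip: right_diff_distrib)
        also have "\<dots> \<le> 1 * norm ((\<zeta> w) ^ n - ?e ^ n)"
          using b_bd[OF elim(2)] by (intro mult_right_mono) auto
        also have "\<dots> \<le> real n * norm (\<zeta> w - ?e)"
          unfolding mult_1_left using \<zeta>_bd[OF elim(2)] cvar_bounds(1)[OF elim(2,1)] by (intro norm_power_diff) auto
        also have "\<dots> \<le> cf_err D t n"
          unfolding cf_err_def s_def[symmetric] \<zeta>_def using cf_factor[OF elim(2,1), of s]
          by (intro mult_left_mono) auto
        finally show ?case unfolding en .
      qed
    qed (use i1 i2 in auto)
    finally show ?thesis by (simp add: prob_space)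
  qed
  ultimately show ?thesis by simp
qed

end

end

lemma exp_minus_lipschitz:
  fixes a b :: real
  assumes "0 \<le> a" "0 \<le> b"
  shows "\<bar>exp (- a) - exp (- b)\<bar> \<le> \<bar>a - b\<bar>"
proof -
  have *: "exp (- x) - exp (- y) \<le> y - x" if "0 \<le> x" "x \<le> y" for x y :: real
  proof -
    define u where "u = y - x"
    have u: "0 \<le> u" "y = x + u" using that by (auto simp: u_def)
    have "exp (- x) - exp (- y) = exp (- x) * (1 - exp (- u))"
      unfolding u(2) by (simp add: algebra_simps flip: exp_add)
    also have "\<dots> \<le> 1 * (1 - exp (- u))"
      using that u(1) by (intro mult_right_mono) auto
    also have "\<dots> \<le> u"
      using exp_ge_add_one_self[of "- u"] by simp
    also have "u = y - x" by (rule u_def)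
    finally show ?thesis .
  qed
  show ?thesis
  proof (cases "a \<le> b")
    case True
    have "exp (- b) \<le> exp (- a)" using True by simp
    with True *[of a b] assms show ?thesis by linarith
  next
    case False
    have "exp (- a) \<le> exp (- b)" using False by simp
    with False *[of b a] assms show ?thesis by linarith
  qed
qed

text \<open>Integrating \<open>w\<close> innermost freezes the parameter \<open>v\<close>, so that
  estimates for a fixed test function can be integrated over \<open>Q\<close> afterwards.\<close>

lemma pair_prob_integral:
  fixes f :: "'w \<Rightarrow> 'v \<Rightarrow> 'b::{banach, second_countable_topology}"
  assumes "prob_space P" "prob_space Q"
    and "(\<lambda>(w, v). f w v) \<in> borel_measurable (P \<Otimes>\<^sub>M Q)"
    and "\<And>w v. w \<in> space P \<Longrightarrow> v \<in> space Q \<Longrightarrow> norm (f w v) \<le> B"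
  shows "integrable (P \<Otimes>\<^sub>M Q) (\<lambda>(w, v). f w v)"
    and "(\<integral>(w, v). f w v \<partial>(P \<Otimes>\<^sub>M Q)) = (\<integral>v. \<integral>w. f w v \<partial>P \<partial>Q)"
    and "integrable Q (\<lambda>v. \<integral>w. f w v \<partial>P)"
proof -
  interpret P: prob_space P by fact
  interpret Q: prob_space Q by fact
  interpret PQ: pair_prob_space P Q ..
  show int: "integrable (P \<Otimes>\<^sub>M Q) (\<lambda>(w, v). f w v)"
  proof (rule PQ.integrable_const_bound[where B=B])
    show "AE x in P \<Otimes>\<^sub>M Q. norm (case x of (w, v) \<Rightarrow> f w v) \<le> B"
      by (rule AE_I2) (auto simp: space_pair_measure assms(4))
  qed (rule assms(3))
  show "(\<integral>(w, v). f w v \<partial>(P \<Otimes>\<^sub>M Q)) = (\<integral>v. \<integral>w. f w v \<partial>P \<partial>Q)"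
    by (rule PQ.integral_snd[OF int, symmetric])
  show "integrable Q (\<lambda>v. \<integral>w. f w v \<partial>P)"
    by (rule PQ.integrable_snd[OF int])
qed

section \<open>Deterministic limiting variance and random test functions\<close>

context cond_sampling
begin

lemma cvar_meas:
  assumes "(\<lambda>(w, z). y w z) \<in> borel_measurable (F \<Otimes>\<^sub>M M)"
  shows "cvar y \<in> borel_measurable F"
proof -
  have "(\<lambda>(w, z). (y w z)\<^sup>2) \<in> borel_measurable (F \<Otimes>\<^sub>M M)"
    using assms unfolding case_prod_beta by measurable
  note [measurable] = cmean_meas[OF this] cmean_meas[OF assms]
  show ?thesis unfolding cvar_def by measurable
qed

lemma abs_cvar_le:
  assumes y_meas: "(\<lambda>(w, z). y w z) \<in> borel_measurable (F \<Otimes>\<^sub>M M)"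
    and y_bd: "\<And>w z. w \<in> space P \<Longrightarrow> z \<in> space M \<Longrightarrow> \<bar>y w z\<bar> \<le> D" and D: "0 \<le> D" and w: "w \<in> space P"
  shows "\<bar>cvar y w\<bar> \<le> 2 * D\<^sup>2"
proof -
  have "(\<lambda>(w, z). (y w z)\<^sup>2) \<in> borel_measurable (F \<Otimes>\<^sub>M M)"
    using y_meas unfolding case_prod_beta by measurable
  then have "\<bar>cmean (\<lambda>w z. (y w z)\<^sup>2) w\<bar> \<le> D\<^sup>2"
    using abs_le_imp_square_le[OF y_bd] w by (intro abs_cmean_le) auto
  moreover have "(cmean y w)\<^sup>2 \<le> D\<^sup>2"
    by (rule abs_le_imp_square_le[OF abs_cmean_le[OF y_meas y_bd D w]])
  ultimately show ?thesis unfolding cvar_def by (simp add: abs_le_iff) (use zero_le_power2[of "cmean y w"] in linarith)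
qed

text \<open>Trades the random conditional variance for its limit \<open>\<sigma>\<close>, as
  \<open>exp (- x)\<close> is 1-Lipschitz on the nonnegative reals. Nonnegativity of
  \<open>cvar\<close> is known only where \<open>k w\<close> has mass 1, that is, almost
  surely.\<close>

lemma smean_cf_const:
  assumes y_meas: "(\<lambda>(w, z). y w z) \<in> borel_measurable (F \<Otimes>\<^sub>M M)"
    and y_bd: "\<And>w z. w \<in> space P \<Longrightarrow> z \<in> space M \<Longrightarrow> \<bar>y w z\<bar> \<le> D" and D: "0 \<le> D"
    and b_meas: "b \<in> borel_measurable F" and b_bd: "\<And>w. w \<in> space P \<Longrightarrow> norm (b w) \<le> 1"
    and \<sigma>: "0 \<le> \<sigma>"
  shows "norm ((\<integral>w. b w * iexp (t * sqrt n * (smean y w - cmean y w)) - b w * complex_of_real (exp (- (t\<^sup>2 * \<sigma> / 2))) \<partial>P))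
    \<le> cf_err D t n + t\<^sup>2 / 2 * (\<integral>w. \<bar>cvar y w - \<sigma>\<bar> \<partial>P)"
proof -
  note b_P[measurable] = from_F[OF b_meas]
  note cv_P[measurable] = from_F[OF cvar_meas[OF y_meas]]
  note cm_P[measurable] = from_F[OF cmean_meas[OF y_meas]]
  note sm_P[measurable] = smean_meas[OF y_meas y_bd D]
  have i0: "integrable P (\<lambda>w. b w * iexp (t * sqrt n * (smean y w - cmean y w)))"
  proof (rule integrable_const_bound[where B=1])
    show "AE w in P. norm (b w * iexp (t * sqrt n * (smean y w - cmean y w))) \<le> 1"
      using b_bd by (intro AE_I2) (simp add: norm_mult)
  qed measurable
  have nn: "AE w in P. 0 \<le> cvar y w"
    using int_k_eq AE_space
  proof eventually_elim
    case (elim w)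
    show ?case by (rule cvar_bounds(1)[OF y_meas y_bd D elim(2,1)])
  qed
  have i1: "integrable P (\<lambda>w. b w * complex_of_real (exp (- (t\<^sup>2 * cvar y w / 2))))"
  proof (rule integrable_const_bound[where B=1])
    show "AE w in P. norm (b w * complex_of_real (exp (- (t\<^sup>2 * cvar y w / 2)))) \<le> 1"
      using nn AE_space
    proof eventually_elim
      case (elim w)
      then have "norm (b w) * exp (- (t\<^sup>2 * cvar y w / 2)) \<le> 1 * 1"
        using b_bd[of w] by (intro mult_mono) auto
      then show ?case by (simp add: norm_mult)
    qed
  qed measurable
  have i2: "integrable P (\<lambda>w. b w * complex_of_real (exp (- (t\<^sup>2 * \<sigma> / 2))))"
  proof (rule integrable_const_bound[where B=1])
    show "AE w in P. norm (b w * complex_of_real (exp (- (t\<^sup>2 * \<sigma> / 2)))) \<le> 1"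
    proof (rule AE_I2)
      fix w assume "w \<in> space P"
      then have "norm (b w) * exp (- (t\<^sup>2 * \<sigma> / 2)) \<le> 1 * 1"
        using b_bd[of w] \<sigma> by (intro mult_mono) auto
      then show "norm (b w * complex_of_real (exp (- (t\<^sup>2 * \<sigma> / 2)))) \<le> 1" by (simp add: norm_mult)
    qed
  qed measurable
  have i3: "integrable P (\<lambda>w. \<bar>cvar y w - \<sigma>\<bar>)"
  proof (rule integrable_const_bound[where B="2 * D\<^sup>2 + \<sigma>"])
    show "AE w in P. norm \<bar>cvar y w - \<sigma>\<bar> \<le> 2 * D\<^sup>2 + \<sigma>"
    proof (rule AE_I2)
      fix w assume "w \<in> space P"
      from abs_cvar_le[OF y_meas y_bd D this] \<sigma> show "norm \<bar>cvar y w - \<sigma>\<bar> \<le> 2 * D\<^sup>2 + \<sigma>"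
        unfolding real_norm_def by linarith
    qed
  qed measurable
  have "norm ((\<integral>w. b w * complex_of_real (exp (- (t\<^sup>2 * cvar y w / 2))) \<partial>P) - (\<integral>w. b w * complex_of_real (exp (- (t\<^sup>2 * \<sigma> / 2))) \<partial>P))
      \<le> (\<integral>w. norm (b w * complex_of_real (exp (- (t\<^sup>2 * cvar y w / 2))) - b w * complex_of_real (exp (- (t\<^sup>2 * \<sigma> / 2)))) \<partial>P)"
    unfolding Bochner_Integration.integral_diff[OF i1 i2, symmetric] by (rule integral_norm_bound)
  also have "\<dots> \<le> (\<integral>w. t\<^sup>2 / 2 * \<bar>cvar y w - \<sigma>\<bar> \<partial>P)"
  proof (rule integral_mono_AE)
    show "integrable P (\<lambda>w. norm (b w * complex_of_real (exp (- (t\<^sup>2 * cvar y w / 2))) - b w * complex_of_real (exp (- (t\<^sup>2 * \<sigma> / 2)))))"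
      by (intro integrable_norm Bochner_Integration.integrable_diff i1 i2)
    show "integrable P (\<lambda>w. t\<^sup>2 / 2 * \<bar>cvar y w - \<sigma>\<bar>)" using i3 by (rule integrable_mult_right)
    show "AE w in P. norm (b w * complex_of_real (exp (- (t\<^sup>2 * cvar y w / 2))) - b w * complex_of_real (exp (- (t\<^sup>2 * \<sigma> / 2))))
        \<le> t\<^sup>2 / 2 * \<bar>cvar y w - \<sigma>\<bar>"
      using nn AE_space
    proof eventually_elim
      case (elim w)
      have "norm (b w * complex_of_real (exp (- (t\<^sup>2 * cvar y w / 2))) - b w * complex_of_real (exp (- (t\<^sup>2 * \<sigma> / 2))))
          = norm (b w) * \<bar>exp (- (t\<^sup>2 * cvar y w / 2)) - exp (- (t\<^sup>2 * \<sigma> / 2))\<bar>"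
        by (simp only: right_diff_distrib[symmetric] norm_mult of_real_diff[symmetric] norm_of_real)
      also have "\<dots> \<le> 1 * \<bar>t\<^sup>2 * cvar y w / 2 - t\<^sup>2 * \<sigma> / 2\<bar>"
        using b_bd[OF elim(2)] elim(1) \<sigma> by (intro mult_mono exp_minus_lipschitz) auto
      also have "\<dots> = t\<^sup>2 / 2 * \<bar>cvar y w - \<sigma>\<bar>"
      proof -
        have "t\<^sup>2 * cvar y w / 2 - t\<^sup>2 * \<sigma> / 2 = t\<^sup>2 / 2 * (cvar y w - \<sigma>)" by (simp add: field_simps)
        then show ?thesis by (simp only: abs_mult abs_of_nonneg zero_le_power2 divide_nonneg_nonneg zero_le_numeral mult_1_left)
      qed
      finally show ?case .
    qed
  qed
  finally have 2: "norm ((\<integral>w. b w * complex_of_real (exp (- (t\<^sup>2 * cvar y w / 2))) \<partial>P) - (\<integral>w. b w * complex_of_real (exp (- (t\<^sup>2 * \<sigma> / 2))) \<partial>P))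
      \<le> t\<^sup>2 / 2 * (\<integral>w. \<bar>cvar y w - \<sigma>\<bar> \<partial>P)"
    by simp
  show ?thesis
    unfolding Bochner_Integration.integral_diff[OF i0 i2]
    by (rule norm_diff_triangle_le[OF smean_cf[OF y_meas y_bd D b_meas b_bd] 2])
qed

end

text \<open>The test functions depend on an independent random parameter \<open>v\<close> with law \<open>Q\<close>.\<close>

locale cond_sampling_rand = cond_sampling P F M n Z k + Q: prob_space Q
  for P :: "'w measure" and F and M :: "'z measure" and n Z k and Q :: "'v measure" +
  fixes y :: "'v \<Rightarrow> 'w \<Rightarrow> 'z \<Rightarrow> real" and D :: real
  assumes yv_meas: "(\<lambda>(v, w, z). y v w z) \<in> borel_measurable (Q \<Otimes>\<^sub>M (F \<Otimes>\<^sub>M M))"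
    and yv_bd: "\<And>v w z. v \<in> space Q \<Longrightarrow> w \<in> space P \<Longrightarrow> z \<in> space M \<Longrightarrow> \<bar>y v w z\<bar> \<le> D"
    and Dnn: "0 \<le> D"
begin

sublocale PQ: pair_prob_space P Q ..

lemma P_to_F: "(\<lambda>x. x) \<in> measurable P F"
  using from_F[OF measurable_ident] by (simp add: id_def)

lemma fst_F: "fst \<in> measurable (P \<Otimes>\<^sub>M Q) F"
  using measurable_compose[OF measurable_fst P_to_F, of Q] by simp

lemma y_v_meas: "v \<in> space Q \<Longrightarrow> (\<lambda>(w, z). y v w z) \<in> borel_measurable (F \<Otimes>\<^sub>M M)"
  using measurable_compose[OF measurable_Pair1' yv_meas, of v] by (simp add: case_prod_beta)

lemma y_assoc_meas: "(\<lambda>((w, v), z). y v w z) \<in> borel_measurable ((F \<Otimes>\<^sub>M Q) \<Otimes>\<^sub>M M)"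
proof -
  have "(\<lambda>x. (snd (fst x), fst (fst x), snd x)) \<in> measurable ((F \<Otimes>\<^sub>M Q) \<Otimes>\<^sub>M M) (Q \<Otimes>\<^sub>M (F \<Otimes>\<^sub>M M))"
    by measurable
  from measurable_compose[OF this yv_meas] show ?thesis by (simp only: case_prod_unfold fst_conv snd_conv)
qed

lemma cmean_pair_meas_F: "(\<lambda>(w, v). cmean (y v) w) \<in> borel_measurable (F \<Otimes>\<^sub>M Q)"
  and cvar_pair_meas_F: "(\<lambda>(w, v). cvar (y v) w) \<in> borel_measurable (F \<Otimes>\<^sub>M Q)"
proof -
  have ym: "(\<lambda>x. y (snd (fst x)) (fst (fst x)) (snd x)) \<in> borel_measurable ((F \<Otimes>\<^sub>M Q) \<Otimes>\<^sub>M M)"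
    using y_assoc_meas by (simp only: case_prod_unfold)
  have "(\<lambda>x. (fst (fst x), snd x)) \<in> measurable ((F \<Otimes>\<^sub>M Q) \<Otimes>\<^sub>M M) (F \<Otimes>\<^sub>M M)" by measurable
  from measurable_compose[OF this k_meas]
  have km: "(\<lambda>x. k (fst (fst x)) (snd x)) \<in> borel_measurable ((F \<Otimes>\<^sub>M Q) \<Otimes>\<^sub>M M)"
    by (simp only: case_prod_unfold fst_conv snd_conv)
  have 1: "(\<lambda>(w, v). cmean (y v) w) \<in> borel_measurable (F \<Otimes>\<^sub>M Q)"
    using M.borel_measurable_lebesgue_integral[of "\<lambda>x z. k (fst x) z * y (snd x) (fst x) z" "F \<Otimes>\<^sub>M Q",
        unfolded case_prod_unfold, OF borel_measurable_times[OF km ym]]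
    by (simp only: cmean_def case_prod_unfold)
  have 2: "(\<lambda>(w, v). cmean (\<lambda>w z. (y v w z)\<^sup>2) w) \<in> borel_measurable (F \<Otimes>\<^sub>M Q)"
    using M.borel_measurable_lebesgue_integral[of "\<lambda>x z. k (fst x) z * (y (snd x) (fst x) z)\<^sup>2" "F \<Otimes>\<^sub>M Q",
        unfolded case_prod_unfold, OF borel_measurable_times[OF km borel_measurable_power[OF ym]]]
    by (simp only: cmean_def case_prod_unfold)
  show "(\<lambda>(w, v). cmean (y v) w) \<in> borel_measurable (F \<Otimes>\<^sub>M Q)" by (rule 1)
  show "(\<lambda>(w, v). cvar (y v) w) \<in> borel_measurable (F \<Otimes>\<^sub>M Q)"
    using borel_measurable_diff[OF 2 borel_measurable_power[OF 1, where n=2]] by (simp only: cvar_def case_prod_unfold)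
qed

lemma pair_F_to_P: "f \<in> measurable (F \<Otimes>\<^sub>M Q) N \<Longrightarrow> f \<in> measurable (P \<Otimes>\<^sub>M Q) N"
  using measurable_compose[OF measurable_Pair[OF fst_F measurable_snd], of f N] by simp

lemmas cmean_pair_meas = pair_F_to_P[OF cmean_pair_meas_F]
lemmas cvar_pair_meas = pair_F_to_P[OF cvar_pair_meas_F]

lemma smean_pair_meas: "(\<lambda>(w, v). smean (y v) w) \<in> borel_measurable (P \<Otimes>\<^sub>M Q)"
proof -
  have "(\<lambda>x. y (snd x) (fst x) (Z l (fst x))) \<in> borel_measurable (P \<Otimes>\<^sub>M Q)" if l: "l \<in> {1..n}" for l
  proof -
    have "(\<lambda>x. (snd x, fst x, Z l (fst x))) \<in> measurable (P \<Otimes>\<^sub>M Q) (Q \<Otimes>\<^sub>M (F \<Otimes>\<^sub>M M))"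
      by (intro measurable_Pair measurable_snd fst_F measurable_compose[OF measurable_fst Z_meas[OF l]])
    from measurable_compose[OF this yv_meas] show ?thesis by simp
  qed
  then show ?thesis
    unfolding smean_def case_prod_beta by (intro borel_measurable_divide borel_measurable_const borel_measurable_sum)
qed

lemma abs_smean_le:
  assumes "w \<in> space P" "v \<in> space Q"
  shows "\<bar>smean (y v) w\<bar> \<le> D"
proof -
  have "\<bar>\<Sum>l=1..n. y v w (Z l w)\<bar> \<le> (\<Sum>l=1..n. D)"
    using yv_bd[OF assms(2,1)] measurable_space[OF Z_meas assms(1)] by (intro order_trans[OF sum_abs] sum_mono) auto
  then show ?thesis unfolding smean_def using n_pos by (simp add: field_simps)
qed

lemma abs_cmean_pair_le:
  assumes "w \<in> space P" "v \<in> space Q"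
  shows "\<bar>cmean (y v) w\<bar> \<le> D"
  by (rule abs_cmean_le[OF y_v_meas[OF assms(2)] yv_bd[OF assms(2)] Dnn assms(1)])

lemma smean_L1_pair: "(\<integral>(w, v). \<bar>smean (y v) w - cmean (y v) w\<bar> \<partial>(P \<Otimes>\<^sub>M Q)) \<le> 2 * D / sqrt n"
proof -
  have m: "(\<lambda>(w, v). \<bar>smean (y v) w - cmean (y v) w\<bar>) \<in> borel_measurable (P \<Otimes>\<^sub>M Q)"
    using borel_measurable_abs[OF borel_measurable_diff[OF smean_pair_meas cmean_pair_meas]]
    by (simp add: case_prod_beta)
  have bd: "norm \<bar>smean (y v) w - cmean (y v) w\<bar> \<le> 2 * D" if "w \<in> space P" "v \<in> space Q" for w v
    using abs_smean_le[OF that] abs_cmean_pair_le[OF that] unfolding real_norm_def by linarith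
  note I = pair_prob_integral[OF prob_space_axioms Q.prob_space_axioms m bd]
  have "(\<integral>(w, v). \<bar>smean (y v) w - cmean (y v) w\<bar> \<partial>(P \<Otimes>\<^sub>M Q)) = (\<integral>v. \<integral>w. \<bar>smean (y v) w - cmean (y v) w\<bar> \<partial>P \<partial>Q)"
    by (rule I(2))
  also have "\<dots> \<le> (\<integral>v. 2 * D / sqrt n \<partial>Q)"
    using I(3) smean_L1[OF y_v_meas yv_bd Dnn] by (intro integral_mono) auto
  finally show ?thesis by (simp add: Q.prob_space)
qed

text \<open>The phase splits into that of the conditional mean, which for fixed \<open>v\<close> is
  a function of the past and takes the place of \<open>b\<close> in \<open>smean_cf_const\<close>,
  and that of the centred part. The scale \<open>d\<close> enters as \<open>t * d\<close> so that
  averages can later be divided by a weight constant.\<close>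

lemma smean_cf_pair:
  assumes \<sigma>: "0 \<le> \<sigma>"
  shows "norm ((\<integral>(w, v). iexp (t * (sqrt n * smean (y v) w * d)) \<partial>(P \<Otimes>\<^sub>M Q))
      - (\<integral>(w, v). iexp (t * (sqrt n * cmean (y v) w * d)) \<partial>(P \<Otimes>\<^sub>M Q)) * complex_of_real (exp (- ((t * d)\<^sup>2 * \<sigma> / 2))))
    \<le> cf_err D (t * d) n + (t * d)\<^sup>2 / 2 * (\<integral>(w, v). \<bar>cvar (y v) w - \<sigma>\<bar> \<partial>(P \<Otimes>\<^sub>M Q))"
proof -
  define e where "e = complex_of_real (exp (- ((t * d)\<^sup>2 * \<sigma> / 2)))"
  define b where "b v w = iexp (t * (sqrt n * cmean (y v) w * d))" for v w
  let ?f = "\<lambda>w v. b v w * iexp ((t * d) * sqrt n * (smean (y v) w - cmean (y v) w)) - b v w * e"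
  have ie_meas: "f \<in> borel_measurable N \<Longrightarrow> (\<lambda>x. iexp (f x)) \<in> borel_measurable N" for f and N :: "'x measure"
    by measurable
  have b_meas: "(\<lambda>(w, v). b v w) \<in> borel_measurable (F \<Otimes>\<^sub>M Q)"
    unfolding b_def case_prod_beta
    using cmean_pair_meas_F unfolding case_prod_beta by measurable
  note b_PQ = pair_F_to_P[OF b_meas]
  have e1: "norm e \<le> 1" using \<sigma> by (simp add: e_def)
  have S_eq: "iexp (t * (sqrt n * smean (y v) w * d)) = b v w * iexp ((t * d) * sqrt n * (smean (y v) w - cmean (y v) w))" for v w
    unfolding b_def by (simp add: algebra_simps flip: exp_add)
  have f_meas: "(\<lambda>(w, v). ?f w v) \<in> borel_measurable (P \<Otimes>\<^sub>M Q)"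
    using b_PQ smean_pair_meas cmean_pair_meas unfolding case_prod_beta by measurable
  have s_meas: "(\<lambda>(w, v). iexp (t * (sqrt n * smean (y v) w * d))) \<in> borel_measurable (P \<Otimes>\<^sub>M Q)"
    using smean_pair_meas unfolding case_prod_beta by measurable
  have b_bd: "norm (b v w) \<le> 1" for v w by (simp add: b_def)
  have f_bd: "norm (?f w v) \<le> 2" for w v
  proof -
    have "norm (b v w * e) \<le> 1 * 1"
      unfolding norm_mult using b_bd e1 by (intro mult_mono) auto
    moreover have "norm (b v w * iexp ((t * d) * sqrt n * (smean (y v) w - cmean (y v) w))) \<le> 1"
      unfolding norm_mult using b_bd by simp
    ultimately show ?thesis
      by (intro order_trans[OF norm_triangle_ineq4]) linarith
  qed
  note I = pair_prob_integral[OF prob_space_axioms Q.prob_space_axioms f_meas f_bd]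
  have c_meas: "(\<lambda>(w, v). \<bar>cvar (y v) w - \<sigma>\<bar>) \<in> borel_measurable (P \<Otimes>\<^sub>M Q)"
    using cvar_pair_meas unfolding case_prod_beta by measurable
  have c_bd: "norm \<bar>cvar (y v) w - \<sigma>\<bar> \<le> 2 * D\<^sup>2 + \<sigma>" if "w \<in> space P" "v \<in> space Q" for w v
    using abs_cvar_le[OF y_v_meas[OF that(2)] yv_bd[OF that(2)] Dnn that(1)] \<sigma> unfolding real_norm_def by linarith
  note J = pair_prob_integral[OF prob_space_axioms Q.prob_space_axioms c_meas c_bd]
  note B = pair_prob_integral[OF prob_space_axioms Q.prob_space_axioms b_PQ b_bd]
  have s_bd: "norm (iexp (t * (sqrt n * smean (y v) w * d))) \<le> 1" for w v by simp
  note S = pair_prob_integral[OF prob_space_axioms Q.prob_space_axioms s_meas s_bd]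
  have "(\<integral>(w, v). iexp (t * (sqrt n * smean (y v) w * d)) \<partial>(P \<Otimes>\<^sub>M Q)) - (\<integral>(w, v). b v w \<partial>(P \<Otimes>\<^sub>M Q)) * e
      = (\<integral>(w, v). ?f w v \<partial>(P \<Otimes>\<^sub>M Q))"
  proof -
    have "(\<integral>x. (case x of (w, v) \<Rightarrow> iexp (t * (sqrt n * smean (y v) w * d))) - (case x of (w, v) \<Rightarrow> b v w) * e \<partial>(P \<Otimes>\<^sub>M Q))
      = (\<integral>(w, v). iexp (t * (sqrt n * smean (y v) w * d)) \<partial>(P \<Otimes>\<^sub>M Q)) - (\<integral>x. (case x of (w, v) \<Rightarrow> b v w) * e \<partial>(P \<Otimes>\<^sub>M Q))"
      by (rule Bochner_Integration.integral_diff[OF S(1) integrable_mult_left[OF B(1)]])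
    moreover have "(\<lambda>x. (case x of (w, v) \<Rightarrow> iexp (t * (sqrt n * smean (y v) w * d))) - (case x of (w, v) \<Rightarrow> b v w) * e) = (\<lambda>(w, v). ?f w v)"
      unfolding S_eq by (simp add: fun_eq_iff)
    ultimately show ?thesis by (simp only: integral_mult_left_zero)
  qed
  also have "norm \<dots> = norm (\<integral>v. \<integral>w. ?f w v \<partial>P \<partial>Q)"
    by (simp only: I(2))
  also have "\<dots> \<le> (\<integral>v. norm (\<integral>w. ?f w v \<partial>P) \<partial>Q)"
    by (rule integral_norm_bound)
  also have "\<dots> \<le> (\<integral>v. cf_err D (t * d) n + (t * d)\<^sup>2 / 2 * (\<integral>w. \<bar>cvar (y v) w - \<sigma>\<bar> \<partial>P) \<partial>Q)"
  proof (rule integral_mono)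
    show "integrable Q (\<lambda>v. norm (\<integral>w. ?f w v \<partial>P))" by (rule integrable_norm[OF I(3)])
    show "integrable Q (\<lambda>v. cf_err D (t * d) n + (t * d)\<^sup>2 / 2 * (\<integral>w. \<bar>cvar (y v) w - \<sigma>\<bar> \<partial>P))"
      by (rule Bochner_Integration.integrable_add[OF Q.integrable_const integrable_mult_right[OF J(3)]])
    show "norm (\<integral>w. ?f w v \<partial>P) \<le> cf_err D (t * d) n + (t * d)\<^sup>2 / 2 * (\<integral>w. \<bar>cvar (y v) w - \<sigma>\<bar> \<partial>P)"
      if v: "v \<in> space Q" for v
      unfolding e_def
    proof (rule smean_cf_const[OF y_v_meas[OF v] yv_bd[OF v] Dnn _ _ \<sigma>])
      show "b v \<in> borel_measurable F"
        using measurable_compose[OF measurable_Pair2' b_meas, OF v] by simp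
    qed (assumption | rule b_bd)+
  qed
  also have "\<dots> = cf_err D (t * d) n + (t * d)\<^sup>2 / 2 * (\<integral>(w, v). \<bar>cvar (y v) w - \<sigma>\<bar> \<partial>(P \<Otimes>\<^sub>M Q))"
    using Bochner_Integration.integral_add[OF Q.integrable_const[of "cf_err D (t * d) n"] integrable_mult_right[OF J(3), of "(t * d)\<^sup>2 / 2"]] J(2)
    by (simp add: Q.prob_space)
  finally show ?thesis unfolding e_def b_def .
qed

end

lemma smean_lln_seq:
  assumes cs: "\<And>N. cond_sampling_rand (P N) (F N) (M N) (Suc N) (Z N) (k N) (Q N) (y N) D"
    and m: "(\<lambda>N. \<integral>(w, v). \<bar>cond_sampling.cmean (M N) (k N) (y N v) w - \<mu>\<bar> \<partial>(P N \<Otimes>\<^sub>M Q N)) \<longlonglongrightarrow> 0"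
  shows "(\<lambda>N. \<integral>(w, v). \<bar>cond_sampling.smean (Suc N) (Z N) (y N v) w - \<mu>\<bar> \<partial>(P N \<Otimes>\<^sub>M Q N)) \<longlonglongrightarrow> 0"
proof (rule Lim_null_comparison)
  let ?r = "\<lambda>N. 2 * D / sqrt (Suc N) + (\<integral>(w, v). \<bar>cond_sampling.cmean (M N) (k N) (y N v) w - \<mu>\<bar> \<partial>(P N \<Otimes>\<^sub>M Q N))"
  have "(\<lambda>N. inverse (sqrt (real (Suc N)))) \<longlonglongrightarrow> 0"
    using LIMSEQ_inverse_real_of_nat[THEN tendsto_real_sqrt] by (simp add: real_sqrt_inverse)
  from tendsto_mult_right_zero[OF this, of "2 * D"] have "(\<lambda>N. 2 * D / sqrt (Suc N)) \<longlonglongrightarrow> 0"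
    by (simp add: field_simps)
  from tendsto_add_zero[OF this m] show "?r \<longlonglongrightarrow> 0" .
  show "\<forall>\<^sub>F N in sequentially. norm (\<integral>(w, v). \<bar>cond_sampling.smean (Suc N) (Z N) (y N v) w - \<mu>\<bar> \<partial>(P N \<Otimes>\<^sub>M Q N)) \<le> ?r N"
  proof (intro always_eventually allI)
    fix N
    interpret cond_sampling_rand "P N" "F N" "M N" "Suc N" "Z N" "k N" "Q N" "y N" D by (rule cs)
    have m1: "(\<lambda>(w, v). \<bar>smean (y N v) w - \<mu>\<bar>) \<in> borel_measurable (P N \<Otimes>\<^sub>M Q N)"
      using smean_pair_meas unfolding case_prod_beta by measurable
    have m2: "(\<lambda>(w, v). \<bar>smean (y N v) w - cmean (y N v) w\<bar>) \<in> borel_measurable (P N \<Otimes>\<^sub>M Q N)"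
      using smean_pair_meas cmean_pair_meas unfolding case_prod_beta by measurable
    have m3: "(\<lambda>(w, v). \<bar>cmean (y N v) w - \<mu>\<bar>) \<in> borel_measurable (P N \<Otimes>\<^sub>M Q N)"
      using cmean_pair_meas unfolding case_prod_beta by measurable
    have b1: "norm \<bar>smean (y N v) w - \<mu>\<bar> \<le> 2 * D + \<bar>\<mu>\<bar>" "norm \<bar>smean (y N v) w - cmean (y N v) w\<bar> \<le> 2 * D + \<bar>\<mu>\<bar>"
       "norm \<bar>cmean (y N v) w - \<mu>\<bar> \<le> 2 * D + \<bar>\<mu>\<bar>" if "w \<in> space (P N)" "v \<in> space (Q N)" for w v
      using abs_smean_le[OF that] abs_cmean_pair_le[OF that] unfolding real_norm_def by linarith+
    note I1 = pair_prob_integral(1)[OF prob_space_axioms Q.prob_space_axioms m1 b1(1)]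
    note I2 = pair_prob_integral(1)[OF prob_space_axioms Q.prob_space_axioms m2 b1(2)]
    note I3 = pair_prob_integral(1)[OF prob_space_axioms Q.prob_space_axioms m3 b1(3)]
    have "norm (\<integral>(w, v). \<bar>smean (y N v) w - \<mu>\<bar> \<partial>(P N \<Otimes>\<^sub>M Q N)) = (\<integral>(w, v). \<bar>smean (y N v) w - \<mu>\<bar> \<partial>(P N \<Otimes>\<^sub>M Q N))"
      unfolding real_norm_def by (intro abs_of_nonneg Bochner_Integration.integral_nonneg) auto
    also have "\<dots> \<le> (\<integral>x. (case x of (w, v) \<Rightarrow> \<bar>smean (y N v) w - cmean (y N v) w\<bar>) + (case x of (w, v) \<Rightarrow> \<bar>cmean (y N v) w - \<mu>\<bar>) \<partial>(P N \<Otimes>\<^sub>M Q N))"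
      by (rule integral_mono[OF I1 Bochner_Integration.integrable_add[OF I2 I3]]) (auto simp: case_prod_beta)
    also have "\<dots> = (\<integral>(w, v). \<bar>smean (y N v) w - cmean (y N v) w\<bar> \<partial>(P N \<Otimes>\<^sub>M Q N)) + (\<integral>(w, v). \<bar>cmean (y N v) w - \<mu>\<bar> \<partial>(P N \<Otimes>\<^sub>M Q N))"
      by (rule Bochner_Integration.integral_add[OF I2 I3])
    also have "\<dots> \<le> ?r N"
      using smean_L1_pair by simp
    finally show "norm (\<integral>(w, v). \<bar>smean (y N v) w - \<mu>\<bar> \<partial>(P N \<Otimes>\<^sub>M Q N)) \<le> ?r N" .
  qed
qed

text \<open>The conditional mean may itself fluctuate at rate \<open>1 / sqrt N\<close>. Its
  characteristic function tends to that of variance \<open>V\<close>, the centred part contributes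
  an asymptotically deterministic Gaussian factor, and the product of the limits adds the
  variances.\<close>

lemma smean_clt_seq:
  assumes cs: "\<And>N. cond_sampling_rand (P N) (F N) (M N) (Suc N) (Z N) (k N) (Q N) (y N) D"
    and \<sigma>: "0 \<le> \<sigma>"
    and v: "(\<lambda>N. \<integral>(w, v). \<bar>cond_sampling.cvar (M N) (k N) (y N v) w - \<sigma>\<bar> \<partial>(P N \<Otimes>\<^sub>M Q N)) \<longlonglongrightarrow> 0"
    and lim: "cf_lim (\<lambda>N. P N \<Otimes>\<^sub>M Q N) (\<lambda>N (w, v). sqrt (Suc N) * cond_sampling.cmean (M N) (k N) (y N v) w * d) V"
  shows "cf_lim (\<lambda>N. P N \<Otimes>\<^sub>M Q N) (\<lambda>N (w, v). sqrt (Suc N) * cond_sampling.smean (Suc N) (Z N) (y N v) w * d) (d\<^sup>2 * \<sigma> + V)"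
  unfolding cf_lim_def
proof
  fix t :: real
  let ?e = "complex_of_real (exp (- ((t * d)\<^sup>2 * \<sigma> / 2)))"
  let ?S = "\<lambda>N. \<integral>(w, v). iexp (t * (sqrt (Suc N) * cond_sampling.smean (Suc N) (Z N) (y N v) w * d)) \<partial>(P N \<Otimes>\<^sub>M Q N)"
  let ?B = "\<lambda>N. \<integral>(w, v). iexp (t * (sqrt (Suc N) * cond_sampling.cmean (M N) (k N) (y N v) w * d)) \<partial>(P N \<Otimes>\<^sub>M Q N)"
  have "(\<lambda>N. ?S N - ?B N * ?e) \<longlonglongrightarrow> 0"
  proof (rule Lim_null_comparison)
    show "\<forall>\<^sub>F N in sequentially. norm (?S N - ?B N * ?e) \<le> cf_err D (t * d) (Suc N)
        + (t * d)\<^sup>2 / 2 * (\<integral>(w, v). \<bar>cond_sampling.cvar (M N) (k N) (y N v) w - \<sigma>\<bar> \<partial>(P N \<Otimes>\<^sub>M Q N))"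
      by (intro always_eventually allI cond_sampling_rand.smean_cf_pair[OF cs] \<sigma>)
    show "(\<lambda>N. cf_err D (t * d) (Suc N)
        + (t * d)\<^sup>2 / 2 * (\<integral>(w, v). \<bar>cond_sampling.cvar (M N) (k N) (y N v) w - \<sigma>\<bar> \<partial>(P N \<Otimes>\<^sub>M Q N))) \<longlonglongrightarrow> 0"
      by (intro tendsto_add_zero cf_err_tendsto tendsto_mult_right_zero v)
  qed
  moreover have "(\<lambda>N. ?B N * ?e) \<longlonglongrightarrow> complex_of_real (exp (- (t\<^sup>2 * V / 2))) * ?e"
  proof (rule tendsto_mult_right)
    have "(\<lambda>N. \<integral>x. iexp (t * (case x of (w, v) \<Rightarrow> sqrt (Suc N) * cond_sampling.cmean (M N) (k N) (y N v) w * d)) \<partial>(P N \<Otimes>\<^sub>M Q N)) \<longlonglongrightarrow> complex_of_real (exp (- (t\<^sup>2 * V / 2)))"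
      using lim unfolding cf_lim_def by blast
    then show "?B \<longlonglongrightarrow> complex_of_real (exp (- (t\<^sup>2 * V / 2)))"
      by (simp only: case_prod_unfold)
  qed
  ultimately have "?S \<longlonglongrightarrow> complex_of_real (exp (- (t\<^sup>2 * V / 2))) * ?e"
    by (rule Lim_transform[rotated])
  moreover have "complex_of_real (exp (- (t\<^sup>2 * V / 2))) * ?e = complex_of_real (exp (- (t\<^sup>2 * (d\<^sup>2 * \<sigma> + V) / 2)))"
    unfolding of_real_mult[symmetric] exp_add[symmetric] by (simp add: field_simps)
  ultimately show "(\<lambda>N. \<integral>x. iexp (t * (case x of (w, v) \<Rightarrow> sqrt (Suc N) * cond_sampling.smean (Suc N) (Z N) (y N v) w * d)) \<partial>(P N \<Otimes>\<^sub>M Q N)) \<longlonglongrightarrow> complex_of_real (exp (- (t\<^sup>2 * (d\<^sup>2 * \<sigma> + V) / 2)))"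
    by (simp only: case_prod_unfold)
qed

section \<open>Weighted samples\<close>

text \<open>Samples are indexed by \<open>N\<close> and have size \<open>Suc N\<close>, so that no average is empty.\<close>

definition emp :: "nat \<Rightarrow> (nat \<Rightarrow> 'w \<Rightarrow> real) \<Rightarrow> (nat \<Rightarrow> 'w \<Rightarrow> 'a) \<Rightarrow> ('a \<Rightarrow> real) \<Rightarrow> 'w \<Rightarrow> real" where
  "emp n W x f w = (\<Sum>l=1..n. W l w * f (x l w)) / real n"

text \<open>Uniformly bounded test functions that converge in mean over \<open>v\<close> at each
  fixed \<open>x\<close>, not uniformly in \<open>x\<close>. A law of large numbers applied to one
  function at a time gives exactly this, and it is enough because the limits are taken under
  integrals against finite measures.\<close>

definition rand_conv :: "'a measure \<Rightarrow> (nat \<Rightarrow> 'v measure) \<Rightarrow> real \<Rightarrow> (nat \<Rightarrow> 'v \<Rightarrow> 'a \<Rightarrow> real) \<Rightarrow> ('a \<Rightarrow> real) \<Rightarrow> bool" where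
  "rand_conv L Q C G f \<longleftrightarrow>
     0 \<le> C \<and> (\<forall>N. (\<lambda>(v, x). G N v x) \<in> borel_measurable (Q N \<Otimes>\<^sub>M L)) \<and> f \<in> borel_measurable L \<and>
     (\<forall>N. \<forall>v\<in>space (Q N). \<forall>x\<in>space L. \<bar>G N v x\<bar> \<le> C) \<and> (\<forall>x\<in>space L. \<bar>f x\<bar> \<le> C) \<and>
     (\<forall>x\<in>space L. (\<lambda>N. \<integral>v. \<bar>G N v x - f x\<bar> \<partial>Q N) \<longlonglongrightarrow> 0)"

text \<open>The weights are unnormalised, hence \<open>c\<close>: the limit of their average when
  \<open>\<phi>\<close> is a probability. The parameter spaces \<open>Q\<close> share the type of
  the sample space because a definition cannot quantify over types; the other particle system lives
  on that type as well.\<close>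

definition sample_lln :: "'a measure \<Rightarrow> (nat \<Rightarrow> 'w measure) \<Rightarrow> (nat \<Rightarrow> nat \<Rightarrow> 'w \<Rightarrow> real) \<Rightarrow>
    (nat \<Rightarrow> nat \<Rightarrow> 'w \<Rightarrow> 'a) \<Rightarrow> 'a measure \<Rightarrow> real \<Rightarrow> bool" where
  "sample_lln L P W x \<phi> c \<longleftrightarrow>
     (\<forall>(Q :: nat \<Rightarrow> 'w measure) C G f. (\<forall>N. prob_space (Q N)) \<longrightarrow> rand_conv L Q C G f \<longrightarrow>
       (\<lambda>N. \<integral>(w, v). \<bar>emp (Suc N) (W N) (x N) (G N v) w - c * (\<integral>x. f x \<partial>\<phi>)\<bar> \<partial>(P N \<Otimes>\<^sub>M Q N)) \<longlonglongrightarrow> 0)"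

text \<open>Only the limit \<open>f\<close> is centred. The \<open>\<phi>\<close>-integrals of the
  random \<open>G N v\<close> may be of order \<open>1 / sqrt N\<close>, and the variance
  \<open>V\<close> of their own Gaussian limit is added. This admits averages over another sample as
  test functions.\<close>

definition sample_clt :: "'a measure \<Rightarrow> (nat \<Rightarrow> 'w measure) \<Rightarrow> (nat \<Rightarrow> nat \<Rightarrow> 'w \<Rightarrow> real) \<Rightarrow>
    (nat \<Rightarrow> nat \<Rightarrow> 'w \<Rightarrow> 'a) \<Rightarrow> 'a measure \<Rightarrow> real \<Rightarrow> (('a \<Rightarrow> real) \<Rightarrow> real) \<Rightarrow> bool" where
  "sample_clt L P W x \<phi> c \<Gamma> \<longleftrightarrow>
     (\<forall>(Q :: nat \<Rightarrow> 'w measure) C G f V. (\<forall>N. prob_space (Q N)) \<longrightarrow> rand_conv L Q C G f \<longrightarrow>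
       (\<integral>x. f x \<partial>\<phi>) = 0 \<longrightarrow>
       cf_lim Q (\<lambda>N v. sqrt (Suc N) * (\<integral>x. G N v x \<partial>\<phi>)) V \<longrightarrow>
       cf_lim (\<lambda>N. P N \<Otimes>\<^sub>M Q N)
         (\<lambda>N (w, v). sqrt (Suc N) * emp (Suc N) (W N) (x N) (G N v) w * (1 / c)) (\<Gamma> f + V))"

lemma rand_conv_const:
  assumes "\<And>N. prob_space (Q N)" "f \<in> borel_measurable L" "\<And>x. x \<in> space L \<Longrightarrow> \<bar>f x\<bar> \<le> C" "0 \<le> C"
  shows "rand_conv L Q C (\<lambda>N v. f) f"
proof -
  have "(\<lambda>(v, x). f x) \<in> borel_measurable (Q N \<Otimes>\<^sub>M L)" for N
    using measurable_compose[OF measurable_snd assms(2)] by (simp add: case_prod_unfold)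
  then show ?thesis using assms by (simp add: rand_conv_def)
qed

lemma rand_conv_meas_x:
  assumes "rand_conv L Q C G f" "v \<in> space (Q N)"
  shows "G N v \<in> borel_measurable L"
proof -
  have "(\<lambda>(v, x). G N v x) \<in> borel_measurable (Q N \<Otimes>\<^sub>M L)" using assms by (auto simp: rand_conv_def)
  from measurable_compose[OF measurable_Pair1' this, OF assms(2)] show ?thesis by simp
qed

lemma rand_conv_meas_v:
  assumes "rand_conv L Q C G f" "x \<in> space L"
  shows "(\<lambda>v. G N v x) \<in> borel_measurable (Q N)"
proof -
  have "(\<lambda>(v, x). G N v x) \<in> borel_measurable (Q N \<Otimes>\<^sub>M L)" using assms by (auto simp: rand_conv_def)
  from measurable_compose[OF measurable_Pair2' this, OF assms(2)] show ?thesis by simp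
qed

text \<open>From \<open>\<bar>a\<^sup>2 - b\<^sup>2\<bar> \<le> 2 * C * \<bar>a - b\<bar>\<close>;
  squares enter through conditional second moments.\<close>

lemma rand_conv_square:
  assumes prob: "\<And>N. prob_space (Q N)" and rc: "rand_conv L Q C G f"
  shows "rand_conv L Q (C\<^sup>2) (\<lambda>N v x. (G N v x)\<^sup>2) (\<lambda>x. (f x)\<^sup>2)"
  unfolding rand_conv_def
proof (intro conjI allI ballI)
  have G_bd: "\<bar>G N v x\<bar> \<le> C" if "v \<in> space (Q N)" "x \<in> space L" for N v x
    using rc that by (auto simp: rand_conv_def)
  have f_bd: "\<bar>f x\<bar> \<le> C" if "x \<in> space L" for x
    using rc that by (auto simp: rand_conv_def)
  have C: "0 \<le> C" using rc by (simp add: rand_conv_def)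
  show "0 \<le> C\<^sup>2" by simp
  show "(\<lambda>(v, x). (G N v x)\<^sup>2) \<in> borel_measurable (Q N \<Otimes>\<^sub>M L)" for N
  proof -
    have "(\<lambda>(v, x). G N v x) \<in> borel_measurable (Q N \<Otimes>\<^sub>M L)" using rc by (auto simp: rand_conv_def)
    from borel_measurable_power[OF this, of 2] show ?thesis by (simp add: case_prod_unfold)
  qed
  have f_meas: "f \<in> borel_measurable L" using rc by (auto simp: rand_conv_def)
  then show "(\<lambda>x. (f x)\<^sup>2) \<in> borel_measurable L" by measurable
  show "\<bar>(G N v x)\<^sup>2\<bar> \<le> C\<^sup>2" if "v \<in> space (Q N)" "x \<in> space L" for N v x
    using abs_le_imp_square_le[OF G_bd[OF that]] by simp
  show "\<bar>(f x)\<^sup>2\<bar> \<le> C\<^sup>2" if "x \<in> space L" for x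
    using abs_le_imp_square_le[OF f_bd[OF that]] by simp
  fix x assume x: "x \<in> space L"
  show "(\<lambda>N. \<integral>v. \<bar>(G N v x)\<^sup>2 - (f x)\<^sup>2\<bar> \<partial>Q N) \<longlonglongrightarrow> 0"
  proof (rule Lim_null_comparison)
    show "(\<lambda>N. 2 * C * (\<integral>v. \<bar>G N v x - f x\<bar> \<partial>Q N)) \<longlonglongrightarrow> 0"
      using rc x by (intro tendsto_mult_right_zero) (auto simp: rand_conv_def)
    show "\<forall>\<^sub>F N in sequentially. norm (\<integral>v. \<bar>(G N v x)\<^sup>2 - (f x)\<^sup>2\<bar> \<partial>Q N) \<le> 2 * C * (\<integral>v. \<bar>G N v x - f x\<bar> \<partial>Q N)"
    proof (intro always_eventually allI)
      fix N
      interpret prob_space "Q N" by (rule prob)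
      note Gm = rand_conv_meas_v[OF rc x, of N]
      have le: "\<bar>(G N v x)\<^sup>2 - (f x)\<^sup>2\<bar> \<le> 2 * C * \<bar>G N v x - f x\<bar>" if "v \<in> space (Q N)" for v
      proof -
        have "\<bar>(G N v x)\<^sup>2 - (f x)\<^sup>2\<bar> = \<bar>G N v x + f x\<bar> * \<bar>G N v x - f x\<bar>"
          unfolding abs_mult[symmetric] by (simp add: power2_eq_square algebra_simps)
        also have "\<dots> \<le> 2 * C * \<bar>G N v x - f x\<bar>"
        proof (rule mult_right_mono)
          show "\<bar>G N v x + f x\<bar> \<le> 2 * C" using G_bd[OF that x] f_bd[OF x] by linarith
        qed simp
        finally show ?thesis .
      qed
      have i: "integrable (Q N) (\<lambda>v. \<bar>G N v x - f x\<bar>)"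
      proof (rule integrable_const_bound[where B="2 * C"])
        show "AE v in Q N. norm \<bar>G N v x - f x\<bar> \<le> 2 * C"
        proof (rule AE_I2)
          fix v assume "v \<in> space (Q N)"
          from G_bd[OF this x] f_bd[OF x] show "norm \<bar>G N v x - f x\<bar> \<le> 2 * C" unfolding real_norm_def by linarith
        qed
      qed (use Gm in measurable)
      have "norm (\<integral>v. \<bar>(G N v x)\<^sup>2 - (f x)\<^sup>2\<bar> \<partial>Q N) = (\<integral>v. \<bar>(G N v x)\<^sup>2 - (f x)\<^sup>2\<bar> \<partial>Q N)"
        unfolding real_norm_def by (intro abs_of_nonneg Bochner_Integration.integral_nonneg) auto
      also have "\<dots> \<le> (\<integral>v. 2 * C * \<bar>G N v x - f x\<bar> \<partial>Q N)"
      proof (rule integral_mono)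
        show "integrable (Q N) (\<lambda>v. 2 * C * \<bar>G N v x - f x\<bar>)" using i by (rule integrable_mult_right)
        show "integrable (Q N) (\<lambda>v. \<bar>(G N v x)\<^sup>2 - (f x)\<^sup>2\<bar>)"
        proof (rule Bochner_Integration.integrable_bound[OF integrable_mult_right[OF i, of "2 * C"]])
          show "AE v in Q N. norm \<bar>(G N v x)\<^sup>2 - (f x)\<^sup>2\<bar> \<le> norm (2 * C * \<bar>G N v x - f x\<bar>)"
          proof (rule AE_I2)
            fix v assume v: "v \<in> space (Q N)"
            show "norm \<bar>(G N v x)\<^sup>2 - (f x)\<^sup>2\<bar> \<le> norm (2 * C * \<bar>G N v x - f x\<bar>)"
              unfolding real_norm_def abs_abs using le[OF v] by linarith
          qed
        qed (use Gm in measurable)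
      qed (rule le)
      finally show "norm (\<integral>v. \<bar>(G N v x)\<^sup>2 - (f x)\<^sup>2\<bar> \<partial>Q N) \<le> 2 * C * (\<integral>v. \<bar>G N v x - f x\<bar> \<partial>Q N)"
        by (simp only: integral_mult_right_zero)
    qed
  qed
qed

text \<open>Fubini moves the expectation over \<open>v\<close> inside the integral over
  \<open>K\<close>, where dominated convergence applies with the bound \<open>2 * C\<close>.\<close>

lemma rand_conv_finite_measure:
  assumes prob: "\<And>N. prob_space (Q N)" and rc: "rand_conv L Q C G f"
    and fin: "finite_measure K" and sets: "sets K = sets L"
  shows "(\<lambda>N. \<integral>v. \<bar>(\<integral>x. G N v x \<partial>K) - (\<integral>x. f x \<partial>K)\<bar> \<partial>Q N) \<longlonglongrightarrow> 0"
proof (rule Lim_null_comparison)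
  interpret K: finite_measure K by (rule fin)
  note [measurable_cong] = sets
  have sp: "space K = space L" using sets by (rule sets_eq_imp_space_eq)
  have G_bd: "\<bar>G N v x\<bar> \<le> C" if "v \<in> space (Q N)" "x \<in> space L" for N v x
    using rc that by (auto simp: rand_conv_def)
  have f_bd: "\<bar>f x\<bar> \<le> C" if "x \<in> space L" for x
    using rc that by (auto simp: rand_conv_def)
  have f_meas: "f \<in> borel_measurable K"
    using rc sets by (auto simp: rand_conv_def cong: measurable_cong_sets)
  have G_pair: "(\<lambda>(v, x). G N v x) \<in> borel_measurable (Q N \<Otimes>\<^sub>M K)" for N
    unfolding measurable_cong_sets[OF sets_pair_measure_cong[OF refl sets] refl] using rc by (auto simp: rand_conv_def)
  have d_pair: "(\<lambda>(v, x). \<bar>G N v x - f x\<bar>) \<in> borel_measurable (Q N \<Otimes>\<^sub>M K)" for N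
    using borel_measurable_abs[OF borel_measurable_diff[OF G_pair measurable_compose[OF measurable_snd f_meas]]]
    by (simp add: case_prod_unfold)
  have d_bd: "norm \<bar>G N v x - f x\<bar> \<le> 2 * C" if "v \<in> space (Q N)" "x \<in> space L" for N v x
    using G_bd[OF that] f_bd[OF that(2)] unfolding real_norm_def by linarith
  have "(\<lambda>N. \<integral>x. (\<integral>v. \<bar>G N v x - f x\<bar> \<partial>Q N) \<partial>K) \<longlonglongrightarrow> (\<integral>x. 0 \<partial>K)"
  proof (rule integral_dominated_convergence[where w="\<lambda>_. 2 * C"])
    show "AE x in K. (\<lambda>N. \<integral>v. \<bar>G N v x - f x\<bar> \<partial>Q N) \<longlonglongrightarrow> 0"
      using rc by (intro AE_I2) (auto simp: rand_conv_def sp)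
    show "(\<lambda>x. \<integral>v. \<bar>G N v x - f x\<bar> \<partial>Q N) \<in> borel_measurable K" for N
    proof -
      interpret prob_space "Q N" by (rule prob)
      have "(\<lambda>(x, v). \<bar>G N v x - f x\<bar>) \<in> borel_measurable (K \<Otimes>\<^sub>M Q N)"
        using measurable_compose[OF measurable_pair_swap' d_pair] by (simp add: case_prod_unfold)
      then show ?thesis by (rule borel_measurable_lebesgue_integral)
    qed
    show "AE x in K. norm (\<integral>v. \<bar>G N v x - f x\<bar> \<partial>Q N) \<le> 2 * C" for N
    proof (rule AE_I2)
      fix x assume "x \<in> space K"
      then have x: "x \<in> space L" by (simp add: sp)
      interpret prob_space "Q N" by (rule prob)
      have i: "integrable (Q N) (\<lambda>v. \<bar>G N v x - f x\<bar>)"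
      proof (rule integrable_const_bound[where B="2 * C"])
        show "AE v in Q N. norm \<bar>G N v x - f x\<bar> \<le> 2 * C" by (rule AE_I2) (rule d_bd[OF _ x])
      qed (use rand_conv_meas_v[OF rc x, of N] in measurable)
      have "norm (\<integral>v. \<bar>G N v x - f x\<bar> \<partial>Q N) \<le> (\<integral>v. norm \<bar>G N v x - f x\<bar> \<partial>Q N)" by (rule integral_norm_bound)
      also have "\<dots> \<le> (\<integral>v. 2 * C \<partial>Q N)" by (rule integral_mono[OF integrable_norm[OF i] integrable_const]) (rule d_bd[OF _ x])
      finally show "norm (\<integral>v. \<bar>G N v x - f x\<bar> \<partial>Q N) \<le> 2 * C" by (simp add: prob_space)
    qed
  qed auto
  then show "(\<lambda>N. \<integral>x. (\<integral>v. \<bar>G N v x - f x\<bar> \<partial>Q N) \<partial>K) \<longlonglongrightarrow> 0" by simp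
  show "\<forall>\<^sub>F N in sequentially. norm (\<integral>v. \<bar>(\<integral>x. G N v x \<partial>K) - (\<integral>x. f x \<partial>K)\<bar> \<partial>Q N) \<le> (\<integral>x. (\<integral>v. \<bar>G N v x - f x\<bar> \<partial>Q N) \<partial>K)"
  proof (intro always_eventually allI)
    fix N
    interpret Q: prob_space "Q N" by (rule prob)
    interpret QK: pair_sigma_finite "Q N" K ..
    interpret QKf: finite_measure "Q N \<Otimes>\<^sub>M K"
      by (rule finite_measure_pair_measure) unfold_locales
    have i: "integrable (Q N \<Otimes>\<^sub>M K) (\<lambda>(v, x). \<bar>G N v x - f x\<bar>)"
    proof (rule QKf.integrable_const_bound[where B="2 * C"])
      show "AE z in Q N \<Otimes>\<^sub>M K. norm (case z of (v, x) \<Rightarrow> \<bar>G N v x - f x\<bar>) \<le> 2 * C"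
      proof (rule AE_I2)
        fix z assume "z \<in> space (Q N \<Otimes>\<^sub>M K)"
        then have "fst z \<in> space (Q N)" "snd z \<in> space L" by (auto simp: space_pair_measure sp)
        from d_bd[OF this] show "norm (case z of (v, x) \<Rightarrow> \<bar>G N v x - f x\<bar>) \<le> 2 * C" by (simp add: case_prod_unfold)
      qed
    qed (rule d_pair)
    have if': "integrable K f"
      by (rule K.integrable_const_bound[where B=C]) (auto simp: f_meas f_bd sp)
    have iG: "integrable K (G N v)" if v: "v \<in> space (Q N)" for v
    proof (rule K.integrable_const_bound[where B=C])
      show "AE x in K. norm (G N v x) \<le> C" using G_bd[OF v] by (intro AE_I2) (simp add: sp)
      show "G N v \<in> borel_measurable K"
        using rand_conv_meas_x[OF rc v] sets by (simp cong: measurable_cong_sets)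
    qed
    have m1: "(\<lambda>v. \<integral>x. G N v x \<partial>K) \<in> borel_measurable (Q N)"
      by (rule K.borel_measurable_lebesgue_integral[OF G_pair])
    have i2: "integrable (Q N) (\<lambda>v. \<integral>x. \<bar>G N v x - f x\<bar> \<partial>K)"
      using QK.integrable_fst'[OF i] by (simp add: case_prod_unfold)
    have le: "\<bar>(\<integral>x. G N v x \<partial>K) - (\<integral>x. f x \<partial>K)\<bar> \<le> (\<integral>x. \<bar>G N v x - f x\<bar> \<partial>K)" if v: "v \<in> space (Q N)" for v
      unfolding Bochner_Integration.integral_diff[OF iG[OF v] if', symmetric]
      by (rule integral_abs_bound)
    have "norm (\<integral>v. \<bar>(\<integral>x. G N v x \<partial>K) - (\<integral>x. f x \<partial>K)\<bar> \<partial>Q N) = (\<integral>v. \<bar>(\<integral>x. G N v x \<partial>K) - (\<integral>x. f x \<partial>K)\<bar> \<partial>Q N)"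
      unfolding real_norm_def by (intro abs_of_nonneg Bochner_Integration.integral_nonneg) auto
    also have "\<dots> \<le> (\<integral>v. \<integral>x. \<bar>G N v x - f x\<bar> \<partial>K \<partial>Q N)"
    proof (rule integral_mono[OF _ i2 le])
      show "integrable (Q N) (\<lambda>v. \<bar>(\<integral>x. G N v x \<partial>K) - (\<integral>x. f x \<partial>K)\<bar>)"
      proof (rule Bochner_Integration.integrable_bound[OF i2])
        show "AE v in Q N. norm \<bar>(\<integral>x. G N v x \<partial>K) - (\<integral>x. f x \<partial>K)\<bar> \<le> norm (\<integral>x. \<bar>G N v x - f x\<bar> \<partial>K)"
        proof (rule AE_I2)
          fix v assume "v \<in> space (Q N)"
          from le[OF this] show "norm \<bar>(\<integral>x. G N v x \<partial>K) - (\<integral>x. f x \<partial>K)\<bar> \<le> norm (\<integral>x. \<bar>G N v x - f x\<bar> \<partial>K)"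
            unfolding real_norm_def by linarith
        qed
      qed (use m1 in measurable)
    qed
    also have "\<dots> = (\<integral>x. \<integral>v. \<bar>G N v x - f x\<bar> \<partial>Q N \<partial>K)"
      by (rule QK.Fubini_integral[OF i, symmetric])
    finally show "norm (\<integral>v. \<bar>(\<integral>x. G N v x \<partial>K) - (\<integral>x. f x \<partial>K)\<bar> \<partial>Q N) \<le> (\<integral>x. (\<integral>v. \<bar>G N v x - f x\<bar> \<partial>Q N) \<partial>K)" .
  qed
qed

lemma integral_kernel_density:
  fixes k :: "'a \<Rightarrow> real" and g :: "'a \<Rightarrow> real"
  assumes "k \<in> borel_measurable L" "\<And>x. x \<in> space L \<Longrightarrow> 0 \<le> k x" "g \<in> borel_measurable L"
  shows "(\<integral>x. k x * g x \<partial>L) = (\<integral>x. g x \<partial>density L (\<lambda>x. ennreal (k x)))"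
  using integral_density[OF assms(3,1)] assms(2) by simp

lemma finite_measure_density:
  assumes "k \<in> borel_measurable L" "(\<integral>\<^sup>+x. ennreal (k x) \<partial>L) \<le> ennreal D"
  shows "finite_measure (density L (\<lambda>x. ennreal (k x)))"
proof (rule finite_measureI)
  have "emeasure (density L (\<lambda>x. ennreal (k x))) (space L) = (\<integral>\<^sup>+x. ennreal (k x) \<partial>L)"
    using assms(1) by (subst emeasure_density) (auto intro!: nn_integral_cong)
  also have "\<dots> < \<infinity>" using assms(2) by (rule order_le_less_trans) simp
  finally show "emeasure (density L (\<lambda>x. ennreal (k x))) (space (density L (\<lambda>x. ennreal (k x)))) \<noteq> \<infinity>" by simp
qed

lemma abs_kernel_integral_le:
  fixes k g :: "'a \<Rightarrow> real"
  assumes k: "k \<in> borel_measurable L" "\<And>x. x \<in> space L \<Longrightarrow> 0 \<le> k x" "(\<integral>\<^sup>+x. ennreal (k x) \<partial>L) \<le> ennreal D" "0 \<le> D"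
    and g: "g \<in> borel_measurable L" "\<And>x. x \<in> space L \<Longrightarrow> \<bar>g x\<bar> \<le> C" and C: "0 \<le> C"
  shows "integrable L (\<lambda>x. k x * g x)" "\<bar>\<integral>x. k x * g x \<partial>L\<bar> \<le> D * C"
proof -
  have ik: "integrable L k"
    using k by (intro integrableI_nonneg) (auto intro: order_le_less_trans)
  have "(\<integral>x. k x \<partial>L) \<le> D"
    using k by (subst integral_eq_nn_integral) (auto intro!: enn2real_leI)
  note int_le = this
  show i: "integrable L (\<lambda>x. k x * g x)"
  proof (rule Bochner_Integration.integrable_bound[OF integrable_mult_left[OF ik, of C]])
    show "AE x in L. norm (k x * g x) \<le> norm (k x * C)"
      using k(2) g(2) C by (intro AE_I2) (simp add: abs_mult mult_left_mono)
  qed (use k(1) g(1) in measurable)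
  have "\<bar>\<integral>x. k x * g x \<partial>L\<bar> \<le> (\<integral>x. \<bar>k x * g x\<bar> \<partial>L)" by (rule integral_abs_bound)
  also have "\<dots> \<le> (\<integral>x. k x * C \<partial>L)"
    using k(2) g(2) C by (intro integral_mono integrable_abs[OF i] integrable_mult_left[OF ik]) (simp add: abs_mult mult_left_mono)
  also have "\<dots> \<le> D * C" using mult_right_mono[OF int_le C] by simp
  finally show "\<bar>\<integral>x. k x * g x \<partial>L\<bar> \<le> D * C" .
qed

text \<open>At each \<open>x\<close>, \<open>rand_conv_finite_measure\<close> is applied to the
  finite measure with density \<open>k x\<close>. This closure under kernels lets a random test
  function be pulled back through a filter step.\<close>

lemma rand_conv_kernel:
  assumes sf: "sigma_finite_measure L" and prob: "\<And>N. prob_space (Q N)" and rc: "rand_conv L Q C G f"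
    and k_meas: "(\<lambda>(x, x'). k x x') \<in> borel_measurable (L \<Otimes>\<^sub>M L)"
    and k_nn: "\<And>x x'. x \<in> space L \<Longrightarrow> x' \<in> space L \<Longrightarrow> 0 \<le> k x x'"
    and k_int: "\<And>x. x \<in> space L \<Longrightarrow> (\<integral>\<^sup>+x'. ennreal (k x x') \<partial>L) \<le> ennreal D" and D: "0 \<le> D"
  shows "rand_conv L Q (D * C) (\<lambda>N v x. \<integral>x'. k x x' * G N v x' \<partial>L) (\<lambda>x. \<integral>x'. k x x' * f x' \<partial>L)"
  unfolding rand_conv_def
proof (intro conjI allI ballI)
  interpret L: sigma_finite_measure L by (rule sf)
  have C: "0 \<le> C" using rc by (simp add: rand_conv_def)
  show "0 \<le> D * C" using C D by simp
  have f_meas: "f \<in> borel_measurable L" using rc by (auto simp: rand_conv_def)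
  have kx: "k x \<in> borel_measurable L" if "x \<in> space L" for x
    using measurable_compose[OF measurable_Pair1' k_meas, OF that] by simp
  have G_bd: "\<bar>G N v x\<bar> \<le> C" if "v \<in> space (Q N)" "x \<in> space L" for N v x
    using rc that by (auto simp: rand_conv_def)
  have f_bd: "\<bar>f x\<bar> \<le> C" if "x \<in> space L" for x
    using rc that by (auto simp: rand_conv_def)
  show "(\<lambda>(v, x). \<integral>x'. k x x' * G N v x' \<partial>L) \<in> borel_measurable (Q N \<Otimes>\<^sub>M L)" for N
  proof -
    have G_pair: "(\<lambda>(v, x). G N v x) \<in> borel_measurable (Q N \<Otimes>\<^sub>M L)" using rc by (auto simp: rand_conv_def)
    have "(\<lambda>z. (snd (fst z), snd z)) \<in> measurable ((Q N \<Otimes>\<^sub>M L) \<Otimes>\<^sub>M L) (L \<Otimes>\<^sub>M L)" by measurable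
    from measurable_compose[OF this k_meas]
    have 1: "(\<lambda>z. k (snd (fst z)) (snd z)) \<in> borel_measurable ((Q N \<Otimes>\<^sub>M L) \<Otimes>\<^sub>M L)"
      by (simp only: case_prod_unfold fst_conv snd_conv)
    have "(\<lambda>z. (fst (fst z), snd z)) \<in> measurable ((Q N \<Otimes>\<^sub>M L) \<Otimes>\<^sub>M L) (Q N \<Otimes>\<^sub>M L)" by measurable
    from measurable_compose[OF this G_pair]
    have 2: "(\<lambda>z. G N (fst (fst z)) (snd z)) \<in> borel_measurable ((Q N \<Otimes>\<^sub>M L) \<Otimes>\<^sub>M L)"
      by (simp only: case_prod_unfold fst_conv snd_conv)
    from L.borel_measurable_lebesgue_integral[of "\<lambda>z x'. k (snd z) x' * G N (fst z) x'" "Q N \<Otimes>\<^sub>M L",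
        unfolded case_prod_unfold, OF borel_measurable_times[OF 1 2]]
    show ?thesis by (simp only: case_prod_unfold)
  qed
  show "(\<lambda>x. \<integral>x'. k x x' * f x' \<partial>L) \<in> borel_measurable L"
    using L.borel_measurable_lebesgue_integral[of "\<lambda>x x'. k x x' * f x'" L, unfolded case_prod_unfold,
        OF borel_measurable_times[OF k_meas[unfolded case_prod_unfold] measurable_compose[OF measurable_snd f_meas]]] .
  show "\<bar>\<integral>x'. k x x' * G N v x' \<partial>L\<bar> \<le> D * C" if "v \<in> space (Q N)" "x \<in> space L" for N v x
    by (rule abs_kernel_integral_le(2)[OF kx[OF that(2)] k_nn[OF that(2)] k_int[OF that(2)] D
          rand_conv_meas_x[OF rc that(1)] G_bd[OF that(1)] C])
  show "\<bar>\<integral>x'. k x x' * f x' \<partial>L\<bar> \<le> D * C" if "x \<in> space L" for x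
    by (rule abs_kernel_integral_le(2)[OF kx[OF that] k_nn[OF that] k_int[OF that] D f_meas f_bd C])
  fix x assume x: "x \<in> space L"
  let ?K = "density L (\<lambda>x'. ennreal (k x x'))"
  have "(\<lambda>N. \<integral>v. \<bar>(\<integral>x'. G N v x' \<partial>?K) - (\<integral>x'. f x' \<partial>?K)\<bar> \<partial>Q N) \<longlonglongrightarrow> 0"
    by (rule rand_conv_finite_measure[OF prob rc finite_measure_density[OF kx[OF x] k_int[OF x]]]) simp
  moreover have "(\<integral>v. \<bar>(\<integral>x'. G N v x' \<partial>?K) - (\<integral>x'. f x' \<partial>?K)\<bar> \<partial>Q N)
      = (\<integral>v. \<bar>(\<integral>x'. k x x' * G N v x' \<partial>L) - (\<integral>x'. k x x' * f x' \<partial>L)\<bar> \<partial>Q N)" for N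
  proof (rule Bochner_Integration.integral_cong[OF refl])
    fix v assume v: "v \<in> space (Q N)"
    show "\<bar>(\<integral>x'. G N v x' \<partial>?K) - (\<integral>x'. f x' \<partial>?K)\<bar> = \<bar>(\<integral>x'. k x x' * G N v x' \<partial>L) - (\<integral>x'. k x x' * f x' \<partial>L)\<bar>"
      using integral_kernel_density[OF kx[OF x] k_nn[OF x] rand_conv_meas_x[OF rc v]]
        integral_kernel_density[OF kx[OF x] k_nn[OF x] f_meas] by simp
  qed
  ultimately show "(\<lambda>N. \<integral>v. \<bar>(\<integral>x'. k x x' * G N v x' \<partial>L) - (\<integral>x'. k x x' * f x' \<partial>L)\<bar> \<partial>Q N) \<longlonglongrightarrow> 0"
    by simp
qed

text \<open>Integrates \<open>ratio_diff_le\<close>; the domination of \<open>X\<close> by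
  \<open>S\<close> takes the place of a lower bound on the denominator.\<close>

lemma ratio_L1_conv:
  fixes X S :: "nat \<Rightarrow> 'w \<Rightarrow> real"
  assumes prob: "\<And>N. prob_space (M N)"
    and iX: "\<And>N. integrable (M N) (X N)" and iS: "\<And>N. integrable (M N) (S N)"
    and le: "\<And>N w. w \<in> space (M N) \<Longrightarrow> \<bar>X N w\<bar> \<le> K * S N w" and S: "\<And>N w. w \<in> space (M N) \<Longrightarrow> 0 \<le> S N w"
    and K: "0 \<le> K" and s0: "0 < s0"
    and lX: "(\<lambda>N. \<integral>w. \<bar>X N w - x0\<bar> \<partial>M N) \<longlonglongrightarrow> 0" and lS: "(\<lambda>N. \<integral>w. \<bar>S N w - s0\<bar> \<partial>M N) \<longlonglongrightarrow> 0"
  shows "(\<lambda>N. \<integral>w. \<bar>X N w / S N w - x0 / s0\<bar> \<partial>M N) \<longlonglongrightarrow> 0"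
proof (rule Lim_null_comparison)
  show "(\<lambda>N. (K * (\<integral>w. \<bar>S N w - s0\<bar> \<partial>M N) + (\<integral>w. \<bar>X N w - x0\<bar> \<partial>M N)) / s0) \<longlonglongrightarrow> 0"
    using tendsto_divide[OF tendsto_add[OF tendsto_mult_left[OF lS, of K] lX] tendsto_const[of s0]] s0 by simp
  show "\<forall>\<^sub>F N in sequentially. norm (\<integral>w. \<bar>X N w / S N w - x0 / s0\<bar> \<partial>M N)
      \<le> (K * (\<integral>w. \<bar>S N w - s0\<bar> \<partial>M N) + (\<integral>w. \<bar>X N w - x0\<bar> \<partial>M N)) / s0"
  proof (intro always_eventually allI)
    fix N
    interpret prob_space "M N" by (rule prob)
    have i1: "integrable (M N) (\<lambda>w. \<bar>S N w - s0\<bar>)" "integrable (M N) (\<lambda>w. \<bar>X N w - x0\<bar>)"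
      using iX[of N] iS[of N] by auto
    have i2: "integrable (M N) (\<lambda>w. (K * \<bar>S N w - s0\<bar> + \<bar>X N w - x0\<bar>) / s0)"
      using i1 by auto
    have le': "\<bar>X N w / S N w - x0 / s0\<bar> \<le> (K * \<bar>S N w - s0\<bar> + \<bar>X N w - x0\<bar>) / s0" if "w \<in> space (M N)" for w
      by (rule ratio_diff_le[OF le[OF that] S[OF that] s0 K])
    have "norm (\<integral>w. \<bar>X N w / S N w - x0 / s0\<bar> \<partial>M N) = (\<integral>w. \<bar>X N w / S N w - x0 / s0\<bar> \<partial>M N)"
      unfolding real_norm_def by (intro abs_of_nonneg Bochner_Integration.integral_nonneg) auto
    also have "\<dots> \<le> (\<integral>w. (K * \<bar>S N w - s0\<bar> + \<bar>X N w - x0\<bar>) / s0 \<partial>M N)"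
    proof (rule integral_mono[OF _ i2 le'])
      show "integrable (M N) (\<lambda>w. \<bar>X N w / S N w - x0 / s0\<bar>)"
      proof (rule Bochner_Integration.integrable_bound[OF i2])
        show "AE w in M N. norm \<bar>X N w / S N w - x0 / s0\<bar> \<le> norm ((K * \<bar>S N w - s0\<bar> + \<bar>X N w - x0\<bar>) / s0)"
        proof (rule AE_I2)
          fix w assume "w \<in> space (M N)"
          from le'[OF this] show "norm \<bar>X N w / S N w - x0 / s0\<bar> \<le> norm ((K * \<bar>S N w - s0\<bar> + \<bar>X N w - x0\<bar>) / s0)"
            unfolding real_norm_def abs_abs by linarith
        qed
        show "(\<lambda>w. \<bar>X N w / S N w - x0 / s0\<bar>) \<in> borel_measurable (M N)"
          using borel_measurable_integrable[OF iX[of N]] borel_measurable_integrable[OF iS[of N]] by measurable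
      qed
    qed
    also have "\<dots> = (K * (\<integral>w. \<bar>S N w - s0\<bar> \<partial>M N) + (\<integral>w. \<bar>X N w - x0\<bar> \<partial>M N)) / s0"
      using i1 by simp
    finally show "norm (\<integral>w. \<bar>X N w / S N w - x0 / s0\<bar> \<partial>M N)
      \<le> (K * (\<integral>w. \<bar>S N w - s0\<bar> \<partial>M N) + (\<integral>w. \<bar>X N w - x0\<bar> \<partial>M N)) / s0" .
  qed
qed

section \<open>The initial sample\<close>

lemma pair_prob_integral_snd:
  fixes g :: "'v \<Rightarrow> 'b::{banach, second_countable_topology}"
  assumes "prob_space P" "prob_space Q" "g \<in> borel_measurable Q" "\<And>v. v \<in> space Q \<Longrightarrow> norm (g v) \<le> B"
  shows "(\<integral>(w, v). g v \<partial>(P \<Otimes>\<^sub>M Q)) = (\<integral>v. g v \<partial>Q)"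
proof -
  interpret P: prob_space P by fact
  have "(\<lambda>(w, v). g v) \<in> borel_measurable (P \<Otimes>\<^sub>M Q)"
    using measurable_compose[OF measurable_snd assms(3)] by (simp add: case_prod_unfold)
  from pair_prob_integral(2)[OF assms(1,2) this assms(4)] show ?thesis
    by (simp add: P.prob_space)
qed

lemma cf_lim_pair_snd:
  assumes "\<And>N. prob_space (P N)" "\<And>N. prob_space (Q N)" "\<And>N. X N \<in> borel_measurable (Q N)"
  shows "cf_lim (\<lambda>N. P N \<Otimes>\<^sub>M Q N) (\<lambda>N (w, v). X N v) V \<longleftrightarrow> cf_lim Q X V"
proof -
  have "(\<integral>x. iexp (t * (case x of (w, v) \<Rightarrow> X N v)) \<partial>(P N \<Otimes>\<^sub>M Q N)) = (\<integral>v. iexp (t * X N v) \<partial>Q N)" for t N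
  proof -
    have "(\<lambda>v. iexp (t * X N v)) \<in> borel_measurable (Q N)" using assms(3)[of N] by measurable
    from pair_prob_integral_snd[OF assms(1)[of N] assms(2)[of N] this, of 1] show ?thesis
      by (simp add: case_prod_unfold)
  qed
  then show ?thesis unfolding cf_lim_def by (simp only:)
qed

lemma cf_lim_cong:
  assumes "\<And>N w. w \<in> space (M N) \<Longrightarrow> X N w = Y N w"
  shows "cf_lim M X v \<longleftrightarrow> cf_lim M Y v"
proof -
  have "(\<integral>w. iexp (t * X N w) \<partial>M N) = (\<integral>w. iexp (t * Y N w) \<partial>M N)" for t N
    by (rule Bochner_Integration.integral_cong[OF refl]) (simp add: assms)
  then show ?thesis unfolding cf_lim_def by (simp only:)
qed

text \<open>The squared mean is negligible because \<open>m\<close> is bounded by \<open>D\<close>,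
  so that \<open>m\<^sup>2 \<le> D * \<bar>m\<bar>\<close>.\<close>

lemma variance_L1_conv:
  fixes A m :: "nat \<Rightarrow> 'w \<Rightarrow> real"
  assumes prob: "\<And>N. prob_space (M N)"
    and A: "\<And>N. integrable (M N) (A N)" and m: "\<And>N. m N \<in> borel_measurable (M N)"
    and m_bd: "\<And>N w. w \<in> space (M N) \<Longrightarrow> \<bar>m N w\<bar> \<le> D"
    and lA: "(\<lambda>N. \<integral>w. \<bar>A N w - \<sigma>\<bar> \<partial>M N) \<longlonglongrightarrow> 0" and lm: "(\<lambda>N. \<integral>w. \<bar>m N w - 0\<bar> \<partial>M N) \<longlonglongrightarrow> 0"
  shows "(\<lambda>N. \<integral>w. \<bar>A N w - (m N w)\<^sup>2 - \<sigma>\<bar> \<partial>M N) \<longlonglongrightarrow> 0"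
proof (rule Lim_null_comparison)
  show "(\<lambda>N. (\<integral>w. \<bar>A N w - \<sigma>\<bar> \<partial>M N) + D * (\<integral>w. \<bar>m N w - 0\<bar> \<partial>M N)) \<longlonglongrightarrow> 0"
    by (intro tendsto_add_zero lA tendsto_mult_right_zero lm)
  show "\<forall>\<^sub>F N in sequentially. norm (\<integral>w. \<bar>A N w - (m N w)\<^sup>2 - \<sigma>\<bar> \<partial>M N)
      \<le> (\<integral>w. \<bar>A N w - \<sigma>\<bar> \<partial>M N) + D * (\<integral>w. \<bar>m N w - 0\<bar> \<partial>M N)"
  proof (intro always_eventually allI)
    fix N
    interpret prob_space "M N" by (rule prob)
    have im: "integrable (M N) (m N)"
      using m_bd by (intro integrable_const_bound[where B=D] m) auto
    have i1: "integrable (M N) (\<lambda>w. \<bar>A N w - \<sigma>\<bar>)" "integrable (M N) (\<lambda>w. \<bar>m N w - 0\<bar>)"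
      using A[of N] im by auto
    have le: "\<bar>A N w - (m N w)\<^sup>2 - \<sigma>\<bar> \<le> \<bar>A N w - \<sigma>\<bar> + D * \<bar>m N w - 0\<bar>" if w: "w \<in> space (M N)" for w
    proof -
      have "(m N w)\<^sup>2 = \<bar>m N w\<bar> * \<bar>m N w\<bar>" by (simp add: power2_eq_square)
      also have "\<dots> \<le> D * \<bar>m N w\<bar>" using m_bd[OF w] by (rule mult_right_mono) simp
      finally show ?thesis using zero_le_power2[of "m N w"] unfolding diff_0_right by linarith
    qed
    have i2: "integrable (M N) (\<lambda>w. \<bar>A N w - \<sigma>\<bar> + D * \<bar>m N w - 0\<bar>)"
      using i1 by auto
    have "norm (\<integral>w. \<bar>A N w - (m N w)\<^sup>2 - \<sigma>\<bar> \<partial>M N) = (\<integral>w. \<bar>A N w - (m N w)\<^sup>2 - \<sigma>\<bar> \<partial>M N)"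
      unfolding real_norm_def by (intro abs_of_nonneg Bochner_Integration.integral_nonneg) auto
    also have "\<dots> \<le> (\<integral>w. \<bar>A N w - \<sigma>\<bar> + D * \<bar>m N w - 0\<bar> \<partial>M N)"
    proof (rule integral_mono[OF _ i2 le])
      show "integrable (M N) (\<lambda>w. \<bar>A N w - (m N w)\<^sup>2 - \<sigma>\<bar>)"
      proof (rule Bochner_Integration.integrable_bound[OF i2])
        show "AE w in M N. norm \<bar>A N w - (m N w)\<^sup>2 - \<sigma>\<bar> \<le> norm (\<bar>A N w - \<sigma>\<bar> + D * \<bar>m N w - 0\<bar>)"
        proof (rule AE_I2)
          fix w assume "w \<in> space (M N)"
          from le[OF this] show "norm \<bar>A N w - (m N w)\<^sup>2 - \<sigma>\<bar> \<le> norm (\<bar>A N w - \<sigma>\<bar> + D * \<bar>m N w - 0\<bar>)"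
            unfolding real_norm_def abs_abs by linarith
        qed
      qed (use borel_measurable_integrable[OF A[of N]] m[of N] in measurable)
    qed
    also have "\<dots> = (\<integral>w. \<bar>A N w - \<sigma>\<bar> \<partial>M N) + D * (\<integral>w. \<bar>m N w - 0\<bar> \<partial>M N)"
      using i1 by simp
    finally show "norm (\<integral>w. \<bar>A N w - (m N w)\<^sup>2 - \<sigma>\<bar> \<partial>M N)
      \<le> (\<integral>w. \<bar>A N w - \<sigma>\<bar> \<partial>M N) + D * (\<integral>w. \<bar>m N w - 0\<bar> \<partial>M N)" .
  qed
qed

lemma rand_conv_mult:
  assumes prob: "\<And>N. prob_space (Q N)" and rc: "rand_conv L Q C G f"
    and u: "u \<in> borel_measurable L" "\<And>x. x \<in> space L \<Longrightarrow> \<bar>u x\<bar> \<le> D"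
  and D: "0 \<le> D"
  shows "rand_conv L Q (D * C) (\<lambda>N v x. u x * G N v x) (\<lambda>x. u x * f x)"
  unfolding rand_conv_def
proof (intro conjI allI ballI)
  have C: "0 \<le> C" using rc by (simp add: rand_conv_def)
  then show "0 \<le> D * C" using D by simp
  have G_bd: "\<bar>G N v x\<bar> \<le> C" if "v \<in> space (Q N)" "x \<in> space L" for N v x
    using rc that by (auto simp: rand_conv_def)
  have f_bd: "\<bar>f x\<bar> \<le> C" if "x \<in> space L" for x
    using rc that by (auto simp: rand_conv_def)
  show "(\<lambda>(v, x). u x * G N v x) \<in> borel_measurable (Q N \<Otimes>\<^sub>M L)" for N
  proof -
    have "(\<lambda>(v, x). G N v x) \<in> borel_measurable (Q N \<Otimes>\<^sub>M L)" using rc by (auto simp: rand_conv_def)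
    from borel_measurable_times[OF measurable_compose[OF measurable_snd u(1)] this] show ?thesis by (simp add: case_prod_unfold)
  qed
  show "(\<lambda>x. u x * f x) \<in> borel_measurable L"
    using rc u(1) by (intro borel_measurable_times) (auto simp: rand_conv_def)
  show "\<bar>u x * G N v x\<bar> \<le> D * C" if "v \<in> space (Q N)" "x \<in> space L" for N v x
    unfolding abs_mult using u(2)[OF that(2)] G_bd[OF that] D by (intro mult_mono) auto
  show "\<bar>u x * f x\<bar> \<le> D * C" if "x \<in> space L" for x
    unfolding abs_mult using u(2)[OF that] f_bd[OF that] D by (intro mult_mono) auto
  fix x assume x: "x \<in> space L"
  have "(\<integral>v. \<bar>u x * G N v x - u x * f x\<bar> \<partial>Q N) = \<bar>u x\<bar> * (\<integral>v. \<bar>G N v x - f x\<bar> \<partial>Q N)" for N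
    unfolding right_diff_distrib[symmetric] abs_mult by simp
  moreover have "(\<lambda>N. \<integral>v. \<bar>G N v x - f x\<bar> \<partial>Q N) \<longlonglongrightarrow> 0"
    using rc x by (auto simp: rand_conv_def)
  ultimately show "(\<lambda>N. \<integral>v. \<bar>u x * G N v x - u x * f x\<bar> \<partial>Q N) \<longlonglongrightarrow> 0"
    by (simp add: tendsto_mult_right_zero)
qed

lemma rand_conv_integral_meas:
  assumes rc: "rand_conv L Q C G f" and fin: "finite_measure K" and sets: "sets K = sets L"
  shows "(\<lambda>v. \<integral>x. G N v x \<partial>K) \<in> borel_measurable (Q N)"
proof -
  interpret K: finite_measure K by (rule fin)
  have "(\<lambda>(v, x). G N v x) \<in> borel_measurable (Q N \<Otimes>\<^sub>M K)"
    unfolding measurable_cong_sets[OF sets_pair_measure_cong[OF refl sets] refl] using rc by (auto simp: rand_conv_def)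
  then show ?thesis by (rule K.borel_measurable_lebesgue_integral)
qed

lemma rand_conv_integral_bd:
  assumes rc: "rand_conv L Q C G f" and pr: "prob_space K" and sets: "sets K = sets L" and v: "v \<in> space (Q N)"
  shows "\<bar>\<integral>x. G N v x \<partial>K\<bar> \<le> C"
proof -
  interpret K: prob_space K by (rule pr)
  have sp: "space K = space L" using sets by (rule sets_eq_imp_space_eq)
  have bd: "\<bar>G N v x\<bar> \<le> C" if "x \<in> space L" for x
    using rc v that by (auto simp: rand_conv_def)
  have i: "integrable K (G N v)"
  proof (rule K.integrable_const_bound[where B=C])
    show "AE x in K. norm (G N v x) \<le> C" using bd by (intro AE_I2) (simp add: sp)
    show "G N v \<in> borel_measurable K"
      using rand_conv_meas_x[OF rc v] sets by (simp cong: measurable_cong_sets)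
  qed
  have "\<bar>\<integral>x. G N v x \<partial>K\<bar> \<le> (\<integral>x. \<bar>G N v x\<bar> \<partial>K)" by (rule integral_abs_bound)
  also have "\<dots> \<le> (\<integral>x. C \<partial>K)"
    by (rule integral_mono[OF integrable_abs[OF i] K.integrable_const]) (simp add: bd sp)
  finally show ?thesis by (simp add: K.prob_space)
qed

text \<open>Importance sampling: \<open>c\<close> times \<open>\<phi>\<close> acts on bounded
  functions as the measure with density \<open>w0\<close> relative to \<open>\<rho>\<close>. This is
  the base case of the chain, without a past.\<close>

locale filter_init =
  fixes L :: "'a measure" and P :: "nat \<Rightarrow> 'w measure" and x :: "nat \<Rightarrow> nat \<Rightarrow> 'w \<Rightarrow> 'a"
    and W :: "nat \<Rightarrow> nat \<Rightarrow> 'w \<Rightarrow> real" and \<rho> :: "'a measure" and w0 :: "'a \<Rightarrow> real" and Cw :: real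
    and \<phi> :: "'a measure" and c :: real
  assumes prob: "\<And>N. prob_space (P N)"
    and x_indep: "\<And>N. prob_space.indep_vars (P N) (\<lambda>_. L) (x N) {1..Suc N}"
    and x_law: "\<And>N l. l \<in> {1..Suc N} \<Longrightarrow> distr (P N) L (x N l) = \<rho>"
    and \<rho>_prob: "prob_space \<rho>" and \<rho>_sets: "sets \<rho> = sets L"
    and w0_meas: "w0 \<in> borel_measurable L"
    and w0_bd: "\<And>z. z \<in> space L \<Longrightarrow> \<bar>w0 z\<bar> \<le> Cw"
    and Cw: "0 \<le> Cw"
    and W_eq: "\<And>N l w. l \<in> {1..Suc N} \<Longrightarrow> w \<in> space (P N) \<Longrightarrow> W N l w = w0 (x N l w)"
    and c_pos: "0 < c"
    and phi: "\<And>f C. f \<in> borel_measurable L \<Longrightarrow> (\<And>z. z \<in> space L \<Longrightarrow> \<bar>f z\<bar> \<le> C) \<Longrightarrow>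
      c * (\<integral>z. f z \<partial>\<phi>) = (\<integral>z. w0 z * f z \<partial>\<rho>)"
begin

sublocale \<rho>: prob_space \<rho> by (rule \<rho>_prob)

lemma \<rho>_space: "space \<rho> = space L"
  using \<rho>_sets by (rule sets_eq_imp_space_eq)

lemma x_meas: "l \<in> {1..Suc N} \<Longrightarrow> x N l \<in> measurable (P N) L"
  using x_indep[of N] prob[of N] by (auto simp: prob_space.indep_vars_def)

text \<open>An i.i.d. sample is conditionally i.i.d. given the trivial sigma-field, with density 1
  relative to its own law. The only events of the past are the empty set and the whole
  space.\<close>

lemma cond_sampling_init:
  "cond_sampling (P N) (sigma (space (P N)) {}) \<rho> (Suc N) (x N) (\<lambda>_ _. 1)"
proof -
  interpret prob_space "P N" by (rule prob)
  show ?thesis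
  proof
    show "subalgebra (P N) (sigma (space (P N)) {})"
      by (auto simp: subalgebra_def sigma_sets_empty_eq)
    show "x N l \<in> measurable (P N) \<rho>" if "l \<in> {1..Suc N}" for l
      using x_meas[OF that] \<rho>_sets by (simp cong: measurable_cong_sets)
    show "(\<integral>\<^sup>+z. ennreal 1 \<partial>\<rho>) \<le> 1" "AE w in P N. (\<integral>\<^sup>+z. ennreal 1 \<partial>\<rho>) = 1"
      by (simp_all add: \<rho>.emeasure_space_1)
    fix A B assume A: "A \<in> sets (sigma (space (P N)) {})" and B: "\<And>l. l \<in> {1..Suc N} \<Longrightarrow> B l \<in> sets \<rho>"
    have BL: "B l \<in> sets L" if "l \<in> {1..Suc N}" for l using B[OF that] by (simp add: \<rho>_sets)
    from A have "A = {} \<or> A = space (P N)"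
      by (simp add: sigma_sets_empty_eq)
    then show "(\<integral>\<^sup>+w. indicator A w * (\<Prod>l=1..Suc N. indicator (B l) (x N l w)) \<partial>P N) =
      (\<integral>\<^sup>+w. indicator A w * (\<Prod>l=1..Suc N. \<integral>\<^sup>+z. ennreal 1 * indicator (B l) z \<partial>\<rho>) \<partial>P N)"
    proof
      assume "A = {}" then show ?thesis by simp
    next
      assume A: "A = space (P N)"
      have ind: "indep_vars (\<lambda>_. borel) (\<lambda>l w. indicator (B l) (x N l w) :: ennreal) {1..Suc N}"
        by (rule indep_vars_compose2[OF x_indep[of N]]) (use BL in \<open>rule borel_measurable_indicator\<close>)
      have "(\<integral>\<^sup>+w. indicator A w * (\<Prod>l=1..Suc N. indicator (B l) (x N l w)) \<partial>P N)
          = (\<integral>\<^sup>+w. (\<Prod>l=1..Suc N. indicator (B l) (x N l w)) \<partial>P N)"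
        by (rule nn_integral_cong) (simp add: A)
      also have "\<dots> = (\<Prod>l=1..Suc N. \<integral>\<^sup>+w. indicator (B l) (x N l w) \<partial>P N)"
        by (rule indep_vars_nn_integral[OF _ ind]) auto
      also have "\<dots> = (\<Prod>l=1..Suc N. \<integral>\<^sup>+z. ennreal 1 * indicator (B l) z \<partial>\<rho>)"
      proof (rule prod.cong[OF refl])
        fix l assume l: "l \<in> {1..Suc N}"
        have "(\<integral>\<^sup>+w. indicator (B l) (x N l w) \<partial>P N) = (\<integral>\<^sup>+z. indicator (B l) z \<partial>distr (P N) L (x N l))"
          by (rule nn_integral_distr[OF x_meas[OF l] borel_measurable_indicator, symmetric]) (simp add: BL[OF l])
        then show "(\<integral>\<^sup>+w. indicator (B l) (x N l w) \<partial>P N) = (\<integral>\<^sup>+z. ennreal 1 * indicator (B l) z \<partial>\<rho>)"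
          by (simp only: x_law[OF l] ennreal_1 mult_1_left)
      qed
      also have "\<dots> = (\<integral>\<^sup>+w. indicator A w * (\<Prod>l=1..Suc N. \<integral>\<^sup>+z. ennreal 1 * indicator (B l) z \<partial>\<rho>) \<partial>P N)"
      proof -
        have "(\<integral>\<^sup>+w. indicator A w * (\<Prod>l=1..Suc N. \<integral>\<^sup>+z. ennreal 1 * indicator (B l) z \<partial>\<rho>) \<partial>P N)
            = (\<integral>\<^sup>+w. (\<Prod>l=1..Suc N. \<integral>\<^sup>+z. ennreal 1 * indicator (B l) z \<partial>\<rho>) \<partial>P N)"
          by (rule nn_integral_cong) (simp add: A)
        then show ?thesis by (simp only: nn_integral_const emeasure_space_1 mult_1_right)
      qed
      finally show ?thesis .
    qed
  qed (auto intro: \<rho>.sigma_finite_measure_axioms)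
qed

context
  fixes Q :: "nat \<Rightarrow> 'w measure" and C :: real and G :: "nat \<Rightarrow> 'w \<Rightarrow> 'a \<Rightarrow> real" and f :: "'a \<Rightarrow> real"
  assumes Q: "\<And>N. prob_space (Q N)" and rc: "rand_conv L Q C G f"
begin

lemma rc_w0: "rand_conv L Q (Cw * C) (\<lambda>N v z. w0 z * G N v z) (\<lambda>z. w0 z * f z)"
  by (rule rand_conv_mult[OF Q rc w0_meas w0_bd Cw])

lemma cs_rand: "cond_sampling_rand (P N) (sigma (space (P N)) {}) \<rho> (Suc N) (x N) (\<lambda>_ _. 1) (Q N)
    (\<lambda>v w z. w0 z * G N v z) (Cw * C)"
proof (intro cond_sampling_rand.intro cond_sampling_init Q cond_sampling_rand_axioms.intro)
  have m: "(\<lambda>(v, z). w0 z * G N v z) \<in> borel_measurable (Q N \<Otimes>\<^sub>M \<rho>)"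
    unfolding measurable_cong_sets[OF sets_pair_measure_cong[OF refl \<rho>_sets] refl] using rc_w0 by (auto simp: rand_conv_def)
  have "(\<lambda>s. (fst s, snd (snd s))) \<in> measurable (Q N \<Otimes>\<^sub>M (sigma (space (P N)) {} \<Otimes>\<^sub>M \<rho>)) (Q N \<Otimes>\<^sub>M \<rho>)"
    by measurable
  from measurable_compose[OF this m]
  show "(\<lambda>(v, w, z). w0 z * G N v z) \<in> borel_measurable (Q N \<Otimes>\<^sub>M (sigma (space (P N)) {} \<Otimes>\<^sub>M \<rho>))"
    by (simp only: case_prod_unfold fst_conv snd_conv)
  show "\<bar>w0 z * G N v z\<bar> \<le> Cw * C" if "v \<in> space (Q N)" "w \<in> space (P N)" "z \<in> space \<rho>" for v w z
    using rc_w0 that by (auto simp: rand_conv_def \<rho>_space)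
  show "0 \<le> Cw * C" using rc_w0 by (simp add: rand_conv_def)
qed

lemma cmean_init: "cond_sampling.cmean \<rho> (\<lambda>_ _. 1) (\<lambda>w z. w0 z * G N v z) (w :: 'w) = (\<integral>z. w0 z * G N v z \<partial>\<rho>)"
  by (simp add: cond_sampling.cmean_def[OF cond_sampling_init])

lemma smean_init: "w \<in> space (P N) \<Longrightarrow>
    cond_sampling.smean (Suc N) (x N) (\<lambda>w z. w0 z * G N v z) w = emp (Suc N) (W N) (x N) (G N v) w"
  unfolding cond_sampling.smean_def[OF cond_sampling_init] emp_def
  by (intro arg_cong2[where f="(/)"] sum.cong refl) (simp add: W_eq)

lemma mean_conv: "(\<lambda>N. \<integral>v. \<bar>(\<integral>z. w0 z * G N v z \<partial>\<rho>) - (\<integral>z. w0 z * f z \<partial>\<rho>)\<bar> \<partial>Q N) \<longlonglongrightarrow> 0"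
  by (rule rand_conv_finite_measure[OF Q rc_w0 \<rho>.finite_measure_axioms \<rho>_sets])

lemma phi_f: "c * (\<integral>z. f z \<partial>\<phi>) = (\<integral>z. w0 z * f z \<partial>\<rho>)"
  using rc by (intro phi[where C=C]) (auto simp: rand_conv_def)

lemma phi_G: "v \<in> space (Q N) \<Longrightarrow> c * (\<integral>z. G N v z \<partial>\<phi>) = (\<integral>z. w0 z * G N v z \<partial>\<rho>)"
  using rc rand_conv_meas_x[OF rc] by (intro phi[where C=C]) (auto simp: rand_conv_def)

lemma lln_init_aux:
  "(\<lambda>N. \<integral>(w, v). \<bar>emp (Suc N) (W N) (x N) (G N v) w - c * (\<integral>z. f z \<partial>\<phi>)\<bar> \<partial>(P N \<Otimes>\<^sub>M Q N)) \<longlonglongrightarrow> 0"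
proof -
  have "(\<lambda>N. \<integral>(w, v). \<bar>cond_sampling.smean (Suc N) (x N) (\<lambda>w z. w0 z * G N v z) w - c * (\<integral>z. f z \<partial>\<phi>)\<bar> \<partial>(P N \<Otimes>\<^sub>M Q N)) \<longlonglongrightarrow> 0"
  proof (rule smean_lln_seq[where y="\<lambda>N v w z. w0 z * G N v z", OF cs_rand])
    have "(\<integral>(w, v). \<bar>(\<integral>z. w0 z * G N v z \<partial>\<rho>) - c * (\<integral>z. f z \<partial>\<phi>)\<bar> \<partial>(P N \<Otimes>\<^sub>M Q N))
       = (\<integral>v. \<bar>(\<integral>z. w0 z * G N v z \<partial>\<rho>) - (\<integral>z. w0 z * f z \<partial>\<rho>)\<bar> \<partial>Q N)" for N
      unfolding phi_f
    proof (rule pair_prob_integral_snd[OF prob Q])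
      show "(\<lambda>v. \<bar>(\<integral>z. w0 z * G N v z \<partial>\<rho>) - (\<integral>z. w0 z * f z \<partial>\<rho>)\<bar>) \<in> borel_measurable (Q N)"
        using rand_conv_integral_meas[OF rc_w0 \<rho>.finite_measure_axioms \<rho>_sets] by measurable
      show "norm \<bar>(\<integral>z. w0 z * G N v z \<partial>\<rho>) - (\<integral>z. w0 z * f z \<partial>\<rho>)\<bar> \<le> Cw * C + \<bar>\<integral>z. w0 z * f z \<partial>\<rho>\<bar>"
        if "v \<in> space (Q N)" for v
        using rand_conv_integral_bd[OF rc_w0 \<rho>_prob \<rho>_sets that] unfolding real_norm_def by linarith
    qed
    then show "(\<lambda>N. \<integral>(w, v). \<bar>cond_sampling.cmean \<rho> (\<lambda>_ _. 1) (\<lambda>w z. w0 z * G N v z) w - c * (\<integral>z. f z \<partial>\<phi>)\<bar> \<partial>(P N \<Otimes>\<^sub>M Q N)) \<longlonglongrightarrow> 0"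
      unfolding cmean_init using mean_conv by simp
  qed
  moreover have "(\<integral>(w, v). \<bar>cond_sampling.smean (Suc N) (x N) (\<lambda>w z. w0 z * G N v z) w - c * (\<integral>z. f z \<partial>\<phi>)\<bar> \<partial>(P N \<Otimes>\<^sub>M Q N))
     = (\<integral>(w, v). \<bar>emp (Suc N) (W N) (x N) (G N v) w - c * (\<integral>z. f z \<partial>\<phi>)\<bar> \<partial>(P N \<Otimes>\<^sub>M Q N))" for N
    by (rule Bochner_Integration.integral_cong[OF refl]) (auto simp: smean_init space_pair_measure)
  ultimately show ?thesis by simp
qed

text \<open>Here the conditional mean depends on \<open>v\<close> alone and equals \<open>c\<close>
  times the \<open>\<phi>\<close>-integral of \<open>G N v\<close>, so after division by
  \<open>c\<close> its fluctuation is exactly the hypothesis \<open>lim\<close>.\<close>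

lemma clt_init_aux:
  assumes f0: "(\<integral>z. f z \<partial>\<phi>) = 0"
    and lim: "cf_lim Q (\<lambda>N v. sqrt (Suc N) * (\<integral>z. G N v z \<partial>\<phi>)) V"
  shows "cf_lim (\<lambda>N. P N \<Otimes>\<^sub>M Q N)
         (\<lambda>N (w, v). sqrt (Suc N) * emp (Suc N) (W N) (x N) (G N v) w * (1 / c))
         ((\<integral>z. (w0 z)\<^sup>2 * (f z)\<^sup>2 \<partial>\<rho>) / c\<^sup>2 + V)"
proof -
  let ?\<sigma> = "\<integral>z. (w0 z)\<^sup>2 * (f z)\<^sup>2 \<partial>\<rho>"
  note rc2 = rand_conv_square[OF Q rc_w0]
  have f0': "(\<integral>z. w0 z * f z \<partial>\<rho>) = 0" using phi_f f0 by simp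
  have cvar_eq: "cond_sampling.cvar \<rho> (\<lambda>_ _. 1) (\<lambda>w z. w0 z * G N v z) w
      = (\<integral>z. (w0 z * G N v z)\<^sup>2 \<partial>\<rho>) - (\<integral>z. w0 z * G N v z \<partial>\<rho>)\<^sup>2" for N v and w :: 'w
    unfolding cond_sampling.cvar_def[OF cond_sampling_init] cmean_init
    by (simp add: cond_sampling.cmean_def[OF cond_sampling_init])
  have m1: "(\<lambda>v. \<integral>z. w0 z * G N v z \<partial>\<rho>) \<in> borel_measurable (Q N)" for N
    by (rule rand_conv_integral_meas[OF rc_w0 \<rho>.finite_measure_axioms \<rho>_sets])
  have m2: "(\<lambda>v. \<integral>z. (w0 z * G N v z)\<^sup>2 \<partial>\<rho>) \<in> borel_measurable (Q N)" for N
    by (rule rand_conv_integral_meas[OF rc2 \<rho>.finite_measure_axioms \<rho>_sets])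
  have b1: "\<bar>\<integral>z. w0 z * G N v z \<partial>\<rho>\<bar> \<le> Cw * C" if "v \<in> space (Q N)" for N v
    by (rule rand_conv_integral_bd[OF rc_w0 \<rho>_prob \<rho>_sets that])
  have b2: "\<bar>\<integral>z. (w0 z * G N v z)\<^sup>2 \<partial>\<rho>\<bar> \<le> (Cw * C)\<^sup>2" if "v \<in> space (Q N)" for N v
    by (rule rand_conv_integral_bd[OF rc2 \<rho>_prob \<rho>_sets that])
  have "cf_lim (\<lambda>N. P N \<Otimes>\<^sub>M Q N)
      (\<lambda>N (w, v). sqrt (Suc N) * cond_sampling.smean (Suc N) (x N) (\<lambda>w z. w0 z * G N v z) w * (1 / c)) ((1 / c)\<^sup>2 * ?\<sigma> + V)"
  proof (rule smean_clt_seq[where y="\<lambda>N v w z. w0 z * G N v z", OF cs_rand])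
    show "0 \<le> ?\<sigma>" by (intro Bochner_Integration.integral_nonneg) simp
    have "(\<lambda>N. \<integral>v. \<bar>(\<integral>z. (w0 z * G N v z)\<^sup>2 \<partial>\<rho>) - (\<integral>z. w0 z * G N v z \<partial>\<rho>)\<^sup>2 - ?\<sigma>\<bar> \<partial>Q N) \<longlonglongrightarrow> 0"
    proof (rule variance_L1_conv[OF Q _ m1 b1])
      show "integrable (Q N) (\<lambda>v. \<integral>z. (w0 z * G N v z)\<^sup>2 \<partial>\<rho>)" for N
      proof -
        interpret prob_space "Q N" by (rule Q)
        show ?thesis using b2 by (intro integrable_const_bound[where B="(Cw * C)\<^sup>2"] m2) (auto intro!: AE_I2)
      qed
      show "(\<lambda>N. \<integral>v. \<bar>(\<integral>z. (w0 z * G N v z)\<^sup>2 \<partial>\<rho>) - ?\<sigma>\<bar> \<partial>Q N) \<longlonglongrightarrow> 0"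
        using rand_conv_finite_measure[OF Q rc2 \<rho>.finite_measure_axioms \<rho>_sets] by (simp add: power_mult_distrib)
      show "(\<lambda>N. \<integral>v. \<bar>(\<integral>z. w0 z * G N v z \<partial>\<rho>) - 0\<bar> \<partial>Q N) \<longlonglongrightarrow> 0"
        using mean_conv unfolding f0' .
    qed
    moreover have "(\<integral>(w, v). \<bar>(\<integral>z. (w0 z * G N v z)\<^sup>2 \<partial>\<rho>) - (\<integral>z. w0 z * G N v z \<partial>\<rho>)\<^sup>2 - ?\<sigma>\<bar> \<partial>(P N \<Otimes>\<^sub>M Q N))
        = (\<integral>v. \<bar>(\<integral>z. (w0 z * G N v z)\<^sup>2 \<partial>\<rho>) - (\<integral>z. w0 z * G N v z \<partial>\<rho>)\<^sup>2 - ?\<sigma>\<bar> \<partial>Q N)" for N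
    proof (rule pair_prob_integral_snd[OF prob Q])
      show "(\<lambda>v. \<bar>(\<integral>z. (w0 z * G N v z)\<^sup>2 \<partial>\<rho>) - (\<integral>z. w0 z * G N v z \<partial>\<rho>)\<^sup>2 - ?\<sigma>\<bar>) \<in> borel_measurable (Q N)"
        using m1 m2 by measurable
      show "norm \<bar>(\<integral>z. (w0 z * G N v z)\<^sup>2 \<partial>\<rho>) - (\<integral>z. w0 z * G N v z \<partial>\<rho>)\<^sup>2 - ?\<sigma>\<bar> \<le> 2 * (Cw * C)\<^sup>2 + \<bar>?\<sigma>\<bar>"
        if "v \<in> space (Q N)" for v
        using b2[OF that] abs_le_imp_square_le[OF b1[OF that]] zero_le_power2[of "\<integral>z. w0 z * G N v z \<partial>\<rho>"]
        unfolding real_norm_def by linarith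
    qed
    ultimately show "(\<lambda>N. \<integral>(w, v). \<bar>cond_sampling.cvar \<rho> (\<lambda>_ _. 1) (\<lambda>w z. w0 z * G N v z) w - ?\<sigma>\<bar> \<partial>(P N \<Otimes>\<^sub>M Q N)) \<longlonglongrightarrow> 0"
      unfolding cvar_eq by simp
    have "cf_lim Q (\<lambda>N v. sqrt (Suc N) * (\<integral>z. w0 z * G N v z \<partial>\<rho>) * (1 / c)) V"
      using lim
    proof (rule cf_lim_cong[THEN iffD1, rotated])
      fix N v assume v: "v \<in> space (Q N)"
      show "sqrt (Suc N) * (\<integral>z. G N v z \<partial>\<phi>) = sqrt (Suc N) * (\<integral>z. w0 z * G N v z \<partial>\<rho>) * (1 / c)"
        unfolding phi_G[OF v, symmetric] using c_pos by simp
    qed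
    then show "cf_lim (\<lambda>N. P N \<Otimes>\<^sub>M Q N)
        (\<lambda>N (w, v). sqrt (Suc N) * cond_sampling.cmean \<rho> (\<lambda>_ _. 1) (\<lambda>w z. w0 z * G N v z) w * (1 / c)) V"
      unfolding cmean_init
      by (rule cf_lim_pair_snd[OF prob Q, THEN iffD2, rotated]) (use m1 in measurable)
  qed
  then have "cf_lim (\<lambda>N. P N \<Otimes>\<^sub>M Q N)
         (\<lambda>N (w, v). sqrt (Suc N) * emp (Suc N) (W N) (x N) (G N v) w * (1 / c)) ((1 / c)\<^sup>2 * ?\<sigma> + V)"
    by (rule cf_lim_cong[THEN iffD1, rotated]) (auto simp: smean_init space_pair_measure)
  then show ?thesis by (simp add: power_divide)
qed

end

theorem lln_init: "sample_lln L P W x \<phi> c"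
  unfolding sample_lln_def using lln_init_aux by blast

theorem clt_init: "sample_clt L P W x \<phi> c (\<lambda>f. (\<integral>z. (w0 z)\<^sup>2 * (f z)\<^sup>2 \<partial>\<rho>) / c\<^sup>2)"
  unfolding sample_clt_def using clt_init_aux by blast

end

section \<open>One step of a particle filter\<close>

lemma nn_integral_count_space_pair:
  assumes I: "finite I" and L: "sigma_finite_measure L"
    and f: "f \<in> borel_measurable (count_space I \<Otimes>\<^sub>M L)"
  shows "(\<integral>\<^sup>+z. f z \<partial>(count_space I \<Otimes>\<^sub>M L)) = (\<Sum>i\<in>I. \<integral>\<^sup>+x. f (i, x) \<partial>L)"
proof -
  interpret L: sigma_finite_measure L by fact
  have "(\<integral>\<^sup>+z. f z \<partial>(count_space I \<Otimes>\<^sub>M L)) = (\<integral>\<^sup>+i. \<integral>\<^sup>+x. f (i, x) \<partial>L \<partial>count_space I)"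
    by (rule L.nn_integral_fst[OF f, symmetric])
  then show ?thesis by (simp only: nn_integral_count_space_finite[OF I])
qed

lemma integral_count_space_pair:
  fixes f :: "'i \<times> 'a \<Rightarrow> real"
  assumes I: "finite I" and L: "sigma_finite_measure L"
    and f: "integrable (count_space I \<Otimes>\<^sub>M L) f"
  shows "(\<integral>z. f z \<partial>(count_space I \<Otimes>\<^sub>M L)) = (\<Sum>i\<in>I. \<integral>x. f (i, x) \<partial>L)"
proof -
  interpret L: sigma_finite_measure L by fact
  interpret C: sigma_finite_measure "count_space I"
    using I by (intro sigma_finite_measure_count_space_finite)
  interpret pair_sigma_finite "count_space I" L ..
  have "(\<integral>z. f z \<partial>(count_space I \<Otimes>\<^sub>M L)) = (\<integral>i. \<integral>x. f (i, x) \<partial>L \<partial>count_space I)"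
    by (rule integral_fst'[OF f, symmetric])
  then show ?thesis by (simp only: lebesgue_integral_count_space_finite[OF I])
qed

text \<open>Used for positions and weights of parents, whose label is itself random.\<close>

lemma measurable_count_space_family:
  assumes I: "finite I" and f: "\<And>i. i \<in> I \<Longrightarrow> (\<lambda>x. f i x) \<in> measurable M N"
    and g: "g \<in> measurable M (count_space I)"
  shows "(\<lambda>x. f (g x) x) \<in> measurable M N"
  by (rule measurable_compose_countable'[OF f g]) (auto intro: countable_finite[OF I])

text \<open>One step in abstract form: \<open>a\<close> is the adjustment multiplier,
  \<open>p\<close> the proposal density, \<open>om\<close> the new importance weight, and
  \<open>\<kappa> = om * a * p\<close> the unnormalised kernel that carries \<open>\<phi>\<close> to
  a multiple of \<open>\<phi>'\<close>. The forward and backward filters differ only in these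
  data.\<close>

locale filter_step =
  fixes L :: "'a measure" and \<phi> \<phi>' :: "'a measure"
    and \<kappa> om p :: "'a \<Rightarrow> 'a \<Rightarrow> real" and a :: "'a \<Rightarrow> real" and Com Ca Cw :: real
    and P F :: "nat \<Rightarrow> 'w measure" and I :: "nat \<Rightarrow> nat \<Rightarrow> 'w \<Rightarrow> nat"
    and xi xi' :: "nat \<Rightarrow> nat \<Rightarrow> 'w \<Rightarrow> 'a" and W W' :: "nat \<Rightarrow> nat \<Rightarrow> 'w \<Rightarrow> real"
  assumes sf: "sigma_finite_measure L"
    and phi_prob: "prob_space \<phi>" and phi_sets: "sets \<phi> = sets L"
    and phi': "\<And>f C. f \<in> borel_measurable L \<Longrightarrow> (\<And>x. x \<in> space L \<Longrightarrow> \<bar>f x\<bar> \<le> C) \<Longrightarrow>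
      (\<integral>x. f x \<partial>\<phi>') * (\<integral>x. (\<integral>x'. \<kappa> x x' \<partial>L) \<partial>\<phi>) = (\<integral>x. (\<integral>x'. \<kappa> x x' * f x' \<partial>L) \<partial>\<phi>)"
    and phi_pos: "0 < (\<integral>x. (\<integral>x'. \<kappa> x x' \<partial>L) \<partial>\<phi>)"
    and a_meas: "a \<in> borel_measurable L"
    and a_nn: "\<And>x. x \<in> space L \<Longrightarrow> 0 \<le> a x" and a_le: "\<And>x. x \<in> space L \<Longrightarrow> a x \<le> Ca"
    and om_meas: "(\<lambda>(x, x'). om x x') \<in> borel_measurable (L \<Otimes>\<^sub>M L)"
    and om_nn: "\<And>x x'. x \<in> space L \<Longrightarrow> x' \<in> space L \<Longrightarrow> 0 \<le> om x x'"
    and om_le: "\<And>x x'. x \<in> space L \<Longrightarrow> x' \<in> space L \<Longrightarrow> om x x' \<le> Com"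
    and Com: "0 \<le> Com" and Ca: "0 \<le> Ca" and Cw: "0 \<le> Cw"
    and p_dens: "markov_density L p"
    and \<kappa>_meas: "(\<lambda>(x, x'). \<kappa> x x') \<in> borel_measurable (L \<Otimes>\<^sub>M L)"
    and \<kappa>_eq: "\<And>x x'. x \<in> space L \<Longrightarrow> x' \<in> space L \<Longrightarrow> \<kappa> x x' = om x x' * (a x * p x x')"
    and prob: "\<And>N. prob_space (P N)"
    and subalg: "\<And>N. subalgebra (P N) (F N)"
    and xi_meas: "\<And>N l. l \<in> {1..Suc N} \<Longrightarrow> xi N l \<in> measurable (F N) L"
    and W_meas: "\<And>N l. l \<in> {1..Suc N} \<Longrightarrow> W N l \<in> borel_measurable (F N)"
    and W_nn: "\<And>N l w. l \<in> {1..Suc N} \<Longrightarrow> w \<in> space (P N) \<Longrightarrow> 0 \<le> W N l w"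
    and W_le: "\<And>N l w. l \<in> {1..Suc N} \<Longrightarrow> w \<in> space (P N) \<Longrightarrow> W N l w \<le> Cw"
    and ciid: "\<And>N. cond_iid (P N) (F N) (Suc N) (count_space {1..Suc N} \<Otimes>\<^sub>M L)
      (\<lambda>l w. (I N l w, xi' N l w))
      (\<lambda>w. normalized_density (count_space {1..Suc N} \<Otimes>\<^sub>M L)
         (\<lambda>(i, x). ennreal (W N i w * a (xi N i w) * p (xi N i w) x)))"
    and pos: "\<And>N. AE w in P N. 0 < (\<Sum>i=1..Suc N. W N i w * a (xi N i w))"
    and W'_eq: "\<And>N l w. l \<in> {1..Suc N} \<Longrightarrow> w \<in> space (P N) \<Longrightarrow>
      W' N l w = om (xi N (I N l w) w) (xi' N l w)"
begin

sublocale L: sigma_finite_measure L by (rule sf)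
sublocale \<phi>: prob_space \<phi> by (rule phi_prob)

definition A :: "nat \<Rightarrow> 'w \<Rightarrow> real" where "A N w = (\<Sum>i=1..Suc N. W N i w * a (xi N i w))"

text \<open>Division by \<open>A N w = 0\<close> yields the zero density. So the total mass is at
  most 1 at every \<open>w\<close>, and equal to 1 wherever \<open>A N w\<close> is
  positive.\<close>

definition kk :: "nat \<Rightarrow> 'w \<Rightarrow> nat \<times> 'a \<Rightarrow> real" where
  "kk N w z = W N (fst z) w * a (xi N (fst z) w) * p (xi N (fst z) w) (snd z) / A N w"

abbreviation "MM N \<equiv> count_space {1..Suc N} \<Otimes>\<^sub>M L"
abbreviation "ZZ N \<equiv> (\<lambda>l w. (I N l w, xi' N l w))"

lemma sp_F: "space (F N) = space (P N)"
  using subalg[of N] by (simp add: subalgebra_def)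

lemma xi_sp: "l \<in> {1..Suc N} \<Longrightarrow> w \<in> space (P N) \<Longrightarrow> xi N l w \<in> space L"
  using measurable_space[OF xi_meas] by (simp add: sp_F)

lemma phi_space: "space \<phi> = space L"
  using phi_sets by (rule sets_eq_imp_space_eq)

lemma p_meas: "(\<lambda>(x, x'). p x x') \<in> borel_measurable (L \<Otimes>\<^sub>M L)"
  and p_nn: "\<And>x x'. x \<in> space L \<Longrightarrow> x' \<in> space L \<Longrightarrow> 0 \<le> p x x'"
  and p_int: "\<And>x. x \<in> space L \<Longrightarrow> (\<integral>\<^sup>+x'. ennreal (p x x') \<partial>L) = 1"
  using p_dens by (auto simp: markov_density_def)

lemma A_nn: "w \<in> space (P N) \<Longrightarrow> 0 \<le> A N w"
  unfolding A_def by (intro sum_nonneg mult_nonneg_nonneg W_nn a_nn xi_sp)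

lemma A_meas: "A N \<in> borel_measurable (F N)"
proof -
  have "(\<lambda>w. W N i w * a (xi N i w)) \<in> borel_measurable (F N)" if "i \<in> {1..Suc N}" for i
    by (rule borel_measurable_times[OF W_meas[OF that] measurable_compose[OF xi_meas[OF that] a_meas]])
  then have "(\<lambda>w. \<Sum>i=1..Suc N. W N i w * a (xi N i w)) \<in> borel_measurable (F N)"
    by (rule borel_measurable_sum)
  then show ?thesis by (simp only: A_def[abs_def])
qed

lemma pair_xi_meas:
  assumes e: "(\<lambda>(x, x'). e x x') \<in> borel_measurable (L \<Otimes>\<^sub>M L)" and i: "i \<in> {1..Suc N}"
  shows "(\<lambda>s. e (xi N i (fst s)) (snd (snd s))) \<in> borel_measurable (F N \<Otimes>\<^sub>M MM N)"
proof -
  have "(\<lambda>s. (xi N i (fst s), snd (snd s))) \<in> measurable (F N \<Otimes>\<^sub>M MM N) (L \<Otimes>\<^sub>M L)"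
    using xi_meas[OF i] by measurable
  from measurable_compose[OF this e] show ?thesis by (simp only: case_prod_unfold fst_conv snd_conv)
qed

lemma kk_meas: "(\<lambda>(w, z). kk N w z) \<in> borel_measurable (F N \<Otimes>\<^sub>M MM N)"
proof -
  have "(\<lambda>s. W N i (fst s) * a (xi N i (fst s)) * p (xi N i (fst s)) (snd (snd s)) / A N (fst s)) \<in> borel_measurable (F N \<Otimes>\<^sub>M MM N)"
    if i: "i \<in> {1..Suc N}" for i
    by (intro borel_measurable_divide measurable_compose[OF measurable_fst A_meas]
        borel_measurable_times[OF borel_measurable_times[OF measurable_compose[OF measurable_fst W_meas[OF i]] measurable_compose[OF measurable_fst measurable_compose[OF xi_meas[OF i] a_meas]]] pair_xi_meas[OF p_meas i]])
  from measurable_count_space_family[where I="{1..Suc N}" and g="\<lambda>s. fst (snd s)" and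
      f="\<lambda>i s. W N i (fst s) * a (xi N i (fst s)) * p (xi N i (fst s)) (snd (snd s)) / A N (fst s)", OF _ this]
  show ?thesis unfolding kk_def case_prod_unfold by simp
qed

lemma weight_density_meas:
  assumes w: "w \<in> space (P N)"
  shows "(\<lambda>(i, x). ennreal (W N i w * a (xi N i w) * p (xi N i w) x)) \<in> borel_measurable (MM N)"
proof -
  have "(\<lambda>s. ennreal (W N i w * a (xi N i w) * p (xi N i w) (snd s))) \<in> borel_measurable (MM N)" if i: "i \<in> {1..Suc N}" for i
  proof -
    have "p (xi N i w) \<in> borel_measurable L"
      using measurable_compose[OF measurable_Pair1' p_meas, OF xi_sp[OF i w]] by simp
    then show ?thesis by measurable
  qed
  from measurable_count_space_family[where I="{1..Suc N}" and g=fst and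
      f="\<lambda>i s. ennreal (W N i w * a (xi N i w) * p (xi N i w) (snd s))", OF _ this]
  show ?thesis unfolding case_prod_unfold by simp
qed

lemma weight_density_int:
  assumes w: "w \<in> space (P N)"
  shows "(\<integral>\<^sup>+z. (case z of (i, x) \<Rightarrow> ennreal (W N i w * a (xi N i w) * p (xi N i w) x)) \<partial>MM N) = ennreal (A N w)"
proof -
  have "(\<integral>\<^sup>+z. (case z of (i, x) \<Rightarrow> ennreal (W N i w * a (xi N i w) * p (xi N i w) x)) \<partial>MM N)
      = (\<Sum>i=1..Suc N. \<integral>\<^sup>+x. ennreal (W N i w * a (xi N i w) * p (xi N i w) x) \<partial>L)"
    using nn_integral_count_space_pair[OF finite_atLeastAtMost sf weight_density_meas[OF w]] by (simp only: prod.case)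
  also have "\<dots> = (\<Sum>i=1..Suc N. ennreal (W N i w * a (xi N i w)))"
  proof (rule sum.cong[OF refl])
    fix i assume i: "i \<in> {1..Suc N}"
    have pm: "p (xi N i w) \<in> borel_measurable L"
      using measurable_compose[OF measurable_Pair1' p_meas, OF xi_sp[OF i w]] by simp
    have nn: "0 \<le> W N i w * a (xi N i w)" by (intro mult_nonneg_nonneg W_nn[OF i w] a_nn xi_sp[OF i w])
    have "(\<integral>\<^sup>+x. ennreal (W N i w * a (xi N i w) * p (xi N i w) x) \<partial>L) = (\<integral>\<^sup>+x. ennreal (W N i w * a (xi N i w)) * ennreal (p (xi N i w) x) \<partial>L)"
      using nn p_nn[OF xi_sp[OF i w]] by (intro nn_integral_cong) (simp add: ennreal_mult)
    also have "\<dots> = ennreal (W N i w * a (xi N i w)) * (\<integral>\<^sup>+x. ennreal (p (xi N i w) x) \<partial>L)"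
      using pm by (intro nn_integral_cmult) measurable
    finally show "(\<integral>\<^sup>+x. ennreal (W N i w * a (xi N i w) * p (xi N i w) x) \<partial>L) = ennreal (W N i w * a (xi N i w))"
      by (simp add: p_int[OF xi_sp[OF i w]])
  qed
  also have "\<dots> = ennreal (A N w)"
    unfolding A_def by (intro sum_ennreal mult_nonneg_nonneg W_nn a_nn xi_sp w)
  finally show ?thesis .
qed

lemma kk_nn: "w \<in> space (P N) \<Longrightarrow> z \<in> space (MM N) \<Longrightarrow> 0 \<le> kk N w z"
  unfolding kk_def
  by (intro divide_nonneg_nonneg mult_nonneg_nonneg W_nn a_nn p_nn xi_sp A_nn) (auto simp: space_pair_measure)

lemma kk_ennreal:
  assumes w: "w \<in> space (P N)" and A: "0 < A N w" and z: "z \<in> space (MM N)"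
  shows "ennreal (kk N w z) = (case z of (i, x) \<Rightarrow> ennreal (W N i w * a (xi N i w) * p (xi N i w) x)) / ennreal (A N w)"
proof -
  have "0 \<le> W N (fst z) w * a (xi N (fst z) w) * p (xi N (fst z) w) (snd z)"
    using z by (intro mult_nonneg_nonneg W_nn a_nn p_nn xi_sp w) (auto simp: space_pair_measure)
  then show ?thesis
    unfolding kk_def using A by (simp add: divide_ennreal case_prod_unfold)
qed

lemma kk_int:
  assumes w: "w \<in> space (P N)" and A: "0 < A N w"
  shows "(\<integral>\<^sup>+z. ennreal (kk N w z) \<partial>MM N) = 1"
proof -
  have "(\<integral>\<^sup>+z. ennreal (kk N w z) \<partial>MM N)
      = (\<integral>\<^sup>+z. (case z of (i, x) \<Rightarrow> ennreal (W N i w * a (xi N i w) * p (xi N i w) x)) / ennreal (A N w) \<partial>MM N)"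
    by (intro nn_integral_cong kk_ennreal w A)
  also have "\<dots> = ennreal (A N w) / ennreal (A N w)"
    using nn_integral_divide[OF weight_density_meas[OF w]] weight_density_int[OF w] by simp
  also have "\<dots> = 1" using A by (simp add: ennreal_divide_self)
  finally show ?thesis .
qed

text \<open>\<open>cond_iid\<close> is an almost sure identity of conditional expectations.
  Integrated over an event of \<open>F\<close> it becomes the product formula \<open>law\<close>,
  once the normalised density is replaced by its real version \<open>kk\<close> where
  \<open>A N w\<close> is positive.\<close>

lemma cond_sampling_step: "cond_sampling (P N) (F N) (MM N) (Suc N) (ZZ N) (kk N)"
proof -
  interpret prob_space "P N" by (rule prob)
  interpret sub: finite_measure_subalgebra "P N" "F N" by (unfold_locales) (rule subalg)
  have Z: "ZZ N l \<in> measurable (P N) (MM N)" if "l \<in> {1..Suc N}" for l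
    using ciid[of N] that unfolding cond_iid_def by blast
  interpret C: sigma_finite_measure "count_space {1..Suc N}"
    by (intro sigma_finite_measure_count_space_finite) simp
  interpret CL: pair_sigma_finite "count_space {1..Suc N}" L ..
  show ?thesis
  proof
    show "subalgebra (P N) (F N)" by (rule subalg)
    show "ZZ N l \<in> measurable (P N) (MM N)" if "l \<in> {1..Suc N}" for l by (rule Z[OF that])
    show "(\<lambda>(w, z). kk N w z) \<in> borel_measurable (F N \<Otimes>\<^sub>M MM N)" by (rule kk_meas)
    show "0 \<le> kk N w z" if "w \<in> space (P N)" "z \<in> space (MM N)" for w z by (rule kk_nn[OF that])
    show "(\<integral>\<^sup>+z. ennreal (kk N w z) \<partial>MM N) \<le> 1" if w: "w \<in> space (P N)" for w
    proof (cases "A N w = 0")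
      case True then show ?thesis by (simp add: kk_def)
    next
      case False
      then show ?thesis using A_nn[OF w] by (simp add: kk_int[OF w])
    qed
    show "AE w in P N. (\<integral>\<^sup>+z. ennreal (kk N w z) \<partial>MM N) = 1"
      using pos[of N] AE_space
    proof eventually_elim
      case (elim w)
      then show ?case by (intro kk_int) (auto simp: A_def)
    qed
    fix S B assume S: "S \<in> sets (F N)" and B: "\<And>l. l \<in> {1..Suc N} \<Longrightarrow> B l \<in> sets (MM N)"
    let ?g = "\<lambda>w. \<Prod>l=1..Suc N. indicator (B l) (ZZ N l w) :: ennreal"
    have g_meas: "?g \<in> borel_measurable (P N)"
    proof -
      have "(\<lambda>w. indicator (B l) (ZZ N l w) :: ennreal) \<in> borel_measurable (P N)" if "l \<in> {1..Suc N}" for l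
        by (rule measurable_compose[OF Z[OF that] borel_measurable_indicator[OF B[OF that]]])
      then show ?thesis by (rule borel_measurable_prod_ennreal)
    qed
    have "(\<integral>\<^sup>+w. indicator S w * ?g w \<partial>P N) = (\<integral>\<^sup>+w. indicator S w * nn_cond_exp (P N) (F N) ?g w \<partial>P N)"
      by (rule sub.nn_cond_exp_intg[OF borel_measurable_indicator[OF S] g_meas, symmetric])
    also have "\<dots> = (\<integral>\<^sup>+w. indicator S w * (\<Prod>l=1..Suc N. \<integral>\<^sup>+z. ennreal (kk N w z) * indicator (B l) z \<partial>MM N) \<partial>P N)"
    proof (rule nn_integral_cong_AE)
      have "AE w in P N. nn_cond_exp (P N) (F N) ?g w = (\<Prod>l=1..Suc N. emeasure (normalized_density (MM N)
         (\<lambda>(i, x). ennreal (W N i w * a (xi N i w) * p (xi N i w) x))) (B l))"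
        using ciid[of N] B unfolding cond_iid_def by blast
      then show "AE w in P N. indicator S w * nn_cond_exp (P N) (F N) ?g w =
         indicator S w * (\<Prod>l=1..Suc N. \<integral>\<^sup>+z. ennreal (kk N w z) * indicator (B l) z \<partial>MM N)"
        using pos[of N] AE_space
      proof eventually_elim
        case (elim w)
        have A: "0 < A N w" using elim(2) by (simp add: A_def)
        have "emeasure (normalized_density (MM N) (\<lambda>(i, x). ennreal (W N i w * a (xi N i w) * p (xi N i w) x))) (B l)
            = (\<integral>\<^sup>+z. ennreal (kk N w z) * indicator (B l) z \<partial>MM N)" if l: "l \<in> {1..Suc N}" for l
        proof -
          have "emeasure (normalized_density (MM N) (\<lambda>(i, x). ennreal (W N i w * a (xi N i w) * p (xi N i w) x))) (B l)
             = (\<integral>\<^sup>+z. (case z of (i, x) \<Rightarrow> ennreal (W N i w * a (xi N i w) * p (xi N i w) x)) / ennreal (A N w) * indicator (B l) z \<partial>MM N)"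
            unfolding normalized_density_def weight_density_int[OF elim(3)]
            using borel_measurable_divide_ennreal[OF weight_density_meas[OF elim(3)] borel_measurable_const] B[OF l]
            by (rule emeasure_density)
          also have "\<dots> = (\<integral>\<^sup>+z. ennreal (kk N w z) * indicator (B l) z \<partial>MM N)"
            by (intro nn_integral_cong) (simp add: kk_ennreal[OF elim(3) A])
          finally show ?thesis .
        qed
        then show ?case unfolding elim(1) by simp
      qed
    qed
    finally show "(\<integral>\<^sup>+w. indicator S w * ?g w \<partial>P N) = (\<integral>\<^sup>+w. indicator S w * (\<Prod>l=1..Suc N. \<integral>\<^sup>+z. ennreal (kk N w z) * indicator (B l) z \<partial>MM N) \<partial>P N)" .
  qed (auto intro: CL.sigma_finite_measure_axioms)
qed

lemma cmean_eq:
  assumes w: "w \<in> space (P N)" and e: "(\<lambda>(x, x'). e x x') \<in> borel_measurable (L \<Otimes>\<^sub>M L)"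
    and bd: "\<And>x x'. x \<in> space L \<Longrightarrow> x' \<in> space L \<Longrightarrow> \<bar>e x x'\<bar> \<le> D"
  shows "cond_sampling.cmean (MM N) (kk N) (\<lambda>w z. e (xi N (fst z) w) (snd z)) w
     = (\<Sum>i=1..Suc N. W N i w * (\<integral>x'. a (xi N i w) * p (xi N i w) x' * e (xi N i w) x' \<partial>L)) / A N w"
proof -
  interpret cs: cond_sampling "P N" "F N" "MM N" "Suc N" "ZZ N" "kk N" by (rule cond_sampling_step)
  have m: "(\<lambda>z. e (xi N (fst z) w) (snd z)) \<in> borel_measurable (MM N)"
  proof (rule measurable_count_space_family[where I="{1..Suc N}" and g=fst and f="\<lambda>i z. e (xi N i w) (snd z)"])
    show "(\<lambda>z. e (xi N i w) (snd z)) \<in> borel_measurable (MM N)" if "i \<in> {1..Suc N}" for i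
      using measurable_compose[OF measurable_Pair1' e, OF xi_sp[OF that w]] by simp
  qed simp_all
  have int: "integrable (MM N) (\<lambda>z. kk N w z * e (xi N (fst z) w) (snd z))"
    using cs.integrable_k[OF w m, of D] bd xi_sp[OF _ w] by (auto simp: space_pair_measure)
  have "cs.cmean (\<lambda>w z. e (xi N (fst z) w) (snd z)) w = (\<Sum>i=1..Suc N. \<integral>x'. kk N w (i, x') * e (xi N i w) x' \<partial>L)"
    unfolding cs.cmean_def using integral_count_space_pair[OF finite_atLeastAtMost sf int] by (simp only: fst_conv snd_conv)
  also have "\<dots> = (\<Sum>i=1..Suc N. W N i w * (\<integral>x'. a (xi N i w) * p (xi N i w) x' * e (xi N i w) x' \<partial>L) / A N w)"
  proof (rule sum.cong[OF refl])
    fix i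
    have "(\<integral>x'. kk N w (i, x') * e (xi N i w) x' \<partial>L) = (\<integral>x'. W N i w / A N w * (a (xi N i w) * p (xi N i w) x' * e (xi N i w) x') \<partial>L)"
      by (intro Bochner_Integration.integral_cong refl) (simp add: kk_def)
    then show "(\<integral>x'. kk N w (i, x') * e (xi N i w) x' \<partial>L) = W N i w * (\<integral>x'. a (xi N i w) * p (xi N i w) x' * e (xi N i w) x' \<partial>L) / A N w"
      by simp
  qed
  finally show ?thesis by (simp only: sum_divide_distrib)
qed

text \<open>Numerators of the conditional mean and second moment of a weighted new particle:
  integrating \<open>om * f\<close> against \<open>a * p\<close> gives \<open>K1 f\<close>, and
  integrating its square gives \<open>K2 f\<close>, where one factor \<open>om\<close> is left over
  beside \<open>\<kappa>\<close>.\<close>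

definition K1 :: "('a \<Rightarrow> real) \<Rightarrow> 'a \<Rightarrow> real" where "K1 f x = (\<integral>x'. \<kappa> x x' * f x' \<partial>L)"
definition K2 :: "('a \<Rightarrow> real) \<Rightarrow> 'a \<Rightarrow> real" where "K2 f x = (\<integral>x'. om x x' * \<kappa> x x' * (f x')\<^sup>2 \<partial>L)"

lemma \<kappa>_nn: "x \<in> space L \<Longrightarrow> x' \<in> space L \<Longrightarrow> 0 \<le> \<kappa> x x'"
  unfolding \<kappa>_eq by (intro mult_nonneg_nonneg om_nn a_nn p_nn)

lemma \<kappa>_x_meas: "x \<in> space L \<Longrightarrow> \<kappa> x \<in> borel_measurable L"
  using measurable_compose[OF measurable_Pair1' \<kappa>_meas] by simp

lemma p_x_meas: "x \<in> space L \<Longrightarrow> p x \<in> borel_measurable L"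
  using measurable_compose[OF measurable_Pair1' p_meas] by simp

lemma om_x_meas: "x \<in> space L \<Longrightarrow> om x \<in> borel_measurable L"
  using measurable_compose[OF measurable_Pair1' om_meas] by simp

text \<open>The factor \<open>a x\<close> is kept in the bound: every numerator is thereby dominated
  by a multiple of the average of \<open>a\<close> in the denominator, however small that average
  is.\<close>

lemma \<kappa>_int_a: "x \<in> space L \<Longrightarrow> (\<integral>\<^sup>+x'. ennreal (\<kappa> x x') \<partial>L) \<le> ennreal (Com * a x)"
proof -
  assume x: "x \<in> space L"
  have "(\<integral>\<^sup>+x'. ennreal (\<kappa> x x') \<partial>L) \<le> (\<integral>\<^sup>+x'. ennreal (Com * a x) * ennreal (p x x') \<partial>L)"
  proof (rule nn_integral_mono)
    fix x' assume x': "x' \<in> space L"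
    have "\<kappa> x x' \<le> Com * (a x * p x x')"
      unfolding \<kappa>_eq[OF x x'] by (intro mult_right_mono om_le x x' mult_nonneg_nonneg a_nn p_nn)
    then show "ennreal (\<kappa> x x') \<le> ennreal (Com * a x) * ennreal (p x x')"
      using Com a_nn[OF x] p_nn[OF x x'] by (simp add: ennreal_mult[symmetric] mult.assoc ennreal_leI)
  qed
  also have "\<dots> = ennreal (Com * a x)"
    using p_x_meas[OF x] p_int[OF x] by (subst nn_integral_cmult) auto
  finally show ?thesis .
qed

lemma \<kappa>_int: "x \<in> space L \<Longrightarrow> (\<integral>\<^sup>+x'. ennreal (\<kappa> x x') \<partial>L) \<le> ennreal (Com * Ca)"
  by (rule order_trans[OF \<kappa>_int_a]) (auto intro!: ennreal_leI mult_left_mono a_le Com)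

lemma om\<kappa>_int: "x \<in> space L \<Longrightarrow> (\<integral>\<^sup>+x'. ennreal (om x x' * \<kappa> x x') \<partial>L) \<le> ennreal (Com * (Com * a x))"
proof -
  assume x: "x \<in> space L"
  have "(\<integral>\<^sup>+x'. ennreal (om x x' * \<kappa> x x') \<partial>L) \<le> (\<integral>\<^sup>+x'. ennreal Com * ennreal (\<kappa> x x') \<partial>L)"
  proof (rule nn_integral_mono)
    fix x' assume x': "x' \<in> space L"
    have "om x x' * \<kappa> x x' \<le> Com * \<kappa> x x'"
      by (intro mult_right_mono om_le x x' \<kappa>_nn)
    then show "ennreal (om x x' * \<kappa> x x') \<le> ennreal Com * ennreal (\<kappa> x x')"
      using Com \<kappa>_nn[OF x x'] by (simp add: ennreal_mult[symmetric] ennreal_leI)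
  qed
  also have "\<dots> = ennreal Com * (\<integral>\<^sup>+x'. ennreal (\<kappa> x x') \<partial>L)"
    using \<kappa>_x_meas[OF x] by (intro nn_integral_cmult) auto
  also have "\<dots> \<le> ennreal Com * ennreal (Com * a x)"
    by (rule mult_left_mono[OF \<kappa>_int_a[OF x]]) simp
  finally show ?thesis using Com a_nn[OF x] by (simp add: ennreal_mult)
qed

lemma om\<kappa>_meas: "(\<lambda>(x, x'). om x x' * \<kappa> x x') \<in> borel_measurable (L \<Otimes>\<^sub>M L)"
  using borel_measurable_times[OF om_meas \<kappa>_meas] by (simp add: case_prod_unfold)

lemma om\<kappa>_x_meas: "x \<in> space L \<Longrightarrow> (\<lambda>x'. om x x' * \<kappa> x x') \<in> borel_measurable L"
  by (intro borel_measurable_times om_x_meas \<kappa>_x_meas)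

lemma om\<kappa>_nn: "x \<in> space L \<Longrightarrow> x' \<in> space L \<Longrightarrow> 0 \<le> om x x' * \<kappa> x x'"
  by (intro mult_nonneg_nonneg om_nn \<kappa>_nn)

lemma K1_le:
  assumes f: "f \<in> borel_measurable L" "\<And>x. x \<in> space L \<Longrightarrow> \<bar>f x\<bar> \<le> C" "0 \<le> C" and x: "x \<in> space L"
  shows "\<bar>K1 f x\<bar> \<le> Com * C * a x"
  using abs_kernel_integral_le(2)[OF \<kappa>_x_meas[OF x] \<kappa>_nn[OF x] \<kappa>_int_a[OF x] _ f] Com a_nn[OF x]
  by (simp add: K1_def mult_ac)

lemma K2_le:
  assumes f: "f \<in> borel_measurable L" "\<And>x. x \<in> space L \<Longrightarrow> \<bar>f x\<bar> \<le> C" and x: "x \<in> space L"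
  shows "\<bar>K2 f x\<bar> \<le> Com * Com * C\<^sup>2 * a x"
proof -
  have "(\<lambda>x. (f x)\<^sup>2) \<in> borel_measurable L" using f(1) by measurable
  moreover have "\<bar>(f x')\<^sup>2\<bar> \<le> C\<^sup>2" if "x' \<in> space L" for x'
    using abs_le_imp_square_le[OF f(2)[OF that]] by simp
  ultimately show ?thesis
    using abs_kernel_integral_le(2)[OF om\<kappa>_x_meas[OF x] om\<kappa>_nn[OF x] om\<kappa>_int[OF x], of "\<lambda>x. (f x)\<^sup>2" "C\<^sup>2"] Com a_nn[OF x]
    by (simp add: K2_def mult_ac)
qed

text \<open>The mass of \<open>\<kappa>\<close> at \<open>x\<close> is at most
  \<open>Com * a x\<close>; if the integral of \<open>a\<close> vanished, so would that of
  \<open>\<kappa>\<close>.\<close>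

lemma phi_a_pos: "0 < (\<integral>x. a x \<partial>\<phi>)"
proof -
  have am: "a \<in> borel_measurable \<phi>" using a_meas phi_sets by (simp cong: measurable_cong_sets)
  have ia: "integrable \<phi> a"
    using a_nn a_le am by (intro \<phi>.integrable_const_bound[where B=Ca]) (auto simp: phi_space)
  have km: "K1 (\<lambda>_. 1) \<in> borel_measurable L"
    using L.borel_measurable_lebesgue_integral[OF \<kappa>_meas] by (simp add: K1_def[abs_def])
  have "(\<integral>x. K1 (\<lambda>_. 1) x \<partial>\<phi>) \<le> (\<integral>x. Com * a x \<partial>\<phi>)"
  proof (rule integral_mono)
    have le: "\<bar>K1 (\<lambda>_. 1) x\<bar> \<le> Com * a x" if "x \<in> space L" for x
      using K1_le[of "\<lambda>_. 1" 1 x] that by simp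
    show "K1 (\<lambda>_. 1) x \<le> Com * a x" if "x \<in> space \<phi>" for x
      using le[of x] that by (simp add: phi_space abs_le_iff)
    show "integrable \<phi> (K1 (\<lambda>_. 1))"
    proof (rule Bochner_Integration.integrable_bound[OF integrable_mult_right[OF ia, of Com]])
      show "K1 (\<lambda>_. 1) \<in> borel_measurable \<phi>" using km phi_sets by (simp cong: measurable_cong_sets)
      show "AE x in \<phi>. norm (K1 (\<lambda>_. 1) x) \<le> norm (Com * a x)"
      proof (rule AE_I2)
        fix x assume "x \<in> space \<phi>"
        then have "\<bar>K1 (\<lambda>_. 1) x\<bar> \<le> Com * a x" using le by (simp add: phi_space)
        then show "norm (K1 (\<lambda>_. 1) x) \<le> norm (Com * a x)" unfolding real_norm_def by linarith
      qed
    qed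
  qed (use ia in simp)
  moreover have "(\<integral>x. K1 (\<lambda>_. 1) x \<partial>\<phi>) = (\<integral>x. (\<integral>x'. \<kappa> x x' \<partial>L) \<partial>\<phi>)" by (simp add: K1_def)
  ultimately have "0 < Com * (\<integral>x. a x \<partial>\<phi>)" using phi_pos by simp
  then show ?thesis using Com by (simp add: zero_less_mult_iff)
qed

lemma emp_meas_pair:
  assumes Q: "sigma_finite_measure Q" and g: "(\<lambda>(v, x). g v x) \<in> borel_measurable (Q \<Otimes>\<^sub>M L)"
  shows "(\<lambda>(w, v). emp (Suc N) (W N) (xi N) (g v) w) \<in> borel_measurable (P N \<Otimes>\<^sub>M Q)"
proof -
  have "(\<lambda>s. W N l (fst s) * g (snd s) (xi N l (fst s))) \<in> borel_measurable (P N \<Otimes>\<^sub>M Q)" if l: "l \<in> {1..Suc N}" for l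
  proof -
    have 1: "(\<lambda>s. W N l (fst s)) \<in> borel_measurable (P N \<Otimes>\<^sub>M Q)"
      by (rule measurable_compose[OF measurable_fst measurable_from_subalg[OF subalg W_meas[OF l]]])
    have "(\<lambda>s. (snd s, xi N l (fst s))) \<in> measurable (P N \<Otimes>\<^sub>M Q) (Q \<Otimes>\<^sub>M L)"
      by (rule measurable_Pair[OF measurable_snd measurable_compose[OF measurable_fst measurable_from_subalg[OF subalg xi_meas[OF l]]]])
    from measurable_compose[OF this g] have 2: "(\<lambda>s. g (snd s) (xi N l (fst s))) \<in> borel_measurable (P N \<Otimes>\<^sub>M Q)"
      by (simp only: case_prod_unfold fst_conv snd_conv)
    show ?thesis by (rule borel_measurable_times[OF 1 2])
  qed
  from borel_measurable_divide[OF borel_measurable_sum[OF this] borel_measurable_const]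
  show ?thesis unfolding emp_def case_prod_unfold .
qed

lemma abs_emp_le:
  assumes w: "w \<in> space (P N)" and g: "\<And>x. x \<in> space L \<Longrightarrow> \<bar>g x\<bar> \<le> C" and C: "0 \<le> C"
  shows "\<bar>emp (Suc N) (W N) (xi N) g w\<bar> \<le> Cw * C"
proof -
  have "\<bar>\<Sum>l=1..Suc N. W N l w * g (xi N l w)\<bar> \<le> (\<Sum>l=1..Suc N. Cw * C)"
  proof (rule order_trans[OF sum_abs sum_mono])
    fix l assume l: "l \<in> {1..Suc N}"
    show "\<bar>W N l w * g (xi N l w)\<bar> \<le> Cw * C"
      unfolding abs_mult using W_nn[OF l w] W_le[OF l w] g[OF xi_sp[OF l w]] C Cw by (intro mult_mono) auto
  qed
  also have "\<dots> = real (Suc N) * (Cw * C)" by simp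
  finally show ?thesis unfolding emp_def abs_divide by (simp add: field_simps del: of_nat_Suc)
qed

lemma emp_dominated:
  assumes w: "w \<in> space (P N)" and g: "\<And>x. x \<in> space L \<Longrightarrow> \<bar>g x\<bar> \<le> K * a x"
  shows "\<bar>emp (Suc N) (W N) (xi N) g w\<bar> \<le> K * emp (Suc N) (W N) (xi N) a w"
proof -
  have "\<bar>\<Sum>l=1..Suc N. W N l w * g (xi N l w)\<bar> \<le> (\<Sum>l=1..Suc N. K * (W N l w * a (xi N l w)))"
  proof (rule order_trans[OF sum_abs sum_mono])
    fix l assume l: "l \<in> {1..Suc N}"
    have "\<bar>W N l w * g (xi N l w)\<bar> = W N l w * \<bar>g (xi N l w)\<bar>" using W_nn[OF l w] by (simp add: abs_mult)
    also have "\<dots> \<le> W N l w * (K * a (xi N l w))" by (rule mult_left_mono[OF g[OF xi_sp[OF l w]] W_nn[OF l w]])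
    finally show "\<bar>W N l w * g (xi N l w)\<bar> \<le> K * (W N l w * a (xi N l w))" by (simp add: mult_ac)
  qed
  also have "\<dots> = K * (\<Sum>l=1..Suc N. W N l w * a (xi N l w))" by (simp only: sum_distrib_left)
  finally show ?thesis
    unfolding emp_def abs_divide by (simp add: divide_right_mono del: of_nat_Suc)
qed

lemma emp_a_nn: "w \<in> space (P N) \<Longrightarrow> 0 \<le> emp (Suc N) (W N) (xi N) a w"
  unfolding emp_def by (intro divide_nonneg_nonneg sum_nonneg mult_nonneg_nonneg W_nn a_nn xi_sp) auto

lemma emp_a: "emp (Suc N) (W N) (xi N) a w = A N w / real (Suc N)"
  by (simp only: emp_def A_def)

text \<open>Limit of the average new weight: the numerator comes from \<open>K1\<close> at the
  constant 1, the denominator from \<open>a\<close>, and the previous constant \<open>c\<close>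
  cancels.\<close>

definition c' :: real where "c' = (\<integral>x. (\<integral>x'. \<kappa> x x' \<partial>L) \<partial>\<phi>) / (\<integral>x. a x \<partial>\<phi>)"

lemma c'_pos: "0 < c'"
  unfolding c'_def using phi_pos phi_a_pos by simp

section \<open>Limit theorems inherited through one step\<close>

context
  fixes Q :: "nat \<Rightarrow> 'w measure" and C :: real and G :: "nat \<Rightarrow> 'w \<Rightarrow> 'a \<Rightarrow> real" and f :: "'a \<Rightarrow> real" and c :: real
  assumes Q: "\<And>N. prob_space (Q N)" and rc: "rand_conv L Q C G f"
    and c_pos: "0 < c" and lln: "sample_lln L P W xi \<phi> c"
begin

lemma C_nn: "0 \<le> C" and f_meas: "f \<in> borel_measurable L" and f_bd: "\<And>x. x \<in> space L \<Longrightarrow> \<bar>f x\<bar> \<le> C"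
  and G_bd: "\<And>N v x. v \<in> space (Q N) \<Longrightarrow> x \<in> space L \<Longrightarrow> \<bar>G N v x\<bar> \<le> C"
  and G_meas: "\<And>N. (\<lambda>(v, x). G N v x) \<in> borel_measurable (Q N \<Otimes>\<^sub>M L)"
  using rc by (auto simp: rand_conv_def)

lemma rc_K1: "rand_conv L Q (Com * Ca * C) (\<lambda>N v. K1 (G N v)) (K1 f)"
  using rand_conv_kernel[OF sf Q rc \<kappa>_meas \<kappa>_nn \<kappa>_int] Com Ca by (simp add: K1_def[abs_def])

lemma rc_K2: "rand_conv L Q (Com * (Com * Ca) * C\<^sup>2) (\<lambda>N v. K2 (G N v)) (K2 f)"
proof -
  have "(\<integral>\<^sup>+x'. ennreal (om x x' * \<kappa> x x') \<partial>L) \<le> ennreal (Com * (Com * Ca))" if "x \<in> space L" for x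
    by (rule order_trans[OF om\<kappa>_int[OF that]]) (intro ennreal_leI mult_left_mono a_le that Com)
  from rand_conv_kernel[OF sf Q rand_conv_square[OF Q rc] om\<kappa>_meas om\<kappa>_nn this]
  show ?thesis using Com Ca by (simp add: K2_def[abs_def])
qed

lemma rc_a: "rand_conv L Q Ca (\<lambda>N v. a) a"
  using a_nn a_le Ca by (intro rand_conv_const Q a_meas) auto

lemma emp_int:
  assumes "rand_conv L Q B g u"
  shows "integrable (P N \<Otimes>\<^sub>M Q N) (\<lambda>(w, v). emp (Suc N) (W N) (xi N) (g N v) w)"
    and "(\<lambda>(w, v). emp (Suc N) (W N) (xi N) (g N v) w) \<in> borel_measurable (P N \<Otimes>\<^sub>M Q N)"
proof -
  interpret prob_space "Q N" by (rule Q)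
  show m: "(\<lambda>(w, v). emp (Suc N) (W N) (xi N) (g N v) w) \<in> borel_measurable (P N \<Otimes>\<^sub>M Q N)"
    using assms by (intro emp_meas_pair sigma_finite_measure_axioms) (auto simp: rand_conv_def)
  have "norm (emp (Suc N) (W N) (xi N) (g N v) w) \<le> Cw * B" if "w \<in> space (P N)" "v \<in> space (Q N)" for w v
    unfolding real_norm_def using assms that by (intro abs_emp_le) (auto simp: rand_conv_def)
  from pair_prob_integral(1)[OF prob Q m this]
  show "integrable (P N \<Otimes>\<^sub>M Q N) (\<lambda>(w, v). emp (Suc N) (W N) (xi N) (g N v) w)" .
qed

lemma lln_use:
  assumes "rand_conv L Q B g u"
  shows "(\<lambda>N. \<integral>x. \<bar>(case x of (w, v) \<Rightarrow> emp (Suc N) (W N) (xi N) (g N v) w) - c * (\<integral>x. u x \<partial>\<phi>)\<bar> \<partial>(P N \<Otimes>\<^sub>M Q N)) \<longlonglongrightarrow> 0"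
  using lln assms Q unfolding sample_lln_def case_prod_unfold by blast

text \<open>Both averages carry the same constant \<open>c\<close>, which cancels; the domination by
  \<open>a\<close> is what allows the two laws of large numbers to be divided.\<close>

lemma ratio_conv:
  assumes rg: "rand_conv L Q B g u" and K: "0 \<le> K"
    and le: "\<And>N v x. v \<in> space (Q N) \<Longrightarrow> x \<in> space L \<Longrightarrow> \<bar>g N v x\<bar> \<le> K * a x"
  shows "(\<lambda>N. \<integral>(w, v). \<bar>emp (Suc N) (W N) (xi N) (g N v) w / emp (Suc N) (W N) (xi N) a w - (\<integral>x. u x \<partial>\<phi>) / (\<integral>x. a x \<partial>\<phi>)\<bar> \<partial>(P N \<Otimes>\<^sub>M Q N)) \<longlonglongrightarrow> 0"
proof -
  have pp: "prob_space (P N \<Otimes>\<^sub>M Q N)" for N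
  proof -
    interpret p: prob_space "P N" by (rule prob)
    interpret q: prob_space "Q N" by (rule Q)
    interpret pair_prob_space "P N" "Q N" ..
    show ?thesis by unfold_locales
  qed
  have "(\<lambda>N. \<integral>x. \<bar>(case x of (w, v) \<Rightarrow> emp (Suc N) (W N) (xi N) (g N v) w) / (case x of (w, v) \<Rightarrow> emp (Suc N) (W N) (xi N) a w)
      - (c * (\<integral>x. u x \<partial>\<phi>)) / (c * (\<integral>x. a x \<partial>\<phi>))\<bar> \<partial>(P N \<Otimes>\<^sub>M Q N)) \<longlonglongrightarrow> 0"
  proof (rule ratio_L1_conv[OF pp emp_int(1)[OF rg] emp_int(1)[OF rc_a] _ _ K _ lln_use[OF rg] lln_use[OF rc_a]])
    show "0 < c * (\<integral>x. a x \<partial>\<phi>)" using c_pos phi_a_pos by simp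
    fix N x assume x: "x \<in> space (P N \<Otimes>\<^sub>M Q N)"
    obtain w v where wv: "x = (w, v)" "w \<in> space (P N)" "v \<in> space (Q N)"
      using x by (auto simp: space_pair_measure)
    show "\<bar>case x of (w, v) \<Rightarrow> emp (Suc N) (W N) (xi N) (g N v) w\<bar> \<le> K * (case x of (w, v) \<Rightarrow> emp (Suc N) (W N) (xi N) a w)"
      unfolding wv(1) prod.case by (rule emp_dominated[OF wv(2) le[OF wv(3)]])
    show "0 \<le> (case x of (w, v) \<Rightarrow> emp (Suc N) (W N) (xi N) a w)"
      unfolding wv(1) prod.case by (rule emp_a_nn[OF wv(2)])
  qed
  then show ?thesis using c_pos by (simp add: case_prod_unfold)
qed

definition y :: "nat \<Rightarrow> 'w \<Rightarrow> 'w \<Rightarrow> nat \<times> 'a \<Rightarrow> real" where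
  "y N v w z = om (xi N (fst z) w) (snd z) * G N v (snd z)"

lemma cs_rand_step: "cond_sampling_rand (P N) (F N) (MM N) (Suc N) (ZZ N) (kk N) (Q N) (y N) (Com * C)"
proof (intro cond_sampling_rand.intro cond_sampling_step Q cond_sampling_rand_axioms.intro)
  have "(\<lambda>s. om (xi N i (fst (snd s))) (snd (snd (snd s)))) \<in> borel_measurable (Q N \<Otimes>\<^sub>M (F N \<Otimes>\<^sub>M MM N))"
    if i: "i \<in> {1..Suc N}" for i
    using measurable_compose[OF measurable_snd pair_xi_meas[OF om_meas i]] .
  from measurable_count_space_family[where I="{1..Suc N}" and g="\<lambda>s. fst (snd (snd s))" and
      f="\<lambda>i s. om (xi N i (fst (snd s))) (snd (snd (snd s)))", OF _ this]
  have 1: "(\<lambda>s. om (xi N (fst (snd (snd s))) (fst (snd s))) (snd (snd (snd s)))) \<in> borel_measurable (Q N \<Otimes>\<^sub>M (F N \<Otimes>\<^sub>M MM N))"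
    by simp
  have "(\<lambda>s. (fst s, snd (snd (snd s)))) \<in> measurable (Q N \<Otimes>\<^sub>M (F N \<Otimes>\<^sub>M MM N)) (Q N \<Otimes>\<^sub>M L)" by measurable
  from measurable_compose[OF this G_meas]
  have 2: "(\<lambda>s. G N (fst s) (snd (snd (snd s)))) \<in> borel_measurable (Q N \<Otimes>\<^sub>M (F N \<Otimes>\<^sub>M MM N))"
    by (simp only: case_prod_unfold fst_conv snd_conv)
  from borel_measurable_times[OF 1 2]
  show "(\<lambda>(v, w, z). y N v w z) \<in> borel_measurable (Q N \<Otimes>\<^sub>M (F N \<Otimes>\<^sub>M MM N))"
    by (simp only: y_def case_prod_unfold)
  show "\<bar>y N v w z\<bar> \<le> Com * C" if "v \<in> space (Q N)" "w \<in> space (P N)" "z \<in> space (MM N)" for v w z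
  proof -
    have z: "fst z \<in> {1..Suc N}" "snd z \<in> space L" using that(3) by (auto simp: space_pair_measure)
    note x = xi_sp[OF z(1) that(2)]
    show ?thesis
      unfolding y_def abs_mult using om_nn[OF x z(2)] om_le[OF x z(2)] G_bd[OF that(1) z(2)] Com
      by (intro mult_mono) auto
  qed
  show "0 \<le> Com * C" using Com C_nn by simp
qed

lemma G_v_meas: "v \<in> space (Q N) \<Longrightarrow> G N v \<in> borel_measurable L"
  by (rule rand_conv_meas_x[OF rc])

lemma e_meas:
  assumes "v \<in> space (Q N)"
  shows "(\<lambda>(x, x'). om x x' * G N v x') \<in> borel_measurable (L \<Otimes>\<^sub>M L)"
  using borel_measurable_times[OF om_meas measurable_compose[OF measurable_snd G_v_meas[OF assms]]]
  by (simp only: case_prod_unfold)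

lemma e_bd:
  assumes "v \<in> space (Q N)" "x \<in> space L" "x' \<in> space L"
  shows "\<bar>om x x' * G N v x'\<bar> \<le> Com * C"
  unfolding abs_mult using om_nn[OF assms(2,3)] om_le[OF assms(2,3)] G_bd[OF assms(1,3)] Com
  by (intro mult_mono) auto

lemma ratio_scale: "(\<Sum>i=1..Suc N. W N i w * g (xi N i w)) / A N w = emp (Suc N) (W N) (xi N) g w / emp (Suc N) (W N) (xi N) a w"
  unfolding emp_a unfolding emp_def by (simp del: of_nat_Suc)

lemma cmean_step:
  assumes w: "w \<in> space (P N)" and v: "v \<in> space (Q N)"
  shows "cond_sampling.cmean (MM N) (kk N) (y N v) w
    = emp (Suc N) (W N) (xi N) (K1 (G N v)) w / emp (Suc N) (W N) (xi N) a w"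
proof -
  have "cond_sampling.cmean (MM N) (kk N) (y N v) w
      = (\<Sum>i=1..Suc N. W N i w * (\<integral>x'. a (xi N i w) * p (xi N i w) x' * (om (xi N i w) x' * G N v x') \<partial>L)) / A N w"
    unfolding y_def[abs_def] by (rule cmean_eq[OF w e_meas[OF v] e_bd[OF v]])
  also have "\<dots> = (\<Sum>i=1..Suc N. W N i w * K1 (G N v) (xi N i w)) / A N w"
  proof (intro arg_cong2[where f="(/)"] sum.cong refl)
    fix i assume i: "i \<in> {1..Suc N}"
    have "(\<integral>x'. a (xi N i w) * p (xi N i w) x' * (om (xi N i w) x' * G N v x') \<partial>L) = K1 (G N v) (xi N i w)"
      unfolding K1_def by (intro Bochner_Integration.integral_cong refl) (simp add: \<kappa>_eq[OF xi_sp[OF i w]])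
    then show "W N i w * (\<integral>x'. a (xi N i w) * p (xi N i w) x' * (om (xi N i w) x' * G N v x') \<partial>L) = W N i w * K1 (G N v) (xi N i w)"
      by (simp only:)
  qed
  finally show ?thesis unfolding ratio_scale .
qed

lemma cmean2_step:
  assumes w: "w \<in> space (P N)" and v: "v \<in> space (Q N)"
  shows "cond_sampling.cmean (MM N) (kk N) (\<lambda>w z. (y N v w z)\<^sup>2) w
    = emp (Suc N) (W N) (xi N) (K2 (G N v)) w / emp (Suc N) (W N) (xi N) a w"
proof -
  have m: "(\<lambda>(x, x'). (om x x' * G N v x')\<^sup>2) \<in> borel_measurable (L \<Otimes>\<^sub>M L)"
    using borel_measurable_power[OF e_meas[OF v], of 2] by (simp only: case_prod_unfold)
  have bd: "\<bar>(om x x' * G N v x')\<^sup>2\<bar> \<le> (Com * C)\<^sup>2" if "x \<in> space L" "x' \<in> space L" for x x'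
    using abs_le_imp_square_le[OF e_bd[OF v that]] by (simp only: abs_power2)
  have "cond_sampling.cmean (MM N) (kk N) (\<lambda>w z. (y N v w z)\<^sup>2) w
      = (\<Sum>i=1..Suc N. W N i w * (\<integral>x'. a (xi N i w) * p (xi N i w) x' * (om (xi N i w) x' * G N v x')\<^sup>2 \<partial>L)) / A N w"
    unfolding y_def[abs_def] by (rule cmean_eq[OF w m bd])
  also have "\<dots> = (\<Sum>i=1..Suc N. W N i w * K2 (G N v) (xi N i w)) / A N w"
  proof (intro arg_cong2[where f="(/)"] sum.cong refl)
    fix i assume i: "i \<in> {1..Suc N}"
    have "(\<integral>x'. a (xi N i w) * p (xi N i w) x' * (om (xi N i w) x' * G N v x')\<^sup>2 \<partial>L) = K2 (G N v) (xi N i w)"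
      unfolding K2_def
      by (intro Bochner_Integration.integral_cong refl) (simp add: \<kappa>_eq[OF xi_sp[OF i w]] power2_eq_square)
    then show "W N i w * (\<integral>x'. a (xi N i w) * p (xi N i w) x' * (om (xi N i w) x' * G N v x')\<^sup>2 \<partial>L) = W N i w * K2 (G N v) (xi N i w)"
      by (simp only:)
  qed
  finally show ?thesis unfolding ratio_scale .
qed

lemma smean_step:
  assumes w: "w \<in> space (P N)"
  shows "cond_sampling.smean (Suc N) (ZZ N) (y N v) w = emp (Suc N) (W' N) (xi' N) (G N v) w"
  unfolding cond_sampling.smean_def[OF cond_sampling_step] emp_def y_def
  by (intro arg_cong2[where f="(/)"] sum.cong refl) (simp add: W'_eq[OF _ w])

lemma phi'_f: "(\<integral>x. f x \<partial>\<phi>') * (\<integral>x. (\<integral>x'. \<kappa> x x' \<partial>L) \<partial>\<phi>) = (\<integral>x. K1 f x \<partial>\<phi>)"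
  unfolding K1_def by (rule phi'[OF f_meas f_bd])

lemma mean_limit: "c' * (\<integral>x. f x \<partial>\<phi>') = (\<integral>x. K1 f x \<partial>\<phi>) / (\<integral>x. a x \<partial>\<phi>)"
  unfolding c'_def using phi'_f by (simp add: mult_ac)

lemma mean_ratio_conv:
  "(\<lambda>N. \<integral>(w, v). \<bar>emp (Suc N) (W N) (xi N) (K1 (G N v)) w / emp (Suc N) (W N) (xi N) a w - c' * (\<integral>x. f x \<partial>\<phi>')\<bar> \<partial>(P N \<Otimes>\<^sub>M Q N)) \<longlonglongrightarrow> 0"
  unfolding mean_limit
  by (rule ratio_conv[OF rc_K1, where K="Com * C"])
     (auto intro!: mult_nonneg_nonneg Com C_nn K1_le G_v_meas G_bd)

lemma lln_step_aux:
  "(\<lambda>N. \<integral>(w, v). \<bar>emp (Suc N) (W' N) (xi' N) (G N v) w - c' * (\<integral>x. f x \<partial>\<phi>')\<bar> \<partial>(P N \<Otimes>\<^sub>M Q N)) \<longlonglongrightarrow> 0"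
proof -
  have "(\<lambda>N. \<integral>(w, v). \<bar>cond_sampling.smean (Suc N) (ZZ N) (y N v) w - c' * (\<integral>x. f x \<partial>\<phi>')\<bar> \<partial>(P N \<Otimes>\<^sub>M Q N)) \<longlonglongrightarrow> 0"
  proof (rule smean_lln_seq[OF cs_rand_step])
    have "(\<integral>(w, v). \<bar>cond_sampling.cmean (MM N) (kk N) (y N v) w - c' * (\<integral>x. f x \<partial>\<phi>')\<bar> \<partial>(P N \<Otimes>\<^sub>M Q N))
       = (\<integral>(w, v). \<bar>emp (Suc N) (W N) (xi N) (K1 (G N v)) w / emp (Suc N) (W N) (xi N) a w - c' * (\<integral>x. f x \<partial>\<phi>')\<bar> \<partial>(P N \<Otimes>\<^sub>M Q N))" for N
      by (rule Bochner_Integration.integral_cong[OF refl]) (auto simp: space_pair_measure cmean_step)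
    then show "(\<lambda>N. \<integral>(w, v). \<bar>cond_sampling.cmean (MM N) (kk N) (y N v) w - c' * (\<integral>x. f x \<partial>\<phi>')\<bar> \<partial>(P N \<Otimes>\<^sub>M Q N)) \<longlonglongrightarrow> 0"
      using mean_ratio_conv by simp
  qed
  moreover have "(\<integral>(w, v). \<bar>cond_sampling.smean (Suc N) (ZZ N) (y N v) w - c' * (\<integral>x. f x \<partial>\<phi>')\<bar> \<partial>(P N \<Otimes>\<^sub>M Q N))
     = (\<integral>(w, v). \<bar>emp (Suc N) (W' N) (xi' N) (G N v) w - c' * (\<integral>x. f x \<partial>\<phi>')\<bar> \<partial>(P N \<Otimes>\<^sub>M Q N))" for N
    by (rule Bochner_Integration.integral_cong[OF refl]) (auto simp: space_pair_measure smean_step)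
  ultimately show ?thesis by simp
qed

text \<open>Two sources of variance: the centred part contributes
  \<open>\<sigma> / c'\<^sup>2\<close>, and the conditional mean, a ratio of averages over the old
  sample, inherits the central limit theorem for the test functions \<open>K1 (G N v)\<close>. With
  \<open>c' = q / r\<close> their sum is the recursion for the variance.\<close>

lemma clt_step_aux:
  assumes clt: "sample_clt L P W xi \<phi> c \<Gamma>"
    and f0: "(\<integral>x. f x \<partial>\<phi>') = 0"
    and lim: "cf_lim Q (\<lambda>N v. sqrt (Suc N) * (\<integral>x. G N v x \<partial>\<phi>')) V"
  shows "cf_lim (\<lambda>N. P N \<Otimes>\<^sub>M Q N)
         (\<lambda>N (w, v). sqrt (Suc N) * emp (Suc N) (W' N) (xi' N) (G N v) w * (1 / c'))
         ((\<Gamma> (K1 f) + (\<integral>x. K2 f x \<partial>\<phi>) * (\<integral>x. a x \<partial>\<phi>)) / (\<integral>x. (\<integral>x'. \<kappa> x x' \<partial>L) \<partial>\<phi>)\<^sup>2 + V)"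
proof -
  define q where "q = (\<integral>x. (\<integral>x'. \<kappa> x x' \<partial>L) \<partial>\<phi>)"
  define r where "r = (\<integral>x. a x \<partial>\<phi>)"
  have q: "0 < q" and r: "0 < r" using phi_pos phi_a_pos by (auto simp: q_def r_def)
  have c'_eq: "c' = q / r" by (simp add: c'_def q_def r_def)
  \<comment> \<open>Limit of the conditional variance. Only the second moment contributes, since the
    conditional mean tends to \<open>c'\<close> times the integral of \<open>f\<close>, which is
    0.\<close>
  define \<sigma> where "\<sigma> = (\<integral>x. K2 f x \<partial>\<phi>) / r"
  let ?m = "\<lambda>N (w, v). emp (Suc N) (W N) (xi N) (K1 (G N v)) w / emp (Suc N) (W N) (xi N) a w"
  let ?A = "\<lambda>N (w, v). emp (Suc N) (W N) (xi N) (K2 (G N v)) w / emp (Suc N) (W N) (xi N) a w"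
  have pp: "prob_space (P N \<Otimes>\<^sub>M Q N)" for N
  proof -
    interpret p: prob_space "P N" by (rule prob)
    interpret q: prob_space "Q N" by (rule Q)
    interpret pair_prob_space "P N" "Q N" ..
    show ?thesis by unfold_locales
  qed
  have K1f0: "(\<integral>x. K1 f x \<partial>\<phi>) = 0" using phi'_f f0 by simp
  have m_meas: "?m N \<in> borel_measurable (P N \<Otimes>\<^sub>M Q N)" for N
    using borel_measurable_divide[OF emp_int(2)[OF rc_K1, of N] emp_int(2)[OF rc_a, of N]] by (simp only: case_prod_unfold)
  have A_meas': "?A N \<in> borel_measurable (P N \<Otimes>\<^sub>M Q N)" for N
    using borel_measurable_divide[OF emp_int(2)[OF rc_K2, of N] emp_int(2)[OF rc_a, of N]] by (simp only: case_prod_unfold)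
  have quot_le: "\<bar>s / t\<bar> \<le> K" if "\<bar>s\<bar> \<le> K * t" "0 \<le> t" "0 \<le> K" for s t K :: real
    using that by (cases "t = 0") (auto simp: abs_divide field_simps)
  have m_bd: "\<bar>?m N x\<bar> \<le> Com * C" if x: "x \<in> space (P N \<Otimes>\<^sub>M Q N)" for N x
  proof -
    obtain w v where wv: "x = (w, v)" "w \<in> space (P N)" "v \<in> space (Q N)"
      using x by (auto simp: space_pair_measure)
    show ?thesis
      unfolding wv(1) prod.case
      by (intro quot_le emp_dominated[OF wv(2)] emp_a_nn[OF wv(2)] K1_le G_v_meas[OF wv(3)] G_bd[OF wv(3)] C_nn mult_nonneg_nonneg Com)
  qed
  have A_bd: "\<bar>?A N x\<bar> \<le> Com * Com * C\<^sup>2" if x: "x \<in> space (P N \<Otimes>\<^sub>M Q N)" for N x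
  proof -
    obtain w v where wv: "x = (w, v)" "w \<in> space (P N)" "v \<in> space (Q N)"
      using x by (auto simp: space_pair_measure)
    show ?thesis
      unfolding wv(1) prod.case
      by (intro quot_le emp_dominated[OF wv(2)] emp_a_nn[OF wv(2)] K2_le G_v_meas[OF wv(3)] G_bd[OF wv(3)] mult_nonneg_nonneg Com zero_le_power2)
  qed
  have A_int: "integrable (P N \<Otimes>\<^sub>M Q N) (?A N)" for N
  proof -
    interpret pq: prob_space "P N \<Otimes>\<^sub>M Q N" by (rule pp)
    show ?thesis
    proof (rule pq.integrable_const_bound[OF _ A_meas'])
      show "AE x in P N \<Otimes>\<^sub>M Q N. norm (?A N x) \<le> Com * Com * C\<^sup>2"
        unfolding real_norm_def by (rule AE_I2[OF A_bd])
    qed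
  qed
  have A_conv: "(\<lambda>N. \<integral>x. \<bar>?A N x - \<sigma>\<bar> \<partial>(P N \<Otimes>\<^sub>M Q N)) \<longlonglongrightarrow> 0"
    using ratio_conv[OF rc_K2, where K="Com * Com * C\<^sup>2"] K2_le[OF G_v_meas G_bd] Com
    unfolding \<sigma>_def r_def by (simp add: case_prod_unfold)
  have m_conv: "(\<lambda>N. \<integral>x. \<bar>?m N x - 0\<bar> \<partial>(P N \<Otimes>\<^sub>M Q N)) \<longlonglongrightarrow> 0"
    using mean_ratio_conv unfolding f0 by (simp add: case_prod_unfold)
  have cvar_conv: "(\<lambda>N. \<integral>(w, v). \<bar>cond_sampling.cvar (MM N) (kk N) (y N v) w - \<sigma>\<bar> \<partial>(P N \<Otimes>\<^sub>M Q N)) \<longlonglongrightarrow> 0"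
  proof -
    have "(\<integral>(w, v). \<bar>cond_sampling.cvar (MM N) (kk N) (y N v) w - \<sigma>\<bar> \<partial>(P N \<Otimes>\<^sub>M Q N))
        = (\<integral>x. \<bar>?A N x - (?m N x)\<^sup>2 - \<sigma>\<bar> \<partial>(P N \<Otimes>\<^sub>M Q N))" for N
    proof (rule Bochner_Integration.integral_cong[OF refl])
      fix x assume x: "x \<in> space (P N \<Otimes>\<^sub>M Q N)"
      then obtain w v where wv: "x = (w, v)" "w \<in> space (P N)" "v \<in> space (Q N)"
        by (auto simp: space_pair_measure)
      show "(case x of (w, v) \<Rightarrow> \<bar>cond_sampling.cvar (MM N) (kk N) (y N v) w - \<sigma>\<bar>) = \<bar>?A N x - (?m N x)\<^sup>2 - \<sigma>\<bar>"
        unfolding wv(1) prod.case cond_sampling.cvar_def[OF cond_sampling_step] cmean_step[OF wv(2,3)] cmean2_step[OF wv(2,3)] ..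
    qed
    then show ?thesis using variance_L1_conv[OF pp A_int m_meas m_bd A_conv m_conv] by simp
  qed
  have \<sigma>_nn: "0 \<le> \<sigma>"
    unfolding \<sigma>_def K2_def using r om\<kappa>_nn
    by (intro divide_nonneg_nonneg Bochner_Integration.integral_nonneg) (auto simp: phi_space)
  \<comment> \<open>\<open>K1 (G N v)\<close> has \<open>\<phi>\<close>-integral equal to
    \<open>q\<close> times the \<open>\<phi>'\<close>-integral of \<open>G N v\<close>, so its
    fluctuation has variance \<open>q\<^sup>2 * V\<close>; the later division by
    \<open>q\<^sup>2\<close> restores \<open>V\<close>.\<close>
  have ih: "cf_lim (\<lambda>N. P N \<Otimes>\<^sub>M Q N)
         (\<lambda>N (w, v). sqrt (Suc N) * emp (Suc N) (W N) (xi N) (K1 (G N v)) w * (1 / c)) (\<Gamma> (K1 f) + q\<^sup>2 * V)"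
  proof -
    have "cf_lim Q (\<lambda>N v. sqrt (Suc N) * (\<integral>x. G N v x \<partial>\<phi>') * q) (q\<^sup>2 * V)"
      by (rule cf_lim_scale[OF lim])
    then have "cf_lim Q (\<lambda>N v. sqrt (Suc N) * (\<integral>x. K1 (G N v) x \<partial>\<phi>)) (q\<^sup>2 * V)"
    proof (rule cf_lim_cong[THEN iffD1, rotated])
      fix N v assume v: "v \<in> space (Q N)"
      have "(\<integral>x. G N v x \<partial>\<phi>') * q = (\<integral>x. K1 (G N v) x \<partial>\<phi>)"
        unfolding q_def K1_def by (rule phi'[OF G_v_meas[OF v] G_bd[OF v]])
      then show "sqrt (Suc N) * (\<integral>x. G N v x \<partial>\<phi>') * q = sqrt (Suc N) * (\<integral>x. K1 (G N v) x \<partial>\<phi>)"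
        by (simp only: mult.assoc)
    qed
    with clt Q rc_K1 K1f0 show ?thesis unfolding sample_clt_def by blast
  qed
  \<comment> \<open>Multiplying by \<open>c / c'\<close> over the average of \<open>a\<close> turns
    the old average scaled by \<open>1 / c\<close> into the conditional mean scaled by
    \<open>1 / c'\<close>. The limit of this factor equals \<open>1 / q\<close>.\<close>
  have S_conv: "(\<lambda>N. \<integral>x. min 1 \<bar>(c / c') / (case x of (w, v) \<Rightarrow> emp (Suc N) (W N) (xi N) a w) - (c / c') / (c * r)\<bar> \<partial>(P N \<Otimes>\<^sub>M Q N)) \<longlonglongrightarrow> 0"
    using lln_use[OF rc_a] emp_int[OF rc_a] c_pos r unfolding r_def[symmetric]
    by (intro inverse_conv_in_prob pp) auto
  have slut: "cf_lim (\<lambda>N. P N \<Otimes>\<^sub>M Q N) (\<lambda>N x. (case x of (w, v) \<Rightarrow> sqrt (Suc N) * emp (Suc N) (W N) (xi N) (K1 (G N v)) w * (1 / c))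
      * ((c / c') / (case x of (w, v) \<Rightarrow> emp (Suc N) (W N) (xi N) a w)))
      (((c / c') / (c * r))\<^sup>2 * (\<Gamma> (K1 f) + q\<^sup>2 * V))"
  proof (rule cf_lim_slutsky[OF ih pp _ _ S_conv])
    show "(\<lambda>(w, v). sqrt (Suc N) * emp (Suc N) (W N) (xi N) (K1 (G N v)) w * (1 / c)) \<in> borel_measurable (P N \<Otimes>\<^sub>M Q N)" for N
      using borel_measurable_times[OF borel_measurable_times[OF borel_measurable_const emp_int(2)[OF rc_K1, of N]] borel_measurable_const, of "sqrt (Suc N)" "1 / c"]
      by (simp only: case_prod_unfold)
    show "(\<lambda>x. (c / c') / (case x of (w, v) \<Rightarrow> emp (Suc N) (W N) (xi N) a w)) \<in> borel_measurable (P N \<Otimes>\<^sub>M Q N)" for N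
      by (rule borel_measurable_divide[OF borel_measurable_const emp_int(2)[OF rc_a, of N]])
  qed
  have limB: "cf_lim (\<lambda>N. P N \<Otimes>\<^sub>M Q N) (\<lambda>N (w, v). sqrt (Suc N) * cond_sampling.cmean (MM N) (kk N) (y N v) w * (1 / c'))
      (((c / c') / (c * r))\<^sup>2 * (\<Gamma> (K1 f) + q\<^sup>2 * V))"
    using slut
  proof (rule cf_lim_cong[THEN iffD1, rotated])
    fix N x assume x: "x \<in> space (P N \<Otimes>\<^sub>M Q N)"
    then obtain w v where wv: "x = (w, v)" "w \<in> space (P N)" "v \<in> space (Q N)"
      by (auto simp: space_pair_measure)
    show "(case x of (w, v) \<Rightarrow> sqrt (Suc N) * emp (Suc N) (W N) (xi N) (K1 (G N v)) w * (1 / c))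
      * ((c / c') / (case x of (w, v) \<Rightarrow> emp (Suc N) (W N) (xi N) a w))
      = (case x of (w, v) \<Rightarrow> sqrt (Suc N) * cond_sampling.cmean (MM N) (kk N) (y N v) w * (1 / c'))"
      unfolding wv(1) prod.case cmean_step[OF wv(2,3)] using c_pos by simp
  qed
  have "cf_lim (\<lambda>N. P N \<Otimes>\<^sub>M Q N)
      (\<lambda>N (w, v). sqrt (Suc N) * cond_sampling.smean (Suc N) (ZZ N) (y N v) w * (1 / c'))
      ((1 / c')\<^sup>2 * \<sigma> + ((c / c') / (c * r))\<^sup>2 * (\<Gamma> (K1 f) + q\<^sup>2 * V))"
    by (rule smean_clt_seq[OF cs_rand_step \<sigma>_nn cvar_conv limB])
  then have "cf_lim (\<lambda>N. P N \<Otimes>\<^sub>M Q N)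
         (\<lambda>N (w, v). sqrt (Suc N) * emp (Suc N) (W' N) (xi' N) (G N v) w * (1 / c'))
      ((1 / c')\<^sup>2 * \<sigma> + ((c / c') / (c * r))\<^sup>2 * (\<Gamma> (K1 f) + q\<^sup>2 * V))"
    by (rule cf_lim_cong[THEN iffD1, rotated]) (auto simp: smean_step space_pair_measure)
  moreover have "(1 / c')\<^sup>2 * \<sigma> + ((c / c') / (c * r))\<^sup>2 * (\<Gamma> (K1 f) + q\<^sup>2 * V)
      = (\<Gamma> (K1 f) + (\<integral>x. K2 f x \<partial>\<phi>) * r) / q\<^sup>2 + V"
    unfolding c'_eq \<sigma>_def using q r c_pos by (simp add: field_simps power2_eq_square)
  ultimately show ?thesis by (simp only: q_def r_def)
qed

end

theorem lln_step:
  assumes "0 < c" "sample_lln L P W xi \<phi> c"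
  shows "sample_lln L P W' xi' \<phi>' c'"
  unfolding sample_lln_def using lln_step_aux assms by blast

theorem clt_step:
  assumes "0 < c" "sample_lln L P W xi \<phi> c" "sample_clt L P W xi \<phi> c \<Gamma>"
  shows "sample_clt L P W' xi' \<phi>' c' (\<lambda>f. (\<Gamma> (K1 f) + (\<integral>x. K2 f x \<partial>\<phi>) * (\<integral>x. a x \<partial>\<phi>)) / (\<integral>x. (\<integral>x'. \<kappa> x x' \<partial>L) \<partial>\<phi>)\<^sup>2)"
  unfolding sample_clt_def using clt_step_aux assms by blast

end

section \<open>Iterating the filter\<close>

definition normalize_measure :: "'a measure \<Rightarrow> 'a measure" where
  "normalize_measure \<eta> = density \<eta> (\<lambda>_. 1 / emeasure \<eta> (space \<eta>))"

lemma sets_normalize_measure[simp]: "sets (normalize_measure \<eta>) = sets \<eta>"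
  by (simp add: normalize_measure_def)

lemma space_normalize_measure[simp]: "space (normalize_measure \<eta>) = space \<eta>"
  by (simp add: normalize_measure_def)

lemma emeasure_eq_measure_finite:
  assumes "emeasure \<eta> (space \<eta>) < \<infinity>"
  shows "emeasure \<eta> (space \<eta>) = ennreal (measure \<eta> (space \<eta>))"
  using assms by (intro emeasure_eq_ennreal_measure) auto

lemma normalize_measure_eq:
  assumes "emeasure \<eta> (space \<eta>) < \<infinity>" "0 < emeasure \<eta> (space \<eta>)"
  shows "normalize_measure \<eta> = density \<eta> (\<lambda>_. ennreal (1 / measure \<eta> (space \<eta>)))" "0 < measure \<eta> (space \<eta>)"
proof -
  note e = emeasure_eq_measure_finite[OF assms(1)]
  show "0 < measure \<eta> (space \<eta>)" using assms(2) unfolding e by simp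
  then have "1 / ennreal (measure \<eta> (space \<eta>)) = ennreal (1 / measure \<eta> (space \<eta>))"
    by (metis divide_ennreal ennreal_1 zero_le_one)
  then show "normalize_measure \<eta> = density \<eta> (\<lambda>_. ennreal (1 / measure \<eta> (space \<eta>)))"
    unfolding normalize_measure_def e by simp
qed

lemma prob_space_normalize_measure:
  assumes "emeasure \<eta> (space \<eta>) < \<infinity>" "0 < emeasure \<eta> (space \<eta>)"
  shows "prob_space (normalize_measure \<eta>)"
proof (rule prob_spaceI)
  have "emeasure (normalize_measure \<eta>) (space \<eta>) = 1 / emeasure \<eta> (space \<eta>) * emeasure \<eta> (space \<eta>)"
    unfolding normalize_measure_def by (subst emeasure_density_const) auto
  also have "\<dots> = 1"
    using assms by (simp add: ennreal_divide_times ennreal_divide_self)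
  finally show "emeasure (normalize_measure \<eta>) (space (normalize_measure \<eta>)) = 1" by simp
qed

lemma integral_normalize_measure:
  fixes f :: "'a \<Rightarrow> real"
  assumes "emeasure \<eta> (space \<eta>) < \<infinity>" "0 < emeasure \<eta> (space \<eta>)" "f \<in> borel_measurable \<eta>"
  shows "(\<integral>x. f x \<partial>normalize_measure \<eta>) = (\<integral>x. f x \<partial>\<eta>) / measure \<eta> (space \<eta>)"
  unfolding normalize_measure_eq(1)[OF assms(1,2)]
  using normalize_measure_eq(2)[OF assms(1,2)] assms(3)
  by (subst integral_density) auto

text \<open>Transport of a finite measure by a kernel with density. Tonelli gives the identity for
  nonnegative functions and the finite mass; bounded real functions are reduced to nonnegative ones
  by adding a constant.\<close>

lemma integral_kernel_measure:
  fixes \<kappa> :: "'a \<Rightarrow> 'a \<Rightarrow> real" and f :: "'a \<Rightarrow> real"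
  assumes sf: "sigma_finite_measure L" and fin: "finite_measure \<eta>" and sets: "sets \<eta> = sets L"
    and \<kappa>_meas: "(\<lambda>(x, x'). \<kappa> x x') \<in> borel_measurable (L \<Otimes>\<^sub>M L)"
    and \<kappa>_nn: "\<And>x x'. x \<in> space L \<Longrightarrow> x' \<in> space L \<Longrightarrow> 0 \<le> \<kappa> x x'"
    and \<kappa>_int: "\<And>x. x \<in> space L \<Longrightarrow> (\<integral>\<^sup>+x'. ennreal (\<kappa> x x') \<partial>L) \<le> ennreal D" and D: "0 \<le> D"
  defines "\<nu> \<equiv> density L (\<lambda>x'. \<integral>\<^sup>+x. ennreal (\<kappa> x x') \<partial>\<eta>)"
  shows "h \<in> borel_measurable L \<Longrightarrow> (\<integral>\<^sup>+x. h x \<partial>\<nu>) = (\<integral>\<^sup>+x. (\<integral>\<^sup>+x'. ennreal (\<kappa> x x') * h x' \<partial>L) \<partial>\<eta>)"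
    and "emeasure \<nu> (space \<nu>) < \<infinity>"
    and "f \<in> borel_measurable L \<Longrightarrow> (\<And>x. x \<in> space L \<Longrightarrow> \<bar>f x\<bar> \<le> C) \<Longrightarrow>
      (\<integral>x. f x \<partial>\<nu>) = (\<integral>x. (\<integral>x'. \<kappa> x x' * f x' \<partial>L) \<partial>\<eta>)"
proof -
  interpret L: sigma_finite_measure L by fact
  interpret E: finite_measure \<eta> by fact
  interpret EL: pair_sigma_finite \<eta> L ..
  have sp: "space \<eta> = space L" using sets by (rule sets_eq_imp_space_eq)
  have \<kappa>_EL: "(\<lambda>(x, x'). \<kappa> x x') \<in> borel_measurable (\<eta> \<Otimes>\<^sub>M L)"
    unfolding measurable_cong_sets[OF sets_pair_measure_cong[OF sets refl] refl] by (rule \<kappa>_meas)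
  have \<kappa>x: "\<kappa> x \<in> borel_measurable L" if "x \<in> space L" for x
    using measurable_compose[OF measurable_Pair1' \<kappa>_meas, OF that] by simp
  have dens: "(\<lambda>x'. \<integral>\<^sup>+x. ennreal (\<kappa> x x') \<partial>\<eta>) \<in> borel_measurable L"
  proof -
    have "(\<lambda>(x', x). ennreal (\<kappa> x x')) \<in> borel_measurable (L \<Otimes>\<^sub>M \<eta>)"
      using measurable_compose[OF measurable_pair_swap' measurable_compose[OF \<kappa>_EL measurable_ennreal]]
      by (simp add: case_prod_unfold)
    then show ?thesis by (rule E.borel_measurable_nn_integral)
  qed
  have nn: "(\<integral>\<^sup>+x. h x \<partial>\<nu>) = (\<integral>\<^sup>+x. (\<integral>\<^sup>+x'. ennreal (\<kappa> x x') * h x' \<partial>L) \<partial>\<eta>)"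
    if h: "h \<in> borel_measurable L" for h
  proof -
    have "(\<integral>\<^sup>+x. h x \<partial>\<nu>) = (\<integral>\<^sup>+x'. (\<integral>\<^sup>+x. ennreal (\<kappa> x x') \<partial>\<eta>) * h x' \<partial>L)"
      unfolding \<nu>_def by (rule nn_integral_density[OF dens h])
    also have "\<dots> = (\<integral>\<^sup>+x'. \<integral>\<^sup>+x. ennreal (\<kappa> x x') * h x' \<partial>\<eta> \<partial>L)"
    proof (rule nn_integral_cong)
      fix x' assume "x' \<in> space L"
      then have "(\<lambda>x. \<kappa> x x') \<in> borel_measurable \<eta>"
        using measurable_compose[OF measurable_Pair2' \<kappa>_EL] by simp
      then show "(\<integral>\<^sup>+x. ennreal (\<kappa> x x') \<partial>\<eta>) * h x' = (\<integral>\<^sup>+x. ennreal (\<kappa> x x') * h x' \<partial>\<eta>)"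
        by (intro nn_integral_multc[symmetric]) auto
    qed
    also have "\<dots> = (\<integral>\<^sup>+x. (\<integral>\<^sup>+x'. ennreal (\<kappa> x x') * h x' \<partial>L) \<partial>\<eta>)"
    proof (rule EL.Fubini')
      show "(\<lambda>(x, x'). ennreal (\<kappa> x x') * h x') \<in> borel_measurable (\<eta> \<Otimes>\<^sub>M L)"
        using borel_measurable_times_ennreal[OF measurable_compose[OF \<kappa>_EL measurable_ennreal] measurable_compose[OF measurable_snd h]]
        by (simp add: case_prod_unfold)
    qed
    finally show ?thesis .
  qed
  then show "h \<in> borel_measurable L \<Longrightarrow> (\<integral>\<^sup>+x. h x \<partial>\<nu>) = (\<integral>\<^sup>+x. (\<integral>\<^sup>+x'. ennreal (\<kappa> x x') * h x' \<partial>L) \<partial>\<eta>)" .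
  have sets_\<nu>: "sets \<nu> = sets L" "space \<nu> = space L" by (simp_all add: \<nu>_def)
  have "emeasure \<nu> (space \<nu>) = (\<integral>\<^sup>+x. 1 \<partial>\<nu>)" by simp
  also have "\<dots> = (\<integral>\<^sup>+x. (\<integral>\<^sup>+x'. ennreal (\<kappa> x x') * 1 \<partial>L) \<partial>\<eta>)" by (rule nn) simp
  also have "\<dots> \<le> (\<integral>\<^sup>+x. ennreal D \<partial>\<eta>)"
    using \<kappa>_int by (intro nn_integral_mono) (simp add: sp)
  also have "\<dots> < \<infinity>"
    using E.emeasure_finite by (simp add: ennreal_mult_eq_top_iff less_top[symmetric])
  finally show fin_\<nu>: "emeasure \<nu> (space \<nu>) < \<infinity>" .
  interpret N: finite_measure \<nu> by (rule finite_measureI) (use fin_\<nu> in simp)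
  assume f: "f \<in> borel_measurable L" and bd: "\<And>x. x \<in> space L \<Longrightarrow> \<bar>f x\<bar> \<le> C"
  \<comment> \<open>\<open>B\<close> is nonnegative and bounds \<open>f\<close>, so both
    \<open>f + B\<close> and the constant \<open>B\<close> are covered by the nonnegative case; the
    claim is their difference.\<close>
  define B where "B = max C 0"
  have B: "0 \<le> B" "\<And>x. x \<in> space L \<Longrightarrow> \<bar>f x\<bar> \<le> B" using bd by (auto simp: B_def intro: le_max_iff_disj[THEN iffD2])
  have bo: "(\<integral>x. g x \<partial>\<nu>) = (\<integral>x. (\<integral>x'. \<kappa> x x' * g x' \<partial>L) \<partial>\<eta>)"
    if g: "g \<in> borel_measurable L" and gnn: "\<And>x. x \<in> space L \<Longrightarrow> 0 \<le> g x" and gle: "\<And>x. x \<in> space L \<Longrightarrow> g x \<le> R" and R: "0 \<le> R"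
    for g :: "'a \<Rightarrow> real" and R
  proof -
    have g_abs: "\<And>x. x \<in> space L \<Longrightarrow> \<bar>g x\<bar> \<le> R" using gnn gle by auto
    note k = abs_kernel_integral_le[OF \<kappa>x \<kappa>_nn \<kappa>_int D g g_abs R]
    have "(\<integral>x. g x \<partial>\<nu>) = enn2real (\<integral>\<^sup>+x. ennreal (g x) \<partial>\<nu>)"
      using g gnn by (intro integral_eq_nn_integral) (auto simp: \<nu>_def)
    also have "(\<integral>\<^sup>+x. ennreal (g x) \<partial>\<nu>) = (\<integral>\<^sup>+x. (\<integral>\<^sup>+x'. ennreal (\<kappa> x x') * ennreal (g x') \<partial>L) \<partial>\<eta>)"
      using g by (intro nn) measurable
    also have "\<dots> = (\<integral>\<^sup>+x. ennreal (\<integral>x'. \<kappa> x x' * g x' \<partial>L) \<partial>\<eta>)"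
    proof (rule nn_integral_cong)
      fix x assume "x \<in> space \<eta>"
      then have x: "x \<in> space L" by (simp add: sp)
      have "(\<integral>\<^sup>+x'. ennreal (\<kappa> x x') * ennreal (g x') \<partial>L) = (\<integral>\<^sup>+x'. ennreal (\<kappa> x x' * g x') \<partial>L)"
        by (rule nn_integral_cong) (simp add: ennreal_mult \<kappa>_nn[OF x] gnn)
      also have "\<dots> = ennreal (\<integral>x'. \<kappa> x x' * g x' \<partial>L)"
        using k(1)[OF x] \<kappa>_nn[OF x] gnn x by (intro nn_integral_eq_integral) auto
      finally show "(\<integral>\<^sup>+x'. ennreal (\<kappa> x x') * ennreal (g x') \<partial>L) = ennreal (\<integral>x'. \<kappa> x x' * g x' \<partial>L)" .
    qed
    also have "enn2real \<dots> = (\<integral>x. (\<integral>x'. \<kappa> x x' * g x' \<partial>L) \<partial>\<eta>)"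
    proof (rule integral_eq_nn_integral[symmetric])
      have "(\<lambda>(x, x'). \<kappa> x x' * g x') \<in> borel_measurable (\<eta> \<Otimes>\<^sub>M L)"
        using borel_measurable_times[OF \<kappa>_EL measurable_compose[OF measurable_snd g]] by (simp add: case_prod_unfold)
      then show "(\<lambda>x. \<integral>x'. \<kappa> x x' * g x' \<partial>L) \<in> borel_measurable \<eta>"
        by (rule L.borel_measurable_lebesgue_integral)
      show "AE x in \<eta>. 0 \<le> (\<integral>x'. \<kappa> x x' * g x' \<partial>L)"
        using \<kappa>_nn gnn by (intro AE_I2 Bochner_Integration.integral_nonneg) (simp add: sp)
    qed
    finally show ?thesis .
  qed
  have int_f: "integrable \<nu> f"
    using B f by (intro N.integrable_const_bound[where B=B]) (auto simp: \<nu>_def)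
  have shift: "(\<integral>x. f x + B \<partial>\<nu>) = (\<integral>x. (\<integral>x'. \<kappa> x x' * (f x' + B) \<partial>L) \<partial>\<eta>)"
  proof (rule bo[where R="2 * B"])
    show "0 \<le> f x + B" "f x + B \<le> 2 * B" if "x \<in> space L" for x using B(2)[OF that] by linarith+
  qed (use f B in auto)
  have cst: "(\<integral>x. B \<partial>\<nu>) = (\<integral>x. (\<integral>x'. \<kappa> x x' * B \<partial>L) \<partial>\<eta>)"
    using B by (intro bo[where R=B]) auto
  have kint: "integrable \<eta> (\<lambda>x. \<integral>x'. \<kappa> x x' * g x' \<partial>L)"
    if g: "g \<in> borel_measurable L" and gle: "\<And>x. x \<in> space L \<Longrightarrow> \<bar>g x\<bar> \<le> R" and R: "0 \<le> R" for g :: "'a \<Rightarrow> real" and R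
  proof (rule E.integrable_const_bound[where B="D * R"])
    have "(\<lambda>(x, x'). \<kappa> x x' * g x') \<in> borel_measurable (\<eta> \<Otimes>\<^sub>M L)"
      using borel_measurable_times[OF \<kappa>_EL measurable_compose[OF measurable_snd g]] by (simp add: case_prod_unfold)
    then show "(\<lambda>x. \<integral>x'. \<kappa> x x' * g x' \<partial>L) \<in> borel_measurable \<eta>"
      by (rule L.borel_measurable_lebesgue_integral)
    show "AE x in \<eta>. norm (\<integral>x'. \<kappa> x x' * g x' \<partial>L) \<le> D * R"
      unfolding real_norm_def
      by (intro AE_I2 abs_kernel_integral_le(2)[OF \<kappa>x \<kappa>_nn \<kappa>_int D g gle R]) (auto simp: sp)
  qed
  have split: "(\<integral>x'. \<kappa> x x' * (f x' + B) \<partial>L) = (\<integral>x'. \<kappa> x x' * f x' \<partial>L) + (\<integral>x'. \<kappa> x x' * B \<partial>L)" if x: "x \<in> space L" for x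
    unfolding distrib_left
    by (intro Bochner_Integration.integral_add abs_kernel_integral_le(1)[OF \<kappa>x \<kappa>_nn \<kappa>_int D _ _ B(1)] x f B(2)) (auto simp: B(1))
  have "(\<integral>x. (\<integral>x'. \<kappa> x x' * (f x' + B) \<partial>L) \<partial>\<eta>) = (\<integral>x. (\<integral>x'. \<kappa> x x' * f x' \<partial>L) + (\<integral>x'. \<kappa> x x' * B \<partial>L) \<partial>\<eta>)"
    by (rule Bochner_Integration.integral_cong[OF refl]) (simp only: split sp)
  also have "\<dots> = (\<integral>x. (\<integral>x'. \<kappa> x x' * f x' \<partial>L) \<partial>\<eta>) + (\<integral>x. (\<integral>x'. \<kappa> x x' * B \<partial>L) \<partial>\<eta>)"
    by (intro Bochner_Integration.integral_add kint[OF f B(2) B(1)] kint[OF _ _ B(1)]) (auto simp: B(1))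
  finally have "(\<integral>x. f x + B \<partial>\<nu>) = (\<integral>x. (\<integral>x'. \<kappa> x x' * f x' \<partial>L) \<partial>\<eta>) + (\<integral>x. B \<partial>\<nu>)"
    unfolding shift cst .
  moreover have "(\<integral>x. f x + B \<partial>\<nu>) = (\<integral>x. f x \<partial>\<nu>) + (\<integral>x. B \<partial>\<nu>)"
    using int_f by (intro Bochner_Integration.integral_add) auto
  ultimately show "(\<integral>x. f x \<partial>\<nu>) = (\<integral>x. (\<integral>x'. \<kappa> x x' * f x' \<partial>L) \<partial>\<eta>)" by simp
qed

text \<open>The index \<open>n\<close> counts steps, so the chain may run forward or backward in
  time; transition data with index \<open>n\<close> lead from step \<open>n\<close> to
  \<open>Suc n\<close>. The measures \<open>\<eta> n\<close> stay unnormalised, which keeps their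
  recursion linear, and \<open>\<Gamma>\<close> is any functional obeying the variance
  recursion.\<close>

locale particle_chain =
  fixes L :: "'a measure" and H :: nat and \<rho> :: "'a measure" and w0 :: "'a \<Rightarrow> real" and C0 :: real
    and \<kappa> om p :: "nat \<Rightarrow> 'a \<Rightarrow> 'a \<Rightarrow> real" and a :: "nat \<Rightarrow> 'a \<Rightarrow> real" and Com Ca :: "nat \<Rightarrow> real"
    and \<eta> :: "nat \<Rightarrow> 'a measure" and \<Gamma> :: "nat \<Rightarrow> ('a \<Rightarrow> real) \<Rightarrow> real"
    and P :: "nat \<Rightarrow> 'w measure" and F :: "nat \<Rightarrow> nat \<Rightarrow> 'w measure"
    and I :: "nat \<Rightarrow> nat \<Rightarrow> nat \<Rightarrow> 'w \<Rightarrow> nat" and xi :: "nat \<Rightarrow> nat \<Rightarrow> nat \<Rightarrow> 'w \<Rightarrow> 'a"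
    and W :: "nat \<Rightarrow> nat \<Rightarrow> nat \<Rightarrow> 'w \<Rightarrow> real"
  assumes sf: "sigma_finite_measure L"
    and \<rho>_prob: "prob_space \<rho>" and \<rho>_sets: "sets \<rho> = sets L"
    and w0_meas: "w0 \<in> borel_measurable L" and w0_nn: "\<And>x. x \<in> space L \<Longrightarrow> 0 \<le> w0 x"
    and w0_le: "\<And>x. x \<in> space L \<Longrightarrow> w0 x \<le> C0" and C0: "0 \<le> C0"
    and a_meas: "\<And>n. n < H \<Longrightarrow> a n \<in> borel_measurable L"
    and a_nn: "\<And>n x. n < H \<Longrightarrow> x \<in> space L \<Longrightarrow> 0 \<le> a n x"
    and a_le: "\<And>n x. n < H \<Longrightarrow> x \<in> space L \<Longrightarrow> a n x \<le> Ca n"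
    and om_meas: "\<And>n. n < H \<Longrightarrow> (\<lambda>(x, x'). om n x x') \<in> borel_measurable (L \<Otimes>\<^sub>M L)"
    and om_nn: "\<And>n x x'. n < H \<Longrightarrow> x \<in> space L \<Longrightarrow> x' \<in> space L \<Longrightarrow> 0 \<le> om n x x'"
    and om_le: "\<And>n x x'. n < H \<Longrightarrow> x \<in> space L \<Longrightarrow> x' \<in> space L \<Longrightarrow> om n x x' \<le> Com n"
    and Com: "\<And>n. n < H \<Longrightarrow> 0 \<le> Com n" and Ca: "\<And>n. n < H \<Longrightarrow> 0 \<le> Ca n"
    and p_dens: "\<And>n. n < H \<Longrightarrow> markov_density L (p n)"
    and \<kappa>_meas: "\<And>n. n < H \<Longrightarrow> (\<lambda>(x, x'). \<kappa> n x x') \<in> borel_measurable (L \<Otimes>\<^sub>M L)"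
    and \<kappa>_eq: "\<And>n x x'. n < H \<Longrightarrow> x \<in> space L \<Longrightarrow> x' \<in> space L \<Longrightarrow> \<kappa> n x x' = om n x x' * (a n x * p n x x')"
    and \<eta>_0: "\<eta> 0 = density \<rho> (\<lambda>x. ennreal (w0 x))"
    and \<eta>_Suc: "\<And>n. n < H \<Longrightarrow> \<eta> (Suc n) = density L (\<lambda>x'. \<integral>\<^sup>+x. ennreal (\<kappa> n x x') \<partial>\<eta> n)"
    and \<eta>_pos: "\<And>n. n \<le> H \<Longrightarrow> 0 < emeasure (\<eta> n) (space L)"
    and \<Gamma>_0: "\<And>f. \<Gamma> 0 f = (\<integral>x. (w0 x)\<^sup>2 * (f x)\<^sup>2 \<partial>\<rho>) / (\<integral>x. w0 x \<partial>\<rho>)\<^sup>2"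
    and \<Gamma>_Suc: "\<And>n f. n < H \<Longrightarrow> \<Gamma> (Suc n) f =
      (\<Gamma> n (\<lambda>x. \<integral>x'. \<kappa> n x x' * f x' \<partial>L) +
       (\<integral>x. (\<integral>x'. om n x x' * \<kappa> n x x' * (f x')\<^sup>2 \<partial>L) \<partial>normalize_measure (\<eta> n)) * (\<integral>x. a n x \<partial>normalize_measure (\<eta> n))) /
      (\<integral>x. (\<integral>x'. \<kappa> n x x' \<partial>L) \<partial>normalize_measure (\<eta> n))\<^sup>2"
    and prob: "\<And>N. prob_space (P N)"
    and xi_indep: "\<And>N. prob_space.indep_vars (P N) (\<lambda>_. L) (xi N 0) {1..Suc N}"
    and xi_law: "\<And>N l. l \<in> {1..Suc N} \<Longrightarrow> distr (P N) L (xi N 0 l) = \<rho>"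
    and subalg: "\<And>N n. n < H \<Longrightarrow> subalgebra (P N) (F N n)"
    and xi_meas: "\<And>N n l. n < H \<Longrightarrow> l \<in> {1..Suc N} \<Longrightarrow> xi N n l \<in> measurable (F N n) L"
    and W_meas: "\<And>N n l. n < H \<Longrightarrow> l \<in> {1..Suc N} \<Longrightarrow> W N n l \<in> borel_measurable (F N n)"
    and ciid: "\<And>N n. n < H \<Longrightarrow> cond_iid (P N) (F N n) (Suc N) (count_space {1..Suc N} \<Otimes>\<^sub>M L)
      (\<lambda>l w. (I N (Suc n) l w, xi N (Suc n) l w))
      (\<lambda>w. normalized_density (count_space {1..Suc N} \<Otimes>\<^sub>M L)
         (\<lambda>(i, x). ennreal (W N n i w * a n (xi N n i w) * p n (xi N n i w) x)))"
    and pos: "\<And>N n. n < H \<Longrightarrow> AE w in P N. 0 < (\<Sum>i=1..Suc N. W N n i w * a n (xi N n i w))"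
    and W_0: "\<And>N l w. l \<in> {1..Suc N} \<Longrightarrow> w \<in> space (P N) \<Longrightarrow> W N 0 l w = w0 (xi N 0 l w)"
    and W_Suc: "\<And>N n l w. n < H \<Longrightarrow> l \<in> {1..Suc N} \<Longrightarrow> w \<in> space (P N) \<Longrightarrow>
      W N (Suc n) l w = om n (xi N n (I N (Suc n) l w) w) (xi N (Suc n) l w)"
begin

interpretation L: sigma_finite_measure L by (rule sf)
interpretation \<rho>: prob_space \<rho> by (rule \<rho>_prob)

definition CW :: "nat \<Rightarrow> real" where "CW n = (case n of 0 \<Rightarrow> C0 | Suc m \<Rightarrow> Com m)"

lemma xi_space: "n \<le> H \<Longrightarrow> l \<in> {1..Suc N} \<Longrightarrow> w \<in> space (P N) \<Longrightarrow> xi N n l w \<in> space L"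
proof (cases n)
  case 0
  assume l: "l \<in> {1..Suc N}" and w: "w \<in> space (P N)"
  have "xi N 0 l \<in> measurable (P N) L"
    using xi_indep[of N] prob[of N] l by (auto simp: prob_space.indep_vars_def)
  then show ?thesis using w unfolding 0 by (rule measurable_space)
next
  case (Suc m)
  assume n: "n \<le> H" and l: "l \<in> {1..Suc N}" and w: "w \<in> space (P N)"
  have "(\<lambda>w. (I N (Suc m) l w, xi N (Suc m) l w)) \<in> measurable (P N) (count_space {1..Suc N} \<Otimes>\<^sub>M L)"
    using ciid[of m N] n l unfolding Suc cond_iid_def by auto
  from measurable_space[OF this w] show ?thesis by (simp add: Suc space_pair_measure)
qed

lemma I_range: "n < H \<Longrightarrow> l \<in> {1..Suc N} \<Longrightarrow> w \<in> space (P N) \<Longrightarrow> I N (Suc n) l w \<in> {1..Suc N}"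
proof -
  assume n: "n < H" and l: "l \<in> {1..Suc N}" and w: "w \<in> space (P N)"
  have "(\<lambda>w. (I N (Suc n) l w, xi N (Suc n) l w)) \<in> measurable (P N) (count_space {1..Suc N} \<Otimes>\<^sub>M L)"
    using ciid[OF n, of N] l unfolding cond_iid_def by blast
  from measurable_space[OF this w] show ?thesis by (simp add: space_pair_measure)
qed

lemma W_bounds: "n \<le> H \<Longrightarrow> l \<in> {1..Suc N} \<Longrightarrow> w \<in> space (P N) \<Longrightarrow> 0 \<le> W N n l w \<and> W N n l w \<le> CW n"
proof (cases n)
  case 0
  assume "l \<in> {1..Suc N}" "w \<in> space (P N)"
  then show ?thesis using xi_space[of 0 l N w] by (simp add: 0 CW_def W_0 w0_nn w0_le)
next
  case (Suc m)
  assume n: "n \<le> H" and l: "l \<in> {1..Suc N}" and w: "w \<in> space (P N)"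
  have m: "m < H" using n Suc by simp
  show ?thesis
    unfolding Suc W_Suc[OF m l w] CW_def
    using xi_space[OF less_imp_le[OF m] I_range[OF m l w] w] xi_space[OF n l w] m
    by (simp add: om_nn om_le Suc)
qed

lemma CW_nn: "n \<le> H \<Longrightarrow> 0 \<le> CW n"
  by (cases n) (auto simp: CW_def C0 Com)

lemma \<eta>_sets: "n \<le> H \<Longrightarrow> sets (\<eta> n) = sets L"
  by (cases n) (simp_all add: \<eta>_0 \<eta>_Suc \<rho>_sets)

lemma \<eta>_space: "n \<le> H \<Longrightarrow> space (\<eta> n) = space L"
  by (rule sets_eq_imp_space_eq[OF \<eta>_sets])

lemma \<kappa>_nn: "n < H \<Longrightarrow> x \<in> space L \<Longrightarrow> x' \<in> space L \<Longrightarrow> 0 \<le> \<kappa> n x x'"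
  using p_dens[of n] unfolding markov_density_def
  by (simp add: \<kappa>_eq om_nn a_nn)

lemma \<kappa>_int: "n < H \<Longrightarrow> x \<in> space L \<Longrightarrow> (\<integral>\<^sup>+x'. ennreal (\<kappa> n x x') \<partial>L) \<le> ennreal (Com n * Ca n)"
proof -
  assume n: "n < H" and x: "x \<in> space L"
  have p: "(\<lambda>(x, x'). p n x x') \<in> borel_measurable (L \<Otimes>\<^sub>M L)"
    "\<And>x'. x' \<in> space L \<Longrightarrow> 0 \<le> p n x x'" "(\<integral>\<^sup>+x'. ennreal (p n x x') \<partial>L) = 1"
    using p_dens[OF n] x unfolding markov_density_def by auto
  have px: "p n x \<in> borel_measurable L"
    using measurable_compose[OF measurable_Pair1' p(1), OF x] by simp
  have "(\<integral>\<^sup>+x'. ennreal (\<kappa> n x x') \<partial>L) \<le> (\<integral>\<^sup>+x'. ennreal (Com n * Ca n) * ennreal (p n x x') \<partial>L)"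
  proof (rule nn_integral_mono)
    fix x' assume x': "x' \<in> space L"
    have "\<kappa> n x x' \<le> Com n * (Ca n * p n x x')"
      unfolding \<kappa>_eq[OF n x x'] using a_nn[OF n x] p(2)[OF x'] om_nn[OF n x x'] om_le[OF n x x'] a_le[OF n x] Com[OF n]
      by (intro mult_mono mult_right_mono) auto
    then show "ennreal (\<kappa> n x x') \<le> ennreal (Com n * Ca n) * ennreal (p n x x')"
      using Com[OF n] Ca[OF n] p(2)[OF x'] by (simp add: ennreal_mult[symmetric] mult.assoc ennreal_leI)
  qed
  also have "\<dots> = ennreal (Com n * Ca n)"
    using px p(3) by (subst nn_integral_cmult) auto
  finally show ?thesis .
qed

lemma \<eta>_fin: "n \<le> H \<Longrightarrow> emeasure (\<eta> n) (space (\<eta> n)) < \<infinity>"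
proof (induction n)
  case 0
  have "(\<integral>\<^sup>+x. ennreal (w0 x) * indicator (space \<rho>) x \<partial>\<rho>) \<le> (\<integral>\<^sup>+x. ennreal C0 \<partial>\<rho>)"
    using w0_le sets_eq_imp_space_eq[OF \<rho>_sets] by (intro nn_integral_mono) (auto intro: ennreal_leI)
  also have "\<dots> < \<infinity>" by (simp add: \<rho>.emeasure_space_1)
  finally have "(\<integral>\<^sup>+x. ennreal (w0 x) * indicator (space \<rho>) x \<partial>\<rho>) < \<infinity>" .
  moreover have "w0 \<in> borel_measurable \<rho>"
    using w0_meas \<rho>_sets by (simp cong: measurable_cong_sets)
  ultimately show ?case unfolding \<eta>_0 by (simp add: emeasure_density)
next
  case (Suc n)
  then have n: "n < H" by simp
  have "finite_measure (\<eta> n)" using Suc by (intro finite_measureI) auto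
  from integral_kernel_measure(2)[OF sf this \<eta>_sets \<kappa>_meas \<kappa>_nn \<kappa>_int] n Com Ca
  show ?case by (simp add: \<eta>_Suc[OF n])
qed

lemma \<eta>_pos': "n \<le> H \<Longrightarrow> 0 < emeasure (\<eta> n) (space (\<eta> n))"
  using \<eta>_pos \<eta>_space by simp

lemma \<eta>_finite_measure: "n \<le> H \<Longrightarrow> finite_measure (\<eta> n)"
  using \<eta>_fin[of n] by (intro finite_measureI) auto

lemma \<phi>_prob: "n \<le> H \<Longrightarrow> prob_space (normalize_measure (\<eta> n))"
  by (rule prob_space_normalize_measure[OF \<eta>_fin \<eta>_pos'])

lemma \<phi>_sets: "n \<le> H \<Longrightarrow> sets (normalize_measure (\<eta> n)) = sets L"
  by (simp add: \<eta>_sets)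

lemma \<eta>_integral_Suc:
  assumes n: "n < H" and f: "f \<in> borel_measurable L" "\<And>x. x \<in> space L \<Longrightarrow> \<bar>f x\<bar> \<le> C"
  shows "(\<integral>x. f x \<partial>\<eta> (Suc n)) = (\<integral>x. (\<integral>x'. \<kappa> n x x' * f x' \<partial>L) \<partial>\<eta> n)"
  unfolding \<eta>_Suc[OF n]
  by (rule integral_kernel_measure(3)[OF sf \<eta>_finite_measure[OF less_imp_le[OF n]] \<eta>_sets[OF less_imp_le[OF n]]
      \<kappa>_meas[OF n] \<kappa>_nn[OF n] \<kappa>_int[OF n] mult_nonneg_nonneg[OF Com[OF n] Ca[OF n]] f])

lemma kernel_meas:
  assumes n: "n < H" and f: "f \<in> borel_measurable L"
  shows "(\<lambda>x. \<integral>x'. \<kappa> n x x' * f x' \<partial>L) \<in> borel_measurable L"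
proof -
  have "(\<lambda>(x, x'). \<kappa> n x x' * f x') \<in> borel_measurable (L \<Otimes>\<^sub>M L)"
    using borel_measurable_times[OF \<kappa>_meas[OF n] measurable_compose[OF measurable_snd f]] by (simp add: case_prod_unfold)
  then show ?thesis by (rule L.borel_measurable_lebesgue_integral)
qed

lemma meas_\<eta>: "n \<le> H \<Longrightarrow> f \<in> borel_measurable L \<Longrightarrow> f \<in> borel_measurable (\<eta> n)"
  using \<eta>_sets by (simp cong: measurable_cong_sets)

lemma \<phi>_integral:
  "n \<le> H \<Longrightarrow> f \<in> borel_measurable L \<Longrightarrow>
    (\<integral>x. f x \<partial>normalize_measure (\<eta> n)) = (\<integral>x. f x \<partial>\<eta> n) / measure (\<eta> n) (space (\<eta> n))" for f :: "'a \<Rightarrow> real"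
  by (rule integral_normalize_measure[OF \<eta>_fin \<eta>_pos' meas_\<eta>])

lemma mass_pos: "n \<le> H \<Longrightarrow> 0 < measure (\<eta> n) (space (\<eta> n))"
  by (rule normalize_measure_eq(2)[OF \<eta>_fin \<eta>_pos'])

lemma mass_Suc:
  assumes n: "n < H"
  shows "measure (\<eta> (Suc n)) (space (\<eta> (Suc n))) = (\<integral>x. (\<integral>x'. \<kappa> n x x' \<partial>L) \<partial>\<eta> n)"
  using \<eta>_integral_Suc[OF n, of "\<lambda>_. 1" 1] by simp

text \<open>Normalises the linear recursion: the mass of \<open>\<eta> n\<close> cancels, and the
  mass of \<open>\<eta> (Suc n)\<close> is the integral of the kernel by
  \<open>mass_Suc\<close>.\<close>

lemma \<phi>_Suc:
  assumes n: "n < H" and f: "f \<in> borel_measurable L" "\<And>x. x \<in> space L \<Longrightarrow> \<bar>f x\<bar> \<le> C"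
  shows "(\<integral>x. f x \<partial>normalize_measure (\<eta> (Suc n))) * (\<integral>x. (\<integral>x'. \<kappa> n x x' \<partial>L) \<partial>normalize_measure (\<eta> n))
    = (\<integral>x. (\<integral>x'. \<kappa> n x x' * f x' \<partial>L) \<partial>normalize_measure (\<eta> n))"
proof -
  have n': "n \<le> H" "Suc n \<le> H" using n by auto
  have k1: "(\<lambda>x. \<integral>x'. \<kappa> n x x' \<partial>L) \<in> borel_measurable L"
    using kernel_meas[OF n, of "\<lambda>_. 1"] by simp
  show ?thesis
    unfolding \<phi>_integral[OF n'(2) f(1)] \<phi>_integral[OF n'(1) k1] \<phi>_integral[OF n'(1) kernel_meas[OF n f(1)]]
      mass_Suc[OF n, symmetric]
    using mass_pos[OF n'(2)] \<eta>_integral_Suc[OF n f] by simp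
qed

lemma \<phi>_\<kappa>_pos:
  assumes n: "n < H"
  shows "0 < (\<integral>x. (\<integral>x'. \<kappa> n x x' \<partial>L) \<partial>normalize_measure (\<eta> n))"
proof -
  have n': "n \<le> H" "Suc n \<le> H" using n by auto
  have k1: "(\<lambda>x. \<integral>x'. \<kappa> n x x' \<partial>L) \<in> borel_measurable L"
    using kernel_meas[OF n, of "\<lambda>_. 1"] by simp
  show ?thesis
    unfolding \<phi>_integral[OF n'(1) k1] mass_Suc[OF n, symmetric]
    using mass_pos[OF n'(1)] mass_pos[OF n'(2)] by simp
qed

text \<open>Both limit theorems are carried through the induction together, as the central limit
  theorem at \<open>Suc n\<close> takes its denominators and conditional variances from the law of
  large numbers at \<open>n\<close>. The constant \<open>c\<close> changes with \<open>n\<close> and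
  is left existential.\<close>

theorem chain_asymptotics:
  "n \<le> H \<Longrightarrow> \<exists>c>0. sample_lln L P (\<lambda>N. W N n) (\<lambda>N. xi N n) (normalize_measure (\<eta> n)) c \<and>
     sample_clt L P (\<lambda>N. W N n) (\<lambda>N. xi N n) (normalize_measure (\<eta> n)) c (\<Gamma> n)"
proof (induction n)
  case 0
  define c where "c = (\<integral>x. w0 x \<partial>\<rho>)"
  have w0_\<rho>: "w0 \<in> borel_measurable \<rho>"
    using w0_meas \<rho>_sets by (simp cong: measurable_cong_sets)
  have sp: "space \<rho> = space L" by (rule sets_eq_imp_space_eq[OF \<rho>_sets])
  have dens: "(\<integral>x. f x \<partial>\<eta> 0) = (\<integral>x. w0 x * f x \<partial>\<rho>)" if "f \<in> borel_measurable L" for f :: "'a \<Rightarrow> real"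
  proof -
    have "f \<in> borel_measurable \<rho>" using that \<rho>_sets by (simp cong: measurable_cong_sets)
    then show ?thesis unfolding \<eta>_0 using w0_\<rho> w0_nn by (subst integral_density) (auto simp: sp)
  qed
  have c_mass: "measure (\<eta> 0) (space (\<eta> 0)) = c"
    using dens[of "\<lambda>_. 1"] by (simp add: c_def)
  have c: "0 < c" using mass_pos[of 0] c_mass by simp
  interpret filter_init L P "\<lambda>N. xi N 0" "\<lambda>N. W N 0" \<rho> w0 C0 "normalize_measure (\<eta> 0)" c
  proof (rule filter_init.intro)
    show "\<bar>w0 z\<bar> \<le> C0" if "z \<in> space L" for z using w0_nn[OF that] w0_le[OF that] by simp
    show "c * (\<integral>z. f z \<partial>normalize_measure (\<eta> 0)) = (\<integral>z. w0 z * f z \<partial>\<rho>)"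
      if "f \<in> borel_measurable L" "\<And>z. z \<in> space L \<Longrightarrow> \<bar>f z\<bar> \<le> C" for f C
      unfolding \<phi>_integral[OF le0 that(1)] c_mass dens[OF that(1)] using c by simp
  qed (rule prob xi_indep xi_law \<rho>_prob \<rho>_sets w0_meas C0 W_0 c; assumption)+
  show ?case
    using c lln_init clt_init by (intro exI[of _ c]) (simp add: \<Gamma>_0[abs_def] c_def)
next
  case (Suc n)
  then have n: "n < H" "n \<le> H" by auto
  from Suc.IH[OF n(2)] obtain c where c: "0 < c"
    "sample_lln L P (\<lambda>N. W N n) (\<lambda>N. xi N n) (normalize_measure (\<eta> n)) c"
    "sample_clt L P (\<lambda>N. W N n) (\<lambda>N. xi N n) (normalize_measure (\<eta> n)) c (\<Gamma> n)" by blast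
  interpret filter_step L "normalize_measure (\<eta> n)" "normalize_measure (\<eta> (Suc n))" "\<kappa> n" "om n" "p n" "a n"
    "Com n" "Ca n" "CW n" P "\<lambda>N. F N n" "\<lambda>N. I N (Suc n)" "\<lambda>N. xi N n" "\<lambda>N. xi N (Suc n)" "\<lambda>N. W N n" "\<lambda>N. W N (Suc n)"
  proof (rule filter_step.intro)
    show "0 \<le> W N n l w" "W N n l w \<le> CW n" if "l \<in> {1..Suc N}" "w \<in> space (P N)" for N l w
      using W_bounds[OF n(2) that] by auto
  qed (rule sf \<phi>_prob[OF n(2)] \<phi>_sets[OF n(2)] \<phi>_Suc[OF n(1)] \<phi>_\<kappa>_pos[OF n(1)] a_meas[OF n(1)] a_nn[OF n(1)]
      a_le[OF n(1)] om_meas[OF n(1)] om_nn[OF n(1)] om_le[OF n(1)] Com[OF n(1)] Ca[OF n(1)] CW_nn[OF n(2)] p_dens[OF n(1)]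
      \<kappa>_meas[OF n(1)] \<kappa>_eq[OF n(1)] prob subalg[OF n(1)] xi_meas[OF n(1)] W_meas[OF n(1)] ciid[OF n(1)] pos[OF n(1)]
      W_Suc[OF n(1)]; assumption)+
  have "\<Gamma> (Suc n) = (\<lambda>f. (\<Gamma> n (K1 f) + (\<integral>x. K2 f x \<partial>normalize_measure (\<eta> n)) * (\<integral>x. a n x \<partial>normalize_measure (\<eta> n))) /
      (\<integral>x. (\<integral>x'. \<kappa> n x x' \<partial>L) \<partial>normalize_measure (\<eta> n))\<^sup>2)"
    by (simp add: fun_eq_iff \<Gamma>_Suc[OF n(1)] K1_def[abs_def] K2_def[abs_def])
  then show ?case
    using c'_pos lln_step[OF c(1,2)] clt_step[OF c] by (intro exI[of _ c']) simp
qed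

end

section \<open>Two independent weighted samples\<close>

lemma pair_prob_integral_fst:
  fixes g :: "'w \<Rightarrow> 'b::{banach, second_countable_topology}"
  assumes P: "prob_space P" and Q: "prob_space Q" and g: "g \<in> borel_measurable P" "\<And>w. w \<in> space P \<Longrightarrow> norm (g w) \<le> B"
  shows "(\<integral>(w, v). g w \<partial>(P \<Otimes>\<^sub>M Q)) = (\<integral>w. g w \<partial>P)"
proof -
  interpret Q: prob_space Q by fact
  have "(\<lambda>(w, v). g w) \<in> borel_measurable (P \<Otimes>\<^sub>M Q)"
    using measurable_compose[OF measurable_fst g(1)] by (simp add: case_prod_unfold)
  from pair_prob_integral(2)[OF P Q this g(2)] show ?thesis
    by (simp add: Q.prob_space)
qed

lemma cf_lim_pair_fst:
  assumes "\<And>N. prob_space (P N)" "\<And>N. prob_space (Q N)" "\<And>N. X N \<in> borel_measurable (P N)"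
  shows "cf_lim (\<lambda>N. P N \<Otimes>\<^sub>M Q N) (\<lambda>N (w, v). X N w) V \<longleftrightarrow> cf_lim P X V"
proof -
  have "(\<integral>x. iexp (t * (case x of (w, v) \<Rightarrow> X N w)) \<partial>(P N \<Otimes>\<^sub>M Q N)) = (\<integral>w. iexp (t * X N w) \<partial>P N)" for t N
  proof -
    have "(\<lambda>w. iexp (t * X N w)) \<in> borel_measurable (P N)" using assms(3)[of N] by measurable
    from pair_prob_integral_fst[OF assms(1)[of N] assms(2)[of N] this, of 1] show ?thesis
      by (simp add: case_prod_unfold)
  qed
  then show ?thesis unfolding cf_lim_def by (simp only:)
qed

lemma emp_mult: "emp n W x (\<lambda>z. f z * k) w = emp n W x f w * k"
  by (simp add: emp_def sum_distrib_right mult.assoc)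

lemma abs_emp_bound:
  assumes W: "\<And>l. l \<in> {1..Suc n} \<Longrightarrow> \<bar>W l w\<bar> \<le> B" and f: "\<And>l. l \<in> {1..Suc n} \<Longrightarrow> \<bar>f (x l w)\<bar> \<le> C" and B: "0 \<le> B"
  shows "\<bar>emp (Suc n) W x f w\<bar> \<le> B * C"
proof -
  have "\<bar>\<Sum>l=1..Suc n. W l w * f (x l w)\<bar> \<le> (\<Sum>l=1..Suc n. B * C)"
  proof (rule order_trans[OF sum_abs sum_mono])
    fix l assume l: "l \<in> {1..Suc n}"
    show "\<bar>W l w * f (x l w)\<bar> \<le> B * C"
      unfolding abs_mult using W[OF l] f[OF l] B by (intro mult_mono) auto
  qed
  also have "\<dots> = real (Suc n) * (B * C)" by simp
  finally show ?thesis unfolding emp_def abs_divide by (simp add: field_simps del: of_nat_Suc)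
qed

text \<open>Each sample is measurable with respect to its own sigma-field, \<open>Ff N\<close> or
  \<open>Fb N\<close>, not merely \<open>P N\<close>. Independence of the two fields then covers all
  functions of the samples at once.\<close>

locale two_samples =
  fixes L :: "'a measure" and P Ff Fb :: "nat \<Rightarrow> 'w measure"
    and W1 W2 :: "nat \<Rightarrow> nat \<Rightarrow> 'w \<Rightarrow> real" and x1 x2 :: "nat \<Rightarrow> nat \<Rightarrow> 'w \<Rightarrow> 'a"
    and \<phi> \<psi> :: "'a measure" and c1 c2 B1 B2 :: real and \<Gamma>1 \<Gamma>2 :: "('a \<Rightarrow> real) \<Rightarrow> real"
  assumes prob: "\<And>N. prob_space (P N)"
    and sub1: "\<And>N. subalgebra (P N) (Ff N)" and sub2: "\<And>N. subalgebra (P N) (Fb N)"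
    and indep: "\<And>N. prob_space.indep_set (P N) (sets (Ff N)) (sets (Fb N))"
    and W1_meas: "\<And>N l. l \<in> {1..Suc N} \<Longrightarrow> W1 N l \<in> borel_measurable (Ff N)"
    and x1_meas: "\<And>N l. l \<in> {1..Suc N} \<Longrightarrow> x1 N l \<in> measurable (Ff N) L"
    and W2_meas: "\<And>N l. l \<in> {1..Suc N} \<Longrightarrow> W2 N l \<in> borel_measurable (Fb N)"
    and x2_meas: "\<And>N l. l \<in> {1..Suc N} \<Longrightarrow> x2 N l \<in> measurable (Fb N) L"
    and W2_bd: "\<And>N l w. l \<in> {1..Suc N} \<Longrightarrow> w \<in> space (P N) \<Longrightarrow> \<bar>W2 N l w\<bar> \<le> B2" and B2: "0 \<le> B2"
    and W1_bd: "\<And>N l w. l \<in> {1..Suc N} \<Longrightarrow> w \<in> space (P N) \<Longrightarrow> \<bar>W1 N l w\<bar> \<le> B1" and B1: "0 \<le> B1"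
    and \<phi>_prob: "prob_space \<phi>" and \<phi>_sets: "sets \<phi> = sets L"
    and \<psi>_prob: "prob_space \<psi>" and \<psi>_sets: "sets \<psi> = sets L"
    and c1: "0 < c1" and c2: "0 < c2"
    and lln1: "sample_lln L P W1 x1 \<phi> c1" and clt1: "sample_clt L P W1 x1 \<phi> c1 \<Gamma>1"
    and lln2: "sample_lln L P W2 x2 \<psi> c2" and clt2: "sample_clt L P W2 x2 \<psi> c2 \<Gamma>2"
begin

text \<open>A double average read at a pair of sample points, one driving each sample. The quantity
  computed by the algorithm is its value on the diagonal.\<close>

definition U :: "nat \<Rightarrow> ('a \<Rightarrow> 'a \<Rightarrow> real) \<Rightarrow> 'w \<times> 'w \<Rightarrow> real" where
  "U N K = (\<lambda>(w, v). emp (Suc N) (W1 N) (x1 N) (\<lambda>x. emp (Suc N) (W2 N) (x2 N) (K x) v) w)"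

lemma space_Ff: "space (Ff N) = space (P N)" and space_Fb: "space (Fb N) = space (P N)"
  using sub1[of N] sub2[of N] by (auto simp: subalgebra_def)

lemma \<phi>_space: "space \<phi> = space L" and \<psi>_space: "space \<psi> = space L"
  using sets_eq_imp_space_eq[OF \<phi>_sets] sets_eq_imp_space_eq[OF \<psi>_sets] by auto

lemma pp: "prob_space (P N \<Otimes>\<^sub>M P N)"
proof -
  interpret p: prob_space "P N" by (rule prob)
  interpret pair_prob_space "P N" "P N" ..
  show ?thesis by unfold_locales
qed

lemma emp2_meas:
  assumes f: "f \<in> borel_measurable L"
  shows "emp (Suc N) (W2 N) (x2 N) f \<in> borel_measurable (Fb N)"
proof -
  have "(\<lambda>w. W2 N l w * f (x2 N l w)) \<in> borel_measurable (Fb N)" if "l \<in> {1..Suc N}" for l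
    by (rule borel_measurable_times[OF W2_meas[OF that] measurable_compose[OF x2_meas[OF that] f]])
  from borel_measurable_divide[OF borel_measurable_sum[OF this] borel_measurable_const]
  show ?thesis unfolding emp_def[abs_def] .
qed

lemma emp2_bd:
  assumes f: "\<And>x. x \<in> space L \<Longrightarrow> \<bar>f x\<bar> \<le> C" and C: "0 \<le> C" and w: "w \<in> space (P N)"
  shows "\<bar>emp (Suc N) (W2 N) (x2 N) f w\<bar> \<le> B2 * C"
proof -
  have x: "x2 N l w \<in> space L" if "l \<in> {1..Suc N}" for l
    using measurable_space[OF x2_meas[OF that]] w by (simp add: space_Fb)
  show ?thesis
    by (rule abs_emp_bound[where W="W2 N" and x="x2 N" and w=w and f=f, OF W2_bd[OF _ w] f[OF x] B2])
qed

lemma K_x_meas: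
  "(\<lambda>(x, x'). K x x') \<in> borel_measurable (L \<Otimes>\<^sub>M L) \<Longrightarrow> x \<in> space L \<Longrightarrow> K x \<in> borel_measurable L"
  using measurable_compose[OF measurable_Pair1'] by fastforce

lemma emp2_pair_meas:
  assumes K: "(\<lambda>(x, x'). K x x') \<in> borel_measurable (L \<Otimes>\<^sub>M L)"
  shows "(\<lambda>(v, x). emp (Suc N) (W2 N) (x2 N) (K x) v) \<in> borel_measurable (Fb N \<Otimes>\<^sub>M L)"
proof -
  have "(\<lambda>s. W2 N l (fst s) * K (snd s) (x2 N l (fst s))) \<in> borel_measurable (Fb N \<Otimes>\<^sub>M L)" if l: "l \<in> {1..Suc N}" for l
  proof -
    have "(\<lambda>s. (snd s, x2 N l (fst s))) \<in> measurable (Fb N \<Otimes>\<^sub>M L) (L \<Otimes>\<^sub>M L)"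
      by (rule measurable_Pair[OF measurable_snd measurable_compose[OF measurable_fst x2_meas[OF l]]])
    from measurable_compose[OF this K] have "(\<lambda>s. K (snd s) (x2 N l (fst s))) \<in> borel_measurable (Fb N \<Otimes>\<^sub>M L)"
      by (simp only: case_prod_unfold fst_conv snd_conv)
    from borel_measurable_times[OF measurable_compose[OF measurable_fst W2_meas[OF l]] this] show ?thesis .
  qed
  from borel_measurable_divide[OF borel_measurable_sum[OF this] borel_measurable_const]
  show ?thesis unfolding emp_def case_prod_unfold .
qed

lemma U_meas:
  assumes K: "(\<lambda>(x, x'). K x x') \<in> borel_measurable (L \<Otimes>\<^sub>M L)"
  shows "U N K \<in> borel_measurable (Ff N \<Otimes>\<^sub>M Fb N)"
proof -
  have "(\<lambda>s. W1 N l (fst s) * emp (Suc N) (W2 N) (x2 N) (K (x1 N l (fst s))) (snd s)) \<in> borel_measurable (Ff N \<Otimes>\<^sub>M Fb N)"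
    if l: "l \<in> {1..Suc N}" for l
  proof -
    have "(\<lambda>s. (snd s, x1 N l (fst s))) \<in> measurable (Ff N \<Otimes>\<^sub>M Fb N) (Fb N \<Otimes>\<^sub>M L)"
      by (rule measurable_Pair[OF measurable_snd measurable_compose[OF measurable_fst x1_meas[OF l]]])
    from measurable_compose[OF this emp2_pair_meas[OF K]]
    have "(\<lambda>s. emp (Suc N) (W2 N) (x2 N) (K (x1 N l (fst s))) (snd s)) \<in> borel_measurable (Ff N \<Otimes>\<^sub>M Fb N)"
      by (simp only: case_prod_unfold fst_conv snd_conv)
    from borel_measurable_times[OF measurable_compose[OF measurable_fst W1_meas[OF l]] this] show ?thesis .
  qed
  from borel_measurable_divide[OF borel_measurable_sum[OF this] borel_measurable_const]
  show ?thesis unfolding U_def emp_def[of _ "W1 N"] case_prod_unfold .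
qed

lemma id_Ff: "(\<lambda>w. w) \<in> measurable (P N) (Ff N)" and id_Fb: "(\<lambda>w. w) \<in> measurable (P N) (Fb N)"
  using measurable_from_subalg[OF sub1 measurable_ident] measurable_from_subalg[OF sub2 measurable_ident]
  by (simp_all add: id_def)

lemma pair_to_P: "f \<in> borel_measurable (Ff N \<Otimes>\<^sub>M Fb N) \<Longrightarrow> f \<in> borel_measurable (P N \<Otimes>\<^sub>M P N)"
proof -
  assume f: "f \<in> borel_measurable (Ff N \<Otimes>\<^sub>M Fb N)"
  have "(\<lambda>s. (fst s, snd s)) \<in> measurable (P N \<Otimes>\<^sub>M P N) (Ff N \<Otimes>\<^sub>M Fb N)"
    by (rule measurable_Pair[OF measurable_compose[OF measurable_fst id_Ff] measurable_compose[OF measurable_snd id_Fb]])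
  from measurable_compose[OF this f] show ?thesis by simp
qed

lemma diag_meas: "(\<lambda>w. (w, w)) \<in> measurable (P N) (Ff N \<Otimes>\<^sub>M Fb N)"
  by (rule measurable_Pair[OF id_Ff id_Fb])

text \<open>By independence, the two samples may be realised on two separate copies of the probability space.\<close>

lemma integral_diag:
  fixes f :: "'w \<times> 'w \<Rightarrow> 'b::{banach, second_countable_topology}"
  assumes f: "f \<in> borel_measurable (Ff N \<Otimes>\<^sub>M Fb N)"
  shows "(\<integral>w. f (w, w) \<partial>P N) = (\<integral>s. f s \<partial>(P N \<Otimes>\<^sub>M P N))"
proof -
  interpret prob_space "P N" by (rule prob)
  have sig: "sigma_sets (space (P N)) {(\<lambda>w. w) -` A \<inter> space (P N) | A. A \<in> sets M} = sets M"
    if "space M = space (P N)" for M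
  proof -
    have "{(\<lambda>w. w) -` A \<inter> space (P N) | A. A \<in> sets M} = sets M"
      unfolding that[symmetric] using sets.sets_into_space by (auto simp: Int_absorb2)
    then show ?thesis using sets.sigma_sets_eq[of M] by (simp add: that)
  qed
  \<comment> \<open>Independence of the two fields, rephrased for the identity maps into them; it
    gives the diagonal map the product law on \<open>Ff N \<Otimes>\<^sub>M Fb N\<close>.\<close>
  have "indep_var (Ff N) (\<lambda>w. w) (Fb N) (\<lambda>w. w)"
    unfolding indep_var_eq sig[OF space_Ff] sig[OF space_Fb] using id_Ff id_Fb indep[of N] by blast
  then have eq: "distr (P N) (Ff N) (\<lambda>w. w) \<Otimes>\<^sub>M distr (P N) (Fb N) (\<lambda>w. w) = distr (P N) (Ff N \<Otimes>\<^sub>M Fb N) (\<lambda>w. (w, w))"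
    unfolding indep_var_distribution_eq by blast
  have "distr (P N) (Ff N) (\<lambda>w. w) \<Otimes>\<^sub>M distr (P N) (Fb N) (\<lambda>w. w)
      = distr (P N \<Otimes>\<^sub>M P N) (Ff N \<Otimes>\<^sub>M Fb N) (\<lambda>(x, y). (x, y))"
  proof (rule pair_measure_distr[OF id_Ff id_Fb])
    show "sigma_finite_measure (distr (P N) (Fb N) (\<lambda>w. w))"
      by (intro prob_space_imp_sigma_finite prob_space_distr id_Fb)
  qed
  then have eq2: "distr (P N) (Ff N \<Otimes>\<^sub>M Fb N) (\<lambda>w. (w, w)) = distr (P N \<Otimes>\<^sub>M P N) (Ff N \<Otimes>\<^sub>M Fb N) (\<lambda>s. s)"
    unfolding eq by (simp add: case_prod_unfold)
  have m: "(\<lambda>s. s) \<in> measurable (P N \<Otimes>\<^sub>M P N) (Ff N \<Otimes>\<^sub>M Fb N)"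
  proof -
    have "(\<lambda>s. (fst s, snd s)) \<in> measurable (P N \<Otimes>\<^sub>M P N) (Ff N \<Otimes>\<^sub>M Fb N)"
      by (rule measurable_Pair[OF measurable_compose[OF measurable_fst id_Ff] measurable_compose[OF measurable_snd id_Fb]])
    then show ?thesis by simp
  qed
  have "(\<integral>w. f (w, w) \<partial>P N) = (\<integral>s. f s \<partial>distr (P N) (Ff N \<Otimes>\<^sub>M Fb N) (\<lambda>w. (w, w)))"
    by (rule integral_distr[OF diag_meas f, symmetric])
  also have "\<dots> = (\<integral>s. f s \<partial>(P N \<Otimes>\<^sub>M P N))"
    unfolding eq2 by (rule integral_distr[OF m f])
  finally show ?thesis .
qed

text \<open>For fixed \<open>x\<close> the law of large numbers of the second sample is used with
  the non-random test function \<open>K x\<close>. The constant \<open>B2 / c2 + 1\<close> covers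
  both the averages, bounded by \<open>B2 * C / c2\<close>, and the limit, bounded by
  \<open>C\<close>.\<close>

lemma rand_conv_second:
  assumes K: "(\<lambda>(x, x'). K x x') \<in> borel_measurable (L \<Otimes>\<^sub>M L)"
    and bd: "\<And>x x'. x \<in> space L \<Longrightarrow> x' \<in> space L \<Longrightarrow> \<bar>K x x'\<bar> \<le> C" and C: "0 \<le> C"
  shows "rand_conv L P ((B2 / c2 + 1) * C) (\<lambda>N v x. emp (Suc N) (W2 N) (x2 N) (K x) v / c2) (\<lambda>x. \<integral>x'. K x x' \<partial>\<psi>)"
  unfolding rand_conv_def
proof (intro conjI allI ballI)
  interpret \<psi>: prob_space \<psi> by (rule \<psi>_prob)
  have r: "0 \<le> B2 / c2" using B2 c2 by simp
  show "0 \<le> (B2 / c2 + 1) * C" using r C by simp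
  show "(\<lambda>(v, x). emp (Suc N) (W2 N) (x2 N) (K x) v / c2) \<in> borel_measurable (P N \<Otimes>\<^sub>M L)" for N
  proof -
    have "(\<lambda>s. (fst s, snd s)) \<in> measurable (P N \<Otimes>\<^sub>M L) (Fb N \<Otimes>\<^sub>M L)"
      by (rule measurable_Pair[OF measurable_compose[OF measurable_fst id_Fb] measurable_snd])
    from measurable_compose[OF this emp2_pair_meas[OF K]]
    have "(\<lambda>s. emp (Suc N) (W2 N) (x2 N) (K (snd s)) (fst s)) \<in> borel_measurable (P N \<Otimes>\<^sub>M L)"
      by (simp only: case_prod_unfold fst_conv snd_conv)
    from borel_measurable_divide[OF this borel_measurable_const] show ?thesis by (simp only: case_prod_unfold)
  qed
  have K\<psi>: "(\<lambda>(x, x'). K x x') \<in> borel_measurable (L \<Otimes>\<^sub>M \<psi>)"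
    unfolding measurable_cong_sets[OF sets_pair_measure_cong[OF refl \<psi>_sets] refl] by (rule K)
  show "(\<lambda>x. \<integral>x'. K x x' \<partial>\<psi>) \<in> borel_measurable L" by (rule \<psi>.borel_measurable_lebesgue_integral[OF K\<psi>])
  show "\<bar>emp (Suc N) (W2 N) (x2 N) (K x) v / c2\<bar> \<le> (B2 / c2 + 1) * C" if v: "v \<in> space (P N)" and x: "x \<in> space L" for N v x
  proof -
    have "\<bar>emp (Suc N) (W2 N) (x2 N) (K x) v / c2\<bar> \<le> B2 * C / c2"
      using emp2_bd[OF bd[OF x] C v] c2 by (simp add: abs_divide divide_right_mono)
    also have "\<dots> \<le> (B2 / c2 + 1) * C" using C by (simp add: distrib_right)
    finally show ?thesis .
  qed
  show "\<bar>\<integral>x'. K x x' \<partial>\<psi>\<bar> \<le> (B2 / c2 + 1) * C" if x: "x \<in> space L" for x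
  proof -
    have kx: "K x \<in> borel_measurable \<psi>" using K_x_meas[OF K x] \<psi>_sets by (simp cong: measurable_cong_sets)
    have i: "integrable \<psi> (K x)"
      using bd[OF x] kx by (intro \<psi>.integrable_const_bound[where B=C]) (auto simp: \<psi>_space)
    have "\<bar>\<integral>x'. K x x' \<partial>\<psi>\<bar> \<le> (\<integral>x'. \<bar>K x x'\<bar> \<partial>\<psi>)" by (rule integral_abs_bound)
    also have "\<dots> \<le> (\<integral>x'. C \<partial>\<psi>)"
      by (rule integral_mono[OF integrable_abs[OF i] \<psi>.integrable_const]) (simp add: bd x \<psi>_space)
    also have "\<dots> = C" by (simp add: \<psi>.prob_space)
    also have "\<dots> \<le> (B2 / c2 + 1) * C" using C mult_nonneg_nonneg[OF r C] by (simp add: distrib_right)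
    finally show ?thesis .
  qed
  fix x assume x: "x \<in> space L"
  let ?m = "\<integral>x'. K x x' \<partial>\<psi>"
  have "rand_conv L P C (\<lambda>N v. K x) (K x)"
    by (rule rand_conv_const[OF prob K_x_meas[OF K x] bd[OF x] C])
  with lln2 prob have "(\<lambda>N. \<integral>(w, v). \<bar>emp (Suc N) (W2 N) (x2 N) (K x) w - c2 * ?m\<bar> \<partial>(P N \<Otimes>\<^sub>M P N)) \<longlonglongrightarrow> 0"
    unfolding sample_lln_def by blast
  moreover have "(\<integral>(w, v). \<bar>emp (Suc N) (W2 N) (x2 N) (K x) w - c2 * ?m\<bar> \<partial>(P N \<Otimes>\<^sub>M P N))
      = (\<integral>w. \<bar>emp (Suc N) (W2 N) (x2 N) (K x) w - c2 * ?m\<bar> \<partial>P N)" for N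
  proof (rule pair_prob_integral_fst[OF prob prob])
    show "(\<lambda>w. \<bar>emp (Suc N) (W2 N) (x2 N) (K x) w - c2 * ?m\<bar>) \<in> borel_measurable (P N)"
      using measurable_from_subalg[OF sub2 emp2_meas[OF K_x_meas[OF K x], of N]] by measurable
    show "norm \<bar>emp (Suc N) (W2 N) (x2 N) (K x) w - c2 * ?m\<bar> \<le> B2 * C + \<bar>c2 * ?m\<bar>" if "w \<in> space (P N)" for w
    proof -
      have "\<bar>emp (Suc N) (W2 N) (x2 N) (K x) w\<bar> \<le> B2 * C" by (rule emp2_bd[OF bd[OF x] C that])
      then show ?thesis unfolding real_norm_def by linarith
    qed
  qed
  ultimately have "(\<lambda>N. (\<integral>w. \<bar>emp (Suc N) (W2 N) (x2 N) (K x) w - c2 * ?m\<bar> \<partial>P N) * (1 / c2)) \<longlonglongrightarrow> 0"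
    by (intro tendsto_mult_left_zero) simp
  moreover have "(\<integral>w. \<bar>emp (Suc N) (W2 N) (x2 N) (K x) w - c2 * ?m\<bar> \<partial>P N) * (1 / c2)
      = (\<integral>v. \<bar>emp (Suc N) (W2 N) (x2 N) (K x) v / c2 - ?m\<bar> \<partial>P N)" for N
  proof -
    have "\<bar>emp (Suc N) (W2 N) (x2 N) (K x) v / c2 - ?m\<bar> = \<bar>emp (Suc N) (W2 N) (x2 N) (K x) v - c2 * ?m\<bar> * (1 / c2)" for v
    proof -
      have "emp (Suc N) (W2 N) (x2 N) (K x) v / c2 - ?m = (emp (Suc N) (W2 N) (x2 N) (K x) v - c2 * ?m) * (1 / c2)"
        using c2 by (simp add: field_simps)
      then show ?thesis using c2 by (simp only: abs_mult) simp
    qed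
    then show ?thesis by (simp only: integral_mult_left_zero)
  qed
  ultimately show "(\<lambda>N. \<integral>v. \<bar>emp (Suc N) (W2 N) (x2 N) (K x) v / c2 - ?m\<bar> \<partial>P N) \<longlonglongrightarrow> 0"
    by simp
qed

text \<open>Proved on the product of two copies of the space and brought back to the diagonal by
  \<open>integral_diag\<close> at the level of characteristic functions. The centring
  \<open>K0\<close> serves twice: directly for the first sample and, by Fubini, for
  \<open>f2\<close> in the second.\<close>

theorem two_sample_clt:
  assumes K: "(\<lambda>(x, x'). K x x') \<in> borel_measurable (L \<Otimes>\<^sub>M L)"
    and K_bd: "\<And>x x'. x \<in> space L \<Longrightarrow> x' \<in> space L \<Longrightarrow> \<bar>K x x'\<bar> \<le> C" and C: "0 \<le> C"
    and K0: "(\<integral>x. (\<integral>x'. K x x' \<partial>\<psi>) \<partial>\<phi>) = 0"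
    and G: "(\<lambda>(x, x'). G x x') \<in> borel_measurable (L \<Otimes>\<^sub>M L)"
    and G_bd: "\<And>x x'. x \<in> space L \<Longrightarrow> x' \<in> space L \<Longrightarrow> \<bar>G x x'\<bar> \<le> D" and D: "0 \<le> D"
    and d: "(\<integral>x. (\<integral>x'. G x x' \<partial>\<psi>) \<partial>\<phi>) = d" "0 < d"
  shows "cf_lim P (\<lambda>N w. sqrt (Suc N) * (U N K (w, w) / U N G (w, w)))
     ((\<Gamma>1 (\<lambda>x. \<integral>x'. K x x' \<partial>\<psi>) + \<Gamma>2 (\<lambda>x'. \<integral>x. K x x' \<partial>\<phi>)) / d\<^sup>2)"
proof -
  interpret \<psi>: prob_space \<psi> by (rule \<psi>_prob)
  interpret \<phi>: prob_space \<phi> by (rule \<phi>_prob)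
  interpret pf: pair_prob_space \<phi> \<psi> ..
  define f2 where "f2 = (\<lambda>x'. \<integral>x. K x x' \<partial>\<phi>)"
  have K_pair: "(\<lambda>(x, x'). K x x') \<in> borel_measurable (\<phi> \<Otimes>\<^sub>M \<psi>)"
    unfolding measurable_cong_sets[OF sets_pair_measure_cong[OF \<phi>_sets \<psi>_sets] refl] by (rule K)
  have K_int: "integrable (\<phi> \<Otimes>\<^sub>M \<psi>) (\<lambda>(x, x'). K x x')"
    by (rule pair_prob_integral(1)[OF \<phi>_prob \<psi>_prob K_pair, of C]) (simp add: K_bd \<phi>_space \<psi>_space)
  have K_swap: "(\<lambda>(x', x). K x x') \<in> borel_measurable (L \<Otimes>\<^sub>M \<phi>)"
  proof -
    have "(\<lambda>(x, x'). K x x') \<in> borel_measurable (\<phi> \<Otimes>\<^sub>M L)"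
      unfolding measurable_cong_sets[OF sets_pair_measure_cong[OF \<phi>_sets refl] refl] by (rule K)
    from measurable_compose[OF measurable_pair_swap' this] show ?thesis by (simp add: case_prod_unfold)
  qed
  have f2_meas: "f2 \<in> borel_measurable L"
    unfolding f2_def by (rule \<phi>.borel_measurable_lebesgue_integral[OF K_swap])
  have Kx'_int: "integrable \<phi> (\<lambda>x. K x x')" if x': "x' \<in> space L" for x'
  proof (rule \<phi>.integrable_const_bound[where B=C])
    show "AE x in \<phi>. norm (K x x') \<le> C" using K_bd[OF _ x'] by (intro AE_I2) (simp add: \<phi>_space)
    have "(\<lambda>x. K x x') \<in> borel_measurable L" using measurable_compose[OF measurable_Pair2' K, OF x'] by simp
    then show "(\<lambda>x. K x x') \<in> borel_measurable \<phi>" using \<phi>_sets by (simp cong: measurable_cong_sets)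
  qed
  have f2_bd: "\<bar>f2 x'\<bar> \<le> C" if x': "x' \<in> space L" for x'
  proof -
    have "\<bar>f2 x'\<bar> \<le> (\<integral>x. \<bar>K x x'\<bar> \<partial>\<phi>)" unfolding f2_def by (rule integral_abs_bound)
    also have "\<dots> \<le> (\<integral>x. C \<partial>\<phi>)"
      by (rule integral_mono[OF integrable_abs[OF Kx'_int[OF x']] \<phi>.integrable_const]) (simp add: K_bd x' \<phi>_space)
    finally show ?thesis by (simp add: \<phi>.prob_space)
  qed
  have f20: "(\<integral>x'. f2 x' \<partial>\<psi>) = 0"
    unfolding f2_def using pf.Fubini_integral[OF K_int] K0 by simp
  have rc2: "rand_conv L P C (\<lambda>N v. f2) f2"
    by (rule rand_conv_const[OF prob f2_meas f2_bd C])
  \<comment> \<open>\<open>f2\<close> is not random and has integral 0, so the limit theorem of the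
    second sample is used with added variance 0.\<close>
  have zero: "cf_lim P (\<lambda>N v. sqrt (Suc N) * (\<integral>x'. f2 x' \<partial>\<psi>)) 0"
  proof -
    have "(\<integral>w. iexp (t * (sqrt (Suc N) * 0)) \<partial>P N) = 1" for t N
    proof -
      interpret prob_space "P N" by (rule prob)
      show ?thesis by (simp add: prob_space)
    qed
    then show ?thesis unfolding cf_lim_def f20 by simp
  qed
  have "cf_lim (\<lambda>N. P N \<Otimes>\<^sub>M P N) (\<lambda>N (w, v). sqrt (Suc N) * emp (Suc N) (W2 N) (x2 N) f2 w * (1 / c2)) (\<Gamma>2 f2 + 0)"
    using clt2 prob rc2 f20 zero unfolding sample_clt_def by blast
  then have lim2: "cf_lim P (\<lambda>N w. sqrt (Suc N) * emp (Suc N) (W2 N) (x2 N) f2 w * (1 / c2)) (\<Gamma>2 f2)"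
  proof (subst (asm) cf_lim_pair_fst[OF prob prob])
    show "(\<lambda>w. sqrt (Suc N) * emp (Suc N) (W2 N) (x2 N) f2 w * (1 / c2)) \<in> borel_measurable (P N)" for N
      using measurable_from_subalg[OF sub2 emp2_meas[OF f2_meas, of N]] by measurable
  qed simp
  note rcK = rand_conv_second[OF K K_bd C]
  note rcG = rand_conv_second[OF G G_bd D]
  have emp_swap: "(\<integral>x. emp (Suc N) (W2 N) (x2 N) (K x) v / c2 \<partial>\<phi>) = emp (Suc N) (W2 N) (x2 N) f2 v * (1 / c2)"
    if v: "v \<in> space (P N)" for N v
  proof -
    have x: "x2 N l v \<in> space L" if "l \<in> {1..Suc N}" for l
      using measurable_space[OF x2_meas[OF that]] v by (simp add: space_Fb)
    have "(\<integral>x. (\<Sum>l=1..Suc N. W2 N l v * K x (x2 N l v)) \<partial>\<phi>) = (\<Sum>l=1..Suc N. \<integral>x. W2 N l v * K x (x2 N l v) \<partial>\<phi>)"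
      by (intro Bochner_Integration.integral_sum integrable_mult_right Kx'_int x)
    also have "\<dots> = (\<Sum>l=1..Suc N. W2 N l v * f2 (x2 N l v))"
      by (simp only: integral_mult_right_zero f2_def)
    finally show ?thesis unfolding emp_def by simp
  qed
  have lim2': "cf_lim P (\<lambda>N v. sqrt (Suc N) * (\<integral>x. emp (Suc N) (W2 N) (x2 N) (K x) v / c2 \<partial>\<phi>)) (\<Gamma>2 f2)"
    using lim2 by (rule cf_lim_cong[THEN iffD1, rotated]) (simp only: emp_swap mult.assoc)
  have lim1: "cf_lim (\<lambda>N. P N \<Otimes>\<^sub>M P N)
      (\<lambda>N (w, v). sqrt (Suc N) * emp (Suc N) (W1 N) (x1 N) (\<lambda>x. emp (Suc N) (W2 N) (x2 N) (K x) v / c2) w * (1 / c1))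
      (\<Gamma>1 (\<lambda>x. \<integral>x'. K x x' \<partial>\<psi>) + \<Gamma>2 f2)"
    using clt1 prob rcK K0 lim2' unfolding sample_clt_def by blast
  have lG: "(\<lambda>N. \<integral>(w, v). \<bar>emp (Suc N) (W1 N) (x1 N) (\<lambda>x. emp (Suc N) (W2 N) (x2 N) (G x) v / c2) w - c1 * d\<bar> \<partial>(P N \<Otimes>\<^sub>M P N)) \<longlonglongrightarrow> 0"
    using lln1 prob rcG d(1) unfolding sample_lln_def by blast
  have U_div: "emp (Suc N) (W1 N) (x1 N) (\<lambda>x. emp (Suc N) (W2 N) (x2 N) (M x) v / c2) w = U N M (w, v) / c2" for N M w v
    using emp_mult[of "Suc N" "W1 N" "x1 N" "\<lambda>x. emp (Suc N) (W2 N) (x2 N) (M x) v" "1 / c2" w] by (simp add: U_def)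
  have UG_meas: "(\<lambda>s. U N G s / c2) \<in> borel_measurable (P N \<Otimes>\<^sub>M P N)" for N
    by (rule borel_measurable_divide[OF pair_to_P[OF U_meas[OF G]] borel_measurable_const])
  have UG_int: "integrable (P N \<Otimes>\<^sub>M P N) (\<lambda>s. U N G s / c2)" for N
  proof -
    interpret pq: prob_space "P N \<Otimes>\<^sub>M P N" by (rule pp)
    show ?thesis
    proof (rule pq.integrable_const_bound[OF _ UG_meas, where B="B1 * (B2 * D) / c2"])
      show "AE s in P N \<Otimes>\<^sub>M P N. norm (U N G s / c2) \<le> B1 * (B2 * D) / c2"
      proof (rule AE_I2)
        fix s assume "s \<in> space (P N \<Otimes>\<^sub>M P N)"
        then obtain w v where s: "s = (w, v)" "w \<in> space (P N)" "v \<in> space (P N)"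
          by (auto simp: space_pair_measure)
        have x: "x1 N l w \<in> space L" if "l \<in> {1..Suc N}" for l
          using measurable_space[OF x1_meas[OF that]] s(2) by (simp add: space_Ff)
        have "\<bar>U N G (w, v)\<bar> \<le> B1 * (B2 * D)"
          unfolding U_def prod.case
          by (rule abs_emp_bound) (auto intro!: W1_bd s x emp2_bd G_bd D B1)
        then show "norm (U N G s / c2) \<le> B1 * (B2 * D) / c2"
          unfolding s(1) real_norm_def abs_divide using c2 by (simp add: divide_right_mono)
      qed
    qed
  qed
  \<comment> \<open>The Slutsky factor: \<open>U N G s / c2\<close> tends to \<open>c1 * d\<close>,
    so \<open>c1\<close> over it tends to \<open>1 / d\<close>, whose square multiplies the
    variance.\<close>
  have "(\<lambda>N. \<integral>s. min 1 \<bar>c1 / (U N G s / c2) - c1 / (c1 * d)\<bar> \<partial>(P N \<Otimes>\<^sub>M P N)) \<longlonglongrightarrow> 0"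
    using lG c1 d(2) unfolding U_div by (intro inverse_conv_in_prob[OF pp UG_meas UG_int]) (auto simp: case_prod_unfold)
  note S = this
  have "cf_lim (\<lambda>N. P N \<Otimes>\<^sub>M P N)
      (\<lambda>N s. (case s of (w, v) \<Rightarrow> sqrt (Suc N) * emp (Suc N) (W1 N) (x1 N) (\<lambda>x. emp (Suc N) (W2 N) (x2 N) (K x) v / c2) w * (1 / c1))
        * (c1 / (U N G s / c2)))
      ((c1 / (c1 * d))\<^sup>2 * (\<Gamma>1 (\<lambda>x. \<integral>x'. K x x' \<partial>\<psi>) + \<Gamma>2 f2))"
  proof (rule cf_lim_slutsky[OF lim1 pp _ _ S])
    show "(\<lambda>(w, v). sqrt (Suc N) * emp (Suc N) (W1 N) (x1 N) (\<lambda>x. emp (Suc N) (W2 N) (x2 N) (K x) v / c2) w * (1 / c1)) \<in> borel_measurable (P N \<Otimes>\<^sub>M P N)" for N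
      unfolding U_div using pair_to_P[OF U_meas[OF K, of N]] by (simp add: case_prod_unfold)
    show "(\<lambda>s. c1 / (U N G s / c2)) \<in> borel_measurable (P N \<Otimes>\<^sub>M P N)" for N
      by (rule borel_measurable_divide[OF borel_measurable_const UG_meas])
  qed
  then have "cf_lim (\<lambda>N. P N \<Otimes>\<^sub>M P N) (\<lambda>N s. sqrt (Suc N) * (U N K s / U N G s))
      ((c1 / (c1 * d))\<^sup>2 * (\<Gamma>1 (\<lambda>x. \<integral>x'. K x x' \<partial>\<psi>) + \<Gamma>2 f2))"
    by (rule cf_lim_cong[THEN iffD1, rotated]) (use c1 c2 in \<open>simp add: U_div case_prod_unfold\<close>)
  moreover have "(\<integral>s. iexp (t * (sqrt (Suc N) * (U N K s / U N G s))) \<partial>(P N \<Otimes>\<^sub>M P N))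
      = (\<integral>w. iexp (t * (sqrt (Suc N) * (U N K (w, w) / U N G (w, w)))) \<partial>P N)" for t N
  proof (rule integral_diag[symmetric, where f="\<lambda>s. iexp (t * (sqrt (Suc N) * (U N K s / U N G s)))"])
    have "(\<lambda>s. t * (sqrt (Suc N) * (U N K s / U N G s))) \<in> borel_measurable (Ff N \<Otimes>\<^sub>M Fb N)"
      using U_meas[OF K, of N] U_meas[OF G, of N] by measurable
    then show "(\<lambda>s. iexp (t * (sqrt (Suc N) * (U N K s / U N G s)))) \<in> borel_measurable (Ff N \<Otimes>\<^sub>M Fb N)"
      by measurable
  qed
  moreover have "(c1 / (c1 * d))\<^sup>2 * (\<Gamma>1 (\<lambda>x. \<integral>x'. K x x' \<partial>\<psi>) + \<Gamma>2 f2)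
      = (\<Gamma>1 (\<lambda>x. \<integral>x'. K x x' \<partial>\<psi>) + \<Gamma>2 f2) / d\<^sup>2"
    using c1 by (simp add: power_divide)
  ultimately show ?thesis unfolding cf_lim_def f2_def by (simp only: simp_thms)
qed

end

section \<open>Smoothing distributions and unnormalized measures\<close>

text \<open>\<open>path_int\<close> carries a whole path, although the integrands that occur look at
  no more than two coordinates. Here the integral is a function of the starting point alone: a
  Feynman-Kac semigroup.\<close>

primrec kernel_iter :: "'a measure \<Rightarrow> (nat \<Rightarrow> 'a \<Rightarrow> 'a \<Rightarrow> ennreal) \<Rightarrow> nat \<Rightarrow> nat \<Rightarrow> ('a \<Rightarrow> ennreal) \<Rightarrow> 'a \<Rightarrow> ennreal" where
  "kernel_iter L k 0 u h = h"
| "kernel_iter L k (Suc m) u h = (\<lambda>x. \<integral>\<^sup>+x'. k u x x' * kernel_iter L k m (Suc u) h x' \<partial>L)"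

text \<open>The defining recursion peels off the first kernel, whereas the filter measures grow by
  the last one.\<close>

lemma kernel_iter_last: "kernel_iter L k (Suc m) u h = kernel_iter L k m u (\<lambda>x. \<integral>\<^sup>+x'. k (u + m) x x' * h x' \<partial>L)"
proof (induction m arbitrary: u)
  case (Suc m)
  show ?case
    unfolding kernel_iter.simps(2)[of L k "Suc m"] Suc.IH by (simp add: fun_eq_iff)
qed simp

lemma kernel_iter_meas:
  assumes "sigma_finite_measure L" "\<And>v. u \<le> v \<Longrightarrow> v < u + m \<Longrightarrow> (\<lambda>(x, x'). k v x x') \<in> borel_measurable (L \<Otimes>\<^sub>M L)"
    "h \<in> borel_measurable L"
  shows "kernel_iter L k m u h \<in> borel_measurable L"
  using assms(2)
proof (induction m arbitrary: u)
  case 0 then show ?case using assms(3) by simp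
next
  case (Suc m)
  interpret sigma_finite_measure L by fact
  have k: "(\<lambda>(x, x'). k u x x') \<in> borel_measurable (L \<Otimes>\<^sub>M L)" by (rule Suc.prems) auto
  have p: "kernel_iter L k m (Suc u) h \<in> borel_measurable L" by (rule Suc.IH) (auto intro: Suc.prems)
  have "(\<lambda>(x, x'). k u x x' * kernel_iter L k m (Suc u) h x') \<in> borel_measurable (L \<Otimes>\<^sub>M L)"
    using borel_measurable_times_ennreal[OF k measurable_compose[OF measurable_snd p]] by (simp only: case_prod_unfold)
  then show ?case by (simp add: borel_measurable_nn_integral)
qed

text \<open>Integration never overwrites a coordinate \<open>j \<le> u\<close>, so \<open>h\<close>
  factors out. This serves the backward information filter, whose test function sits at the starting
  time.\<close>

lemma path_int_early:
  assumes "sigma_finite_measure L" "\<And>v. u \<le> v \<Longrightarrow> v < u + m \<Longrightarrow> (\<lambda>(x, x'). k v x x') \<in> borel_measurable (L \<Otimes>\<^sub>M L)"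
    "G \<in> borel_measurable L" "j \<le> u" "y u \<in> space L"
  shows "path_int L k m u y (\<lambda>y. h (y j) * G (y (u + m))) = h (y j) * kernel_iter L k m u G (y u)"
  using assms(2,4,5)
proof (induction m arbitrary: u y)
  case (Suc m)
  have "path_int L k (Suc m) u y (\<lambda>y. h (y j) * G (y (u + Suc m)))
      = (\<integral>\<^sup>+x. k u (y u) x * path_int L k m (Suc u) (y(Suc u := x)) (\<lambda>y. h (y j) * G (y (Suc u + m))) \<partial>L)"
    by simp
  also have "\<dots> = (\<integral>\<^sup>+x. h (y j) * (k u (y u) x * kernel_iter L k m (Suc u) G x) \<partial>L)"
  proof (rule nn_integral_cong)
    fix x assume x: "x \<in> space L"
    have "path_int L k m (Suc u) (y(Suc u := x)) (\<lambda>y. h (y j) * G (y (Suc u + m)))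
        = h ((y(Suc u := x)) j) * kernel_iter L k m (Suc u) G ((y(Suc u := x)) (Suc u))"
      by (rule Suc.IH) (use Suc.prems x in auto)
    then show "k u (y u) x * path_int L k m (Suc u) (y(Suc u := x)) (\<lambda>y. h (y j) * G (y (Suc u + m)))
        = h (y j) * (k u (y u) x * kernel_iter L k m (Suc u) G x)"
      using Suc.prems(2) by (simp add: mult_ac)
  qed
  also have "\<dots> = h (y j) * (\<integral>\<^sup>+x. k u (y u) x * kernel_iter L k m (Suc u) G x \<partial>L)"
  proof (rule nn_integral_cmult)
    have k: "(\<lambda>(x, x'). k u x x') \<in> borel_measurable (L \<Otimes>\<^sub>M L)" by (rule Suc.prems) auto
    have "k u (y u) \<in> borel_measurable L" using measurable_compose[OF measurable_Pair1' k, OF Suc.prems(3)] by simp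
    moreover have "kernel_iter L k m (Suc u) G \<in> borel_measurable L"
      by (rule kernel_iter_meas[OF assms(1) _ assms(3)]) (auto intro: Suc.prems)
    ultimately show "(\<lambda>x. k u (y u) x * kernel_iter L k m (Suc u) G x) \<in> borel_measurable L"
      by (rule borel_measurable_times_ennreal)
  qed
  finally show ?case by simp
qed simp

text \<open>Cuts the path at time \<open>u + m\<close>, where the integral over later coordinates
  becomes a function of the current state. With \<open>m' = 0\<close> this handles filtering, with
  \<open>m' = T - s\<close> smoothing.\<close>

lemma path_int_split:
  assumes "sigma_finite_measure L"
    "\<And>v. u \<le> v \<Longrightarrow> v < u + m + m' \<Longrightarrow> (\<lambda>(x, x'). k v x x') \<in> borel_measurable (L \<Otimes>\<^sub>M L)"
    "G \<in> borel_measurable L" "y u \<in> space L"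
  shows "path_int L k (m + m') u y (\<lambda>y. h (y (u + m)) * G (y (u + m + m')))
    = kernel_iter L k m u (\<lambda>x. h x * kernel_iter L k m' (u + m) G x) (y u)"
  using assms(2,4)
proof (induction m arbitrary: u y)
  case 0
  show ?case using path_int_early[OF assms(1) _ assms(3), of u m' k u y h] 0 by simp
next
  case (Suc m)
  have "path_int L k (Suc m + m') u y (\<lambda>y. h (y (u + Suc m)) * G (y (u + Suc m + m')))
      = (\<integral>\<^sup>+x. k u (y u) x * path_int L k (m + m') (Suc u) (y(Suc u := x)) (\<lambda>y. h (y (Suc u + m)) * G (y (Suc u + m + m'))) \<partial>L)"
    by simp
  also have "\<dots> = (\<integral>\<^sup>+x. k u (y u) x * kernel_iter L k m (Suc u) (\<lambda>x. h x * kernel_iter L k m' (Suc u + m) G x) x \<partial>L)"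
  proof (rule nn_integral_cong)
    fix x assume x: "x \<in> space L"
    have "path_int L k (m + m') (Suc u) (y(Suc u := x)) (\<lambda>y. h (y (Suc u + m)) * G (y (Suc u + m + m')))
        = kernel_iter L k m (Suc u) (\<lambda>x. h x * kernel_iter L k m' (Suc u + m) G x) ((y(Suc u := x)) (Suc u))"
      by (rule Suc.IH) (use Suc.prems x in auto)
    then show "k u (y u) x * path_int L k (m + m') (Suc u) (y(Suc u := x)) (\<lambda>y. h (y (Suc u + m)) * G (y (Suc u + m + m')))
        = k u (y u) x * kernel_iter L k m (Suc u) (\<lambda>x. h x * kernel_iter L k m' (Suc u + m) G x) x" by simp
  qed
  finally show ?case by simp
qed

lemma nn_integral_pos:
  assumes f: "f \<in> borel_measurable M" and pos: "\<And>x. x \<in> space M \<Longrightarrow> 0 < f x" and M: "0 < emeasure M (space M)"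
  shows "0 < (\<integral>\<^sup>+x. f x \<partial>M)"
proof (rule ccontr)
  assume "\<not> 0 < (\<integral>\<^sup>+x. f x \<partial>M)"
  then have "(\<integral>\<^sup>+x. f x \<partial>M) = 0" by (simp add: zero_less_iff_neq_zero)
  then have "AE x in M. f x = 0" using nn_integral_0_iff_AE[OF f] by simp
  then have "AE x in M. False" using AE_space by eventually_elim (use pos in force)
  then have "emeasure M (space M) = 0" by (simp add: AE_iff_null null_setsD1)
  then show False using M by simp
qed

text \<open>\<open>measure_of\<close> takes a set function at face value only if it is countably
  additive; agreement with the emeasure of an existing measure settles that.\<close>

lemma measure_of_normalize:
  assumes sets: "sets \<eta> = sets L" and J: "\<And>h. h \<in> borel_measurable L \<Longrightarrow> J h = (\<integral>\<^sup>+x. h x \<partial>\<eta>)"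
  shows "measure_of (space L) (sets L) (\<lambda>A. J (indicator A) / J (\<lambda>_. 1)) = normalize_measure \<eta>"
proof -
  have sp: "space \<eta> = space L" by (rule sets_eq_imp_space_eq[OF sets])
  have "measure_of (space L) (sets L) (\<lambda>A. J (indicator A) / J (\<lambda>_. 1))
      = measure_of (space L) (sets L) (emeasure (normalize_measure \<eta>))"
  proof (rule measure_of_eq)
    show "sets L \<subseteq> Pow (space L)" by (rule sets.space_closed)
    fix A assume "A \<in> sigma_sets (space L) (sets L)"
    then have A: "A \<in> sets L" by (simp add: sets.sigma_sets_eq)
    have "J (indicator A) = emeasure \<eta> A" using A sets by (subst J) auto
    moreover have "J (\<lambda>_. 1) = emeasure \<eta> (space \<eta>)" by (subst J) auto
    moreover have "emeasure (normalize_measure \<eta>) A = 1 / emeasure \<eta> (space \<eta>) * emeasure \<eta> A"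
      unfolding normalize_measure_def using A sets by (subst emeasure_density_const) auto
    ultimately show "J (indicator A) / J (\<lambda>_. 1) = emeasure (normalize_measure \<eta>) A"
      by (simp add: divide_ennreal_def mult.commute)
  qed
  also have "\<dots> = measure_of (space (normalize_measure \<eta>)) (sets (normalize_measure \<eta>)) (emeasure (normalize_measure \<eta>))"
    by (simp add: sets sp)
  also have "\<dots> = normalize_measure \<eta>" by (rule measure_of_of_measure)
  finally show ?thesis .
qed

text \<open>The measure with density \<open>f\<close> is finite, and \<open>M\<close> is recovered
  from it by the everywhere finite density \<open>1 / f\<close>.\<close>

lemma sigma_finite_of_pos_integrable:
  assumes f: "f \<in> borel_measurable M" and pos: "\<And>x. x \<in> space M \<Longrightarrow> 0 < f x" "\<And>x. x \<in> space M \<Longrightarrow> f x < \<infinity>"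
    and fin: "(\<integral>\<^sup>+x. f x \<partial>M) < \<infinity>"
  shows "sigma_finite_measure M"
proof -
  let ?D = "density M f"
  have "finite_measure ?D"
  proof (rule finite_measureI)
    have "emeasure ?D (space M) = (\<integral>\<^sup>+x. f x \<partial>M)"
      using f by (subst emeasure_density) (auto intro!: nn_integral_cong)
    then show "emeasure ?D (space ?D) \<noteq> \<infinity>" using fin by simp
  qed
  then interpret finite_measure ?D .
  have g: "(\<lambda>x. 1 / f x) \<in> borel_measurable M"
    by (rule borel_measurable_divide_ennreal[OF borel_measurable_const f])
  have "density ?D (\<lambda>x. 1 / f x) = density M (\<lambda>x. f x * (1 / f x))"
    by (rule density_density_eq[OF f g])
  also have "\<dots> = density M (\<lambda>_. 1)"
  proof (rule density_cong)
    show "AE x in M. f x * (1 / f x) = 1"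
    proof (rule AE_I2)
      fix x assume "x \<in> space M"
      with pos have "0 < f x" "f x < \<infinity>" by auto
      then show "f x * (1 / f x) = 1"
        by (simp add: ennreal_times_divide ennreal_divide_self)
    qed
  qed (use borel_measurable_times_ennreal[OF f g] in simp_all)
  also have "\<dots> = M" by (rule density_1)
  finally have eq: "density ?D (\<lambda>x. 1 / f x) = M" .
  have "AE x in ?D. 1 / f x \<noteq> \<infinity>"
  proof (rule AE_I2)
    fix x assume "x \<in> space ?D"
    then have "0 < f x" using pos(1) by simp
    then show "1 / f x \<noteq> \<infinity>" by (auto simp: ennreal_divide_eq_top_iff)
  qed
  moreover have "(\<lambda>x. 1 / f x) \<in> borel_measurable ?D" using g by simp
  ultimately show ?thesis using sigma_finite_iff_density_finite[of "\<lambda>x. 1 / f x"] eq by simp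
qed

text \<open>\<open>\<sigma>\<close> is the first marginal of the measure with density
  \<open>G\<close> relative to the product of \<open>\<eta>\<close> and \<open>\<nu>\<close>.
  Centring \<open>h\<close> at its mean under this marginal is therefore centring
  \<open>(h - \<mu>) * G\<close> under the product; normalisation only rescales. Exchanging the two
  factors serves the other estimator.\<close>

lemma weighted_mean:
  fixes G :: "'a \<Rightarrow> 'b \<Rightarrow> real" and h :: "'a \<Rightarrow> real"
  assumes \<eta>: "emeasure \<eta> (space \<eta>) < \<infinity>" "0 < emeasure \<eta> (space \<eta>)"
    and \<nu>: "emeasure \<nu> (space \<nu>) < \<infinity>" "0 < emeasure \<nu> (space \<nu>)"
    and G: "(\<lambda>(x, x'). G x x') \<in> borel_measurable (\<eta> \<Otimes>\<^sub>M \<nu>)"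
    and G_nn: "\<And>x x'. x \<in> space \<eta> \<Longrightarrow> x' \<in> space \<nu> \<Longrightarrow> 0 \<le> G x x'"
    and G_le: "\<And>x x'. x \<in> space \<eta> \<Longrightarrow> x' \<in> space \<nu> \<Longrightarrow> G x x' \<le> B"
    and h: "h \<in> borel_measurable \<eta>" "\<And>x. x \<in> space \<eta> \<Longrightarrow> \<bar>h x\<bar> \<le> C"
    and \<sigma>: "\<sigma> = density \<eta> (\<lambda>x. \<integral>\<^sup>+x'. ennreal (G x x') \<partial>\<nu>)"
    and \<sigma>_pos: "0 < emeasure \<sigma> (space \<eta>)"
    and \<mu>: "\<mu> = (\<integral>x. h x \<partial>normalize_measure \<sigma>)"
  shows "(\<integral>x. (\<integral>x'. (h x - \<mu>) * G x x' \<partial>normalize_measure \<nu>) \<partial>normalize_measure \<eta>) = 0"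
    and "0 < (\<integral>x. (\<integral>x'. G x x' \<partial>normalize_measure \<nu>) \<partial>normalize_measure \<eta>)"
proof -
  interpret E: finite_measure \<eta> using \<eta>(1) by (intro finite_measureI) auto
  interpret N: finite_measure \<nu> using \<nu>(1) by (intro finite_measureI) auto
  define gg where "gg x = (\<integral>x'. G x x' \<partial>\<nu>)" for x
  have gg_meas: "gg \<in> borel_measurable \<eta>"
    unfolding gg_def[abs_def] by (rule N.borel_measurable_lebesgue_integral[OF G])
  have Gx: "G x \<in> borel_measurable \<nu>" if "x \<in> space \<eta>" for x
    using measurable_compose[OF measurable_Pair1' G, OF that] by simp
  have Gi: "integrable \<nu> (G x)" if x: "x \<in> space \<eta>" for x
    using G_nn[OF x] G_le[OF x] Gx[OF x] by (intro N.integrable_const_bound[where B=B]) auto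
  have gg_nn: "0 \<le> gg x" if x: "x \<in> space \<eta>" for x
    unfolding gg_def by (rule Bochner_Integration.integral_nonneg) (rule G_nn[OF x])
  have gg_le: "gg x \<le> B * measure \<nu> (space \<nu>)" if x: "x \<in> space \<eta>" for x
  proof -
    have "gg x \<le> (\<integral>x'. B \<partial>\<nu>)" unfolding gg_def by (rule integral_mono[OF Gi[OF x]]) (auto simp: G_le[OF x])
    then show ?thesis by (simp add: mult.commute)
  qed
  have \<sigma>_eq: "\<sigma> = density \<eta> (\<lambda>x. ennreal (gg x))"
    unfolding \<sigma>
  proof (rule density_cong)
    show "(\<lambda>x. \<integral>\<^sup>+x'. ennreal (G x x') \<partial>\<nu>) \<in> borel_measurable \<eta>"
      using N.borel_measurable_nn_integral[of "\<lambda>x x'. ennreal (G x x')" \<eta>] measurable_compose[OF G measurable_ennreal]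
      by (simp add: case_prod_unfold)
    show "(\<lambda>x. ennreal (gg x)) \<in> borel_measurable \<eta>" using gg_meas by measurable
    show "AE x in \<eta>. (\<integral>\<^sup>+x'. ennreal (G x x') \<partial>\<nu>) = ennreal (gg x)"
      unfolding gg_def by (intro AE_I2 nn_integral_eq_integral Gi) (auto intro: G_nn)
  qed
  have \<sigma>_sp: "space \<sigma> = space \<eta>" by (simp add: \<sigma>)
  have gg_int: "integrable \<eta> gg"
    using gg_nn gg_le gg_meas by (intro E.integrable_const_bound[where B="B * measure \<nu> (space \<nu>)"]) auto
  have \<sigma>_mass: "emeasure \<sigma> (space \<sigma>) = ennreal (\<integral>x. gg x \<partial>\<eta>)"
  proof -
    have "emeasure \<sigma> (space \<sigma>) = (\<integral>\<^sup>+x. ennreal (gg x) \<partial>\<eta>)"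
      unfolding \<sigma>_sp unfolding \<sigma>_eq using gg_meas by (subst emeasure_density) (auto intro!: nn_integral_cong)
    also have "\<dots> = ennreal (\<integral>x. gg x \<partial>\<eta>)" by (rule nn_integral_eq_integral[OF gg_int]) (auto intro: gg_nn)
    finally show ?thesis .
  qed
  have gg_pos: "0 < (\<integral>x. gg x \<partial>\<eta>)" using \<sigma>_pos \<sigma>_mass \<sigma>_sp by simp
  have \<sigma>_m: "measure \<sigma> (space \<sigma>) = (\<integral>x. gg x \<partial>\<eta>)"
    unfolding measure_def \<sigma>_mass using gg_pos by simp
  have mu_eq: "\<mu> * (\<integral>x. gg x \<partial>\<eta>) = (\<integral>x. gg x * h x \<partial>\<eta>)"
  proof -
    have "\<mu> = (\<integral>x. h x \<partial>\<sigma>) / (\<integral>x. gg x \<partial>\<eta>)"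
      unfolding \<mu> \<sigma>_m[symmetric]
      using \<sigma>_mass \<sigma>_pos \<sigma>_sp h(1) by (intro integral_normalize_measure) (auto simp: \<sigma>)
    moreover have "(\<integral>x. h x \<partial>\<sigma>) = (\<integral>x. gg x * h x \<partial>\<eta>)"
      unfolding \<sigma>_eq using h(1) gg_meas gg_nn by (subst integral_density) auto
    ultimately show ?thesis using gg_pos by simp
  qed
  have inner: "(\<integral>x'. k * G x x' \<partial>normalize_measure \<nu>) = k * gg x / measure \<nu> (space \<nu>)" if x: "x \<in> space \<eta>" for x k
    using integral_normalize_measure[OF \<nu>, of "\<lambda>x'. k * G x x'"] Gx[OF x] by (simp add: gg_def)
  have ghi: "integrable \<eta> (\<lambda>x. gg x * h x)"
  proof (rule Bochner_Integration.integrable_bound[OF integrable_mult_left[OF gg_int, of C]])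
    show "AE x in \<eta>. norm (gg x * h x) \<le> norm (gg x * C)"
    proof (rule AE_I2)
      fix x assume x: "x \<in> space \<eta>"
      have "\<bar>h x\<bar> \<le> \<bar>C\<bar>" using h(2)[OF x] by linarith
      then show "norm (gg x * h x) \<le> norm (gg x * C)" by (simp add: abs_mult mult_left_mono)
    qed
  qed (use gg_meas h(1) in measurable)
  have "(\<integral>x. (\<integral>x'. (h x - \<mu>) * G x x' \<partial>normalize_measure \<nu>) \<partial>normalize_measure \<eta>)
      = (\<integral>x. (gg x * h x - \<mu> * gg x) / measure \<nu> (space \<nu>) \<partial>normalize_measure \<eta>)"
  proof (rule Bochner_Integration.integral_cong[OF refl])
    fix x assume "x \<in> space (normalize_measure \<eta>)"
    then have x: "x \<in> space \<eta>" by simp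
    show "(\<integral>x'. (h x - \<mu>) * G x x' \<partial>normalize_measure \<nu>) = (gg x * h x - \<mu> * gg x) / measure \<nu> (space \<nu>)"
      unfolding inner[OF x] by (simp add: algebra_simps)
  qed
  also have "\<dots> = (\<integral>x. (gg x * h x - \<mu> * gg x) / measure \<nu> (space \<nu>) \<partial>\<eta>) / measure \<eta> (space \<eta>)"
    by (intro integral_normalize_measure[OF \<eta>] borel_measurable_divide borel_measurable_diff borel_measurable_times gg_meas h(1) borel_measurable_const)
  also have "\<dots> = 0"
    using ghi gg_int mu_eq by simp
  finally show "(\<integral>x. (\<integral>x'. (h x - \<mu>) * G x x' \<partial>normalize_measure \<nu>) \<partial>normalize_measure \<eta>) = 0" .
  have "(\<integral>x. (\<integral>x'. G x x' \<partial>normalize_measure \<nu>) \<partial>normalize_measure \<eta>)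
      = (\<integral>x. gg x / measure \<nu> (space \<nu>) \<partial>normalize_measure \<eta>)"
    by (rule Bochner_Integration.integral_cong[OF refl]) (use inner[of _ 1] in simp)
  also have "\<dots> = (\<integral>x. gg x / measure \<nu> (space \<nu>) \<partial>\<eta>) / measure \<eta> (space \<eta>)"
    by (intro integral_normalize_measure[OF \<eta>] borel_measurable_divide gg_meas borel_measurable_const)
  also have "\<dots> > 0"
    using gg_pos normalize_measure_eq(2)[OF \<nu>] normalize_measure_eq(2)[OF \<eta>] by simp
  finally show "0 < (\<integral>x. (\<integral>x'. G x x' \<partial>normalize_measure \<nu>) \<partial>normalize_measure \<eta>)" .
qed

text \<open>As \<open>c / 0 = \<infinity>\<close> for positive \<open>c\<close>, a finite ratio
  forces the numerator to vanish wherever the denominator does. In this way bounded importance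
  weights make the proposal cover the target.\<close>

lemma enn2real_divide_mult:
  assumes "0 \<le> u" "0 \<le> v" "ennreal u / ennreal v < \<infinity>"
  shows "enn2real (ennreal u / ennreal v) * v = u"
proof (cases "v = 0")
  case True
  then have "ennreal u = 0" using assms(3) by (cases "ennreal u = 0") simp_all
  then show ?thesis using True assms(1) by simp
next
  case False
  then have "0 < v" using assms(2) by simp
  then show ?thesis using assms(1) by (simp add: divide_ennreal)
qed

section \<open>The model: unnormalised filters, backward information and smoothing marginals\<close>

locale two_filter_model =
  fixes S :: "'a model" and T :: nat
  assumes model: "standing_assumptions S T"
    and A1_q: "bounded ((\<lambda>(x, x'). trans_dens S x x') ` (space (base S) \<times> space (base S)))"
    and A1_g: "\<forall>t\<le>T. (\<forall>x\<in>space (base S). 0 < pot S t x) \<and> bounded (pot S t ` space (base S))"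
    and A2_omega0: "(SUP x\<in>space (base S). omega0 S x) < \<infinity>"
    and A2: "\<forall>t\<in>{1..T}. (SUP (x, x')\<in>space (base S) \<times> space (base S). omega S t x x') < \<infinity> \<and>
               bounded (fwd_adj S t ` space (base S)) \<and>
               bounded ((\<lambda>(x, x'). fwd_prop S t x x') ` (space (base S) \<times> space (base S)))"
    and A3_omega_final: "(SUP x\<in>space (base S). bwd_omega_final S T x) < \<infinity>"
    and A3_bwd: "\<forall>t<T. bounded ((\<lambda>x. bwd_adj S t x / gam S (t + 1) x) ` space (base S)) \<and>
               bounded ((\<lambda>(x, x'). bwd_prop S t x x') ` (space (base S) \<times> space (base S))) \<and>
               (SUP (x, x')\<in>space (base S) \<times> space (base S). bwd_omega S t x x') < \<infinity>"
begin

abbreviation "L \<equiv> base S"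
abbreviation "X \<equiv> space (base S)"
abbreviation "q \<equiv> trans_dens S"
abbreviation "g \<equiv> pot S"
abbreviation "\<gamma> \<equiv> gam S"

lemma q_dens: "markov_density L q"
  and g_meas: "t \<le> T \<Longrightarrow> g t \<in> borel_measurable L"
  and \<chi>_prob: "prob_space (init_law S)" and \<chi>_sets: "sets (init_law S) = sets L"
  and \<rho>_prob: "prob_space (init_prop S)" and \<rho>_sets: "sets (init_prop S) = sets L"
  and deriv_meas: "init_deriv S \<in> borel_measurable L"
  and deriv: "density (init_prop S) (init_deriv S) = init_law S"
  and adj_meas: "t \<in> {1..T} \<Longrightarrow> fwd_adj S t \<in> borel_measurable L"
  and adj_nn: "t \<in> {1..T} \<Longrightarrow> x \<in> X \<Longrightarrow> 0 \<le> fwd_adj S t x"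
  and prop_dens: "t \<in> {1..T} \<Longrightarrow> markov_density L (fwd_prop S t)"
  and \<gamma>_meas: "t \<le> T \<Longrightarrow> \<gamma> t \<in> borel_measurable L"
  and \<gamma>_pos: "t \<le> T \<Longrightarrow> x \<in> X \<Longrightarrow> 0 < \<gamma> t x"
  and info_fin: "t \<le> T \<Longrightarrow> bwd_info_int S T t (\<lambda>_. 1) < \<infinity>"
  and b0_meas: "bwd_init_prop S \<in> borel_measurable L"
  and b0_nn: "x \<in> X \<Longrightarrow> 0 \<le> bwd_init_prop S x"
  and b0_int: "(\<integral>\<^sup>+x. ennreal (bwd_init_prop S x) \<partial>L) = 1"
  and badj_meas: "t < T \<Longrightarrow> bwd_adj S t \<in> borel_measurable L"
  and badj_nn: "t < T \<Longrightarrow> x \<in> X \<Longrightarrow> 0 \<le> bwd_adj S t x"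
  and bprop_dens: "t < T \<Longrightarrow> markov_density L (bwd_prop S t)"
  using model unfolding standing_assumptions_def Let_def by (elim conjE, simp)+

lemma g_pos: "t \<le> T \<Longrightarrow> x \<in> X \<Longrightarrow> 0 < g t x"
  using A1_g by blast

lemma q_meas: "(\<lambda>(x, x'). q x x') \<in> borel_measurable (L \<Otimes>\<^sub>M L)"
  and q_nn: "x \<in> X \<Longrightarrow> x' \<in> X \<Longrightarrow> 0 \<le> q x x'"
  and q_int: "x \<in> X \<Longrightarrow> (\<integral>\<^sup>+x'. ennreal (q x x') \<partial>L) = 1"
  using q_dens by (auto simp: markov_density_def)

lemma g_bounded: "t \<le> T \<Longrightarrow> \<exists>B\<ge>0. \<forall>x\<in>X. g t x \<le> B"
proof -
  assume t: "t \<le> T"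
  then obtain B where B: "\<forall>x\<in>X. \<bar>g t x\<bar> \<le> B"
    using A1_g by (auto simp: bounded_iff)
  show ?thesis
    by (rule exI[of _ "max B 0"]) (use B in \<open>auto intro: le_max_iff_disj[THEN iffD2] order_trans[OF abs_ge_self]\<close>)
qed

lemma ennreal_g_meas: "t \<le> T \<Longrightarrow> (\<lambda>x. ennreal (g t x)) \<in> borel_measurable L"
  using measurable_compose[OF g_meas measurable_ennreal] .

text \<open>The base measure is an arbitrary measure in the model; the positive function
  \<open>\<gamma> T * g T\<close> has finite integral by the instance \<open>t = T\<close> of
  \<open>info_fin\<close>.\<close>

lemma sf: "sigma_finite_measure L"
proof (rule sigma_finite_of_pos_integrable)
  show "(\<lambda>x. ennreal (\<gamma> T x) * ennreal (g T x)) \<in> borel_measurable L"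
    using measurable_compose[OF \<gamma>_meas measurable_ennreal, OF order_refl] ennreal_g_meas[OF order_refl]
    by (rule borel_measurable_times_ennreal)
  show "0 < ennreal (\<gamma> T x) * ennreal (g T x)" if "x \<in> X" for x
    using \<gamma>_pos[OF order_refl that] g_pos[OF order_refl that] by (simp add: ennreal_zero_less_mult_iff)
  show "ennreal (\<gamma> T x) * ennreal (g T x) < \<infinity>" for x
    by (simp add: ennreal_mult_less_top)
  show "(\<integral>\<^sup>+x. ennreal (\<gamma> T x) * ennreal (g T x) \<partial>L) < \<infinity>"
    using info_fin[OF order_refl] by (simp add: bwd_info_int_def)
qed

sublocale L: sigma_finite_measure L by (rule sf)
sublocale \<rho>: prob_space "init_prop S" by (rule \<rho>_prob)

text \<open>The space carries a probability, so it has a point \<open>x\<close>, and the density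
  \<open>q x\<close> of integral 1 cannot live on a null space.\<close>

lemma X_mass: "0 < emeasure L X"
proof -
  have "X \<noteq> {}"
    using \<rho>.not_empty sets_eq_imp_space_eq[OF \<rho>_sets] by simp
  then obtain x where x: "x \<in> X" by blast
  show ?thesis
  proof (rule ccontr)
    assume "\<not> 0 < emeasure L X"
    then have "emeasure L X = 0" by (simp add: zero_less_iff_neq_zero)
    then have "AE x' in L. ennreal (q x x') = 0"
      by (intro AE_I[where N=X]) auto
    then have "(\<integral>\<^sup>+x'. ennreal (q x x') \<partial>L) = (\<integral>\<^sup>+x'. 0 \<partial>L)" by (rule nn_integral_cong_AE)
    then show False using q_int[OF x] by simp
  qed
qed

lemma q_x_meas: "x \<in> X \<Longrightarrow> q x \<in> borel_measurable L"
  using measurable_compose[OF measurable_Pair1' q_meas] by simp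

lemma q_integral_pos:
  assumes x: "x \<in> X" and f: "f \<in> borel_measurable L" "\<And>x'. x' \<in> X \<Longrightarrow> 0 < f x'"
  shows "0 < (\<integral>\<^sup>+x'. ennreal (q x x') * f x' \<partial>L)"
proof -
  have "(\<integral>\<^sup>+x'. ennreal (q x x') * f x' \<partial>L) = (\<integral>\<^sup>+x'. f x' \<partial>density L (\<lambda>x'. ennreal (q x x')))"
    using q_x_meas[OF x] f(1) by (intro nn_integral_density[symmetric]) auto
  also have "\<dots> > 0"
  proof (rule nn_integral_pos)
    have "emeasure (density L (\<lambda>x'. ennreal (q x x'))) X = (\<integral>\<^sup>+x'. ennreal (q x x') \<partial>L)"
      using q_x_meas[OF x] by (subst emeasure_density) (auto intro!: nn_integral_cong)
    then show "0 < emeasure (density L (\<lambda>x'. ennreal (q x x'))) (space (density L (\<lambda>x'. ennreal (q x x'))))"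
      by (simp add: q_int[OF x])
  qed (use f in auto)
  finally show ?thesis .
qed

lemma omega0_fin: "x \<in> X \<Longrightarrow> omega0 S x < \<infinity>"
  using A2_omega0 SUP_upper[of x X "omega0 S"] by (rule order_le_less_trans[rotated])

text \<open>\<open>kf\<close> attaches the potential to the arrival point and \<open>kb\<close> to
  the departure point, as in the two path integrals of the model; \<open>g_\<beta>\<close> passes
  from one to the other.\<close>

definition kf :: "nat \<Rightarrow> 'a \<Rightarrow> 'a \<Rightarrow> ennreal" where "kf v x x' = ennreal (q x x' * g (Suc v) x')"
definition kb :: "nat \<Rightarrow> 'a \<Rightarrow> 'a \<Rightarrow> ennreal" where "kb v x x' = ennreal (g v x * q x x')"

definition \<kappa>f :: "nat \<Rightarrow> 'a \<Rightarrow> 'a \<Rightarrow> real" where "\<kappa>f n x x' = q x x' * g (Suc n) x'"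
text \<open>Time reversal: step \<open>n\<close> goes from time \<open>T - n\<close> back to
  \<open>T - Suc n\<close>, and the arguments are swapped so that the departure point comes
  first.\<close>

definition \<kappa>b :: "nat \<Rightarrow> 'a \<Rightarrow> 'a \<Rightarrow> real" where "\<kappa>b n x x' = bwd_kernel S (T - Suc n) x' x"

primrec \<eta> :: "nat \<Rightarrow> 'a measure" where
  "\<eta> 0 = density (init_prop S) (\<lambda>x. ennreal (enn2real (omega0 S x)))"
| "\<eta> (Suc n) = density L (\<lambda>x'. \<integral>\<^sup>+x. ennreal (\<kappa>f n x x') \<partial>\<eta> n)"

text \<open>The initial measure has density \<open>g T * \<gamma> T\<close>, written as proposal
  density times weight to match the start of a particle chain.\<close>

primrec \<nu> :: "nat \<Rightarrow> 'a measure" where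
  "\<nu> 0 = density (density L (\<lambda>x. ennreal (bwd_init_prop S x))) (\<lambda>x. ennreal (enn2real (bwd_omega_final S T x)))"
| "\<nu> (Suc n) = density L (\<lambda>x'. \<integral>\<^sup>+x. ennreal (\<kappa>b n x x') \<partial>\<nu> n)"

lemma \<eta>_sets: "sets (\<eta> n) = sets L" and \<eta>_space: "space (\<eta> n) = X"
proof -
  show s: "sets (\<eta> n) = sets L" by (cases n) (simp_all add: \<rho>_sets)
  show "space (\<eta> n) = X" by (rule sets_eq_imp_space_eq[OF s])
qed

lemma \<nu>_sets: "sets (\<nu> n) = sets L" and \<nu>_space: "space (\<nu> n) = X"
  by (cases n; simp)+

lemma \<kappa>f_meas: "n < T \<Longrightarrow> (\<lambda>(x, x'). \<kappa>f n x x') \<in> borel_measurable (L \<Otimes>\<^sub>M L)"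
  using borel_measurable_times[OF q_meas measurable_compose[OF measurable_snd g_meas[of "Suc n"]]]
  by (simp add: \<kappa>f_def case_prod_unfold)

lemma \<kappa>f_nn: "n < T \<Longrightarrow> x \<in> X \<Longrightarrow> x' \<in> X \<Longrightarrow> 0 \<le> \<kappa>f n x x'"
  unfolding \<kappa>f_def by (intro mult_nonneg_nonneg q_nn less_imp_le[OF g_pos]) auto

lemma kf_meas: "v < T \<Longrightarrow> (\<lambda>(x, x'). kf v x x') \<in> borel_measurable (L \<Otimes>\<^sub>M L)"
  using measurable_compose[OF \<kappa>f_meas measurable_ennreal] by (simp add: kf_def \<kappa>f_def case_prod_unfold)

lemma kb_meas: "v \<le> T \<Longrightarrow> (\<lambda>(x, x'). kb v x x') \<in> borel_measurable (L \<Otimes>\<^sub>M L)"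
  using measurable_compose[OF borel_measurable_times[OF measurable_compose[OF measurable_fst g_meas] q_meas] measurable_ennreal, of v]
  by (simp add: kb_def case_prod_unfold)

lemma \<kappa>f_int: "n < T \<Longrightarrow> \<exists>B\<ge>0. \<forall>x\<in>X. (\<integral>\<^sup>+x'. ennreal (\<kappa>f n x x') \<partial>L) \<le> ennreal B"
proof -
  assume n: "n < T"
  then obtain B where B: "0 \<le> B" "\<forall>x\<in>X. g (Suc n) x \<le> B" using g_bounded[of "Suc n"] by auto
  have "(\<integral>\<^sup>+x'. ennreal (\<kappa>f n x x') \<partial>L) \<le> ennreal B" if x: "x \<in> X" for x
  proof -
    have "(\<integral>\<^sup>+x'. ennreal (\<kappa>f n x x') \<partial>L) \<le> (\<integral>\<^sup>+x'. ennreal B * ennreal (q x x') \<partial>L)"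
    proof (rule nn_integral_mono)
      fix x' assume x': "x' \<in> X"
      have "\<kappa>f n x x' \<le> B * q x x'"
        unfolding \<kappa>f_def using mult_left_mono[OF B(2)[rule_format, OF x'] q_nn[OF x x']] by (simp add: mult.commute)
      then show "ennreal (\<kappa>f n x x') \<le> ennreal B * ennreal (q x x')"
        using B(1) q_nn[OF x x'] by (simp add: ennreal_mult[symmetric] ennreal_leI)
    qed
    also have "\<dots> = ennreal B" using q_x_meas[OF x] q_int[OF x] by (subst nn_integral_cmult) auto
    finally show ?thesis .
  qed
  with B(1) show ?thesis by blast
qed

lemma \<eta>_fin: "n \<le> T \<Longrightarrow> emeasure (\<eta> n) (space (\<eta> n)) < \<infinity>"
proof (induction n)
  case 0
  have om: "(\<lambda>x. ennreal (enn2real (omega0 S x))) \<in> borel_measurable (init_prop S)"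
    using deriv_meas g_meas[of 0] \<rho>_sets unfolding omega0_def by (simp cong: measurable_cong_sets)
  have "emeasure (\<eta> 0) (space (\<eta> 0)) = (\<integral>\<^sup>+x. ennreal (enn2real (omega0 S x)) * indicator (space (init_prop S)) x \<partial>init_prop S)"
    unfolding \<eta>.simps space_density by (rule emeasure_density[OF om sets.top])
  also have "\<dots> \<le> (\<integral>\<^sup>+x. (SUP x\<in>X. omega0 S x) \<partial>init_prop S)"
  proof (rule nn_integral_mono)
    fix x assume "x \<in> space (init_prop S)"
    then have x: "x \<in> X" using sets_eq_imp_space_eq[OF \<rho>_sets] by simp
    have "ennreal (enn2real (omega0 S x)) = omega0 S x" using omega0_fin[OF x] by simp
    also have "\<dots> \<le> (SUP x\<in>X. omega0 S x)" by (rule SUP_upper[OF x])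
    finally show "ennreal (enn2real (omega0 S x)) * indicator (space (init_prop S)) x \<le> (SUP x\<in>X. omega0 S x)"
      by (simp add: indicator_def)
  qed
  also have "\<dots> < \<infinity>" using A2_omega0 by (simp add: \<rho>.emeasure_space_1)
  finally show ?case .
next
  case (Suc n)
  then have n: "n < T" "n \<le> T" by auto
  obtain B where B: "0 \<le> B" "\<forall>x\<in>X. (\<integral>\<^sup>+x'. ennreal (\<kappa>f n x x') \<partial>L) \<le> ennreal B" using \<kappa>f_int[OF n(1)] by blast
  have "finite_measure (\<eta> n)" using Suc.IH[OF n(2)] by (intro finite_measureI) auto
  from integral_kernel_measure(2)[OF sf this \<eta>_sets \<kappa>f_meas[OF n(1)] \<kappa>f_nn[OF n(1)] B(2)[rule_format] B(1)]
  show ?case by simp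
qed

lemma \<eta>_finite_measure: "n \<le> T \<Longrightarrow> finite_measure (\<eta> n)"
  using \<eta>_fin[of n] by (intro finite_measureI) auto

text \<open>The induction is over all \<open>h\<close>, because \<open>kernel_iter_last\<close>
  absorbs the last kernel into \<open>h\<close>. At \<open>n = 0\<close>, \<open>init_deriv\<close>
  turns the integral over \<open>init_law\<close> into one over \<open>init_prop\<close>.\<close>

lemma \<eta>_integral:
  assumes n: "n \<le> T" and h: "h \<in> borel_measurable L"
  shows "(\<integral>\<^sup>+x. ennreal (g 0 x) * kernel_iter L kf n 0 h x \<partial>init_law S) = (\<integral>\<^sup>+x. h x \<partial>\<eta> n)"
  using n h
proof (induction n arbitrary: h)
  case 0
  have hm: "h \<in> borel_measurable (init_prop S)" "init_deriv S \<in> borel_measurable (init_prop S)"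
    "(\<lambda>x. ennreal (g 0 x)) \<in> borel_measurable (init_prop S)"
    using 0 deriv_meas ennreal_g_meas[of 0] \<rho>_sets by (simp_all cong: measurable_cong_sets)
  have om: "(\<lambda>x. ennreal (enn2real (omega0 S x))) \<in> borel_measurable (init_prop S)"
    using hm unfolding omega0_def by measurable
  have "(\<integral>\<^sup>+x. ennreal (g 0 x) * h x \<partial>init_law S) = (\<integral>\<^sup>+x. init_deriv S x * (ennreal (g 0 x) * h x) \<partial>init_prop S)"
    unfolding deriv[symmetric] by (rule nn_integral_density[OF hm(2) borel_measurable_times_ennreal[OF hm(3,1)]])
  also have "\<dots> = (\<integral>\<^sup>+x. ennreal (enn2real (omega0 S x)) * h x \<partial>init_prop S)"
  proof (rule nn_integral_cong)
    fix x assume "x \<in> space (init_prop S)"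
    then have "x \<in> X" using sets_eq_imp_space_eq[OF \<rho>_sets] by simp
    then have "ennreal (enn2real (omega0 S x)) = omega0 S x" using omega0_fin by simp
    then show "init_deriv S x * (ennreal (g 0 x) * h x) = ennreal (enn2real (omega0 S x)) * h x"
      by (simp add: omega0_def mult.assoc)
  qed
  also have "\<dots> = (\<integral>\<^sup>+x. h x \<partial>\<eta> 0)"
    by (simp add: nn_integral_density[OF om hm(1)])
  finally show ?case by simp
next
  case (Suc n)
  then have n: "n < T" "n \<le> T" by auto
  obtain B where B: "0 \<le> B" "\<forall>x\<in>X. (\<integral>\<^sup>+x'. ennreal (\<kappa>f n x x') \<partial>L) \<le> ennreal B" using \<kappa>f_int[OF n(1)] by blast
  have hk: "(\<lambda>x. \<integral>\<^sup>+x'. kf n x x' * h x' \<partial>L) \<in> borel_measurable L"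
  proof -
    have "(\<lambda>(x, x'). kf n x x' * h x') \<in> borel_measurable (L \<Otimes>\<^sub>M L)"
      using borel_measurable_times_ennreal[OF kf_meas[OF n(1)] measurable_compose[OF measurable_snd Suc.prems(2)]]
      by (simp only: case_prod_unfold)
    then show ?thesis by (rule L.borel_measurable_nn_integral)
  qed
  have "(\<integral>\<^sup>+x. ennreal (g 0 x) * kernel_iter L kf (Suc n) 0 h x \<partial>init_law S)
      = (\<integral>\<^sup>+x. (\<integral>\<^sup>+x'. kf n x x' * h x' \<partial>L) \<partial>\<eta> n)"
    unfolding kernel_iter_last using Suc.IH[OF n(2) hk] by simp
  also have "\<dots> = (\<integral>\<^sup>+x. h x \<partial>\<eta> (Suc n))"
    using integral_kernel_measure(1)[OF sf \<eta>_finite_measure[OF n(2)] \<eta>_sets \<kappa>f_meas[OF n(1)] \<kappa>f_nn[OF n(1)] B(2)[rule_format] B(1) Suc.prems(2)]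
    by (simp add: kf_def \<kappa>f_def)
  finally show ?case .
qed

text \<open>The future path integral from a state at time \<open>s\<close>, without the potential at
  \<open>s\<close> itself; \<open>bb t\<close> includes the one at \<open>t\<close>.\<close>

definition \<beta> :: "nat \<Rightarrow> 'a \<Rightarrow> ennreal" where "\<beta> s = kernel_iter L kf (T - s) s (\<lambda>_. 1)"
definition bb :: "nat \<Rightarrow> 'a \<Rightarrow> ennreal" where "bb t = kernel_iter L kb (T - t) t (\<lambda>x. ennreal (g T x))"

lemma \<beta>_meas: "s \<le> T \<Longrightarrow> \<beta> s \<in> borel_measurable L"
  unfolding \<beta>_def by (rule kernel_iter_meas[OF sf]) (auto intro: kf_meas)

lemma bb_meas: "t \<le> T \<Longrightarrow> bb t \<in> borel_measurable L"
  unfolding bb_def by (rule kernel_iter_meas[OF sf]) (auto intro: kb_meas ennreal_g_meas)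

text \<open>Each potential moves from the arrival end of one transition to the departure end of the
  next, which leaves \<open>g t\<close> at the start and \<open>g T\<close> at the end.\<close>

lemma g_\<beta>: "t \<le> T \<Longrightarrow> x \<in> X \<Longrightarrow> ennreal (g t x) * \<beta> t x = bb t x"
proof -
  have "ennreal (g u x) * kernel_iter L kf m u (\<lambda>_. 1) x = kernel_iter L kb m u (\<lambda>x. ennreal (g T x)) x"
    if "u + m = T" "x \<in> X" for u m x
    using that
  proof (induction m arbitrary: u x)
    case (Suc m)
    have u: "u \<le> T" "Suc u \<le> T" "u < T" using Suc.prems by auto
    let ?f = "\<lambda>x'. kernel_iter L kf m (Suc u) (\<lambda>_. 1) x'"
    have fm: "?f \<in> borel_measurable L"
      using Suc.prems(1) by (intro kernel_iter_meas[OF sf]) (auto intro: kf_meas)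
    have "ennreal (g u x) * kernel_iter L kf (Suc m) u (\<lambda>_. 1) x = (\<integral>\<^sup>+x'. ennreal (g u x) * (kf u x x' * ?f x') \<partial>L)"
    proof -
      have "kf u x \<in> borel_measurable L"
        using measurable_compose[OF measurable_Pair1' kf_meas[OF u(3)], OF Suc.prems(2)] by simp
      then show ?thesis using fm by (simp add: nn_integral_cmult)
    qed
    also have "\<dots> = (\<integral>\<^sup>+x'. kb u x x' * kernel_iter L kb m (Suc u) (\<lambda>x. ennreal (g T x)) x' \<partial>L)"
    proof (rule nn_integral_cong)
      fix x' assume x': "x' \<in> X"
      have "ennreal (g u x) * (kf u x x' * ?f x') = kb u x x' * (ennreal (g (Suc u) x') * ?f x')"
        using g_pos[OF u(1) Suc.prems(2)] g_pos[OF u(2) x'] q_nn[OF Suc.prems(2) x']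
        by (simp add: kf_def kb_def ennreal_mult mult_ac)
      also have "ennreal (g (Suc u) x') * ?f x' = kernel_iter L kb m (Suc u) (\<lambda>x. ennreal (g T x)) x'"
        using Suc.prems x' by (intro Suc.IH) auto
      finally show "ennreal (g u x) * (kf u x x' * ?f x') = kb u x x' * kernel_iter L kb m (Suc u) (\<lambda>x. ennreal (g T x)) x'" .
    qed
    finally show ?case by simp
  qed simp
  then show "t \<le> T \<Longrightarrow> x \<in> X \<Longrightarrow> ennreal (g t x) * \<beta> t x = bb t x"
    unfolding \<beta>_def bb_def by simp
qed

lemma \<beta>_Suc: "s < T \<Longrightarrow> x \<in> X \<Longrightarrow> \<beta> s x = (\<integral>\<^sup>+x'. ennreal (q x x') * bb (Suc s) x' \<partial>L)"
proof -
  assume s: "s < T" and x: "x \<in> X"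
  then have "T - s = Suc (T - Suc s)" by simp
  then have "\<beta> s x = (\<integral>\<^sup>+x'. kf s x x' * \<beta> (Suc s) x' \<partial>L)" by (simp add: \<beta>_def)
  also have "\<dots> = (\<integral>\<^sup>+x'. ennreal (q x x') * bb (Suc s) x' \<partial>L)"
  proof (rule nn_integral_cong)
    fix x' assume x': "x' \<in> X"
    show "kf s x x' * \<beta> (Suc s) x' = ennreal (q x x') * bb (Suc s) x'"
      using g_\<beta>[of "Suc s" x'] s x' q_nn[OF x x'] g_pos[of "Suc s" x'] by (simp add: kf_def ennreal_mult mult.assoc)
  qed
  finally show ?thesis .
qed

lemma bb_Suc: "t < T \<Longrightarrow> x \<in> X \<Longrightarrow> bb t x = ennreal (g t x) * (\<integral>\<^sup>+x'. ennreal (q x x') * bb (Suc t) x' \<partial>L)"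
  using g_\<beta>[of t x] \<beta>_Suc[of t x] by simp

lemma bb_pos: "t \<le> T \<Longrightarrow> x \<in> X \<Longrightarrow> 0 < bb t x"
proof (induction "T - t" arbitrary: t x)
  case 0
  then have "t = T" by simp
  then show ?case using g_pos[of T x] 0 by (simp add: bb_def)
next
  case (Suc m)
  then have t: "t < T" "Suc t \<le> T" by auto
  have "0 < (\<integral>\<^sup>+x'. ennreal (q x x') * bb (Suc t) x' \<partial>L)"
    by (rule q_integral_pos[OF Suc.prems(2) bb_meas[OF t(2)]]) (rule Suc.hyps(1), use Suc.hyps(2) t in auto)
  then show ?case
    unfolding bb_Suc[OF t(1) Suc.prems(2)] using g_pos[OF Suc.prems] by (simp add: ennreal_zero_less_mult_iff)
qed

lemma ennreal_\<gamma>_meas: "t \<le> T \<Longrightarrow> (\<lambda>x. ennreal (\<gamma> t x)) \<in> borel_measurable L"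
  using measurable_compose[OF \<gamma>_meas measurable_ennreal] .

lemma \<gamma>bb_meas: "t \<le> T \<Longrightarrow> (\<lambda>x. ennreal (\<gamma> t x) * bb t x) \<in> borel_measurable L"
  by (intro borel_measurable_times_ennreal ennreal_\<gamma>_meas bb_meas)

lemma b0_prob: "prob_space (density L (\<lambda>x. ennreal (bwd_init_prop S x)))"
proof (rule prob_spaceI)
  have "emeasure (density L (\<lambda>x. ennreal (bwd_init_prop S x))) X = (\<integral>\<^sup>+x. ennreal (bwd_init_prop S x) \<partial>L)"
    using b0_meas by (subst emeasure_density) (auto intro!: nn_integral_cong)
  then show "emeasure (density L (\<lambda>x. ennreal (bwd_init_prop S x))) (space (density L (\<lambda>x. ennreal (bwd_init_prop S x)))) = 1"
    by (simp add: b0_int)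
qed

lemma final_fin: "x \<in> X \<Longrightarrow> bwd_omega_final S T x < \<infinity>"
  using A3_omega_final SUP_upper[of x X "bwd_omega_final S T"] by (rule order_le_less_trans[rotated])

lemma final_meas: "bwd_omega_final S T \<in> borel_measurable L"
proof -
  have "(\<lambda>x. ennreal (g T x * \<gamma> T x)) \<in> borel_measurable L"
    using measurable_compose[OF borel_measurable_times[OF g_meas \<gamma>_meas] measurable_ennreal, of T T] by simp
  from borel_measurable_divide_ennreal[OF this measurable_compose[OF b0_meas measurable_ennreal]]
  show ?thesis unfolding bwd_omega_final_def[abs_def] by simp
qed

lemma final_mult: "x \<in> X \<Longrightarrow> enn2real (bwd_omega_final S T x) * bwd_init_prop S x = g T x * \<gamma> T x"
  using final_fin[of x] g_pos[of T x] \<gamma>_pos[of T x] b0_nn[of x] unfolding bwd_omega_final_def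
  by (intro enn2real_divide_mult) auto

text \<open>\<open>bwd_kernel\<close> divides by \<open>\<gamma>\<close> at the later time,
  cancelling the factor in the preceding density, and multiplies by \<open>\<gamma>\<close> at the
  earlier time. Thus only one artificial factor is present at each step.\<close>

lemma \<nu>_density: "m \<le> T \<Longrightarrow> \<nu> m = density L (\<lambda>x. ennreal (\<gamma> (T - m) x) * bb (T - m) x)"
proof (induction m)
  case 0
  have om: "(\<lambda>x. ennreal (enn2real (bwd_omega_final S T x))) \<in> borel_measurable L"
    using final_meas by measurable
  have "\<nu> 0 = density L (\<lambda>x. ennreal (bwd_init_prop S x) * ennreal (enn2real (bwd_omega_final S T x)))"
    using b0_meas om by (simp add: density_density_eq)
  also have "\<dots> = density L (\<lambda>x. ennreal (\<gamma> T x) * bb T x)"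
  proof (rule density_cong)
    show "AE x in L. ennreal (bwd_init_prop S x) * ennreal (enn2real (bwd_omega_final S T x)) = ennreal (\<gamma> T x) * bb T x"
    proof (rule AE_I2)
      fix x assume x: "x \<in> X"
      have "ennreal (bwd_init_prop S x) * ennreal (enn2real (bwd_omega_final S T x)) = ennreal (enn2real (bwd_omega_final S T x) * bwd_init_prop S x)"
        using b0_nn[OF x] by (simp add: ennreal_mult mult.commute)
      also have "\<dots> = ennreal (\<gamma> T x) * bb T x"
        unfolding final_mult[OF x] bb_def using g_pos[of T x] \<gamma>_pos[of T x] x by (simp add: ennreal_mult mult.commute)
      finally show "ennreal (bwd_init_prop S x) * ennreal (enn2real (bwd_omega_final S T x)) = ennreal (\<gamma> T x) * bb T x" .
    qed
    show "(\<lambda>x. ennreal (bwd_init_prop S x) * ennreal (enn2real (bwd_omega_final S T x))) \<in> borel_measurable L"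
      by (rule borel_measurable_times_ennreal[OF measurable_compose[OF b0_meas measurable_ennreal] om])
  qed (rule \<gamma>bb_meas[OF order_refl])
  finally show ?case by simp
next
  case (Suc m)
  define t where "t = T - Suc m"
  have t: "t < T" "Suc t = T - m" "Suc t \<le> T" "t \<le> T" using Suc.prems by (auto simp: t_def)
  have IH: "\<nu> m = density L (\<lambda>x. ennreal (\<gamma> (Suc t) x) * bb (Suc t) x)"
    using Suc unfolding t(2) by simp
  have kx: "(\<lambda>x'. bwd_kernel S t x x') \<in> borel_measurable L" if x: "x \<in> X" for x
  proof -
    have "(\<lambda>x'. \<gamma> t x * g t x * q x x') \<in> borel_measurable L" using q_x_meas[OF x] by measurable
    moreover have "(\<lambda>x'. inverse (\<gamma> (Suc t) x')) \<in> borel_measurable L" using \<gamma>_meas[OF t(3)] by measurable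
    ultimately show ?thesis unfolding bwd_kernel_def by (rule borel_measurable_times)
  qed
  have point: "(\<integral>\<^sup>+x'. ennreal (bwd_kernel S t x x') \<partial>\<nu> m) = ennreal (\<gamma> t x) * bb t x" if x: "x \<in> X" for x
  proof -
    have "(\<integral>\<^sup>+x'. ennreal (bwd_kernel S t x x') \<partial>\<nu> m)
        = (\<integral>\<^sup>+x'. ennreal (\<gamma> (Suc t) x') * bb (Suc t) x' * ennreal (bwd_kernel S t x x') \<partial>L)"
      unfolding IH by (rule nn_integral_density[OF \<gamma>bb_meas[OF t(3)] measurable_compose[OF kx[OF x] measurable_ennreal]])
    also have "\<dots> = (\<integral>\<^sup>+x'. ennreal (\<gamma> t x * g t x) * (ennreal (q x x') * bb (Suc t) x') \<partial>L)"
    proof (rule nn_integral_cong)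
      fix x' assume x': "x' \<in> X"
      have "ennreal (\<gamma> (Suc t) x') * ennreal (bwd_kernel S t x x') = ennreal (\<gamma> (Suc t) x' * bwd_kernel S t x x')"
        using \<gamma>_pos[OF t(3) x'] \<gamma>_pos[OF t(4) x] g_pos[OF t(4) x] q_nn[OF x x']
        by (intro ennreal_mult[symmetric]) (auto simp: bwd_kernel_def)
      also have "\<gamma> (Suc t) x' * bwd_kernel S t x x' = \<gamma> t x * g t x * q x x'"
        using \<gamma>_pos[OF t(3) x'] by (simp add: bwd_kernel_def)
      also have "ennreal (\<gamma> t x * g t x * q x x') = ennreal (\<gamma> t x * g t x) * ennreal (q x x')"
        using \<gamma>_pos[OF t(4) x] g_pos[OF t(4) x] q_nn[OF x x'] by (intro ennreal_mult) auto
      finally have "ennreal (\<gamma> (Suc t) x') * ennreal (bwd_kernel S t x x') = ennreal (\<gamma> t x * g t x) * ennreal (q x x')" .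
      then show "ennreal (\<gamma> (Suc t) x') * bb (Suc t) x' * ennreal (bwd_kernel S t x x')
          = ennreal (\<gamma> t x * g t x) * (ennreal (q x x') * bb (Suc t) x')"
        by (metis mult.assoc mult.commute)
    qed
    also have "\<dots> = ennreal (\<gamma> t x * g t x) * (\<integral>\<^sup>+x'. ennreal (q x x') * bb (Suc t) x' \<partial>L)"
      by (intro nn_integral_cmult borel_measurable_times_ennreal measurable_compose[OF q_x_meas[OF x] measurable_ennreal] bb_meas t)
    also have "\<dots> = ennreal (\<gamma> t x) * bb t x"
      unfolding bb_Suc[OF t(1) x] using \<gamma>_pos[OF t(4) x] g_pos[OF t(4) x] by (simp add: ennreal_mult mult.assoc)
    finally show ?thesis .
  qed
  have eq: "\<nu> (Suc m) = density L (\<lambda>x. \<integral>\<^sup>+x'. ennreal (bwd_kernel S t x x') \<partial>\<nu> m)"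
    by (simp add: \<kappa>b_def t_def)
  also have "\<dots> = density L (\<lambda>x. ennreal (\<gamma> t x) * bb t x)"
  proof (rule density_cong)
    show "AE x in L. (\<integral>\<^sup>+x'. ennreal (bwd_kernel S t x x') \<partial>\<nu> m) = ennreal (\<gamma> t x) * bb t x"
      by (rule AE_I2) (rule point)
    show "(\<lambda>x. \<integral>\<^sup>+x'. ennreal (bwd_kernel S t x x') \<partial>\<nu> m) \<in> borel_measurable L"
      using \<gamma>bb_meas[OF t(4)] point by (subst measurable_cong) auto
  qed (rule \<gamma>bb_meas[OF t(4)])
  finally show ?case by (simp add: t_def)
qed

lemma filtering_eq: "s \<le> T \<Longrightarrow> filtering S s = normalize_measure (\<eta> s)"
  unfolding filtering_def smoothing_def
proof (rule measure_of_normalize[OF \<eta>_sets])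
  fix h :: "'a \<Rightarrow> ennreal" assume s: "s \<le> T" and h: "h \<in> borel_measurable L"
  have "smoothing_int S s s h = (\<integral>\<^sup>+x. ennreal (g 0 x) * kernel_iter L kf s 0 h x \<partial>init_law S)"
    unfolding smoothing_int_def
  proof (rule nn_integral_cong)
    fix x assume "x \<in> space (init_law S)"
    then have x: "x \<in> X" using sets_eq_imp_space_eq[OF \<chi>_sets] by simp
    have "path_int L kf (s + 0) 0 (\<lambda>_. x) (\<lambda>y. h (y (0 + s)) * 1) = kernel_iter L kf s 0 (\<lambda>x. h x * kernel_iter L kf 0 (0 + s) (\<lambda>_. 1) x) x"
      using path_int_split[OF sf, of 0 s 0 kf "\<lambda>_. 1" "\<lambda>_. x" h] s x kf_meas by simp
    then show "ennreal (g 0 x) * path_int L (\<lambda>v x x'. ennreal (q x x' * g (Suc v) x')) s 0 (\<lambda>_. x) (\<lambda>y. h (y s))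
        = ennreal (g 0 x) * kernel_iter L kf s 0 h x"
      by (simp add: kf_def[abs_def])
  qed
  also have "\<dots> = (\<integral>\<^sup>+x. h x \<partial>\<eta> s)" by (rule \<eta>_integral[OF s h])
  finally show "smoothing_int S s s h = (\<integral>\<^sup>+x. h x \<partial>\<eta> s)" .
qed

text \<open>The unnormalised smoothing marginal: past and present enter through
  \<open>\<eta> s\<close>, the future through \<open>\<beta> s\<close>.\<close>

definition \<sigma> :: "nat \<Rightarrow> 'a measure" where "\<sigma> s = density (\<eta> s) (\<beta> s)"

lemma smoothing_eq: "s \<le> T \<Longrightarrow> smoothing S s T = normalize_measure (\<sigma> s)"
  unfolding smoothing_def
proof (rule measure_of_normalize)
  show "sets (\<sigma> s) = sets L" by (simp add: \<sigma>_def \<eta>_sets)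
  fix h :: "'a \<Rightarrow> ennreal" assume s: "s \<le> T" and h: "h \<in> borel_measurable L"
  have m: "(\<lambda>x. h x * \<beta> s x) \<in> borel_measurable L" by (rule borel_measurable_times_ennreal[OF h \<beta>_meas[OF s]])
  have "smoothing_int S s T h = (\<integral>\<^sup>+x. ennreal (g 0 x) * kernel_iter L kf s 0 (\<lambda>x. h x * \<beta> s x) x \<partial>init_law S)"
    unfolding smoothing_int_def
  proof (rule nn_integral_cong)
    fix x assume "x \<in> space (init_law S)"
    then have x: "x \<in> X" using sets_eq_imp_space_eq[OF \<chi>_sets] by simp
    have "path_int L kf (s + (T - s)) 0 (\<lambda>_. x) (\<lambda>y. h (y (0 + s)) * 1) = kernel_iter L kf s 0 (\<lambda>x. h x * kernel_iter L kf (T - s) (0 + s) (\<lambda>_. 1) x) x"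
      by (rule path_int_split[OF sf, of 0 s "T - s" kf "\<lambda>_. 1" "\<lambda>_. x" h]) (use s x kf_meas in auto)
    then show "ennreal (g 0 x) * path_int L (\<lambda>v x x'. ennreal (q x x' * g (Suc v) x')) T 0 (\<lambda>_. x) (\<lambda>y. h (y s))
        = ennreal (g 0 x) * kernel_iter L kf s 0 (\<lambda>x. h x * \<beta> s x) x"
      using s by (simp add: kf_def[abs_def] \<beta>_def)
  qed
  also have "\<dots> = (\<integral>\<^sup>+x. h x * \<beta> s x \<partial>\<eta> s)" by (rule \<eta>_integral[OF s m])
  also have "\<dots> = (\<integral>\<^sup>+x. h x \<partial>\<sigma> s)"
    unfolding \<sigma>_def using \<beta>_meas[OF s] h \<eta>_sets
    by (subst nn_integral_density) (auto simp: mult.commute cong: measurable_cong_sets)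
  finally show "smoothing_int S s T h = (\<integral>\<^sup>+x. h x \<partial>\<sigma> s)" .
qed

lemma bwd_info_int_eq:
  assumes t: "t \<le> T" and h: "h \<in> borel_measurable L"
  shows "bwd_info_int S T t h = (\<integral>\<^sup>+x. h x \<partial>\<nu> (T - t))"
proof -
  have "bwd_info_int S T t h = (\<integral>\<^sup>+x. ennreal (\<gamma> t x) * bb t x * h x \<partial>L)"
    unfolding bwd_info_int_def
  proof (rule nn_integral_cong)
    fix x assume x: "x \<in> X"
    have "path_int L kb (T - t) t (\<lambda>_. x) (\<lambda>y. h (y t) * ennreal (g T (y (t + (T - t))))) = h x * bb t x"
      unfolding bb_def
      by (rule path_int_early[OF sf, of t "T - t" kb "\<lambda>x. ennreal (g T x)" t "\<lambda>_. x" h]) (use t x kb_meas ennreal_g_meas in auto)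
    then show "ennreal (\<gamma> t x) * path_int L (\<lambda>v x x'. ennreal (g v x * q x x')) (T - t) t (\<lambda>_. x) (\<lambda>y. ennreal (g T (y T)) * h (y t))
        = ennreal (\<gamma> t x) * bb t x * h x"
      using t by (simp add: kb_def[abs_def] mult_ac)
  qed
  also have "\<dots> = (\<integral>\<^sup>+x. h x \<partial>\<nu> (T - t))"
    using t h \<nu>_density[of "T - t"] by (simp add: nn_integral_density[OF \<gamma>bb_meas[OF t] h])
  finally show ?thesis .
qed

lemma bwd_info_eq: "t \<le> T \<Longrightarrow> bwd_info S T t = normalize_measure (\<nu> (T - t))"
  unfolding bwd_info_def by (rule measure_of_normalize[OF \<nu>_sets]) (rule bwd_info_int_eq)

lemma \<nu>_fin: "m \<le> T \<Longrightarrow> emeasure (\<nu> m) (space (\<nu> m)) < \<infinity>"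
  using info_fin[of "T - m"] bwd_info_int_eq[of "T - m" "\<lambda>_. 1"] by simp

lemma \<nu>_pos: "m \<le> T \<Longrightarrow> 0 < emeasure (\<nu> m) (space (\<nu> m))"
proof -
  assume m: "m \<le> T"
  have "emeasure (\<nu> m) (space (\<nu> m)) = (\<integral>\<^sup>+x. ennreal (\<gamma> (T - m) x) * bb (T - m) x \<partial>L)"
    unfolding \<nu>_space unfolding \<nu>_density[OF m] using \<gamma>bb_meas[of "T - m"]
    by (subst emeasure_density) (auto intro!: nn_integral_cong)
  also have "\<dots> > 0"
    using \<gamma>_pos[of "T - m"] bb_pos[of "T - m"] \<gamma>bb_meas[of "T - m"] X_mass
    by (intro nn_integral_pos) (auto simp: ennreal_zero_less_mult_iff)
  finally show ?thesis .
qed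

lemma \<eta>_pos: "n \<le> T \<Longrightarrow> 0 < emeasure (\<eta> n) (space (\<eta> n))"
proof (induction n)
  case 0
  interpret chi: prob_space "init_law S" by (rule \<chi>_prob)
  have "emeasure (\<eta> 0) (space (\<eta> 0)) = (\<integral>\<^sup>+x. 1 \<partial>\<eta> 0)" by simp
  also have "\<dots> = (\<integral>\<^sup>+x. ennreal (g 0 x) \<partial>init_law S)"
    using \<eta>_integral[of 0 "\<lambda>_. 1"] by simp
  also have "\<dots> > 0"
    using ennreal_g_meas[of 0] \<chi>_sets sets_eq_imp_space_eq[OF \<chi>_sets] g_pos[of 0] chi.emeasure_space_1
    by (intro nn_integral_pos) (auto cong: measurable_cong_sets)
  finally show ?case .
next
  case (Suc n)
  then have n: "n < T" "n \<le> T" "Suc n \<le> T" by auto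
  obtain B where B: "0 \<le> B" "\<forall>x\<in>X. (\<integral>\<^sup>+x'. ennreal (\<kappa>f n x x') \<partial>L) \<le> ennreal B" using \<kappa>f_int[OF n(1)] by blast
  have "emeasure (\<eta> (Suc n)) (space (\<eta> (Suc n))) = (\<integral>\<^sup>+x. 1 \<partial>\<eta> (Suc n))" by simp
  also have "\<dots> = (\<integral>\<^sup>+x. (\<integral>\<^sup>+x'. ennreal (\<kappa>f n x x') * 1 \<partial>L) \<partial>\<eta> n)"
    using integral_kernel_measure(1)[OF sf \<eta>_finite_measure[OF n(2)] \<eta>_sets \<kappa>f_meas[OF n(1)] \<kappa>f_nn[OF n(1)] B(2)[rule_format] B(1), of "\<lambda>_. 1"] by simp
  also have "\<dots> > 0"
  proof (rule nn_integral_pos)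
    have "(\<lambda>x. \<integral>\<^sup>+x'. ennreal (\<kappa>f n x x') * 1 \<partial>L) \<in> borel_measurable L"
      using L.borel_measurable_nn_integral[of "\<lambda>x x'. ennreal (\<kappa>f n x x')" L] measurable_compose[OF \<kappa>f_meas[OF n(1)] measurable_ennreal]
      by (simp add: case_prod_unfold)
    then show "(\<lambda>x. \<integral>\<^sup>+x'. ennreal (\<kappa>f n x x') * 1 \<partial>L) \<in> borel_measurable (\<eta> n)"
      using \<eta>_sets by (simp cong: measurable_cong_sets)
    show "0 < (\<integral>\<^sup>+x'. ennreal (\<kappa>f n x x') * 1 \<partial>L)" if "x \<in> space (\<eta> n)" for x
    proof -
      have x: "x \<in> X" using that by (simp add: \<eta>_space)
      have "0 < (\<integral>\<^sup>+x'. ennreal (q x x') * ennreal (g (Suc n) x') \<partial>L)"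
        using g_pos[OF n(3)] by (intro q_integral_pos[OF x ennreal_g_meas[OF n(3)]]) auto
      also have "\<dots> = (\<integral>\<^sup>+x'. ennreal (\<kappa>f n x x') * 1 \<partial>L)"
        using q_nn[OF x] g_pos[OF n(3)] by (intro nn_integral_cong) (simp add: \<kappa>f_def ennreal_mult less_imp_le)
      finally show ?thesis .
    qed
    show "0 < emeasure (\<eta> n) (space (\<eta> n))" by (rule Suc.IH[OF n(2)])
  qed
  finally show ?case .
qed

text \<open>The kernel common to both estimators and to their normalising constants. Its inverse
  factor undoes the artificial \<open>\<gamma>\<close> in the backward measure.\<close>

definition GG :: "nat \<Rightarrow> 'a \<Rightarrow> 'a \<Rightarrow> real" where "GG t x x' = (trans_dens S \<odot> inv_gam S t) x x'"

lemma GG_eq: "GG t x x' = q x x' * inverse (\<gamma> t x')"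
  by (simp add: GG_def odot_def)

lemma GG_meas: "t \<le> T \<Longrightarrow> (\<lambda>(x, x'). GG t x x') \<in> borel_measurable (L \<Otimes>\<^sub>M L)"
  using borel_measurable_times[OF q_meas measurable_compose[OF measurable_snd borel_measurable_inverse[OF \<gamma>_meas]], of t]
  by (simp add: GG_eq case_prod_unfold)

lemma GG_nn: "t \<le> T \<Longrightarrow> x \<in> X \<Longrightarrow> x' \<in> X \<Longrightarrow> 0 \<le> GG t x x'"
  unfolding GG_eq using q_nn[of x x'] \<gamma>_pos[of t x'] by (intro mult_nonneg_nonneg) auto

lemma GG_\<gamma>: "t \<le> T \<Longrightarrow> x \<in> X \<Longrightarrow> x' \<in> X \<Longrightarrow> ennreal (\<gamma> t x') * ennreal (GG t x x') = ennreal (q x x')"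
  using \<gamma>_pos[of t x'] GG_nn[of t x x'] by (simp add: GG_eq mult.left_commute[of "\<gamma> t x'"] flip: ennreal_mult)

text \<open>Smoothing seen from the filter at time \<open>n\<close>: the future factor
  \<open>\<beta> n\<close> is the integral of \<open>GG\<close> against the backward measure at time
  \<open>Suc n\<close>, in which \<open>\<gamma>\<close> cancels.\<close>

lemma \<sigma>_fwd:
  assumes n: "n < T"
  shows "\<sigma> n = density (\<eta> n) (\<lambda>x. \<integral>\<^sup>+x'. ennreal (GG (Suc n) x x') \<partial>\<nu> (T - Suc n))"
proof -
  have t: "Suc n \<le> T" using n by simp
  have Gx: "(\<lambda>x'. ennreal (GG (Suc n) x x')) \<in> borel_measurable L" if "x \<in> X" for x
    using measurable_compose[OF measurable_compose[OF measurable_Pair1' GG_meas[OF t], OF that] measurable_ennreal] by simp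
  have point: "\<beta> n x = (\<integral>\<^sup>+x'. ennreal (GG (Suc n) x x') \<partial>\<nu> (T - Suc n))" if x: "x \<in> X" for x
  proof -
    have "(\<integral>\<^sup>+x'. ennreal (GG (Suc n) x x') \<partial>\<nu> (T - Suc n)) = (\<integral>\<^sup>+x'. ennreal (\<gamma> (Suc n) x') * bb (Suc n) x' * ennreal (GG (Suc n) x x') \<partial>L)"
      using \<nu>_density[of "T - Suc n"] t by (simp add: nn_integral_density[OF \<gamma>bb_meas[OF t] Gx[OF x]])
    also have "\<dots> = (\<integral>\<^sup>+x'. ennreal (q x x') * bb (Suc n) x' \<partial>L)"
    proof (rule nn_integral_cong)
      fix x' assume "x' \<in> X"
      from GG_\<gamma>[OF t x this] show "ennreal (\<gamma> (Suc n) x') * bb (Suc n) x' * ennreal (GG (Suc n) x x') = ennreal (q x x') * bb (Suc n) x'"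
        by (metis mult.assoc mult.commute)
    qed
    finally show ?thesis using \<beta>_Suc[OF n x] by simp
  qed
  have \<beta>m: "\<beta> n \<in> borel_measurable (\<eta> n)" using \<beta>_meas[of n] n \<eta>_sets by (simp cong: measurable_cong_sets)
  show ?thesis
    unfolding \<sigma>_def
  proof (rule density_cong[OF \<beta>m])
    show "AE x in \<eta> n. \<beta> n x = (\<integral>\<^sup>+x'. ennreal (GG (Suc n) x x') \<partial>\<nu> (T - Suc n))"
      by (rule AE_I2) (simp add: point \<eta>_space)
    show "(\<lambda>x. \<integral>\<^sup>+x'. ennreal (GG (Suc n) x x') \<partial>\<nu> (T - Suc n)) \<in> borel_measurable (\<eta> n)"
      using \<beta>m point by (subst measurable_cong[of _ _ "\<beta> n"]) (auto simp: \<eta>_space)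
  qed
qed

text \<open>The same pair measure seen from its later end: the backward measure at time
  \<open>Suc n\<close> is weighted by the prediction from the filter at \<open>n\<close>. The
  potential in \<open>\<eta> (Suc n)\<close> merges with \<open>\<beta> (Suc n)\<close> into
  \<open>bb (Suc n)\<close>.\<close>

lemma \<sigma>_bwd:
  assumes n: "n < T"
  shows "\<sigma> (Suc n) = density (\<nu> (T - Suc n)) (\<lambda>x'. \<integral>\<^sup>+x. ennreal (GG (Suc n) x x') \<partial>\<eta> n)"
proof -
  have t: "Suc n \<le> T" "n \<le> T" using n by auto
  interpret E: finite_measure "\<eta> n" by (rule \<eta>_finite_measure[OF t(2)])
  have swap: "(\<lambda>x'. \<integral>\<^sup>+x. ennreal (f x x') \<partial>\<eta> n) \<in> borel_measurable L"
    if f: "(\<lambda>(x, x'). f x x') \<in> borel_measurable (L \<Otimes>\<^sub>M L)" for f :: "'a \<Rightarrow> 'a \<Rightarrow> real"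
  proof -
    have "(\<lambda>(x, x'). f x x') \<in> borel_measurable (\<eta> n \<Otimes>\<^sub>M L)"
      unfolding measurable_cong_sets[OF sets_pair_measure_cong[OF \<eta>_sets refl] refl] by (rule f)
    from measurable_compose[OF measurable_pair_swap' measurable_compose[OF this measurable_ennreal]]
    show ?thesis by (intro E.borel_measurable_nn_integral) (simp add: case_prod_unfold)
  qed
  note em = swap[OF \<kappa>f_meas[OF n]] and gm = swap[OF GG_meas[OF t(1)]]
  have "\<sigma> (Suc n) = density L (\<lambda>x'. (\<integral>\<^sup>+x. ennreal (\<kappa>f n x x') \<partial>\<eta> n) * \<beta> (Suc n) x')"
    unfolding \<sigma>_def \<eta>.simps by (rule density_density_eq[OF em \<beta>_meas[OF t(1)]])
  also have "\<dots> = density L (\<lambda>x'. ennreal (\<gamma> (Suc n) x') * bb (Suc n) x' * (\<integral>\<^sup>+x. ennreal (GG (Suc n) x x') \<partial>\<eta> n))"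
  proof (rule density_cong)
    show "AE x' in L. (\<integral>\<^sup>+x. ennreal (\<kappa>f n x x') \<partial>\<eta> n) * \<beta> (Suc n) x' = ennreal (\<gamma> (Suc n) x') * bb (Suc n) x' * (\<integral>\<^sup>+x. ennreal (GG (Suc n) x x') \<partial>\<eta> n)"
    proof (rule AE_I2)
      fix x' assume x': "x' \<in> X"
      have qm: "(\<lambda>x. ennreal (q x x')) \<in> borel_measurable (\<eta> n)"
        using measurable_compose[OF measurable_compose[OF measurable_Pair2' q_meas, OF x'] measurable_ennreal] \<eta>_sets
        by (simp cong: measurable_cong_sets)
      have Gm: "(\<lambda>x. ennreal (GG (Suc n) x x')) \<in> borel_measurable (\<eta> n)"
        using measurable_compose[OF measurable_compose[OF measurable_Pair2' GG_meas[OF t(1)], OF x'] measurable_ennreal] \<eta>_sets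
        by (simp cong: measurable_cong_sets)
      have 1: "(\<integral>\<^sup>+x. ennreal (\<kappa>f n x x') \<partial>\<eta> n) = ennreal (g (Suc n) x') * (\<integral>\<^sup>+x. ennreal (q x x') \<partial>\<eta> n)"
      proof -
        have "(\<integral>\<^sup>+x. ennreal (\<kappa>f n x x') \<partial>\<eta> n) = (\<integral>\<^sup>+x. ennreal (g (Suc n) x') * ennreal (q x x') \<partial>\<eta> n)"
        proof (rule nn_integral_cong)
          fix x assume "x \<in> space (\<eta> n)"
          then have x: "x \<in> X" by (simp add: \<eta>_space)
          show "ennreal (\<kappa>f n x x') = ennreal (g (Suc n) x') * ennreal (q x x')"
            using q_nn[OF x x'] g_pos[OF t(1) x'] by (simp add: \<kappa>f_def ennreal_mult mult.commute)
        qed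
        then show ?thesis by (simp add: nn_integral_cmult[OF qm])
      qed
      have 2: "(\<integral>\<^sup>+x. ennreal (q x x') \<partial>\<eta> n) = ennreal (\<gamma> (Suc n) x') * (\<integral>\<^sup>+x. ennreal (GG (Suc n) x x') \<partial>\<eta> n)"
        unfolding nn_integral_cmult[OF Gm, symmetric]
        by (rule nn_integral_cong) (simp add: GG_\<gamma>[OF t(1)] \<eta>_space x')
      show "(\<integral>\<^sup>+x. ennreal (\<kappa>f n x x') \<partial>\<eta> n) * \<beta> (Suc n) x' = ennreal (\<gamma> (Suc n) x') * bb (Suc n) x' * (\<integral>\<^sup>+x. ennreal (GG (Suc n) x x') \<partial>\<eta> n)"
        unfolding 1 2 g_\<beta>[OF t(1) x', symmetric] by (simp add: mult_ac)
    qed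
  qed (intro borel_measurable_times_ennreal em gm \<beta>_meas[OF t(1)] \<gamma>bb_meas[OF t(1)])+
  also have "\<dots> = density (density L (\<lambda>x'. ennreal (\<gamma> (Suc n) x') * bb (Suc n) x')) (\<lambda>x'. \<integral>\<^sup>+x. ennreal (GG (Suc n) x x') \<partial>\<eta> n)"
    by (rule density_density_eq[OF \<gamma>bb_meas[OF t(1)] gm, symmetric])
  also have "\<dots> = density (\<nu> (T - Suc n)) (\<lambda>x'. \<integral>\<^sup>+x. ennreal (GG (Suc n) x x') \<partial>\<eta> n)"
    using \<nu>_density[of "T - Suc n"] t(1) by simp
  finally show ?thesis .
qed

lemma \<sigma>_pos: "s \<le> T \<Longrightarrow> 0 < emeasure (\<sigma> s) X"
proof -
  assume s: "s \<le> T"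
  have \<beta>m: "\<beta> s \<in> borel_measurable (\<eta> s)" using \<beta>_meas[OF s] \<eta>_sets by (simp cong: measurable_cong_sets)
  have "emeasure (\<sigma> s) X = (\<integral>\<^sup>+x. \<beta> s x \<partial>\<eta> s)"
    unfolding \<sigma>_def using \<beta>m sets.top[of "\<eta> s"] by (subst emeasure_density) (auto simp: \<eta>_space intro!: nn_integral_cong)
  also have "\<dots> > 0"
  proof (rule nn_integral_pos[OF \<beta>m _ \<eta>_pos[OF s]])
    fix x assume "x \<in> space (\<eta> s)"
    then have x: "x \<in> X" by (simp add: \<eta>_space)
    have "ennreal (g s x) * \<beta> s x > 0" using bb_pos[OF s x] g_\<beta>[OF s x] by simp
    then show "0 < \<beta> s x" by (simp add: ennreal_zero_less_mult_iff)
  qed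
  finally show ?thesis .
qed

end

section \<open>Particle histories and the two filters\<close>

lemma enn2real_le_SUP:
  assumes "(SUP i\<in>A. f i) < (\<infinity>::ennreal)" "i \<in> A"
  shows "enn2real (f i) \<le> enn2real (SUP i\<in>A. f i)"
  using SUP_upper[OF assms(2), of f] assms(1) by (intro enn2real_mono) auto

lemma bounded_image_nonneg_bound:
  fixes f :: "'a \<Rightarrow> real"
  assumes "bounded (f ` A)"
  obtains B where "0 \<le> B" "\<And>x. x \<in> A \<Longrightarrow> \<bar>f x\<bar> \<le> B"
proof -
  obtain B where "\<And>x. x \<in> A \<Longrightarrow> \<bar>f x\<bar> \<le> B" using assms by (auto simp: bounded_iff)
  then have "0 \<le> max 0 B" "\<And>x. x \<in> A \<Longrightarrow> \<bar>f x\<bar> \<le> max 0 B" by (auto simp: max.coboundedI2)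
  then show ?thesis by (rule that)
qed

lemma space_particle_history: "space (particle_history P L N U V I xi) = space P"
  and sets_particle_history: "sets (particle_history P L N U V I xi) = sigma_sets (space P)
     ({xi u l -` A \<inter> space P | u l A. u \<in> U \<and> l \<in> {1..N} \<and> A \<in> sets L} \<union>
      {I u l -` J \<inter> space P | u l J. u \<in> V \<and> l \<in> {1..N} \<and> J \<subseteq> {1..N}})"
  unfolding particle_history_def by (subst space_measure_of sets_measure_of; blast)+

lemma measurable_particle_history_position:
  assumes "u \<in> U" "l \<in> {1..N}" "xi u l \<in> measurable P L"
  shows "xi u l \<in> measurable (particle_history P L N U V I xi) L"
proof (rule measurableI)
  show "xi u l w \<in> space L" if "w \<in> space (particle_history P L N U V I xi)" for w
    using measurable_space[OF assms(3)] that by (simp add: space_particle_history)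
  show "xi u l -` A \<inter> space (particle_history P L N U V I xi) \<in> sets (particle_history P L N U V I xi)"
    if "A \<in> sets L" for A
    unfolding space_particle_history sets_particle_history
    using assms(1,2) that by (intro sigma_sets.Basic UnI1) blast
qed

lemma measurable_particle_history_index:
  assumes "u \<in> V" "l \<in> {1..N}" "I u l \<in> measurable P (count_space {1..N})"
  shows "I u l \<in> measurable (particle_history P L N U V I xi) (count_space {1..N})"
proof (rule measurableI)
  show "I u l w \<in> space (count_space {1..N})" if "w \<in> space (particle_history P L N U V I xi)" for w
    using measurable_space[OF assms(3)] that by (simp add: space_particle_history)
  show "I u l -` A \<inter> space (particle_history P L N U V I xi) \<in> sets (particle_history P L N U V I xi)"
    if "A \<in> sets (count_space {1..N})" for A
    unfolding space_particle_history sets_particle_history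
    using assms(1,2) that by (intro sigma_sets.Basic UnI2) auto
qed

lemma subalgebra_particle_history:
  assumes xi: "\<And>u l. u \<in> U \<Longrightarrow> l \<in> {1..N} \<Longrightarrow> xi u l \<in> measurable P L"
    and I: "\<And>u l. u \<in> V \<Longrightarrow> l \<in> {1..N} \<Longrightarrow> I u l \<in> measurable P (count_space {1..N})"
  shows "subalgebra P (particle_history P L N U V I xi)"
  unfolding subalgebra_def space_particle_history sets_particle_history
proof (intro conjI refl sets.sigma_sets_subset subsetI)
  fix A assume "A \<in> {xi u l -` A \<inter> space P | u l A. u \<in> U \<and> l \<in> {1..N} \<and> A \<in> sets L} \<union>
      {I u l -` J \<inter> space P | u l J. u \<in> V \<and> l \<in> {1..N} \<and> J \<subseteq> {1..N}}"
  then consider u l B where "u \<in> U" "l \<in> {1..N}" "B \<in> sets L" "A = xi u l -` B \<inter> space P"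
    | u l B where "u \<in> V" "l \<in> {1..N}" "B \<subseteq> {1..N}" "A = I u l -` B \<inter> space P" by blast
  then show "A \<in> sets P"
  proof cases
    case 1
    then show ?thesis using measurable_sets[OF xi] by blast
  next
    case 2
    then show ?thesis using measurable_sets[OF I[OF 2(1,2)], of B] by simp
  qed
qed

lemma cond_iid_pair_measurable:
  assumes "cond_iid P F N (A \<Otimes>\<^sub>M L) (\<lambda>l w. (I l w, x l w)) K" "l \<in> {1..N}"
  shows "I l \<in> measurable P A" "x l \<in> measurable P L"
proof -
  have "(\<lambda>w. (I l w, x l w)) \<in> measurable P (A \<Otimes>\<^sub>M L)"
    using assms unfolding cond_iid_def by blast
  from measurable_compose[OF this measurable_fst] measurable_compose[OF this measurable_snd]
  show "I l \<in> measurable P A" "x l \<in> measurable P L" by simp_all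
qed

section \<open>Importance weights as ratios of target kernel and proposal\<close>

context two_filter_model
begin

lemma omega0_meas: "omega0 S \<in> borel_measurable L"
  unfolding omega0_def[abs_def] by (rule borel_measurable_times_ennreal[OF deriv_meas ennreal_g_meas[OF le0]])

lemma markov_density_meas: "markov_density L k \<Longrightarrow> (\<lambda>(x, x'). k x x') \<in> borel_measurable (L \<Otimes>\<^sub>M L)"
  and markov_density_nn: "markov_density L k \<Longrightarrow> x \<in> X \<Longrightarrow> x' \<in> X \<Longrightarrow> 0 \<le> k x x'"
  by (auto simp: markov_density_def)

lemma omega_meas:
  assumes n: "n < T"
  shows "(\<lambda>(x, x'). enn2real (omega S (Suc n) x x')) \<in> borel_measurable (L \<Otimes>\<^sub>M L)"
proof -
  have num: "(\<lambda>z. ennreal (q (fst z) (snd z) * g (Suc n) (snd z))) \<in> borel_measurable (L \<Otimes>\<^sub>M L)"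
    using measurable_compose[OF \<kappa>f_meas[OF n] measurable_ennreal] by (simp add: case_prod_unfold \<kappa>f_def)
  have "(\<lambda>z. fwd_adj S (Suc n) (fst z) * fwd_prop S (Suc n) (fst z) (snd z)) \<in> borel_measurable (L \<Otimes>\<^sub>M L)"
    using borel_measurable_times[OF measurable_compose[OF measurable_fst adj_meas] markov_density_meas[OF prop_dens], of "Suc n" "Suc n"] n
    by (simp add: case_prod_unfold)
  from measurable_compose[OF borel_measurable_divide_ennreal[OF num measurable_compose[OF this measurable_ennreal]] borel_measurable_enn2real]
  show ?thesis by (simp add: omega_def case_prod_unfold)
qed

lemma bwd_kernel_meas:
  assumes t: "t < T"
  shows "(\<lambda>(x, x'). bwd_kernel S t x x') \<in> borel_measurable (L \<Otimes>\<^sub>M L)"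
proof -
  have "(\<lambda>z. \<gamma> t (fst z) * g t (fst z) * (case z of (x, x') \<Rightarrow> q x x') * inverse (\<gamma> (Suc t) (snd z))) \<in> borel_measurable (L \<Otimes>\<^sub>M L)"
    using t by (intro borel_measurable_times q_meas borel_measurable_inverse measurable_compose[OF measurable_fst \<gamma>_meas]
        measurable_compose[OF measurable_fst g_meas] measurable_compose[OF measurable_snd \<gamma>_meas]) auto
  then show ?thesis by (simp add: bwd_kernel_def case_prod_unfold)
qed

lemma bwd_omega_meas:
  assumes t: "t < T"
  shows "(\<lambda>(x, x'). enn2real (bwd_omega S t x' x)) \<in> borel_measurable (L \<Otimes>\<^sub>M L)"
proof -
  have q': "(\<lambda>z. q (snd z) (fst z)) \<in> borel_measurable (L \<Otimes>\<^sub>M L)"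
    using measurable_compose[OF measurable_pair_swap' q_meas] by (simp add: case_prod_unfold)
  have num: "(\<lambda>z. \<gamma> t (snd z) * g t (snd z) * q (snd z) (fst z)) \<in> borel_measurable (L \<Otimes>\<^sub>M L)"
    using t by (intro borel_measurable_times q' measurable_compose[OF measurable_snd \<gamma>_meas]
        measurable_compose[OF measurable_snd g_meas]) auto
  have den: "(\<lambda>z. bwd_adj S t (fst z) * bwd_prop S t (fst z) (snd z)) \<in> borel_measurable (L \<Otimes>\<^sub>M L)"
    using borel_measurable_times[OF measurable_compose[OF measurable_fst badj_meas[OF t]] markov_density_meas[OF bprop_dens[OF t]]]
    by (simp add: case_prod_unfold)
  from measurable_compose[OF borel_measurable_divide_ennreal[OF measurable_compose[OF num measurable_ennreal]
      measurable_compose[OF den measurable_ennreal]] borel_measurable_enn2real]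
  show ?thesis by (simp add: bwd_omega_def case_prod_unfold)
qed

lemma \<kappa>b_meas: "n < T \<Longrightarrow> (\<lambda>(x, x'). \<kappa>b n x x') \<in> borel_measurable (L \<Otimes>\<^sub>M L)"
  using measurable_compose[OF measurable_pair_swap' bwd_kernel_meas[of "T - Suc n"]]
  by (simp add: \<kappa>b_def case_prod_unfold)

lemma omega_SUP: "t \<in> {1..T} \<Longrightarrow> x \<in> X \<Longrightarrow> x' \<in> X \<Longrightarrow>
    omega S t x x' < \<infinity> \<and> enn2real (omega S t x x') \<le> enn2real (SUP (x, x')\<in>X \<times> X. omega S t x x')"
  using A2[rule_format, THEN conjunct1, of t] enn2real_le_SUP[of "\<lambda>(x, x'). omega S t x x'" "X \<times> X" "(x, x')"]
    SUP_upper[of "(x, x')" "X \<times> X" "\<lambda>(x, x'). omega S t x x'"]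
  by (auto intro: order_le_less_trans)

lemma bwd_omega_SUP: "t < T \<Longrightarrow> x \<in> X \<Longrightarrow> x' \<in> X \<Longrightarrow>
    bwd_omega S t x x' < \<infinity> \<and> enn2real (bwd_omega S t x x') \<le> enn2real (SUP (x, x')\<in>X \<times> X. bwd_omega S t x x')"
  using A3_bwd[rule_format, THEN conjunct2, THEN conjunct2, of t]
    enn2real_le_SUP[of "\<lambda>(x, x'). bwd_omega S t x x'" "X \<times> X" "(x, x')"]
    SUP_upper[of "(x, x')" "X \<times> X" "\<lambda>(x, x'). bwd_omega S t x x'"]
  by (auto intro: order_le_less_trans)

lemma \<kappa>f_eq:
  assumes n: "n < T" and x: "x \<in> X" "x' \<in> X"
  shows "\<kappa>f n x x' = enn2real (omega S (Suc n) x x') * (fwd_adj S (Suc n) x * fwd_prop S (Suc n) x x')"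
proof -
  have t: "Suc n \<in> {1..T}" using n by auto
  show ?thesis
    unfolding \<kappa>f_def omega_def
  proof (rule enn2real_divide_mult[symmetric])
    show "0 \<le> q x x' * g (Suc n) x'" using \<kappa>f_nn[OF n x] by (simp add: \<kappa>f_def)
    show "0 \<le> fwd_adj S (Suc n) x * fwd_prop S (Suc n) x x'"
      by (intro mult_nonneg_nonneg adj_nn[OF t x(1)] markov_density_nn[OF prop_dens[OF t] x])
    show "ennreal (q x x' * g (Suc n) x') / ennreal (fwd_adj S (Suc n) x * fwd_prop S (Suc n) x x') < \<infinity>"
      using omega_SUP[OF t x] by (simp add: omega_def)
  qed
qed

text \<open>In the backward chain the adjustment multiplier is \<open>bwd_adj\<close> times
  \<open>inv_gam\<close>, the quantity whose boundedness is assumed; \<open>bwd_omega\<close> itself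
  carries no inverse of \<open>\<gamma>\<close>.\<close>

lemma bwd_kernel_eq:
  assumes t: "t < T" and x: "x \<in> X" "x' \<in> X"
  shows "bwd_kernel S t x x' = enn2real (bwd_omega S t x x') * (bwd_adj S t x' * inv_gam S (Suc t) x' * bwd_prop S t x' x)"
proof -
  have "enn2real (bwd_omega S t x x') * (bwd_adj S t x' * bwd_prop S t x' x) = \<gamma> t x * g t x * q x x'"
    unfolding bwd_omega_def
  proof (rule enn2real_divide_mult)
    show "0 \<le> \<gamma> t x * g t x * q x x'"
      using t \<gamma>_pos[of t x] g_pos[of t x] q_nn[OF x] x by (intro mult_nonneg_nonneg) auto
    show "0 \<le> bwd_adj S t x' * bwd_prop S t x' x"
      by (intro mult_nonneg_nonneg badj_nn[OF t x(2)] markov_density_nn[OF bprop_dens[OF t] x(2,1)])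
    show "ennreal (\<gamma> t x * g t x * q x x') / ennreal (bwd_adj S t x' * bwd_prop S t x' x) < \<infinity>"
      using bwd_omega_SUP[OF t x] by (simp add: bwd_omega_def)
  qed
  then show ?thesis unfolding bwd_kernel_def by (metis mult.assoc mult.commute)
qed

text \<open>Claimed for every \<open>F\<close>, measurable or not, because
  \<open>particle_chain\<close> asks for its variance formula at all functions. For non-measurable
  \<open>F\<close> both sides are 0: by \<open>final_mult\<close> the density
  \<open>bwd_init_prop\<close> never vanishes, so multiplying by it cannot restore
  measurability.\<close>

lemma integral_b0:
  fixes F :: "'a \<Rightarrow> real"
  shows "(\<integral>x. F x \<partial>density L (\<lambda>x. ennreal (bwd_init_prop S x))) = (\<integral>x. bwd_init_prop S x * F x \<partial>L)"
proof (cases "F \<in> borel_measurable L")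
  case True
  then show ?thesis using b0_meas b0_nn by (subst integral_density) auto
next
  case False
  have b0: "bwd_init_prop S x \<noteq> 0" if "x \<in> X" for x
    using final_mult[OF that] g_pos[OF order_refl that] \<gamma>_pos[OF order_refl that] by auto
  have "(\<lambda>x. bwd_init_prop S x * F x) \<notin> borel_measurable L"
  proof
    assume "(\<lambda>x. bwd_init_prop S x * F x) \<in> borel_measurable L"
    from borel_measurable_divide[OF this b0_meas] have "F \<in> borel_measurable L"
      using b0 by (subst measurable_cong[where g="\<lambda>x. bwd_init_prop S x * F x / bwd_init_prop S x"]) auto
    with False show False by simp
  qed
  with False show ?thesis
    by (subst (1 2) not_integrable_integral_eq) (auto dest: borel_measurable_integrable)
qed

end

section \<open>Both particle filters as instances of the chain\<close>

locale two_filter_algorithm = two_filter_model S T for S :: "'a model" and T :: nat +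
  fixes P :: "nat \<Rightarrow> 'w measure" and I J :: "nat \<Rightarrow> nat \<Rightarrow> nat \<Rightarrow> 'w \<Rightarrow> nat"
    and xi zeta :: "nat \<Rightarrow> nat \<Rightarrow> nat \<Rightarrow> 'w \<Rightarrow> 'a"
  assumes prob: "\<And>N. 1 \<le> N \<Longrightarrow> prob_space (P N)"
    and fwd: "\<And>N. 1 \<le> N \<Longrightarrow> forward_filter S T (P N) N (I N) (xi N)"
    and bwd: "\<And>N. 1 \<le> N \<Longrightarrow> backward_filter S T (P N) N (J N) (zeta N)"
    and indep: "\<And>N. 1 \<le> N \<Longrightarrow> filters_independent S T (P N) N (I N) (xi N) (J N) (zeta N)"
    and pos: "\<And>N. 1 \<le> N \<Longrightarrow> normalizers_positive S T (P N) N (I N) (xi N) (J N) (zeta N)"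
begin

abbreviation "fwd_history N U V \<equiv> particle_history (P N) L N U V (I N) (xi N)"
abbreviation "bwd_history N U V \<equiv> particle_history (P N) L N U V (J N) (zeta N)"

lemma fwd_init: "1 \<le> N \<Longrightarrow> prob_space.indep_vars (P N) (\<lambda>_. L) (xi N 0) {1..N}"
    "1 \<le> N \<Longrightarrow> l \<in> {1..N} \<Longrightarrow> distr (P N) L (xi N 0 l) = init_prop S"
  and fwd_step: "1 \<le> N \<Longrightarrow> s \<in> {1..T} \<Longrightarrow> cond_iid (P N) (fwd_history N {..<s} {1..<s}) N
          (count_space {1..N} \<Otimes>\<^sub>M L) (\<lambda>l w. (I N s l w, xi N s l w))
          (\<lambda>w. normalized_density (count_space {1..N} \<Otimes>\<^sub>M L)
             (\<lambda>(i, x). ennreal (fwd_weight S (I N) (xi N) (s - 1) i w * fwd_adj S s (xi N (s - 1) i w) *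
                                fwd_prop S s (xi N (s - 1) i w) x)))"
  using fwd[of N] unfolding forward_filter_def by blast+

lemma bwd_init: "1 \<le> N \<Longrightarrow> prob_space.indep_vars (P N) (\<lambda>_. L) (zeta N T) {1..N}"
    "1 \<le> N \<Longrightarrow> l \<in> {1..N} \<Longrightarrow> distributed (P N) L (zeta N T l) (\<lambda>x. ennreal (bwd_init_prop S x))"
  and bwd_step: "1 \<le> N \<Longrightarrow> t < T \<Longrightarrow> cond_iid (P N) (bwd_history N {Suc t..T} {Suc t..<T}) N
          (count_space {1..N} \<Otimes>\<^sub>M L) (\<lambda>l w. (J N t l w, zeta N t l w))
          (\<lambda>w. normalized_density (count_space {1..N} \<Otimes>\<^sub>M L)
             (\<lambda>(j, x). ennreal (bwd_weight S T (J N) (zeta N) (Suc t) j w * bwd_adj S t (zeta N (Suc t) j w) *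
                                inv_gam S (Suc t) (zeta N (Suc t) j w) *
                                bwd_prop S t (zeta N (Suc t) j w) x)))"
  using bwd[of N] unfolding backward_filter_def by blast+

lemma xi_meas: "1 \<le> N \<Longrightarrow> u \<le> T \<Longrightarrow> l \<in> {1..N} \<Longrightarrow> xi N u l \<in> measurable (P N) L"
proof (cases "u = 0")
  case True
  assume N: "1 \<le> N" and l: "l \<in> {1..N}"
  show ?thesis
    using l fwd_init(1)[OF N] unfolding True prob_space.indep_vars_def[OF prob[OF N]] by simp
next
  case False
  assume "1 \<le> N" "u \<le> T" "l \<in> {1..N}"
  then show ?thesis using False cond_iid_pair_measurable(2)[OF fwd_step[of N u]] by auto
qed

lemma I_meas: "1 \<le> N \<Longrightarrow> u \<in> {1..T} \<Longrightarrow> l \<in> {1..N} \<Longrightarrow> I N u l \<in> measurable (P N) (count_space {1..N})"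
  by (rule cond_iid_pair_measurable(1)[OF fwd_step])

lemma zeta_meas: "1 \<le> N \<Longrightarrow> u \<le> T \<Longrightarrow> l \<in> {1..N} \<Longrightarrow> zeta N u l \<in> measurable (P N) L"
proof (cases "u = T")
  case True
  assume N: "1 \<le> N" and l: "l \<in> {1..N}"
  show ?thesis
    using l bwd_init(1)[OF N] unfolding True prob_space.indep_vars_def[OF prob[OF N]] by simp
next
  case False
  assume "1 \<le> N" "u \<le> T" "l \<in> {1..N}"
  then show ?thesis using False cond_iid_pair_measurable(2)[OF bwd_step[of N u]] by auto
qed

lemma J_meas: "1 \<le> N \<Longrightarrow> u < T \<Longrightarrow> l \<in> {1..N} \<Longrightarrow> J N u l \<in> measurable (P N) (count_space {1..N})"
  by (rule cond_iid_pair_measurable(1)[OF bwd_step])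

lemma xi_history: "1 \<le> N \<Longrightarrow> u \<le> T \<Longrightarrow> l \<in> {1..N} \<Longrightarrow> u \<in> U \<Longrightarrow> xi N u l \<in> measurable (fwd_history N U V) L"
  by (rule measurable_particle_history_position[OF _ _ xi_meas])

lemma zeta_history: "1 \<le> N \<Longrightarrow> u \<le> T \<Longrightarrow> l \<in> {1..N} \<Longrightarrow> u \<in> U \<Longrightarrow> zeta N u l \<in> measurable (bwd_history N U V) L"
  by (rule measurable_particle_history_position[OF _ _ zeta_meas])

lemma fwd_subalgebra: "1 \<le> N \<Longrightarrow> U \<subseteq> {0..T} \<Longrightarrow> V \<subseteq> {1..T} \<Longrightarrow> subalgebra (P N) (fwd_history N U V)"
  by (rule subalgebra_particle_history[OF xi_meas I_meas]) auto

lemma bwd_subalgebra: "1 \<le> N \<Longrightarrow> U \<subseteq> {0..T} \<Longrightarrow> V \<subseteq> {0..<T} \<Longrightarrow> subalgebra (P N) (bwd_history N U V)"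
  by (rule subalgebra_particle_history[OF zeta_meas J_meas]) auto

text \<open>The weight at time \<open>n\<close> involves positions at \<open>n - 1\<close> and
  \<open>n\<close> and the index at \<open>n\<close>; at \<open>n = 0\<close> truncated subtraction
  leaves the single time 0. The random parent is treated by letting its label range over the finite
  label set.\<close>

lemma fwd_weight_history:
  assumes N: "1 \<le> N" and n: "n \<le> T" and l: "l \<in> {1..N}" and U: "{n - 1..n} \<subseteq> U" and V: "{1..n} \<subseteq> V"
  shows "fwd_weight S (I N) (xi N) n l \<in> borel_measurable (fwd_history N U V)"
proof (cases n)
  case 0
  have "xi N 0 l \<in> measurable (fwd_history N U V) L" using N l U by (intro xi_history) (auto simp: 0)
  from measurable_compose[OF measurable_compose[OF this omega0_meas] borel_measurable_enn2real]
  show ?thesis by (simp add: 0 fwd_weight_def[abs_def])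
next
  case (Suc m)
  then have m: "m < T" "m \<le> T" "Suc m \<le> T" "Suc m \<in> U" "m \<in> U" "Suc m \<in> V" using n U V by auto
  have I: "I N (Suc m) l \<in> measurable (fwd_history N U V) (count_space {1..N})"
    using m by (intro measurable_particle_history_index l I_meas[OF N]) auto
  have "(\<lambda>w. enn2real (omega S (Suc m) (xi N m (I N (Suc m) l w) w) (xi N (Suc m) l w))) \<in> borel_measurable (fwd_history N U V)"
  proof (rule measurable_count_space_family[where I="{1..N}" and g="I N (Suc m) l" and
      f="\<lambda>i w. enn2real (omega S (Suc m) (xi N m i w) (xi N (Suc m) l w))", OF _ _ I])
    fix i assume i: "i \<in> {1..N}"
    have "(\<lambda>w. (xi N m i w, xi N (Suc m) l w)) \<in> measurable (fwd_history N U V) (L \<Otimes>\<^sub>M L)"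
      using m by (intro measurable_Pair xi_history[OF N] i l)
    from measurable_compose[OF this omega_meas[OF m(1)]]
    show "(\<lambda>w. enn2real (omega S (Suc m) (xi N m i w) (xi N (Suc m) l w))) \<in> borel_measurable (fwd_history N U V)" by simp
  qed simp
  then show ?thesis by (simp add: Suc fwd_weight_def[abs_def])
qed

lemma bwd_weight_history:
  assumes N: "1 \<le> N" and t: "t \<le> T" and l: "l \<in> {1..N}" and U: "{t..T} \<subseteq> U" and V: "{t..<T} \<subseteq> V"
  shows "bwd_weight S T (J N) (zeta N) t l \<in> borel_measurable (bwd_history N U V)"
proof (cases "t = T")
  case True
  have "zeta N T l \<in> measurable (bwd_history N U V) L" using N l U by (intro zeta_history) (auto simp: True)
  from measurable_compose[OF measurable_compose[OF this final_meas] borel_measurable_enn2real]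
  show ?thesis by (simp add: True bwd_weight_def[abs_def])
next
  case False
  then have t': "t < T" "Suc t \<le> T" "t \<in> U" "Suc t \<in> U" "t \<in> V" using t U V by auto
  have J: "J N t l \<in> measurable (bwd_history N U V) (count_space {1..N})"
    using t' by (intro measurable_particle_history_index l J_meas[OF N]) auto
  have "(\<lambda>w. enn2real (bwd_omega S t (zeta N t l w) (zeta N (Suc t) (J N t l w) w))) \<in> borel_measurable (bwd_history N U V)"
  proof (rule measurable_count_space_family[where I="{1..N}" and g="J N t l" and
      f="\<lambda>i w. enn2real (bwd_omega S t (zeta N t l w) (zeta N (Suc t) i w))", OF _ _ J])
    fix i assume i: "i \<in> {1..N}"
    have "(\<lambda>w. (zeta N (Suc t) i w, zeta N t l w)) \<in> measurable (bwd_history N U V) (L \<Otimes>\<^sub>M L)"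
      using t' t by (intro measurable_Pair zeta_history[OF N] i l)
    from measurable_compose[OF this bwd_omega_meas[OF t'(1)]]
    show "(\<lambda>w. enn2real (bwd_omega S t (zeta N t l w) (zeta N (Suc t) i w))) \<in> borel_measurable (bwd_history N U V)" by simp
  qed simp
  then show ?thesis using False by (simp add: bwd_weight_def[abs_def])
qed

text \<open>The chain index is time itself. The past of the step from \<open>m\<close> to
  \<open>Suc m\<close> holds positions at times 0 to \<open>m\<close> and indices at times 1 to
  \<open>m\<close>, there being no index at time 0.\<close>

lemma fwd_asymptotics:
  assumes n: "n \<le> T"
  obtains c B where "0 < c" "0 \<le> B"
    "\<And>N l w. l \<in> {1..Suc N} \<Longrightarrow> w \<in> space (P (Suc N)) \<Longrightarrow> \<bar>fwd_weight S (I (Suc N)) (xi (Suc N)) n l w\<bar> \<le> B"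
    "sample_lln L (\<lambda>N. P (Suc N)) (\<lambda>N. fwd_weight S (I (Suc N)) (xi (Suc N)) n) (\<lambda>N. xi (Suc N) n) (filtering S n) c"
    "sample_clt L (\<lambda>N. P (Suc N)) (\<lambda>N. fwd_weight S (I (Suc N)) (xi (Suc N)) n) (\<lambda>N. xi (Suc N) n) (filtering S n) c (Gamma_fwd S n)"
proof -
  have "\<exists>B. m < T \<longrightarrow> 0 \<le> B \<and> (\<forall>x\<in>X. fwd_adj S (Suc m) x \<le> B)" for m
  proof (cases "m < T")
    case True
    then have b: "bounded (fwd_adj S (Suc m) ` X)" using A2 by simp
    obtain B where "0 \<le> B" "\<And>x. x \<in> X \<Longrightarrow> \<bar>fwd_adj S (Suc m) x\<bar> \<le> B" using bounded_image_nonneg_bound[OF b] by blast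
    then show ?thesis by (intro exI[of _ B]) (auto intro: order_trans[OF abs_ge_self])
  qed auto
  then obtain Ca where Ca: "\<And>m. m < T \<Longrightarrow> 0 \<le> Ca m" "\<And>m x. m < T \<Longrightarrow> x \<in> X \<Longrightarrow> fwd_adj S (Suc m) x \<le> Ca m" by metis
  interpret C: particle_chain L T "init_prop S" "\<lambda>x. enn2real (omega0 S x)" "enn2real (SUP x\<in>X. omega0 S x)" \<kappa>f
    "\<lambda>m x x'. enn2real (omega S (Suc m) x x')" "\<lambda>m. fwd_prop S (Suc m)" "\<lambda>m. fwd_adj S (Suc m)"
    "\<lambda>m. enn2real (SUP (x, x')\<in>X \<times> X. omega S (Suc m) x x')" Ca \<eta> "Gamma_fwd S" "\<lambda>N. P (Suc N)"
    "\<lambda>N m. fwd_history (Suc N) {..<Suc m} {1..<Suc m}" "\<lambda>N. I (Suc N)" "\<lambda>N. xi (Suc N)"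
    "\<lambda>N. fwd_weight S (I (Suc N)) (xi (Suc N))"
  proof (rule particle_chain.intro)
    show "(\<lambda>x. enn2real (omega0 S x)) \<in> borel_measurable L" using omega0_meas by measurable
    show "enn2real (omega0 S x) \<le> enn2real (SUP x\<in>X. omega0 S x)" if "x \<in> X" for x
      by (rule enn2real_le_SUP[OF A2_omega0 that])
    show "enn2real (omega S (Suc m) x x') \<le> enn2real (SUP (x, x')\<in>X \<times> X. omega S (Suc m) x x')"
      if "m < T" "x \<in> X" "x' \<in> X" for m x x'
      using omega_SUP[of "Suc m" x x'] that by auto
    show "0 < emeasure (\<eta> m) X" if "m \<le> T" for m using \<eta>_pos[OF that] by (simp add: \<eta>_space)
    show "Gamma_fwd S (Suc m) f = (Gamma_fwd S m (\<lambda>x. \<integral>x'. \<kappa>f m x x' * f x' \<partial>L) +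
       (\<integral>x. (\<integral>x'. enn2real (omega S (Suc m) x x') * \<kappa>f m x x' * (f x')\<^sup>2 \<partial>L) \<partial>normalize_measure (\<eta> m)) *
       (\<integral>x. fwd_adj S (Suc m) x \<partial>normalize_measure (\<eta> m))) / (\<integral>x. (\<integral>x'. \<kappa>f m x x' \<partial>L) \<partial>normalize_measure (\<eta> m))\<^sup>2"
      if "m < T" for m f
      using filtering_eq[of m] that by (simp add: \<kappa>f_def mult.assoc)
    show "xi (Suc N) m l \<in> measurable (fwd_history (Suc N) {..<Suc m} {1..<Suc m}) L"
      if "m < T" "l \<in> {1..Suc N}" for N m l
      using that by (intro xi_history) auto
    show "fwd_weight S (I (Suc N)) (xi (Suc N)) m l \<in> borel_measurable (fwd_history (Suc N) {..<Suc m} {1..<Suc m})"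
      if "m < T" "l \<in> {1..Suc N}" for N m l
      using that by (intro fwd_weight_history) auto
    show "cond_iid (P (Suc N)) (fwd_history (Suc N) {..<Suc m} {1..<Suc m}) (Suc N) (count_space {1..Suc N} \<Otimes>\<^sub>M L)
      (\<lambda>l w. (I (Suc N) (Suc m) l w, xi (Suc N) (Suc m) l w))
      (\<lambda>w. normalized_density (count_space {1..Suc N} \<Otimes>\<^sub>M L)
         (\<lambda>(i, x). ennreal (fwd_weight S (I (Suc N)) (xi (Suc N)) m i w * fwd_adj S (Suc m) (xi (Suc N) m i w) *
            fwd_prop S (Suc m) (xi (Suc N) m i w) x)))" if "m < T" for N m
      using fwd_step[of "Suc N" "Suc m"] that by simp
    show "AE w in P (Suc N). 0 < (\<Sum>i=1..Suc N. fwd_weight S (I (Suc N)) (xi (Suc N)) m i w * fwd_adj S (Suc m) (xi (Suc N) m i w))"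
      if "m < T" for N m
    proof -
      have "\<forall>s\<in>{1..T}. AE w in P (Suc N). 0 < (\<Sum>i=1..Suc N. fwd_weight S (I (Suc N)) (xi (Suc N)) (s - 1) i w * fwd_adj S s (xi (Suc N) (s - 1) i w))"
        using pos[of "Suc N"] unfolding normalizers_positive_def by simp
      from bspec[OF this, of "Suc m"] show ?thesis using that by simp
    qed
    show "subalgebra (P (Suc N)) (fwd_history (Suc N) {..<Suc m} {1..<Suc m})" if "m < T" for N m
      using that by (intro fwd_subalgebra) auto
  qed (use \<rho>_prob \<rho>_sets sf adj_meas adj_nn Ca omega_meas prop_dens \<kappa>f_meas \<kappa>f_eq prob fwd_init in
      \<open>auto simp: fwd_weight_def\<close>)
  from C.chain_asymptotics[OF n] obtain c where "0 < c"
    "sample_lln L (\<lambda>N. P (Suc N)) (\<lambda>N. fwd_weight S (I (Suc N)) (xi (Suc N)) n) (\<lambda>N. xi (Suc N) n) (normalize_measure (\<eta> n)) c"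
    "sample_clt L (\<lambda>N. P (Suc N)) (\<lambda>N. fwd_weight S (I (Suc N)) (xi (Suc N)) n) (\<lambda>N. xi (Suc N) n) (normalize_measure (\<eta> n)) c (Gamma_fwd S n)"
    by blast
  then show thesis using C.W_bounds[OF n] C.CW_nn[OF n] unfolding filtering_eq[OF n, symmetric]
    by (intro that[of c "C.CW n"]) auto
qed

text \<open>The chain is evaluated at index \<open>T - t\<close>. Its step from \<open>m\<close> to
  \<open>Suc m\<close> uses the proposal data of time \<open>T - Suc m\<close>, and its past
  consists of the times from \<open>T - m\<close> on.\<close>

lemma bwd_asymptotics:
  assumes t: "t \<le> T"
  obtains c B where "0 < c" "0 \<le> B"
    "\<And>N l w. l \<in> {1..Suc N} \<Longrightarrow> w \<in> space (P (Suc N)) \<Longrightarrow> \<bar>bwd_weight S T (J (Suc N)) (zeta (Suc N)) t l w\<bar> \<le> B"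
    "sample_lln L (\<lambda>N. P (Suc N)) (\<lambda>N. bwd_weight S T (J (Suc N)) (zeta (Suc N)) t) (\<lambda>N. zeta (Suc N) t) (bwd_info S T t) c"
    "sample_clt L (\<lambda>N. P (Suc N)) (\<lambda>N. bwd_weight S T (J (Suc N)) (zeta (Suc N)) t) (\<lambda>N. zeta (Suc N) t) (bwd_info S T t) c (Gamma_bwd S T t)"
proof -
  let ?\<rho> = "density L (\<lambda>x. ennreal (bwd_init_prop S x))"
  let ?a = "\<lambda>m x. bwd_adj S (T - Suc m) x * inv_gam S (Suc (T - Suc m)) x"
  let ?W = "\<lambda>N m. bwd_weight S T (J (Suc N)) (zeta (Suc N)) (T - m)"
  \<comment> \<open>Natural subtraction reverses time faithfully only for
    \<open>m < T\<close>.\<close>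
  have Suc_back: "Suc (T - Suc m) = T - m" "T - Suc m < T" "T - m \<le> T" if "m < T" for m using that by auto
  have "\<exists>B. m < T \<longrightarrow> 0 \<le> B \<and> (\<forall>x\<in>X. ?a m x \<le> B)" for m
  proof (cases "m < T")
    case True
    then have b: "bounded ((\<lambda>x. bwd_adj S (T - Suc m) x / \<gamma> (T - Suc m + 1) x) ` X)"
      using A3_bwd[rule_format, OF Suc_back(2)] by blast
    obtain B where B: "0 \<le> B" "\<And>x. x \<in> X \<Longrightarrow> \<bar>bwd_adj S (T - Suc m) x / \<gamma> (T - Suc m + 1) x\<bar> \<le> B"
      using bounded_image_nonneg_bound[OF b] by blast
    have "?a m x \<le> B" if "x \<in> X" for x
      using order_trans[OF abs_ge_self B(2)[OF that]] by (simp only: divide_inverse Suc_eq_plus1)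
    then show ?thesis using B(1) by blast
  qed auto
  then obtain Ca where Ca: "\<And>m. m < T \<Longrightarrow> 0 \<le> Ca m" "\<And>m x. m < T \<Longrightarrow> x \<in> X \<Longrightarrow> ?a m x \<le> Ca m" by metis
  interpret C: particle_chain L T ?\<rho> "\<lambda>x. enn2real (bwd_omega_final S T x)" "enn2real (SUP x\<in>X. bwd_omega_final S T x)" \<kappa>b
    "\<lambda>m x x'. enn2real (bwd_omega S (T - Suc m) x' x)" "\<lambda>m. bwd_prop S (T - Suc m)" ?a
    "\<lambda>m. enn2real (SUP (x, x')\<in>X \<times> X. bwd_omega S (T - Suc m) x x')" Ca \<nu> "Gamma_bwd_steps S T" "\<lambda>N. P (Suc N)"
    "\<lambda>N m. bwd_history (Suc N) {T - m..T} {T - m..<T}" "\<lambda>N m. J (Suc N) (T - m)" "\<lambda>N m. zeta (Suc N) (T - m)" ?W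
  proof (rule particle_chain.intro)
    show "(\<lambda>x. enn2real (bwd_omega_final S T x)) \<in> borel_measurable L" using final_meas by measurable
    show "enn2real (bwd_omega_final S T x) \<le> enn2real (SUP x\<in>X. bwd_omega_final S T x)" if "x \<in> X" for x
      by (rule enn2real_le_SUP[OF A3_omega_final that])
    show "enn2real (bwd_omega S (T - Suc m) x' x) \<le> enn2real (SUP (x, x')\<in>X \<times> X. bwd_omega S (T - Suc m) x x')"
      if "m < T" "x \<in> X" "x' \<in> X" for m x x'
      using bwd_omega_SUP[OF Suc_back(2)[OF that(1)] that(3,2)] by blast
    show "?a m \<in> borel_measurable L" if "m < T" for m
      using that by (intro borel_measurable_times borel_measurable_inverse badj_meas \<gamma>_meas) auto
    show "0 \<le> ?a m x" if "m < T" "x \<in> X" for m x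
      using badj_nn[OF Suc_back(2)[OF that(1)] that(2)] \<gamma>_pos[OF _ that(2), of "Suc (T - Suc m)"] Suc_back[OF that(1)]
      by (intro mult_nonneg_nonneg) auto
    show "(\<lambda>(x, x'). enn2real (bwd_omega S (T - Suc m) x' x)) \<in> borel_measurable (L \<Otimes>\<^sub>M L)" if "m < T" for m
      by (rule bwd_omega_meas[OF Suc_back(2)[OF that]])
    show "markov_density L (bwd_prop S (T - Suc m))" if "m < T" for m
      by (rule bprop_dens[OF Suc_back(2)[OF that]])
    show "\<kappa>b m x x' = enn2real (bwd_omega S (T - Suc m) x' x) * (?a m x * bwd_prop S (T - Suc m) x x')"
      if "m < T" "x \<in> X" "x' \<in> X" for m x x'
      unfolding \<kappa>b_def by (rule bwd_kernel_eq[OF Suc_back(2)[OF that(1)] that(3,2)])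
    show "0 < emeasure (\<nu> m) X" if "m \<le> T" for m using \<nu>_pos[OF that] by (simp only: \<nu>_space)
    \<comment> \<open>Here \<open>f\<close> is arbitrary, so the change of measure has to hold
      without measurability.\<close>
    show "Gamma_bwd_steps S T 0 f = (\<integral>x. (enn2real (bwd_omega_final S T x))\<^sup>2 * (f x)\<^sup>2 \<partial>?\<rho>) / (\<integral>x. enn2real (bwd_omega_final S T x) \<partial>?\<rho>)\<^sup>2" for f
      unfolding integral_b0 by (simp add: mult.assoc)
    show "Gamma_bwd_steps S T (Suc m) f = (Gamma_bwd_steps S T m (\<lambda>x. \<integral>x'. \<kappa>b m x x' * f x' \<partial>L) +
       (\<integral>x. (\<integral>x'. enn2real (bwd_omega S (T - Suc m) x' x) * \<kappa>b m x x' * (f x')\<^sup>2 \<partial>L) \<partial>normalize_measure (\<nu> m)) *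
       (\<integral>x. ?a m x \<partial>normalize_measure (\<nu> m))) / (\<integral>x. (\<integral>x'. \<kappa>b m x x' \<partial>L) \<partial>normalize_measure (\<nu> m))\<^sup>2"
      if "m < T" for m f
    proof -
      have "bwd_info S T (Suc (T - Suc m)) = normalize_measure (\<nu> m)"
        using that by (simp only: Suc_back[OF that] bwd_info_eq) simp
      then show ?thesis by (simp add: \<kappa>b_def Let_def)
    qed
    show "distr (P (Suc N)) L (zeta (Suc N) (T - 0) l) = ?\<rho>" if "l \<in> {1..Suc N}" for N l
      using bwd_init(2)[OF _ that] by (simp add: distributed_distr_eq_density)
    show "zeta (Suc N) (T - m) l \<in> measurable (bwd_history (Suc N) {T - m..T} {T - m..<T}) L"
      if "m < T" "l \<in> {1..Suc N}" for N m l
      using that by (intro zeta_history) auto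
    show "?W N m l \<in> borel_measurable (bwd_history (Suc N) {T - m..T} {T - m..<T})"
      if "m < T" "l \<in> {1..Suc N}" for N m l
      using that by (intro bwd_weight_history) auto
    show "subalgebra (P (Suc N)) (bwd_history (Suc N) {T - m..T} {T - m..<T})" for N m
      by (rule bwd_subalgebra) auto
    show "cond_iid (P (Suc N)) (bwd_history (Suc N) {T - m..T} {T - m..<T}) (Suc N) (count_space {1..Suc N} \<Otimes>\<^sub>M L)
      (\<lambda>l w. (J (Suc N) (T - Suc m) l w, zeta (Suc N) (T - Suc m) l w))
      (\<lambda>w. normalized_density (count_space {1..Suc N} \<Otimes>\<^sub>M L)
         (\<lambda>(i, x). ennreal (?W N m i w * ?a m (zeta (Suc N) (T - m) i w) *
            bwd_prop S (T - Suc m) (zeta (Suc N) (T - m) i w) x)))" if "m < T" for N m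
      using bwd_step[of "Suc N", OF _ Suc_back(2)[OF that]] unfolding Suc_back(1)[OF that] mult.assoc by simp
    show "AE w in P (Suc N). 0 < (\<Sum>i=1..Suc N. ?W N m i w * ?a m (zeta (Suc N) (T - m) i w))"
      if "m < T" for N m
    proof -
      have "\<forall>t<T. AE w in P (Suc N). 0 < (\<Sum>j=1..Suc N. bwd_weight S T (J (Suc N)) (zeta (Suc N)) (Suc t) j w *
         bwd_adj S t (zeta (Suc N) (Suc t) j w) * inv_gam S (Suc t) (zeta (Suc N) (Suc t) j w))"
        using pos[of "Suc N"] unfolding normalizers_positive_def by simp
      from this[rule_format, OF Suc_back(2)[OF that]] show ?thesis unfolding Suc_back(1)[OF that] by (simp only: mult.assoc)
    qed
    show "?W N (Suc m) l w = enn2real (bwd_omega S (T - Suc m) (zeta (Suc N) (T - Suc m) l w)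
        (zeta (Suc N) (T - m) (J (Suc N) (T - Suc m) l w) w))" if "m < T" for N m l w
      using less_imp_neq[OF Suc_back(2)[OF that]] Suc_back(1)[OF that] by (simp add: bwd_weight_def)
  qed (use b0_prob sf Ca \<kappa>b_meas prob bwd_init in \<open>auto simp: bwd_weight_def\<close>)
  have inv: "T - t \<le> T" "T - (T - t) = t" using t by auto
  from C.chain_asymptotics[OF inv(1)] obtain c where "0 < c"
    "sample_lln L (\<lambda>N. P (Suc N)) (\<lambda>N. ?W N (T - t)) (\<lambda>N. zeta (Suc N) (T - (T - t))) (normalize_measure (\<nu> (T - t))) c"
    "sample_clt L (\<lambda>N. P (Suc N)) (\<lambda>N. ?W N (T - t)) (\<lambda>N. zeta (Suc N) (T - (T - t))) (normalize_measure (\<nu> (T - t))) c (Gamma_bwd_steps S T (T - t))"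
    by blast
  then show thesis
    using C.W_bounds[OF inv(1)] C.CW_nn[OF inv(1)] unfolding inv(2) bwd_info_eq[OF t, symmetric]
    by (intro that[of c "C.CW (T - t)"]) (auto simp: Gamma_bwd_def[abs_def])
qed

end

section \<open>The two-filter estimators\<close>

lemma cf_lim_cong_AE:
  assumes X: "\<And>N. X N \<in> borel_measurable (M N)" and Y: "\<And>N. Y N \<in> borel_measurable (M N)"
    and eq: "\<And>N. AE w in M N. X N w = Y N w"
  shows "cf_lim M X v \<longleftrightarrow> cf_lim M Y v"
proof -
  have "(\<integral>w. iexp (t * X N w) \<partial>M N) = (\<integral>w. iexp (t * Y N w) \<partial>M N)" for t N
  proof (rule integral_cong_AE)
    show "(\<lambda>w. iexp (t * X N w)) \<in> borel_measurable (M N)" "(\<lambda>w. iexp (t * Y N w)) \<in> borel_measurable (M N)"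
      using X[of N] Y[of N] by measurable
    show "AE w in M N. iexp (t * X N w) = iexp (t * Y N w)" using eq[of N] by eventually_elim simp
  qed
  then show ?thesis unfolding cf_lim_def by (simp only:)
qed

text \<open>Sizes were shifted to \<open>Suc N\<close> to keep averages nonempty; the shift is
  undone here.\<close>

lemma weak_conv_m_Suc: "weak_conv_m (\<lambda>N. M (Suc N)) M' \<Longrightarrow> weak_conv_m M M'"
  unfolding weak_conv_m_def weak_conv_def using LIMSEQ_imp_Suc by fast

context two_filter_algorithm
begin

text \<open>Forward particles at time \<open>n\<close> meet backward particles at time
  \<open>Suc n\<close>. The forward reweighting at time \<open>s\<close> has \<open>n = s\<close>,
  the backward one \<open>n = s - 1\<close>.\<close>

definition double_sum :: "nat \<Rightarrow> nat \<Rightarrow> ('a \<Rightarrow> 'a \<Rightarrow> real) \<Rightarrow> 'w \<Rightarrow> real" where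
  "double_sum n N K w = (\<Sum>i=1..N. fwd_weight S (I N) (xi N) n i w *
     (\<Sum>j=1..N. bwd_weight S T (J N) (zeta N) (Suc n) j w * K (xi N n i w) (zeta N (Suc n) j w)))"

lemma filtering_prob: "n \<le> T \<Longrightarrow> prob_space (filtering S n)"
  and filtering_sets: "n \<le> T \<Longrightarrow> sets (filtering S n) = sets L"
  using prob_space_normalize_measure[OF \<eta>_fin \<eta>_pos] by (simp_all add: filtering_eq \<eta>_sets)

lemma bwd_info_prob: "t \<le> T \<Longrightarrow> prob_space (bwd_info S T t)"
  and bwd_info_sets: "t \<le> T \<Longrightarrow> sets (bwd_info S T t) = sets L"
  using prob_space_normalize_measure[OF \<nu>_fin \<nu>_pos] by (simp_all add: bwd_info_eq \<nu>_sets)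

text \<open>\<open>R\<close> is to be a centred estimator at every \<open>w\<close>, so it needs an
  explicit value \<open>e\<close> where the total weight is 0. Off that null set it is the ratio of
  two double averages, to which \<open>two_sample_clt\<close> applies.\<close>

lemma double_sum_weak_conv:
  assumes n: "n < T"
    and K: "(\<lambda>(x, x'). K x x') \<in> borel_measurable (L \<Otimes>\<^sub>M L)"
    and K_bd: "\<And>x x'. x \<in> X \<Longrightarrow> x' \<in> X \<Longrightarrow> \<bar>K x x'\<bar> \<le> C" and C: "0 \<le> C"
    and G_bd: "\<And>x x'. x \<in> X \<Longrightarrow> x' \<in> X \<Longrightarrow> \<bar>GG (Suc n) x x'\<bar> \<le> D" and D: "0 \<le> D"
    and K0: "(\<integral>x. (\<integral>x'. K x x' \<partial>bwd_info S T (Suc n)) \<partial>filtering S n) = 0"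
    and d: "0 < (\<integral>x. (\<integral>x'. GG (Suc n) x x' \<partial>bwd_info S T (Suc n)) \<partial>filtering S n)"
    and R: "\<And>N w. R N w = (if double_sum n N (GG (Suc n)) w = 0 then e else double_sum n N K w / double_sum n N (GG (Suc n)) w)"
    and G0: "\<And>N. 1 \<le> N \<Longrightarrow> AE w in P N. double_sum n N (GG (Suc n)) w \<noteq> 0"
  shows "weak_conv_m (\<lambda>N. distr (P N) borel (\<lambda>w. sqrt (real N) * R N w))
    (gaussian (Gamma_tilde S T n (Suc n) K /
      (\<integral>(x, x'). (trans_dens S \<odot> inv_gam S (Suc n)) x x' \<partial>(filtering S n \<Otimes>\<^sub>M bwd_info S T (Suc n)))\<^sup>2))"
proof -
  have nT: "n \<le> T" "Suc n \<le> T" using n by auto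
  note G = GG_meas[OF nT(2)]
  obtain c1 B1 where c1: "0 < c1" "0 \<le> B1"
    "\<And>N l w. l \<in> {1..Suc N} \<Longrightarrow> w \<in> space (P (Suc N)) \<Longrightarrow> \<bar>fwd_weight S (I (Suc N)) (xi (Suc N)) n l w\<bar> \<le> B1"
    "sample_lln L (\<lambda>N. P (Suc N)) (\<lambda>N. fwd_weight S (I (Suc N)) (xi (Suc N)) n) (\<lambda>N. xi (Suc N) n) (filtering S n) c1"
    "sample_clt L (\<lambda>N. P (Suc N)) (\<lambda>N. fwd_weight S (I (Suc N)) (xi (Suc N)) n) (\<lambda>N. xi (Suc N) n) (filtering S n) c1 (Gamma_fwd S n)"
    using fwd_asymptotics[OF nT(1)] by blast
  obtain c2 B2 where c2: "0 < c2" "0 \<le> B2"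
    "\<And>N l w. l \<in> {1..Suc N} \<Longrightarrow> w \<in> space (P (Suc N)) \<Longrightarrow> \<bar>bwd_weight S T (J (Suc N)) (zeta (Suc N)) (Suc n) l w\<bar> \<le> B2"
    "sample_lln L (\<lambda>N. P (Suc N)) (\<lambda>N. bwd_weight S T (J (Suc N)) (zeta (Suc N)) (Suc n)) (\<lambda>N. zeta (Suc N) (Suc n)) (bwd_info S T (Suc n)) c2"
    "sample_clt L (\<lambda>N. P (Suc N)) (\<lambda>N. bwd_weight S T (J (Suc N)) (zeta (Suc N)) (Suc n)) (\<lambda>N. zeta (Suc N) (Suc n)) (bwd_info S T (Suc n)) c2 (Gamma_bwd S T (Suc n))"
    using bwd_asymptotics[OF nT(2)] by blast
  interpret two_samples L "\<lambda>N. P (Suc N)" "\<lambda>N. fwd_history (Suc N) {0..T} {1..T}" "\<lambda>N. bwd_history (Suc N) {0..T} {0..<T}"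
    "\<lambda>N. fwd_weight S (I (Suc N)) (xi (Suc N)) n" "\<lambda>N. bwd_weight S T (J (Suc N)) (zeta (Suc N)) (Suc n)"
    "\<lambda>N. xi (Suc N) n" "\<lambda>N. zeta (Suc N) (Suc n)" "filtering S n" "bwd_info S T (Suc n)" c1 c2 B1 B2
    "Gamma_fwd S n" "Gamma_bwd S T (Suc n)"
  proof (rule two_samples.intro)
    show "prob_space.indep_set (P (Suc N)) (sets (fwd_history (Suc N) {0..T} {1..T})) (sets (bwd_history (Suc N) {0..T} {0..<T}))" for N
      using indep[of "Suc N"] by (simp add: filters_independent_def)
    show "prob_space (P (Suc N))" for N by (rule prob) simp
    show "subalgebra (P (Suc N)) (fwd_history (Suc N) {0..T} {1..T})" for N by (rule fwd_subalgebra) auto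
    show "subalgebra (P (Suc N)) (bwd_history (Suc N) {0..T} {0..<T})" for N by (rule bwd_subalgebra) auto
    show "fwd_weight S (I (Suc N)) (xi (Suc N)) n l \<in> borel_measurable (fwd_history (Suc N) {0..T} {1..T})" if "l \<in> {1..Suc N}" for N l
      using that nT by (intro fwd_weight_history) auto
    show "bwd_weight S T (J (Suc N)) (zeta (Suc N)) (Suc n) l \<in> borel_measurable (bwd_history (Suc N) {0..T} {0..<T})" if "l \<in> {1..Suc N}" for N l
      using that nT by (intro bwd_weight_history) auto
    show "xi (Suc N) n l \<in> measurable (fwd_history (Suc N) {0..T} {1..T}) L" if "l \<in> {1..Suc N}" for N l
      using that nT by (intro xi_history) auto
    show "zeta (Suc N) (Suc n) l \<in> measurable (bwd_history (Suc N) {0..T} {0..<T}) L" if "l \<in> {1..Suc N}" for N l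
      using that nT by (intro zeta_history) auto
  qed (fact filtering_prob[OF nT(1)] filtering_sets[OF nT(1)] bwd_info_prob[OF nT(2)] bwd_info_sets[OF nT(2)] | rule c1 c2; assumption)+
  \<comment> \<open>Each of the two averages contributes a factor \<open>1 / Suc N\<close>;
    numerator and denominator share it, so it cancels in the ratio.\<close>
  have DU: "double_sum n (Suc N) K w = (real (Suc N))\<^sup>2 * U N K (w, w)" for N K w
    unfolding double_sum_def U_def emp_def power2_eq_square
    by (simp del: of_nat_Suc sum.cl_ivl_Suc add: sum_divide_distrib[symmetric] times_divide_eq_right)
  have ratio: "R (Suc N) w = (if U N (GG (Suc n)) (w, w) = 0 then e else U N K (w, w) / U N (GG (Suc n)) (w, w))" for N w
    unfolding R DU by (simp del: of_nat_Suc)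
  have Um: "(\<lambda>w. U N K (w, w)) \<in> borel_measurable (P (Suc N))" if "(\<lambda>(x, x'). K x x') \<in> borel_measurable (L \<Otimes>\<^sub>M L)" for N K
    by (rule measurable_compose[OF diag_meas U_meas[OF that]])
  have Rm: "R (Suc N) \<in> borel_measurable (P (Suc N))" for N
    unfolding ratio[abs_def] using Um[OF K, of N] Um[OF G, of N] by measurable
  let ?d = "\<integral>x. (\<integral>x'. GG (Suc n) x x' \<partial>bwd_info S T (Suc n)) \<partial>filtering S n"
  have "cf_lim (\<lambda>N. P (Suc N)) (\<lambda>N w. sqrt (real (Suc N)) * R (Suc N) w) (Gamma_tilde S T n (Suc n) K / ?d\<^sup>2)"
  proof (subst cf_lim_cong_AE)
    show "cf_lim (\<lambda>N. P (Suc N)) (\<lambda>N w. sqrt (real (Suc N)) * (U N K (w, w) / U N (GG (Suc n)) (w, w))) (Gamma_tilde S T n (Suc n) K / ?d\<^sup>2)"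
      unfolding Gamma_tilde_def by (rule two_sample_clt[OF K K_bd C K0 G G_bd D refl d])
    show "AE w in P (Suc N). sqrt (real (Suc N)) * R (Suc N) w = sqrt (real (Suc N)) * (U N K (w, w) / U N (GG (Suc n)) (w, w))" for N
    proof -
      have "AE w in P (Suc N). U N (GG (Suc n)) (w, w) \<noteq> 0" using G0[of "Suc N"] unfolding DU by (simp del: of_nat_Suc)
      then show ?thesis unfolding ratio by eventually_elim simp
    qed
    show "(\<lambda>w. sqrt (real (Suc N)) * R (Suc N) w) \<in> borel_measurable (P (Suc N))" for N
      using Rm[of N] by measurable
    show "(\<lambda>w. sqrt (real (Suc N)) * (U N K (w, w) / U N (GG (Suc n)) (w, w))) \<in> borel_measurable (P (Suc N))" for N
      using Um[OF K, of N] Um[OF G, of N] by measurable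
  qed
  from cf_lim_weak_conv[OF this] have "weak_conv_m (\<lambda>N. distr (P (Suc N)) borel (\<lambda>w. sqrt (real (Suc N)) * R (Suc N) w))
      (gaussian (Gamma_tilde S T n (Suc n) K / ?d\<^sup>2))"
    using Rm by (simp del: of_nat_Suc add: prob)
  \<comment> \<open>\<open>Delta_fwd\<close> and \<open>Delta_bwd\<close> normalise by an integral
    over the product measure; boundedness of \<open>GG\<close> makes it equal to the iterated
    one.\<close>
  moreover have "?d = (\<integral>(x, x'). (trans_dens S \<odot> inv_gam S (Suc n)) x x' \<partial>(filtering S n \<Otimes>\<^sub>M bwd_info S T (Suc n)))"
  proof -
    interpret f: prob_space "filtering S n" by (rule \<phi>_prob)
    interpret b: prob_space "bwd_info S T (Suc n)" by (rule \<psi>_prob)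
    interpret fb: pair_prob_space "filtering S n" "bwd_info S T (Suc n)" ..
    have "integrable (filtering S n \<Otimes>\<^sub>M bwd_info S T (Suc n)) (\<lambda>(x, x'). GG (Suc n) x x')"
    proof (rule fb.integrable_const_bound[where B=D])
      show "AE z in filtering S n \<Otimes>\<^sub>M bwd_info S T (Suc n). norm (case z of (x, x') \<Rightarrow> GG (Suc n) x x') \<le> D"
        using G_bd by (intro AE_I2) (auto simp: space_pair_measure \<phi>_space \<psi>_space)
      show "(\<lambda>(x, x'). GG (Suc n) x x') \<in> borel_measurable (filtering S n \<Otimes>\<^sub>M bwd_info S T (Suc n))"
        unfolding measurable_cong_sets[OF sets_pair_measure_cong[OF \<phi>_sets \<psi>_sets] refl] by (rule G)
    qed
    from fb.integral_fst'[OF this] show ?thesis by (simp add: GG_def case_prod_unfold)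
  qed
  ultimately have "weak_conv_m (\<lambda>N. distr (P (Suc N)) borel (\<lambda>w. sqrt (real (Suc N)) * R (Suc N) w)) (gaussian (Gamma_tilde S T n (Suc n) K /
      (\<integral>(x, x'). (trans_dens S \<odot> inv_gam S (Suc n)) x x' \<partial>(filtering S n \<Otimes>\<^sub>M bwd_info S T (Suc n)))\<^sup>2))" by simp
  then show ?thesis by (rule weak_conv_m_Suc)
qed

lemma iterated_integral_swap:
  fixes K :: "'a \<Rightarrow> 'a \<Rightarrow> real"
  assumes n: "n < T" and K: "(\<lambda>(x, x'). K x x') \<in> borel_measurable (L \<Otimes>\<^sub>M L)"
    and K_bd: "\<And>x x'. x \<in> X \<Longrightarrow> x' \<in> X \<Longrightarrow> \<bar>K x x'\<bar> \<le> C"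
  shows "(\<integral>x. (\<integral>x'. K x x' \<partial>bwd_info S T (Suc n)) \<partial>filtering S n) = (\<integral>x'. (\<integral>x. K x x' \<partial>filtering S n) \<partial>bwd_info S T (Suc n))"
proof -
  have nT: "n \<le> T" "Suc n \<le> T" using n by auto
  note sets = filtering_sets[OF nT(1)] bwd_info_sets[OF nT(2)]
  interpret f: prob_space "filtering S n" by (rule filtering_prob[OF nT(1)])
  interpret b: prob_space "bwd_info S T (Suc n)" by (rule bwd_info_prob[OF nT(2)])
  interpret fb: pair_prob_space "filtering S n" "bwd_info S T (Suc n)" ..
  have "integrable (filtering S n \<Otimes>\<^sub>M bwd_info S T (Suc n)) (\<lambda>(x, x'). K x x')"
  proof (rule fb.integrable_const_bound[where B=C])
    show "AE z in filtering S n \<Otimes>\<^sub>M bwd_info S T (Suc n). norm (case z of (x, x') \<Rightarrow> K x x') \<le> C"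
      using K_bd by (intro AE_I2) (auto simp: space_pair_measure sets_eq_imp_space_eq[OF sets(1)] sets_eq_imp_space_eq[OF sets(2)])
    show "(\<lambda>(x, x'). K x x') \<in> borel_measurable (filtering S n \<Otimes>\<^sub>M bwd_info S T (Suc n))"
      unfolding measurable_cong_sets[OF sets_pair_measure_cong[OF sets] refl] by (rule K)
  qed
  from fb.Fubini_integral[OF this] show ?thesis by simp
qed

text \<open>\<open>weighted_mean\<close> is used twice, with filter and backward measure exchanging
  roles, through \<open>\<sigma>_fwd\<close> and \<open>\<sigma>_bwd\<close>. The smoothing mean is
  thus exactly the constant that centres the pair kernel, as \<open>two_sample_clt\<close>
  demands.\<close>

lemma GG_centred:
  fixes h :: "'a \<Rightarrow> real"
  assumes n: "n < T" and G_bd: "\<And>x x'. x \<in> X \<Longrightarrow> x' \<in> X \<Longrightarrow> \<bar>GG (Suc n) x x'\<bar> \<le> D"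
    and h: "h \<in> borel_measurable L" and h_bd: "\<And>x. x \<in> X \<Longrightarrow> \<bar>h x\<bar> \<le> C"
  shows "(\<integral>x. (\<integral>x'. (h x - (\<integral>y. h y \<partial>smoothing S n T)) * GG (Suc n) x x' \<partial>bwd_info S T (Suc n)) \<partial>filtering S n) = 0"
    and "(\<integral>x'. (\<integral>x. (h x' - (\<integral>y. h y \<partial>smoothing S (Suc n) T)) * GG (Suc n) x x' \<partial>filtering S n) \<partial>bwd_info S T (Suc n)) = 0"
    and "0 < (\<integral>x. (\<integral>x'. GG (Suc n) x x' \<partial>bwd_info S T (Suc n)) \<partial>filtering S n)"
proof -
  have nT: "n \<le> T" "Suc n \<le> T" "T - Suc n \<le> T" using n by auto
  note eqs = filtering_eq[OF nT(1)] bwd_info_eq[OF nT(2)]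
  note fp = \<eta>_fin[OF nT(1)] \<eta>_pos[OF nT(1)] \<nu>_fin[OF nT(3)] \<nu>_pos[OF nT(3)]
  have G: "(\<lambda>(x, x'). GG (Suc n) x x') \<in> borel_measurable (\<eta> n \<Otimes>\<^sub>M \<nu> (T - Suc n))"
    unfolding measurable_cong_sets[OF sets_pair_measure_cong[OF \<eta>_sets \<nu>_sets] refl] by (rule GG_meas[OF nT(2)])
  have G': "(\<lambda>(x', x). GG (Suc n) x x') \<in> borel_measurable (\<nu> (T - Suc n) \<Otimes>\<^sub>M \<eta> n)"
    using measurable_compose[OF measurable_pair_swap' G] by (simp add: case_prod_unfold)
  have G_le: "GG (Suc n) x x' \<le> D" if "x \<in> X" "x' \<in> X" for x x' using G_bd[OF that] by simp
  have h': "h \<in> borel_measurable (\<eta> n)" "h \<in> borel_measurable (\<nu> (T - Suc n))"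
    using h \<eta>_sets \<nu>_sets by (simp_all cong: measurable_cong_sets)
  have sm: "(\<integral>x. h x \<partial>smoothing S n T) = (\<integral>x. h x \<partial>normalize_measure (\<sigma> n))"
    "(\<integral>x. h x \<partial>smoothing S (Suc n) T) = (\<integral>x. h x \<partial>normalize_measure (\<sigma> (Suc n)))"
    by (simp_all only: smoothing_eq nT)
  note fwd = weighted_mean[OF fp G _ _ h'(1) _ \<sigma>_fwd[OF n] _ sm(1), unfolded \<eta>_space \<nu>_space]
  show "(\<integral>x. (\<integral>x'. (h x - (\<integral>y. h y \<partial>smoothing S n T)) * GG (Suc n) x x' \<partial>bwd_info S T (Suc n)) \<partial>filtering S n) = 0"
    "0 < (\<integral>x. (\<integral>x'. GG (Suc n) x x' \<partial>bwd_info S T (Suc n)) \<partial>filtering S n)"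
    unfolding eqs by (rule fwd[OF GG_nn[OF nT(2)] G_le h_bd \<sigma>_pos[OF nT(1)]]; assumption)+
  note bwd = weighted_mean(1)[OF fp(3,4,1,2) G' _ _ h'(2) _ \<sigma>_bwd[OF n] _ sm(2), unfolded \<eta>_space \<nu>_space]
  show "(\<integral>x'. (\<integral>x. (h x' - (\<integral>y. h y \<partial>smoothing S (Suc n) T)) * GG (Suc n) x x' \<partial>filtering S n) \<partial>bwd_info S T (Suc n)) = 0"
    unfolding eqs by (rule bwd[OF _ _ h_bd \<sigma>_pos[OF nT(2)]]) (auto intro: GG_nn[OF nT(2)] G_le)
qed

text \<open>Moving \<open>m\<close> into the sum relies on normalised weights adding up to 1. If the
  total weight is 0 all quotients are 0 and only \<open>- m\<close> remains, whence the value
  \<open>e\<close> in \<open>double_sum_weak_conv\<close>.\<close>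

lemma self_normalized_minus:
  "self_normalized N W x h w - m =
    (if (\<Sum>l=1..N. W l w) = 0 then - m else (\<Sum>l=1..N. W l w * (h (x l w) - m)) / (\<Sum>l=1..N. W l w))"
proof -
  have "(\<Sum>l=1..N. W l w * (h (x l w) - m)) = (\<Sum>l=1..N. W l w * h (x l w)) - (\<Sum>l=1..N. W l w) * m"
    by (simp add: right_diff_distrib sum_subtractf sum_distrib_right)
  moreover have "self_normalized N W x h w = (\<Sum>l=1..N. W l w * h (x l w)) / (\<Sum>l=1..N. W l w)"
    by (simp add: self_normalized_def sum_divide_distrib)
  ultimately show ?thesis by (simp add: diff_divide_distrib)
qed

lemma fwd_weight_double_sum:
  "(\<Sum>i=1..N. two_filter_fwd_weight S T N (I N) (xi N) (J N) (zeta N) s i w * f (xi N s i w))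
    = double_sum s N (\<lambda>x x'. f x * GG (Suc s) x x') w"
  unfolding double_sum_def two_filter_fwd_weight_def GG_eq divide_inverse Suc_eq_plus1
  by (intro sum.cong refl) (simp add: sum_distrib_right sum_distrib_left mult_ac)

text \<open>The inner sum of these weights runs over the forward particles, so the order of
  summation is exchanged to match \<open>double_sum\<close>.\<close>

lemma bwd_weight_double_sum:
  "(\<Sum>j=1..N. two_filter_bwd_weight S T N (I N) (xi N) (J N) (zeta N) (Suc n) j w * f (zeta N (Suc n) j w))
    = double_sum n N (\<lambda>x x'. GG (Suc n) x x' * f x') w"
  unfolding double_sum_def two_filter_bwd_weight_def GG_eq divide_inverse diff_Suc_1 sum_distrib_right sum_distrib_left
  by (subst sum.swap) (intro sum.cong refl, simp add: mult_ac)

lemma fwd_weak_conv: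
  assumes s: "s \<in> {1..<T}" and G: "bounded ((\<lambda>(x, x'). GG (Suc s) x x') ` (X \<times> X))"
    and h: "h \<in> borel_measurable L" "bounded (h ` X)"
  defines "m \<equiv> \<integral>x. h x \<partial>smoothing S s T"
  shows "weak_conv_m (\<lambda>N. distr (P N) borel (\<lambda>w. sqrt (real N) *
      (self_normalized N (two_filter_fwd_weight S T N (I N) (xi N) (J N) (zeta N) s) (xi N s) h w - m)))
    (gaussian (Delta_fwd S T s (\<lambda>x. h x - m)))"
proof -
  have n: "s < T" using s by simp
  obtain D where D0: "0 \<le> D" "\<And>z. z \<in> X \<times> X \<Longrightarrow> \<bar>case z of (x, x') \<Rightarrow> GG (Suc s) x x'\<bar> \<le> D"
    using bounded_image_nonneg_bound[OF G] by blast
  have D: "0 \<le> D" "\<And>x x'. x \<in> X \<Longrightarrow> x' \<in> X \<Longrightarrow> \<bar>GG (Suc s) x x'\<bar> \<le> D"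
    using D0(1) D0(2)[of "(_, _)"] by (auto)
  obtain C where C: "0 \<le> C" "\<And>x. x \<in> X \<Longrightarrow> \<bar>h x\<bar> \<le> C" using bounded_image_nonneg_bound[OF h(2)] by blast
  have H: "H_fwd S s (\<lambda>x. h x - m) = (\<lambda>x x'. (h x - m) * GG (Suc s) x x')"
    by (simp add: H_fwd_def GG_eq fun_eq_iff flip: Suc_eq_plus1)
  show ?thesis
    unfolding Delta_fwd_def H Suc_eq_plus1[symmetric]
  proof (rule double_sum_weak_conv[OF n, where C="(C + \<bar>m\<bar>) * D" and D=D and e="- m"])
    show "(\<lambda>(x, x'). (h x - m) * GG (Suc s) x x') \<in> borel_measurable (L \<Otimes>\<^sub>M L)"
      using borel_measurable_times[OF borel_measurable_diff[OF measurable_compose[OF measurable_fst h(1)] borel_measurable_const] GG_meas, of "Suc s" m] n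
      by (simp add: case_prod_unfold)
    show "\<bar>(h x - m) * GG (Suc s) x x'\<bar> \<le> (C + \<bar>m\<bar>) * D" if "x \<in> X" "x' \<in> X" for x x'
      unfolding abs_mult using C D(2)[OF that] C(2)[OF that(1)] by (intro mult_mono) auto
    show "(\<integral>x. (\<integral>x'. (h x - m) * GG (Suc s) x x' \<partial>bwd_info S T (Suc s)) \<partial>filtering S s) = 0"
      unfolding m_def by (rule GG_centred(1)[OF n D(2) h(1) C(2)])
    show "0 < (\<integral>x. (\<integral>x'. GG (Suc s) x x' \<partial>bwd_info S T (Suc s)) \<partial>filtering S s)"
      by (rule GG_centred(3)[OF n D(2) h(1) C(2)])
    show "self_normalized N (two_filter_fwd_weight S T N (I N) (xi N) (J N) (zeta N) s) (xi N s) h w - m =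
        (if double_sum s N (GG (Suc s)) w = 0 then - m
         else double_sum s N (\<lambda>x x'. (h x - m) * GG (Suc s) x x') w / double_sum s N (GG (Suc s)) w)" for N w
      unfolding self_normalized_minus fwd_weight_double_sum[of _ _ _ "\<lambda>x. h x - m"]
        fwd_weight_double_sum[of _ _ _ "\<lambda>_. 1", unfolded mult_1 mult_1_right] ..
    show "AE w in P N. double_sum s N (GG (Suc s)) w \<noteq> 0" if "1 \<le> N" for N
    proof -
      have "AE w in P N. 0 < (\<Sum>i=1..N. two_filter_fwd_weight S T N (I N) (xi N) (J N) (zeta N) s i w)"
        using pos[OF that] s unfolding normalizers_positive_def by blast
      then show ?thesis
        unfolding fwd_weight_double_sum[of _ _ _ "\<lambda>_. 1", unfolded mult_1 mult_1_right] by eventually_elim simp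
    qed
  qed (use C D in auto)
qed

lemma bwd_weak_conv:
  assumes s: "s \<in> {1..<T}" and G: "bounded ((\<lambda>(x, x'). GG s x x') ` (X \<times> X))"
    and h: "h \<in> borel_measurable L" "bounded (h ` X)"
  defines "m \<equiv> \<integral>x. h x \<partial>smoothing S s T"
  shows "weak_conv_m (\<lambda>N. distr (P N) borel (\<lambda>w. sqrt (real N) *
      (self_normalized N (two_filter_bwd_weight S T N (I N) (xi N) (J N) (zeta N) s) (zeta N s) h w - m)))
    (gaussian (Delta_bwd S T s (\<lambda>x. h x - m)))"
proof -
  \<comment> \<open>The forward particles enter at time \<open>n = s - 1\<close>, which exists
    because \<open>1 \<le> s\<close>.\<close>
  obtain n where sn: "s = Suc n" using s by (cases s) auto
  have n: "n < T" using s sn by simp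
  obtain D where D0: "0 \<le> D" "\<And>z. z \<in> X \<times> X \<Longrightarrow> \<bar>case z of (x, x') \<Rightarrow> GG s x x'\<bar> \<le> D"
    using bounded_image_nonneg_bound[OF G] by blast
  have D: "0 \<le> D" "\<And>x x'. x \<in> X \<Longrightarrow> x' \<in> X \<Longrightarrow> \<bar>GG (Suc n) x x'\<bar> \<le> D"
    using D0(1) D0(2)[of "(_, _)"] by (auto simp: sn)
  obtain C where C: "0 \<le> C" "\<And>x. x \<in> X \<Longrightarrow> \<bar>h x\<bar> \<le> C" using bounded_image_nonneg_bound[OF h(2)] by blast
  have H: "H_bwd S (Suc n) (\<lambda>x. h x - m) = (\<lambda>x x'. GG (Suc n) x x' * (h x' - m))"
    by (simp add: H_bwd_def GG_eq fun_eq_iff)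
  have K: "(\<lambda>(x, x'). GG (Suc n) x x' * (h x' - m)) \<in> borel_measurable (L \<Otimes>\<^sub>M L)"
    using borel_measurable_times[OF GG_meas borel_measurable_diff[OF measurable_compose[OF measurable_snd h(1)] borel_measurable_const], of "Suc n" m] n
    by (simp add: case_prod_unfold)
  have K_bd: "\<bar>GG (Suc n) x x' * (h x' - m)\<bar> \<le> D * (C + \<bar>m\<bar>)" if "x \<in> X" "x' \<in> X" for x x'
    unfolding abs_mult using C D(2)[OF that] C(2)[OF that(2)] D(1) by (intro mult_mono) auto
  show ?thesis
    unfolding Delta_bwd_def sn H diff_Suc_1
  proof (rule double_sum_weak_conv[OF n K K_bd, where D=D and e="- m"])
    \<comment> \<open>\<open>GG_centred\<close> gives the integral in the other order; the bound
      \<open>K_bd\<close> permits Fubini.\<close>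
    show "(\<integral>x. (\<integral>x'. GG (Suc n) x x' * (h x' - m) \<partial>bwd_info S T (Suc n)) \<partial>filtering S n) = 0"
      using GG_centred(2)[OF n D(2) h(1) C(2), folded sn, folded m_def]
      by (subst iterated_integral_swap[OF n K K_bd]) (simp_all only: sn mult.commute)
    show "0 < (\<integral>x. (\<integral>x'. GG (Suc n) x x' \<partial>bwd_info S T (Suc n)) \<partial>filtering S n)"
      by (rule GG_centred(3)[OF n D(2) h(1) C(2)])
    show "self_normalized N (two_filter_bwd_weight S T N (I N) (xi N) (J N) (zeta N) (Suc n)) (zeta N (Suc n)) h w - m =
        (if double_sum n N (GG (Suc n)) w = 0 then - m
         else double_sum n N (\<lambda>x x'. GG (Suc n) x x' * (h x' - m)) w / double_sum n N (GG (Suc n)) w)" for N w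
      unfolding self_normalized_minus bwd_weight_double_sum[of _ _ _ "\<lambda>x. h x - m"]
        bwd_weight_double_sum[of _ _ _ "\<lambda>_. 1", unfolded mult_1_right] ..
    show "AE w in P N. double_sum n N (GG (Suc n)) w \<noteq> 0" if "1 \<le> N" for N
    proof -
      have "AE w in P N. 0 < (\<Sum>j=1..N. two_filter_bwd_weight S T N (I N) (xi N) (J N) (zeta N) (Suc n) j w)"
        using pos[OF that] s unfolding normalizers_positive_def sn by blast
      then show ?thesis
        unfolding bwd_weight_double_sum[of _ _ _ "\<lambda>_. 1", unfolded mult_1_right] by eventually_elim simp
    qed
  qed (use C D in auto)
qed

end

theorem theorem6:
  fixes S :: "'a model" and T s :: nat and h :: "'a \<Rightarrow> real"
    and P :: "nat \<Rightarrow> 'w measure"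
    and I J :: "nat \<Rightarrow> nat \<Rightarrow> nat \<Rightarrow> 'w \<Rightarrow> nat"
    and xi zeta :: "nat \<Rightarrow> nat \<Rightarrow> nat \<Rightarrow> 'w \<Rightarrow> 'a"
  defines "X \<equiv> space (base S)"
  assumes model: "standing_assumptions S T"
    and prob: "\<And>N. 1 \<le> N \<Longrightarrow> prob_space (P N)"
    and fwd: "\<And>N. 1 \<le> N \<Longrightarrow> forward_filter S T (P N) N (I N) (xi N)"
    and bwd: "\<And>N. 1 \<le> N \<Longrightarrow> backward_filter S T (P N) N (J N) (zeta N)"
    and indep: "\<And>N. 1 \<le> N \<Longrightarrow> filters_independent S T (P N) N (I N) (xi N) (J N) (zeta N)"
    and pos: "\<And>N. 1 \<le> N \<Longrightarrow> normalizers_positive S T (P N) N (I N) (xi N) (J N) (zeta N)"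
    and A1_q: "bounded ((\<lambda>(x, x'). trans_dens S x x') ` (X \<times> X))"
    and A1_g: "\<forall>t\<le>T. (\<forall>x\<in>X. 0 < pot S t x) \<and> bounded (pot S t ` X)"
    and A2_omega0: "(SUP x\<in>X. omega0 S x) < \<infinity>"
    and A2: "\<forall>t\<in>{1..T}. (SUP (x, x')\<in>X \<times> X. omega S t x x') < \<infinity> \<and>
               bounded (fwd_adj S t ` X) \<and>
               bounded ((\<lambda>(x, x'). fwd_prop S t x x') ` (X \<times> X))"
    and A3_omega_final: "(SUP x\<in>X. bwd_omega_final S T x) < \<infinity>"
    and A3_bwd: "\<forall>t<T. bounded ((\<lambda>x. bwd_adj S t x / gam S (t + 1) x) ` X) \<and>
               bounded ((\<lambda>(x, x'). bwd_prop S t x x') ` (X \<times> X)) \<and>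
               (SUP (x, x')\<in>X \<times> X. bwd_omega S t x x') < \<infinity>"
    and A3_smo: "\<forall>t\<in>{1..<T}.
               bounded ((\<lambda>(x, x'). (smo_adj S t \<odot> inv_gam S (t + 1)) x x') ` (X \<times> X)) \<and>
               bounded ((\<lambda>(x, x'). (trans_dens S \<odot> inv_gam S (t + 1)) x x') ` (X \<times> X)) \<and>
               (SUP (x, x', x'')\<in>X \<times> X \<times> X. smo_omega S t x x' x'') < \<infinity> \<and>
               bounded ((\<lambda>(x, x', x''). smo_prop S t x x' x'') ` (X \<times> X \<times> X))"
    and s: "s \<in> {1..<T}"
    and h: "h \<in> borel_measurable (base S)" "bounded (h ` X)"
  shows "weak_conv_m
           (\<lambda>N. distr (P N) borel (\<lambda>w. sqrt (real N) *
              (self_normalized N (two_filter_fwd_weight S T N (I N) (xi N) (J N) (zeta N) s) (xi N s) h w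
               - (\<integral>x. h x \<partial>smoothing S s T))))
           (gaussian (Delta_fwd S T s (\<lambda>x. h x - (\<integral>y. h y \<partial>smoothing S s T)))) \<and>
         ((s = 1 \<longrightarrow> bounded ((\<lambda>(x, x'). (trans_dens S \<odot> inv_gam S 1) x x') ` (X \<times> X))) \<longrightarrow>
          weak_conv_m
           (\<lambda>N. distr (P N) borel (\<lambda>w. sqrt (real N) *
              (self_normalized N (two_filter_bwd_weight S T N (I N) (xi N) (J N) (zeta N) s) (zeta N s) h w
               - (\<integral>x. h x \<partial>smoothing S s T))))
           (gaussian (Delta_bwd S T s (\<lambda>x. h x - (\<integral>y. h y \<partial>smoothing S s T)))))"
proof -
  interpret two_filter_algorithm S T P I J xi zeta
    by (rule two_filter_algorithm.intro[OF two_filter_model.intro[OF model A1_q[unfolded X_def] A1_g[unfolded X_def]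
          A2_omega0[unfolded X_def] A2[unfolded X_def] A3_omega_final[unfolded X_def] A3_bwd[unfolded X_def]]
        two_filter_algorithm_axioms.intro[OF prob fwd bwd indep pos]])
  have GG_bd: "bounded ((\<lambda>(x, x'). GG (Suc t) x x') ` (space (base S) \<times> space (base S)))" if "t \<in> {1..<T}" for t
    using A3_smo[rule_format, OF that] unfolding GG_def X_def Suc_eq_plus1 by blast
  show ?thesis
  proof (intro conjI impI)
    \<comment> \<open>The bounds in \<open>A3_smo\<close> reach the kernels with
      \<open>\<gamma>\<close> at times 2 to \<open>T\<close>, while the backward estimator at
      \<open>s\<close> involves \<open>\<gamma>\<close> at time \<open>s\<close>. For
      \<open>s > 1\<close> the instance \<open>t = s - 1\<close> applies; at \<open>s = 1\<close>
      the bound is the premise assumed here.\<close>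
    assume s1: "s = 1 \<longrightarrow> bounded ((\<lambda>(x, x'). (trans_dens S \<odot> inv_gam S 1) x x') ` (X \<times> X))"
    have "bounded ((\<lambda>(x, x'). GG s x x') ` (space (base S) \<times> space (base S)))"
    proof (cases "s = 1")
      case True
      then show ?thesis using s1 unfolding GG_def X_def by simp
    next
      case False
      then have "s - 1 \<in> {1..<T}" "Suc (s - 1) = s" using s by auto
      then show ?thesis using GG_bd[of "s - 1"] by simp
    qed
    from bwd_weak_conv[OF s this h(1) h(2)[unfolded X_def]]
    show "weak_conv_m
           (\<lambda>N. distr (P N) borel (\<lambda>w. sqrt (real N) *
              (self_normalized N (two_filter_bwd_weight S T N (I N) (xi N) (J N) (zeta N) s) (zeta N s) h w
               - (\<integral>x. h x \<partial>smoothing S s T))))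
           (gaussian (Delta_bwd S T s (\<lambda>x. h x - (\<integral>y. h y \<partial>smoothing S s T))))" .
  qed (rule fwd_weak_conv[OF s GG_bd[OF s] h(1) h(2)[unfolded X_def]])
qed
end
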